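(* Let $k$ be a field, $m\ge 1$, $R=k[t_1,\dots,t_m]$, and let $K$ be any simplicial complex on the vertex set $[m]$. Let $L_K\colon R\text{-mod}\to\mathcal{L}(K)$ be the $K$-localization functor, which is exact, and let $q\colon R\text{-mod}\to R\text{-mod}/\ker(L_K)$ be the Serre quotient. Then the functor $\overline{L_K}\colon R\text{-mod}/\ker(L_K)\to\mathcal{L}(K)$ induced by $L_K$ (the unique exact functor with $\overline{L_K}\circ q=L_K$) is an equivalence of categories.
   Context: $R$ is $\mathbb{N}^m$-graded ($0\in\mathbb{N}$) with $|t_i|=\vec e_i$, the $i$-th standard basis vector, and $R$-mod is the category of finitely generated $\mathbb{N}^m$-graded $R$-modules, with multidegree-preserving maps. For $\sigma\subseteq[m]=\{1,\dots,m\}$, let $\sigma^{-1}\mathbb{N}^m=\{\vec d\in\mathbb{Z}^m : d_i\ge 0 \text{ for } i\notin\sigma\}$ and $R_\sigma=R[t_i^{-1}\mid i\in\sigma]$; $R_\sigma$-modules are $\sigma^{-1}\mathbb{N}^m$-graded (and extended by zero to larger grading sets when necessary). A simplicial complex on $[m]$ is a downward closed collection $K$ of subsets of $[m]$ (possibly empty; not every $\{i\}$ need belong to $K$). A missing face is a subset $\sigma\subseteq[m]$ with $\sigma\notin K$. A $K$-localized persistence module $M$ consists of: for each missing face $\sigma$ a finitely generated $R_\sigma$-module $M_\sigma$; for all missing faces $\sigma\subseteq\tau$ a map of $R_\sigma$-modules $\varphi_{\sigma,\tau}\colon M_\sigma\to M_\tau$ such that the induced map $R_\tau\otimes_{R_\sigma}M_\sigma\to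 M_\tau$ is an isomorphism, with $\varphi_{\sigma,\sigma}=\mathrm{id}$ and $\varphi_{\tau,\upsilon}\circ\varphi_{\sigma,\tau}=\varphi_{\sigma,\upsilon}$ for missing faces $\sigma\subseteq\tau\subseteq\upsilon$. Morphisms are families of $R_\sigma$-module maps commuting with the transition maps. These form the abelian category $\mathcal{L}(K)$ (kernels and cokernels computed pointwise). The functor $L_K$ sends $M$ to the object with $L_K(M)_\sigma=R_\sigma\otimes_R M$ and the canonical localization maps; $\ker(L_K)$ is the Serre subcategory of modules $M$ with $L_K(M)\cong 0$. *)

theory Defs
  imports
    "HOL-Analysis.Finite_Cartesian_Product"
    "HOL-Algebra.Free_Abelian_Groups"
    "HOL-Algebra.AbelCoset"
    "HOL-Algebra.Module"
begin

section \<open>Categories, exact functors, equivalences\<close>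

text \<open>Hom-sets are indexed by their source and target and need not be disjoint.
  For \<open>f : X \<rightarrow> Y\<close> and \<open>g : Y \<rightarrow> Z\<close> the composite \<open>g \<circ> f\<close> is \<open>Comp C X Y Z g f\<close>.\<close>

record ('o, 'm) cat =
  Obj :: "'o set"
  Hom :: "'o \<Rightarrow> 'o \<Rightarrow> 'm set"
  Idt :: "'o \<Rightarrow> 'm"
  Comp :: "'o \<Rightarrow> 'o \<Rightarrow> 'o \<Rightarrow> 'm \<Rightarrow> 'm \<Rightarrow> 'm"

definition is_category :: "('o, 'm) cat \<Rightarrow> bool" where
  "is_category C \<longleftrightarrow>
     (\<forall>X\<in>Obj C. Idt C X \<in> Hom C X X) \<and>
     (\<forall>X\<in>Obj C. \<forall>Y\<in>Obj C. \<forall>Z\<in>Obj C. \<forall>f\<in>Hom C X Y. \<forall>g\<in>Hom C Y Z.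
        Comp C X Y Z g f \<in> Hom C X Z) \<and>
     (\<forall>X\<in>Obj C. \<forall>Y\<in>Obj C. \<forall>f\<in>Hom C X Y.
        Comp C X X Y f (Idt C X) = f \<and> Comp C X Y Y (Idt C Y) f = f) \<and>
     (\<forall>W\<in>Obj C. \<forall>X\<in>Obj C. \<forall>Y\<in>Obj C. \<forall>Z\<in>Obj C.
        \<forall>f\<in>Hom C W X. \<forall>g\<in>Hom C X Y. \<forall>h\<in>Hom C Y Z.
          Comp C W Y Z h (Comp C W X Y g f) = Comp C W X Z (Comp C X Y Z h g) f)"

definition is_iso_arrow :: "('o, 'm) cat \<Rightarrow> 'o \<Rightarrow> 'o \<Rightarrow> 'm \<Rightarrow> bool" where
  "is_iso_arrow C X Y f \<longleftrightarrow> f \<in> Hom C X Y \<and>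
     (\<exists>g\<in>Hom C Y X. Comp C X Y X g f = Idt C X \<and> Comp C Y X Y f g = Idt C Y)"

definition is_zero_object :: "('o, 'm) cat \<Rightarrow> 'o \<Rightarrow> bool" where
  "is_zero_object C Z \<longleftrightarrow> Z \<in> Obj C \<and>
     (\<forall>X\<in>Obj C. (\<exists>!f. f \<in> Hom C X Z) \<and> (\<exists>!f. f \<in> Hom C Z X))"

definition is_zero_arrow :: "('o, 'm) cat \<Rightarrow> 'o \<Rightarrow> 'o \<Rightarrow> 'm \<Rightarrow> bool" where
  "is_zero_arrow C X Y f \<longleftrightarrow>
     (\<exists>Z g h. is_zero_object C Z \<and> g \<in> Hom C X Z \<and> h \<in> Hom C Z Y \<and> f = Comp C X Z Y h g)"

definition is_kernel :: "('o, 'm) cat \<Rightarrow> 'o \<Rightarrow> 'o \<Rightarrow> 'm \<Rightarrow> 'o \<Rightarrow> 'm \<Rightarrow> bool" where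
  "is_kernel C X Y f N i \<longleftrightarrow> N \<in> Obj C \<and> i \<in> Hom C N X \<and>
     is_zero_arrow C N Y (Comp C N X Y f i) \<and>
     (\<forall>T\<in>Obj C. \<forall>g\<in>Hom C T X. is_zero_arrow C T Y (Comp C T X Y f g) \<longrightarrow>
        (\<exists>!h. h \<in> Hom C T N \<and> Comp C T N X i h = g))"

definition is_cokernel :: "('o, 'm) cat \<Rightarrow> 'o \<Rightarrow> 'o \<Rightarrow> 'm \<Rightarrow> 'o \<Rightarrow> 'm \<Rightarrow> bool" where
  "is_cokernel C X Y f Q p \<longleftrightarrow> Q \<in> Obj C \<and> p \<in> Hom C Y Q \<and>
     is_zero_arrow C X Q (Comp C X Y Q p f) \<and>
     (\<forall>T\<in>Obj C. \<forall>g\<in>Hom C Y T. is_zero_arrow C X T (Comp C X Y T g f) \<longrightarrow>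
        (\<exists>!h. h \<in> Hom C Q T \<and> Comp C Y Q T h p = g))"

definition short_exact :: "('o, 'm) cat \<Rightarrow> 'o \<Rightarrow> 'o \<Rightarrow> 'o \<Rightarrow> 'm \<Rightarrow> 'm \<Rightarrow> bool" where
  "short_exact C X Y Z f g \<longleftrightarrow>
     X \<in> Obj C \<and> Y \<in> Obj C \<and> Z \<in> Obj C \<and> f \<in> Hom C X Y \<and> g \<in> Hom C Y Z \<and>
     is_kernel C Y Z g X f \<and> is_cokernel C X Y f Z g"

record ('o, 'm, 'p, 'n) cfunctor =
  on_obj :: "'o \<Rightarrow> 'p"
  on_hom :: "'o \<Rightarrow> 'o \<Rightarrow> 'm \<Rightarrow> 'n"

definition is_functor :: "('o, 'm) cat \<Rightarrow> ('p, 'n) cat \<Rightarrow> ('o, 'm, 'p, 'n) cfunctor \<Rightarrow> bool" where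
  "is_functor C D F \<longleftrightarrow> is_category C \<and> is_category D \<and>
     (\<forall>X\<in>Obj C. on_obj F X \<in> Obj D) \<and>
     (\<forall>X\<in>Obj C. \<forall>Y\<in>Obj C. \<forall>f\<in>Hom C X Y. on_hom F X Y f \<in> Hom D (on_obj F X) (on_obj F Y)) \<and>
     (\<forall>X\<in>Obj C. on_hom F X X (Idt C X) = Idt D (on_obj F X)) \<and>
     (\<forall>X\<in>Obj C. \<forall>Y\<in>Obj C. \<forall>Z\<in>Obj C. \<forall>f\<in>Hom C X Y. \<forall>g\<in>Hom C Y Z.
        on_hom F X Z (Comp C X Y Z g f) =
          Comp D (on_obj F X) (on_obj F Y) (on_obj F Z) (on_hom F Y Z g) (on_hom F X Y f))"

text \<open>Equality of functors on \<open>C\<close>: the values of the record fields outside the objects and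
  arrows of \<open>C\<close> are irrelevant.\<close>

definition functor_eq ::
  "('o, 'm) cat \<Rightarrow> ('o, 'm, 'p, 'n) cfunctor \<Rightarrow> ('o, 'm, 'p, 'n) cfunctor \<Rightarrow> bool" where
  "functor_eq C F G \<longleftrightarrow> (\<forall>X\<in>Obj C. on_obj F X = on_obj G X) \<and>
     (\<forall>X\<in>Obj C. \<forall>Y\<in>Obj C. \<forall>f\<in>Hom C X Y. on_hom F X Y f = on_hom G X Y f)"

definition id_functor :: "('o, 'm, 'o, 'm) cfunctor" where
  "id_functor = \<lparr>on_obj = (\<lambda>X. X), on_hom = (\<lambda>X Y f. f)\<rparr>"

definition comp_functor ::
  "('p, 'n, 'q, 'l) cfunctor \<Rightarrow> ('o, 'm, 'p, 'n) cfunctor \<Rightarrow> ('o, 'm, 'q, 'l) cfunctor" where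
  "comp_functor G F = \<lparr>on_obj = (\<lambda>X. on_obj G (on_obj F X)),
     on_hom = (\<lambda>X Y f. on_hom G (on_obj F X) (on_obj F Y) (on_hom F X Y f))\<rparr>"

definition naturally_isomorphic ::
  "('o, 'm) cat \<Rightarrow> ('p, 'n) cat \<Rightarrow> ('o, 'm, 'p, 'n) cfunctor \<Rightarrow> ('o, 'm, 'p, 'n) cfunctor \<Rightarrow> bool"
  where
  "naturally_isomorphic C D F G \<longleftrightarrow>
     (\<exists>\<eta>. (\<forall>X\<in>Obj C. is_iso_arrow D (on_obj F X) (on_obj G X) (\<eta> X)) \<and>
       (\<forall>X\<in>Obj C. \<forall>Y\<in>Obj C. \<forall>f\<in>Hom C X Y.
          Comp D (on_obj F X) (on_obj F Y) (on_obj G Y) (\<eta> Y) (on_hom F X Y f) =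
          Comp D (on_obj F X) (on_obj G X) (on_obj G Y) (on_hom G X Y f) (\<eta> X)))"

definition is_equivalence :: "('o, 'm) cat \<Rightarrow> ('p, 'n) cat \<Rightarrow> ('o, 'm, 'p, 'n) cfunctor \<Rightarrow> bool"
  where
  "is_equivalence C D F \<longleftrightarrow> is_functor C D F \<and>
     (\<exists>G. is_functor D C G \<and>
        naturally_isomorphic C C (comp_functor G F) id_functor \<and>
        naturally_isomorphic D D (comp_functor F G) id_functor)"

text \<open>Additivity need not be demanded: between abelian categories, a functor that preserves
  short exact sequences preserves zero objects and split short exact sequences, hence biproducts,
  hence sums of arrows.\<close>

definition exact_functor :: "('o, 'm) cat \<Rightarrow> ('p, 'n) cat \<Rightarrow> ('o, 'm, 'p, 'n) cfunctor \<Rightarrow> bool"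
  where
  "exact_functor C D F \<longleftrightarrow> is_functor C D F \<and>
     (\<forall>X Y Z f g. short_exact C X Y Z f g \<longrightarrow>
        short_exact D (on_obj F X) (on_obj F Y) (on_obj F Z) (on_hom F X Y f) (on_hom F Y Z g))"

definition functor_kernel :: "('o, 'm) cat \<Rightarrow> ('p, 'n) cat \<Rightarrow> ('o, 'm, 'p, 'n) cfunctor \<Rightarrow> 'o set"
  where
  "functor_kernel C D F = {X \<in> Obj C. is_zero_object D (on_obj F X)}"


section \<open>Serre quotients\<close>

text \<open>For a Serre subcategory \<open>S\<close> of an abelian category \<open>C\<close>, the quotient \<open>C/S\<close> is the
  localization of \<open>C\<close> at the arrows with kernel and cokernel in \<open>S\<close>. It is constructed by
  calculus of fractions: an arrow \<open>X \<rightarrow> Y\<close> of \<open>C/S\<close> is a class of roofs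
  \<open>X \<leftarrow>s\<midarrow> A \<midarrow>f\<rightarrow> Y\<close>, here triples \<open>(A, s, f)\<close>, with \<open>s\<close> such an arrow.\<close>

definition inverted_arrow :: "('o, 'm) cat \<Rightarrow> 'o set \<Rightarrow> 'o \<Rightarrow> 'o \<Rightarrow> 'm \<Rightarrow> bool" where
  "inverted_arrow C S X Y f \<longleftrightarrow> f \<in> Hom C X Y \<and>
     (\<exists>N\<in>S. \<exists>i. is_kernel C X Y f N i) \<and> (\<exists>Q\<in>S. \<exists>p. is_cokernel C X Y f Q p)"

definition roofs :: "('o, 'm) cat \<Rightarrow> 'o set \<Rightarrow> 'o \<Rightarrow> 'o \<Rightarrow> ('o \<times> 'm \<times> 'm) set" where
  "roofs C S X Y = {(A, s, f). A \<in> Obj C \<and> inverted_arrow C S A X s \<and> f \<in> Hom C A Y}"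

definition roof_rel ::
  "('o, 'm) cat \<Rightarrow> 'o set \<Rightarrow> 'o \<Rightarrow> 'o \<Rightarrow> (('o \<times> 'm \<times> 'm) \<times> ('o \<times> 'm \<times> 'm)) set" where
  "roof_rel C S X Y = {((A, s, f), (B, t, g)).
     (A, s, f) \<in> roofs C S X Y \<and> (B, t, g) \<in> roofs C S X Y \<and>
     (\<exists>U\<in>Obj C. \<exists>u\<in>Hom C U A. \<exists>v\<in>Hom C U B.
        inverted_arrow C S U X (Comp C U A X s u) \<and>
        Comp C U A X s u = Comp C U B X t v \<and>
        Comp C U A Y f u = Comp C U B Y g v)}"

text \<open>The composite of \<open>[A, s, f] : X \<rightarrow> Y\<close> and \<open>[B, t, g] : Y \<rightarrow> Z\<close> is \<open>[U, s \<circ> u, g \<circ> v]\<close> for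
  any \<open>u : U \<rightarrow> A\<close> in the inverted class and \<open>v : U \<rightarrow> B\<close> with \<open>f \<circ> u = t \<circ> v\<close>. All choices give the
  same class, so the union below is that class.\<close>

definition serre_quotient :: "('o, 'm) cat \<Rightarrow> 'o set \<Rightarrow> ('o, ('o \<times> 'm \<times> 'm) set) cat" where
  "serre_quotient C S = \<lparr>
     Obj = Obj C,
     Hom = (\<lambda>X Y. roofs C S X Y // roof_rel C S X Y),
     Idt = (\<lambda>X. roof_rel C S X X `` {(X, Idt C X, Idt C X)}),
     Comp = (\<lambda>X Y Z \<psi> \<phi>. roof_rel C S X Z `` {(U, Comp C U A X s u, Comp C U B Z g v) |
               U u v A s f B t g.
               (A, s, f) \<in> \<phi> \<and> (B, t, g) \<in> \<psi> \<and> U \<in> Obj C \<and>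
               inverted_arrow C S U A u \<and> v \<in> Hom C U B \<and>
               Comp C U A Y f u = Comp C U B Y t v})\<rparr>"

definition quotient_functor ::
  "('o, 'm) cat \<Rightarrow> 'o set \<Rightarrow> ('o, 'm, 'o, ('o \<times> 'm \<times> 'm) set) cfunctor" where
  "quotient_functor C S = \<lparr>
     on_obj = (\<lambda>X. X),
     on_hom = (\<lambda>X Y f. roof_rel C S X Y `` {(X, Idt C X, f)})\<rparr>"


section \<open>The rings \<open>R\<^sub>\<sigma>\<close> and their graded modules\<close>

text \<open>The index set \<open>[m]\<close> is a finite type \<open>'n\<close>, so \<open>m = CARD('n) \<ge> 1\<close>. All the rings live inside
  the Laurent polynomial ring \<open>k[t\<^sub>1\<^sup>\<plusminus>, \<dots>, t\<^sub>m\<^sup>\<plusminus>]\<close>, the monoid algebra of \<open>\<int>\<^sup>m\<close> over \<open>k\<close>;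
  \<open>R = k[t\<^sub>1, \<dots>, t\<^sub>m]\<close> is \<open>loc_ring {}\<close>.\<close>

type_synonym ('k, 'n) laurent = "(int ^ 'n) \<Rightarrow>\<^sub>0 'k"

definition loc_degrees :: "'n::finite set \<Rightarrow> (int ^ 'n) set" where
  "loc_degrees \<sigma> = {d. \<forall>i. i \<notin> \<sigma> \<longrightarrow> 0 \<le> d $ i}"

definition loc_ring :: "'n::finite set \<Rightarrow> ('k::field, 'n) laurent ring" where
  "loc_ring \<sigma> = \<lparr>carrier = {p. Poly_Mapping.keys p \<subseteq> loc_degrees \<sigma>},
     monoid.mult = (*), one = 1, zero = 0, add = (+)\<rparr>"

definition ring_homogeneous :: "'n::finite set \<Rightarrow> int ^ 'n \<Rightarrow> ('k::field, 'n) laurent set" where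
  "ring_homogeneous \<sigma> d = {p \<in> carrier (loc_ring \<sigma>). Poly_Mapping.keys p \<subseteq> {d}}"

record ('r, 'a, 'd) gmodule = "('r, 'a) module" +
  hcomp :: "'d \<Rightarrow> 'a set"

type_synonym ('k, 'n, 'a) gmod = "(('k, 'n) laurent, 'a, int ^ 'n) gmodule"

text \<open>The gradings are indexed by all of \<open>\<int>\<^sup>m\<close> and vanish outside \<open>\<sigma>\<inverse>\<nat>\<^sup>m\<close>.\<close>

definition graded_module :: "'n::finite set \<Rightarrow> ('k::field, 'n, 'a) gmod \<Rightarrow> bool" where
  "graded_module \<sigma> M \<longleftrightarrow> module (loc_ring \<sigma>) M \<and>
     (\<forall>d. additive_subgroup (hcomp M d) M) \<and>
     (\<forall>d. d \<notin> loc_degrees \<sigma> \<longrightarrow> hcomp M d = {\<zero>\<^bsub>M\<^esub>}) \<and>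
     (\<forall>x\<in>carrier M. \<exists>!c. (\<forall>d. c d \<in> hcomp M d) \<and> finite {d. c d \<noteq> \<zero>\<^bsub>M\<^esub>} \<and>
        x = finsum M c {d. c d \<noteq> \<zero>\<^bsub>M\<^esub>}) \<and>
     (\<forall>a b. \<forall>p\<in>ring_homogeneous \<sigma> a. \<forall>x\<in>hcomp M b. p \<odot>\<^bsub>M\<^esub> x \<in> hcomp M (a + b))"

definition finitely_generated :: "'n::finite set \<Rightarrow> ('k::field, 'n, 'a) gmod \<Rightarrow> bool" where
  "finitely_generated \<sigma> M \<longleftrightarrow>
     (\<exists>A. finite A \<and> A \<subseteq> carrier M \<and>
        (\<forall>x\<in>carrier M. \<exists>p \<in> A \<rightarrow> carrier (loc_ring \<sigma>). x = finsum M (\<lambda>a. p a \<odot>\<^bsub>M\<^esub> a) A))"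

definition graded_hom ::
  "'n::finite set \<Rightarrow> ('k::field, 'n, 'a) gmod \<Rightarrow> ('k, 'n, 'b) gmod \<Rightarrow> ('a \<Rightarrow> 'b) set" where
  "graded_hom \<sigma> M N = {f \<in> carrier M \<rightarrow>\<^sub>E carrier N.
     (\<forall>x\<in>carrier M. \<forall>y\<in>carrier M. f (x \<oplus>\<^bsub>M\<^esub> y) = f x \<oplus>\<^bsub>N\<^esub> f y) \<and>
     (\<forall>p\<in>carrier (loc_ring \<sigma>). \<forall>x\<in>carrier M. f (p \<odot>\<^bsub>M\<^esub> x) = p \<odot>\<^bsub>N\<^esub> f x) \<and>
     (\<forall>d. f ` hcomp M d \<subseteq> hcomp N d)}"

text \<open>The category of finitely generated \<open>\<nat>\<^sup>m\<close>-graded \<open>R\<close>-modules with elements in \<open>'a\<close>. A finitely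
  generated module over any \<open>R\<^sub>\<sigma>\<close> has at most as many elements as the (infinite) Laurent polynomial
  ring, so if that ring injects into \<open>'a\<close>, every finitely generated graded module is isomorphic to
  one with elements in \<open>'a\<close>.\<close>

definition Rmod :: "(('k::field, 'n::finite, 'a) gmod, 'a \<Rightarrow> 'a) cat" where
  "Rmod = \<lparr>
     Obj = {M. graded_module {} M \<and> finitely_generated {} M},
     Hom = graded_hom {},
     Idt = (\<lambda>M. \<lambda>x\<in>carrier M. x),
     Comp = (\<lambda>L M N g f. compose (carrier L) g f)\<rparr>"


section \<open>Extension of scalars\<close>

text \<open>For \<open>\<sigma> \<subseteq> \<tau>\<close> and an \<open>R\<^sub>\<sigma>\<close>-module \<open>M\<close>, the tensor product of \<open>R\<^sub>\<tau>\<close> and \<open>M\<close> over \<open>R\<^sub>\<sigma>\<close> is the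
  free abelian group on the pairs \<open>(s, x)\<close> modulo the bilinearity and balancing relations.\<close>

definition tensor_free ::
  "'n::finite set \<Rightarrow> ('k::field, 'n, 'a) gmod \<Rightarrow> ((('k, 'n) laurent \<times> 'a) \<Rightarrow>\<^sub>0 int) monoid" where
  "tensor_free \<tau> M = free_Abelian_group (carrier (loc_ring \<tau>) \<times> carrier M)"

definition tensor_relators ::
  "'n::finite set \<Rightarrow> 'n set \<Rightarrow> ('k::field, 'n, 'a) gmod \<Rightarrow> ((('k, 'n) laurent \<times> 'a) \<Rightarrow>\<^sub>0 int) set"
  where
  "tensor_relators \<sigma> \<tau> M =
     {frag_of (s + s', x) - frag_of (s, x) - frag_of (s', x) | s s' x.
        s \<in> carrier (loc_ring \<tau>) \<and> s' \<in> carrier (loc_ring \<tau>) \<and> x \<in> carrier M} \<union>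
     {frag_of (s, x \<oplus>\<^bsub>M\<^esub> y) - frag_of (s, x) - frag_of (s, y) | s x y.
        s \<in> carrier (loc_ring \<tau>) \<and> x \<in> carrier M \<and> y \<in> carrier M} \<union>
     {frag_of (s * r, x) - frag_of (s, r \<odot>\<^bsub>M\<^esub> x) | s r x.
        s \<in> carrier (loc_ring \<tau>) \<and> r \<in> carrier (loc_ring \<sigma>) \<and> x \<in> carrier M}"

definition tensor_null ::
  "'n::finite set \<Rightarrow> 'n set \<Rightarrow> ('k::field, 'n, 'a) gmod \<Rightarrow> ((('k, 'n) laurent \<times> 'a) \<Rightarrow>\<^sub>0 int) set"
  where
  "tensor_null \<sigma> \<tau> M = generate (tensor_free \<tau> M) (tensor_relators \<sigma> \<tau> M)"

definition tensor_group ::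
  "'n::finite set \<Rightarrow> 'n set \<Rightarrow> ('k::field, 'n, 'a) gmod
     \<Rightarrow> ((('k, 'n) laurent \<times> 'a) \<Rightarrow>\<^sub>0 int) set monoid" where
  "tensor_group \<sigma> \<tau> M = tensor_free \<tau> M Mod tensor_null \<sigma> \<tau> M"

definition tensor_class ::
  "'n::finite set \<Rightarrow> 'n set \<Rightarrow> ('k::field, 'n, 'a) gmod
     \<Rightarrow> ((('k, 'n) laurent \<times> 'a) \<Rightarrow>\<^sub>0 int) \<Rightarrow> ((('k, 'n) laurent \<times> 'a) \<Rightarrow>\<^sub>0 int) set" where
  "tensor_class \<sigma> \<tau> M c = tensor_null \<sigma> \<tau> M #>\<^bsub>tensor_free \<tau> M\<^esub> c"

definition pure_tensor ::
  "'n::finite set \<Rightarrow> 'n set \<Rightarrow> ('k::field, 'n, 'a) gmod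
     \<Rightarrow> ('k, 'n) laurent \<Rightarrow> 'a \<Rightarrow> ((('k, 'n) laurent \<times> 'a) \<Rightarrow>\<^sub>0 int) set" where
  "pure_tensor \<sigma> \<tau> M s x = tensor_class \<sigma> \<tau> M (frag_of (s, x))"

text \<open>If \<open>(s, x) \<mapsto> h (s, x)\<close> respects the relations, the classes of the images of all
  representatives of \<open>c\<close> in \<open>R\<^sub>\<tau> \<otimes> N\<close> coincide, and the union is the image of \<open>c\<close> under the
  induced map into \<open>R\<^sub>\<tau> \<otimes> N\<close>.\<close>

definition tensor_induced ::
  "'n::finite set \<Rightarrow> 'n set \<Rightarrow> ('k::field, 'n, 'b) gmod
     \<Rightarrow> (('k, 'n) laurent \<times> 'a \<Rightarrow> ('k, 'n) laurent \<times> 'b)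
     \<Rightarrow> ((('k, 'n) laurent \<times> 'a) \<Rightarrow>\<^sub>0 int) set \<Rightarrow> ((('k, 'n) laurent \<times> 'b) \<Rightarrow>\<^sub>0 int) set" where
  "tensor_induced \<sigma> \<tau> N h c = (\<Union>z\<in>c. tensor_class \<sigma> \<tau> N (frag_extend (frag_of \<circ> h) z))"

text \<open>The multiplication and unit of a module record are never used. The degree \<open>d\<close> part is
  spanned by the \<open>s \<otimes> x\<close> with \<open>s\<close>, \<open>x\<close> homogeneous of degrees adding up to \<open>d\<close>.\<close>

definition base_change ::
  "'n::finite set \<Rightarrow> 'n set \<Rightarrow> ('k::field, 'n, 'a) gmod
     \<Rightarrow> ('k, 'n, ((('k, 'n) laurent \<times> 'a) \<Rightarrow>\<^sub>0 int) set) gmod" where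
  "base_change \<sigma> \<tau> M = \<lparr>
     carrier = carrier (tensor_group \<sigma> \<tau> M),
     monoid.mult = undefined,
     one = undefined,
     zero = \<one>\<^bsub>tensor_group \<sigma> \<tau> M\<^esub>,
     add = monoid.mult (tensor_group \<sigma> \<tau> M),
     smult = (\<lambda>p. tensor_induced \<sigma> \<tau> M (\<lambda>(s, x). (p * s, x))),
     hcomp = (\<lambda>d. generate (tensor_group \<sigma> \<tau> M)
       {pure_tensor \<sigma> \<tau> M s x | s x a b.
          s \<in> ring_homogeneous \<tau> a \<and> x \<in> hcomp M b \<and> a + b = d})\<rparr>"


section \<open>Localized persistence modules\<close>

definition simplicial_complex :: "'n set set \<Rightarrow> bool" where
  "simplicial_complex K \<longleftrightarrow> (\<forall>\<sigma>\<in>K. \<forall>\<tau>. \<tau> \<subseteq> \<sigma> \<longrightarrow> \<tau> \<in> K)"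

definition missing_faces :: "'n set set \<Rightarrow> 'n set set" where
  "missing_faces K = {\<sigma>. \<sigma> \<notin> K}"

record ('n, 'r, 'b, 'd) face_system =
  at_face :: "'n set \<Rightarrow> ('r, 'b, 'd) gmodule"
  transition :: "'n set \<Rightarrow> 'n set \<Rightarrow> 'b \<Rightarrow> 'b"

type_synonym ('k, 'n, 'b) lmod = "('n, ('k, 'n) laurent, 'b, int ^ 'n) face_system"

text \<open>The map \<open>h\<close> below is the induced map \<open>s \<otimes> x \<mapsto> s \<sqdot> \<phi> x\<close>; it is determined by its values on
  pure tensors. A bijective graded homomorphism is an isomorphism of graded modules.\<close>

definition localization_map ::
  "'n::finite set \<Rightarrow> 'n set \<Rightarrow> ('k::field, 'n, 'b) gmod \<Rightarrow> ('k, 'n, 'b) gmod \<Rightarrow> ('b \<Rightarrow> 'b) \<Rightarrow> bool"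
  where
  "localization_map \<sigma> \<tau> M N \<phi> \<longleftrightarrow> \<phi> \<in> graded_hom \<sigma> M N \<and>
     (\<exists>h \<in> graded_hom \<tau> (base_change \<sigma> \<tau> M) N.
        (\<forall>s\<in>carrier (loc_ring \<tau>). \<forall>x\<in>carrier M. h (pure_tensor \<sigma> \<tau> M s x) = s \<odot>\<^bsub>N\<^esub> \<phi> x) \<and>
        bij_betw h (carrier (base_change \<sigma> \<tau> M)) (carrier N))"

definition localized_module :: "'n::finite set set \<Rightarrow> ('k::field, 'n, 'b) lmod \<Rightarrow> bool" where
  "localized_module K M \<longleftrightarrow>
     (\<forall>\<sigma>\<in>missing_faces K. graded_module \<sigma> (at_face M \<sigma>) \<and> finitely_generated \<sigma> (at_face M \<sigma>)) \<and>
     (\<forall>\<sigma>\<in>missing_faces K. \<forall>\<tau>\<in>missing_faces K. \<sigma> \<subseteq> \<tau> \<longrightarrow>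
        localization_map \<sigma> \<tau> (at_face M \<sigma>) (at_face M \<tau>) (transition M \<sigma> \<tau>)) \<and>
     (\<forall>\<sigma>\<in>missing_faces K. \<forall>x\<in>carrier (at_face M \<sigma>). transition M \<sigma> \<sigma> x = x) \<and>
     (\<forall>\<sigma>\<in>missing_faces K. \<forall>\<tau>\<in>missing_faces K. \<forall>\<upsilon>\<in>missing_faces K. \<sigma> \<subseteq> \<tau> \<longrightarrow> \<tau> \<subseteq> \<upsilon> \<longrightarrow>
        (\<forall>x\<in>carrier (at_face M \<sigma>). transition M \<tau> \<upsilon> (transition M \<sigma> \<tau> x) = transition M \<sigma> \<upsilon> x))"

definition localized_hom ::
  "'n::finite set set \<Rightarrow> ('k::field, 'n, 'b) lmod \<Rightarrow> ('k, 'n, 'b) lmod \<Rightarrow> ('n set \<Rightarrow> 'b \<Rightarrow> 'b) set"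
  where
  "localized_hom K M N =
     {f \<in> (\<Pi>\<^sub>E \<sigma>\<in>missing_faces K. graded_hom \<sigma> (at_face M \<sigma>) (at_face N \<sigma>)).
        \<forall>\<sigma>\<in>missing_faces K. \<forall>\<tau>\<in>missing_faces K. \<sigma> \<subseteq> \<tau> \<longrightarrow>
          (\<forall>x\<in>carrier (at_face M \<sigma>). f \<tau> (transition M \<sigma> \<tau> x) = transition N \<sigma> \<tau> (f \<sigma> x))}"

definition Lcat ::
  "'n::finite set set \<Rightarrow> (('k::field, 'n, 'b) lmod, 'n set \<Rightarrow> 'b \<Rightarrow> 'b) cat" where
  "Lcat K = \<lparr>
     Obj = {M. localized_module K M},
     Hom = localized_hom K,
     Idt = (\<lambda>M. \<lambda>\<sigma>\<in>missing_faces K. \<lambda>x\<in>carrier (at_face M \<sigma>). x),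
     Comp = (\<lambda>L M N g f. \<lambda>\<sigma>\<in>missing_faces K. compose (carrier (at_face L \<sigma>)) (g \<sigma>) (f \<sigma>))\<rparr>"

text \<open>The values of the localization functor have elements in the type of the tensor products
  \<open>R\<^sub>\<sigma> \<otimes> M\<close>, into which \<open>'a\<close> and the Laurent polynomial ring inject.\<close>

definition localization_functor ::
  "'n::finite set set \<Rightarrow>
     (('k::field, 'n, 'a) gmod, 'a \<Rightarrow> 'a,
      ('k, 'n, ((('k, 'n) laurent \<times> 'a) \<Rightarrow>\<^sub>0 int) set) lmod,
      'n set \<Rightarrow> ((('k, 'n) laurent \<times> 'a) \<Rightarrow>\<^sub>0 int) set \<Rightarrow> ((('k, 'n) laurent \<times> 'a) \<Rightarrow>\<^sub>0 int) set)
     cfunctor" where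
  "localization_functor K = \<lparr>
     on_obj = (\<lambda>M. \<lparr>
       at_face = (\<lambda>\<sigma>. base_change {} \<sigma> M),
       transition = (\<lambda>\<sigma> \<tau>. \<lambda>c\<in>carrier (base_change {} \<sigma> M). tensor_induced {} \<tau> M id c)\<rparr>),
     on_hom = (\<lambda>M N f. \<lambda>\<sigma>\<in>missing_faces K.
       \<lambda>c\<in>carrier (base_change {} \<sigma> M). tensor_induced {} \<sigma> N (\<lambda>(s, x). (s, f x)) c)\<rparr>"

definition localization_kernel :: "'n::finite set set \<Rightarrow> ('k::field, 'n, 'a) gmod set" where
  "localization_kernel K = functor_kernel Rmod (Lcat K) (localization_functor K)"

end

theory Submission
  imports Defs
begin

text \<open>
  Write \<open>t\<^sub>\<sigma>\<close> for the product of the \<open>t\<^sub>i\<close> with \<open>i \<in> \<sigma>\<close>. Extension of scalars to \<open>R\<^sub>\<sigma>\<close> inverts \<open>t\<^sub>\<sigma>\<close>, so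
  everything about it can be said without tensors: a map is a localization at \<open>\<tau>\<close> iff its kernel is
  \<open>t\<^sub>\<tau>\<close>-power torsion and \<open>t\<^sub>\<tau>\<close>-powers carry each element of the target into the image
  (\<open>localization_map_iff\<close>). Clearing denominators gives the exactness of \<open>L\<^sub>K\<close> (\<open>Loc_exact\<close>) and shows
  that \<open>L\<^sub>K f\<close> is invertible iff \<open>L\<^sub>K\<close> kills the kernel and the cokernel of \<open>f\<close>, which
  means iff the Serre quotient inverts \<open>f\<close> (\<open>Loc_iso_iff\<close>, \<open>inverted_iff_torsion_iso\<close>).

  The rest of the passage to the quotient is formal. A functor that inverts the right arrows induces
  an equivalence as soon as its target objects are all reached, every arrow \<open>L X \<rightarrow> L Y\<close> is a
  fraction \<open>L f \<circ> (L s)\<inverse>\<close>, and arrows of the source with the same image agree after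
  composition with an inverted arrow (\<open>induced_equivalence\<close>). Faithfulness in this sense comes from the equalizer
  (\<open>Loc_faithful\<close>).

  The other two properties rest on a gluing argument. Let \<open>N\<close> be in \<open>\<L>(K)\<close> and \<open>\<sigma>\<close>, \<open>\<tau>\<close> missing
  faces. Supersets of missing faces are missing, so \<open>N\<close> has a value at \<open>\<sigma> \<union> \<tau>\<close>; and as the variables
  in \<open>\<tau>\<close> already act invertibly on \<open>N\<^sub>\<tau>\<close>, the map from \<open>N\<^sub>\<tau>\<close> to that value inverts just \<open>t\<^sub>\<sigma>\<close>
  (\<open>power_localization_union\<close>). Hence, given \<open>y\<close> in \<open>N\<^sub>\<sigma>\<close>, some multiple \<open>t\<^sub>\<sigma>\<^sup>n y\<close> and
  elements of the other \<open>N\<^sub>\<tau>\<close> agree over all \<open>\<sigma> \<union> \<tau>\<close>. Their failure to be compatible among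
  each other vanishes there too, thus is \<open>t\<^sub>\<sigma>\<close>-power torsion, and a larger \<open>n\<close> removes it, uniformly as
  there are finitely many faces (\<open>uniform_torsion\<close>). So \<open>t\<^sub>\<sigma>\<^sup>n y\<close> extends to a
  family compatible with the transition maps (\<open>compatible_extension\<close>). Extending generators of all
  the \<open>N\<^sub>\<sigma>\<close> in this way gives finitely many families, homogeneous of degrees in \<open>\<nat>\<^sup>m\<close>, and the
  \<open>R\<close>-module \<open>X\<close> that they span satisfies \<open>L\<^sub>K X \<cong> N\<close>
  (\<open>generating_object\<close>, \<open>Loc_essentially_surjective\<close>). Likewise, for \<open>h : L\<^sub>K X \<rightarrow> L\<^sub>K Y\<close> there are enough
  pairs \<open>(x, y)\<close> with \<open>h (x/1) = y/1\<close> at all missing faces, and the projections of the module that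
  finitely many of them span write \<open>h\<close> as a fraction (\<open>Loc_full\<close>).
\<close>

section \<open>Equivalences of categories\<close>

lemma ex1_memE:
  assumes "\<exists>!f. f \<in> A"
  obtains a where "a \<in> A" "\<And>b. b \<in> A \<Longrightarrow> b = a"
  using assms by auto

lemma zero_object_homs:
  "is_zero_object C Z \<Longrightarrow> X \<in> Obj C \<Longrightarrow> (\<exists>!f. f \<in> Hom C X Z) \<and> (\<exists>!f. f \<in> Hom C Z X)"
  unfolding is_zero_object_def by simp

locale category =
  fixes C :: "('o, 'm) cat"
  assumes is_category: "is_category C"
begin

lemma idt_in: "X \<in> Obj C \<Longrightarrow> Idt C X \<in> Hom C X X"
  using is_category unfolding is_category_def by blast

lemma comp_in:
  "\<lbrakk>X \<in> Obj C; Y \<in> Obj C; Z \<in> Obj C; f \<in> Hom C X Y; g \<in> Hom C Y Z\<rbrakk> \<Longrightarrow> Comp C X Y Z g f \<in> Hom C X Z"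
  using is_category unfolding is_category_def by blast

lemma comp_idt: "\<lbrakk>X \<in> Obj C; Y \<in> Obj C; f \<in> Hom C X Y\<rbrakk> \<Longrightarrow> Comp C X X Y f (Idt C X) = f"
  using is_category unfolding is_category_def by blast

lemma idt_comp: "\<lbrakk>X \<in> Obj C; Y \<in> Obj C; f \<in> Hom C X Y\<rbrakk> \<Longrightarrow> Comp C X Y Y (Idt C Y) f = f"
  using is_category unfolding is_category_def by blast

lemma comp_assoc:
  "\<lbrakk>W \<in> Obj C; X \<in> Obj C; Y \<in> Obj C; Z \<in> Obj C; f \<in> Hom C W X; g \<in> Hom C X Y; h \<in> Hom C Y Z\<rbrakk> \<Longrightarrow>
   Comp C W Y Z h (Comp C W X Y g f) = Comp C W X Z (Comp C X Y Z h g) f"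
  using is_category unfolding is_category_def by blast

lemma iso_inverse:
  assumes "is_iso_arrow C X Y s" "X \<in> Obj C" "Y \<in> Obj C"
  obtains t where "t \<in> Hom C Y X" "Comp C X Y X t s = Idt C X" "Comp C Y X Y s t = Idt C Y"
    "is_iso_arrow C Y X t"
  using assms unfolding is_iso_arrow_def by blast

lemma iso_in: "is_iso_arrow C X Y s \<Longrightarrow> s \<in> Hom C X Y"
  unfolding is_iso_arrow_def by blast

lemma iso_epi:
  assumes "is_iso_arrow C X Y s" "X \<in> Obj C" "Y \<in> Obj C" "Z \<in> Obj C" "g \<in> Hom C Y Z" "h \<in> Hom C Y Z"
    and eq: "Comp C X Y Z g s = Comp C X Y Z h s"
  shows "g = h"
proof -
  obtain t where t: "t \<in> Hom C Y X" "Comp C Y X Y s t = Idt C Y"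
    using iso_inverse assms(1-3) by metis
  have "g = Comp C Y X Z (Comp C X Y Z g s) t" if "g \<in> Hom C Y Z" for g
    using comp_assoc[of Y X Y Z t s g] comp_idt[of Y Z g] t that assms iso_in by metis
  then show ?thesis using eq assms(5,6) by metis
qed

lemma iso_mono:
  assumes "is_iso_arrow C X Y s" "X \<in> Obj C" "Y \<in> Obj C" "Z \<in> Obj C" "g \<in> Hom C Z X" "h \<in> Hom C Z X"
    and eq: "Comp C Z X Y s g = Comp C Z X Y s h"
  shows "g = h"
proof -
  obtain t where t: "t \<in> Hom C Y X" "Comp C X Y X t s = Idt C X"
    using iso_inverse assms(1-3) by metis
  have "g = Comp C Z Y X t (Comp C Z X Y s g)" if "g \<in> Hom C Z X" for g
    using comp_assoc[of Z X Y X g s t] idt_comp[of Z X g] t that assms iso_in by metis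
  then show ?thesis using eq assms(5,6) by metis
qed

lemma iso_extend:
  assumes "is_iso_arrow C X Y s" "X \<in> Obj C" "Y \<in> Obj C" "Z \<in> Obj C" "f \<in> Hom C X Z"
  shows "\<exists>h\<in>Hom C Y Z. Comp C X Y Z h s = f"
proof -
  obtain t where t: "t \<in> Hom C Y X" "Comp C X Y X t s = Idt C X"
    using iso_inverse assms(1-3) by metis
  have "Comp C X Y Z (Comp C Y X Z f t) s = f"
    using comp_assoc[of X Y X Z s t f] comp_idt[of X Z f] t assms iso_in by metis
  then show ?thesis using comp_in t assms by meson
qed

lemma iso_lift:
  assumes "is_iso_arrow C X Y s" "X \<in> Obj C" "Y \<in> Obj C" "Z \<in> Obj C" "f \<in> Hom C Z Y"
  shows "\<exists>h\<in>Hom C Z X. Comp C Z X Y s h = f"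
proof -
  obtain t where t: "t \<in> Hom C Y X" "Comp C Y X Y s t = Idt C Y"
    using iso_inverse assms(1-3) by metis
  have "Comp C Z X Y s (Comp C Z Y X t f) = f"
    using comp_assoc[of Z Y X Y f t s] idt_comp[of Z Y f] t assms iso_in by metis
  then show ?thesis using comp_in t assms by meson
qed

lemma iso_idt: "X \<in> Obj C \<Longrightarrow> is_iso_arrow C X X (Idt C X)"
  unfolding is_iso_arrow_def using idt_in comp_idt by metis

lemma iso_comp:
  assumes s: "is_iso_arrow C X Y s" and t: "is_iso_arrow C Y Z t"
    and ob: "X \<in> Obj C" "Y \<in> Obj C" "Z \<in> Obj C"
  shows "is_iso_arrow C X Z (Comp C X Y Z t s)"
proof -
  obtain s' where s': "s' \<in> Hom C Y X" "Comp C X Y X s' s = Idt C X" "Comp C Y X Y s s' = Idt C Y"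
    using iso_inverse s ob by metis
  obtain t' where t': "t' \<in> Hom C Z Y" "Comp C Y Z Y t' t = Idt C Y" "Comp C Z Y Z t t' = Idt C Z"
    using iso_inverse t ob by metis
  note h = s' t' iso_in[OF s] iso_in[OF t] ob
  have ts: "Comp C X Y Z t s \<in> Hom C X Z" and st: "Comp C Z Y X s' t' \<in> Hom C Z X"
    using h comp_in by meson+
  have "Comp C X Z X (Comp C Z Y X s' t') (Comp C X Y Z t s)
      = Comp C X Y X s' (Comp C X Z Y t' (Comp C X Y Z t s))"
    using comp_assoc[of X Z Y X "Comp C X Y Z t s" t' s'] ts h by simp
  also have "Comp C X Z Y t' (Comp C X Y Z t s) = s"
    using comp_assoc[of X Y Z Y s t t'] idt_comp[of X Y s] h by simp
  finally have 1: "Comp C X Z X (Comp C Z Y X s' t') (Comp C X Y Z t s) = Idt C X" using s' by simp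
  have "Comp C Z X Z (Comp C X Y Z t s) (Comp C Z Y X s' t')
      = Comp C Z Y Z t (Comp C Z X Y s (Comp C Z Y X s' t'))"
    using comp_assoc[of Z X Y Z "Comp C Z Y X s' t'" s t] st h by simp
  also have "Comp C Z X Y s (Comp C Z Y X s' t') = t'"
    using comp_assoc[of Z Y X Y t' s' s] idt_comp[of Z Y t'] h by simp
  finally have 2: "Comp C Z X Z (Comp C X Y Z t s) (Comp C Z Y X s' t') = Idt C Z" using t' by simp
  show ?thesis unfolding is_iso_arrow_def using 1 2 ts st by blast
qed

lemma zero_object_iso:
  assumes Z: "is_zero_object C Z" and s: "is_iso_arrow C Z Z' s" and Z': "Z' \<in> Obj C"
  shows "is_zero_object C Z'"
proof -
  have ZO: "Z \<in> Obj C" using Z unfolding is_zero_object_def by blast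
  have "(\<exists>!f. f \<in> Hom C X Z') \<and> (\<exists>!f. f \<in> Hom C Z' X)" if X: "X \<in> Obj C" for X
  proof
    have homs: "\<exists>!f. f \<in> Hom C X Z" "\<exists>!f. f \<in> Hom C Z X"
      using Z X unfolding is_zero_object_def by blast+
    from homs(1) obtain a where a: "a \<in> Hom C X Z" "\<And>b. b \<in> Hom C X Z \<Longrightarrow> b = a"
      by (rule ex1_memE) (rule that)
    show "\<exists>!f. f \<in> Hom C X Z'"
    proof (rule ex1I)
      show "Comp C X Z Z' s a \<in> Hom C X Z'" using comp_in[OF X ZO Z' a(1)] iso_in[OF s] by blast
      show "f = Comp C X Z Z' s a" if "f \<in> Hom C X Z'" for f
        using iso_lift[OF s ZO Z' X that] a(2) by blast
    qed
    from homs(2) obtain c where c: "c \<in> Hom C Z X" "\<And>b. b \<in> Hom C Z X \<Longrightarrow> b = c"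
      by (rule ex1_memE) (rule that)
    obtain d where d: "d \<in> Hom C Z' X" using iso_extend[OF s ZO Z' X c(1)] by blast
    show "\<exists>!f. f \<in> Hom C Z' X"
    proof (rule ex1I, rule d)
      show "f = d" if "f \<in> Hom C Z' X" for f
        by (rule iso_epi[OF s ZO Z' X that d], rule trans[OF c(2) c(2)[symmetric]];
            rule comp_in[OF ZO Z' X iso_in[OF s]]) (fact that d)+
    qed
  qed
  then show ?thesis using Z' unfolding is_zero_object_def by blast
qed

end

lemma functor_category:
  assumes "is_functor C D F"
  shows "category C" "category D"
  using assms unfolding is_functor_def category_def by auto

lemma functor_obj: "is_functor C D F \<Longrightarrow> X \<in> Obj C \<Longrightarrow> on_obj F X \<in> Obj D"
  unfolding is_functor_def by blast

lemma functor_hom: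
  "\<lbrakk>is_functor C D F; X \<in> Obj C; Y \<in> Obj C; f \<in> Hom C X Y\<rbrakk>
    \<Longrightarrow> on_hom F X Y f \<in> Hom D (on_obj F X) (on_obj F Y)"
  unfolding is_functor_def by blast

lemma functor_idt: "is_functor C D F \<Longrightarrow> X \<in> Obj C \<Longrightarrow> on_hom F X X (Idt C X) = Idt D (on_obj F X)"
  unfolding is_functor_def by blast

lemma functor_comp:
  "\<lbrakk>is_functor C D F; X \<in> Obj C; Y \<in> Obj C; Z \<in> Obj C; f \<in> Hom C X Y; g \<in> Hom C Y Z\<rbrakk>
    \<Longrightarrow> on_hom F X Z (Comp C X Y Z g f) =
      Comp D (on_obj F X) (on_obj F Y) (on_obj F Z) (on_hom F Y Z g) (on_hom F X Y f)"
  unfolding is_functor_def by blast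

locale fully_faithful_essentially_surjective =
  fixes C :: "('o, 'm) cat" and D :: "('p, 'n) cat" and F :: "('o, 'm, 'p, 'n) cfunctor"
  assumes F: "is_functor C D F"
    and fully_faithful: "\<And>X Y. X \<in> Obj C \<Longrightarrow> Y \<in> Obj C \<Longrightarrow>
      bij_betw (on_hom F X Y) (Hom C X Y) (Hom D (on_obj F X) (on_obj F Y))"
    and essentially_surjective: "\<And>N. N \<in> Obj D \<Longrightarrow> \<exists>X\<in>Obj C. \<exists>e. is_iso_arrow D (on_obj F X) N e"
begin

abbreviation "Fo \<equiv> on_obj F"
abbreviation "Fh \<equiv> on_hom F"

sublocale C: category C by (rule functor_category[OF F])
sublocale D: category D by (rule functor_category[OF F])

lemmas F_obj = functor_obj[OF F]
lemmas F_hom = functor_hom[OF F]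
lemmas F_idt = functor_idt[OF F]
lemmas F_comp = functor_comp[OF F]

lemma full: "\<lbrakk>X \<in> Obj C; Y \<in> Obj C; h \<in> Hom D (Fo X) (Fo Y)\<rbrakk> \<Longrightarrow> \<exists>f\<in>Hom C X Y. Fh X Y f = h"
  using fully_faithful[of X Y] unfolding bij_betw_def by (metis imageE)

lemma faithful:
  "\<lbrakk>X \<in> Obj C; Y \<in> Obj C; f \<in> Hom C X Y; g \<in> Hom C X Y; Fh X Y f = Fh X Y g\<rbrakk> \<Longrightarrow> f = g"
  using fully_faithful[of X Y] unfolding bij_betw_def by (metis inj_onD)

lemma reflects_iso:
  assumes X: "X \<in> Obj C" and Y: "Y \<in> Obj C" and f: "f \<in> Hom C X Y"
    and iso: "is_iso_arrow D (Fo X) (Fo Y) (Fh X Y f)"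
  shows "is_iso_arrow C X Y f"
proof -
  obtain k where k: "k \<in> Hom D (Fo Y) (Fo X)"
    "Comp D (Fo X) (Fo Y) (Fo X) k (Fh X Y f) = Idt D (Fo X)"
    "Comp D (Fo Y) (Fo X) (Fo Y) (Fh X Y f) k = Idt D (Fo Y)"
    using D.iso_inverse[OF iso] F_obj X Y by metis
  obtain g where g: "g \<in> Hom C Y X" "Fh Y X g = k" using full k X Y by metis
  have "Comp C X Y X g f = Idt C X"
    by (rule faithful[OF X X C.comp_in[OF X Y X f g(1)] C.idt_in[OF X]])
      (simp add: F_comp[OF X Y X f g(1)] F_idt[OF X] g k)
  moreover have "Comp C Y X Y f g = Idt C Y"
    by (rule faithful[OF Y Y C.comp_in[OF Y X Y g(1) f] C.idt_in[OF Y]])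
      (simp add: F_comp[OF Y X Y g(1) f] F_idt[OF Y] g k)
  ultimately show ?thesis unfolding is_iso_arrow_def using f g by blast
qed

lemma equivalence: "is_equivalence C D F"
proof -
  obtain G where G: "\<And>N. N \<in> Obj D \<Longrightarrow> G N \<in> Obj C \<and> (\<exists>e. is_iso_arrow D (Fo (G N)) N e)"
    using essentially_surjective by metis
  then obtain e where e: "\<And>N. N \<in> Obj D \<Longrightarrow> is_iso_arrow D (Fo (G N)) N (e N)" by metis
  have GO: "\<And>N. N \<in> Obj D \<Longrightarrow> G N \<in> Obj C" using G by blast
  note FG = F_obj[OF GO]
  note eh = D.iso_in[OF e]
  \<comment> \<open>The value of the quasi-inverse on \<open>f\<close> is characterized by naturality of \<open>e\<close>.\<close>
  have "\<exists>a. a \<in> Hom C (G N) (G P) \<and>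
      Comp D (Fo (G N)) (Fo (G P)) P (e P) (Fh (G N) (G P) a)
        = Comp D (Fo (G N)) N P f (e N)"
    if N: "N \<in> Obj D" and P: "P \<in> Obj D" and f: "f \<in> Hom D N P" for N P f
  proof -
    have "Comp D (Fo (G N)) N P f (e N) \<in> Hom D (Fo (G N)) P"
      by (rule D.comp_in[OF FG[OF N] N P eh[OF N] f])
    then obtain h where h: "h \<in> Hom D (Fo (G N)) (Fo (G P))"
      and eq: "Comp D (Fo (G N)) (Fo (G P)) P (e P) h = Comp D (Fo (G N)) N P f (e N)"
      using D.iso_lift[OF e[OF P] FG[OF P] P FG[OF N]] by blast
    from full[OF GO[OF N] GO[OF P] h] eq show ?thesis by blast
  qed
  then obtain g where g: "\<And>N P f. \<lbrakk>N \<in> Obj D; P \<in> Obj D; f \<in> Hom D N P\<rbrakk> \<Longrightarrow> g N P f \<in> Hom C (G N) (G P)"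
    and nat: "\<And>N P f. \<lbrakk>N \<in> Obj D; P \<in> Obj D; f \<in> Hom D N P\<rbrakk> \<Longrightarrow>
      Comp D (Fo (G N)) (Fo (G P)) P (e P) (Fh (G N) (G P) (g N P f))
        = Comp D (Fo (G N)) N P f (e N)" by metis
  have g_unique: "g N P f = a"
    if N: "N \<in> Obj D" and P: "P \<in> Obj D" and f: "f \<in> Hom D N P" and a: "a \<in> Hom C (G N) (G P)"
      and eq: "Comp D (Fo (G N)) (Fo (G P)) P (e P) (Fh (G N) (G P) a)
        = Comp D (Fo (G N)) N P f (e N)" for N P f a
    by (rule faithful[OF GO[OF N] GO[OF P] g[OF N P f] a],
        rule D.iso_mono[OF e[OF P] FG[OF P] P FG[OF N] F_hom[OF GO[OF N] GO[OF P] g[OF N P f]]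
          F_hom[OF GO[OF N] GO[OF P] a]], rule trans[OF nat[OF N P f] eq[symmetric]])
  let ?G = "\<lparr>on_obj = G, on_hom = g\<rparr>"
  have 1: "is_functor D C ?G"
    unfolding is_functor_def
  proof (intro conjI ballI)
    show "on_hom ?G N N (Idt D N) = Idt C (on_obj ?G N)" if N: "N \<in> Obj D" for N
    proof -
      have "g N N (Idt D N) = Idt C (G N)"
        by (rule g_unique) (use N FG GO eh in \<open>simp_all add: D.idt_in C.idt_in F_idt D.comp_idt D.idt_comp\<close>)
      then show ?thesis by simp
    qed
    show "on_hom ?G N Q (Comp D N P Q b a) =
        Comp C (on_obj ?G N) (on_obj ?G P) (on_obj ?G Q) (on_hom ?G P Q b) (on_hom ?G N P a)"
      if ob: "N \<in> Obj D" "P \<in> Obj D" "Q \<in> Obj D" and a: "a \<in> Hom D N P" and b: "b \<in> Hom D P Q" for N P Q a b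
    proof -
      let ?Fa = "Fh (G N) (G P) (g N P a)" and ?Fb = "Fh (G P) (G Q) (g P Q b)"
      have Fa: "?Fa \<in> Hom D (Fo (G N)) (Fo (G P))"
        and Fb: "?Fb \<in> Hom D (Fo (G P)) (Fo (G Q))"
        using F_hom GO g ob a b by meson+
      have "Comp D (Fo (G N)) (Fo (G Q)) Q (e Q)
              (Comp D (Fo (G N)) (Fo (G P)) (Fo (G Q)) ?Fb ?Fa)
          = Comp D (Fo (G N)) (Fo (G P)) Q
              (Comp D (Fo (G P)) P Q b (e P)) ?Fa"
        using nat[of P Q b] D.comp_assoc[OF FG FG FG _ Fa Fb eh] ob b by simp
      also have "\<dots> = Comp D (Fo (G N)) P Q b (Comp D (Fo (G N)) N P a (e N))"
        using D.comp_assoc[OF FG FG _ _ Fa eh b] nat[of N P a] ob a by simp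
      also have "\<dots> = Comp D (Fo (G N)) N Q (Comp D N P Q b a) (e N)"
        using D.comp_assoc[OF FG _ _ _ eh a b] ob by simp
      finally have "g N Q (Comp D N P Q b a) = Comp C (G N) (G P) (G Q) (g P Q b) (g N P a)"
        using ob a b by (intro g_unique) (auto intro!: D.comp_in C.comp_in GO g simp: F_comp GO g)
      then show ?thesis by simp
    qed
  qed (auto simp: C.is_category D.is_category GO g)
  have 2: "naturally_isomorphic D D (comp_functor F ?G) id_functor"
    unfolding naturally_isomorphic_def comp_functor_def id_functor_def
    by (rule exI[of _ e]) (simp add: e nat)
  have "\<exists>a. a \<in> Hom C (G (Fo X)) X \<and> Fh (G (Fo X)) X a = e (Fo X)"
    if "X \<in> Obj C" for X
    using full[of "G (Fo X)" X "e (Fo X)"] GO F_obj eh that by metis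
  then obtain \<eta> where \<eta>: "\<And>X. X \<in> Obj C \<Longrightarrow> \<eta> X \<in> Hom C (G (Fo X)) X"
    "\<And>X. X \<in> Obj C \<Longrightarrow> Fh (G (Fo X)) X (\<eta> X) = e (Fo X)" by metis
  have "naturally_isomorphic C C (comp_functor ?G F) id_functor"
    unfolding naturally_isomorphic_def comp_functor_def id_functor_def
  proof (rule exI[of _ \<eta>], simp, intro conjI ballI)
    show "is_iso_arrow C (G (Fo X)) X (\<eta> X)" if "X \<in> Obj C" for X
      using reflects_iso[of "G (Fo X)" X "\<eta> X"] \<eta> e F_obj GO that by simp
    show "Comp C (G (Fo X)) (G (Fo Y)) Y (\<eta> Y) (g (Fo X) (Fo Y) (Fh X Y f))
        = Comp C (G (Fo X)) X Y f (\<eta> X)"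
      if "X \<in> Obj C" "Y \<in> Obj C" "f \<in> Hom C X Y" for X Y f
      by (rule faithful[of "G (Fo X)" Y])
        (use that in \<open>auto intro!: C.comp_in[of _ "G (Fo Y)"] C.comp_in[of _ X] g GO F_obj F_hom \<eta>
          simp: F_comp[of _ "G (Fo Y)"] F_comp[of _ X] GO F_obj g F_hom \<eta> nat\<close>)
  qed
  then show ?thesis unfolding is_equivalence_def using F 1 2 by blast
qed

lemma unique_hom_iff:
  assumes X: "X \<in> Obj C" and Y: "Y \<in> Obj C"
  shows "(\<exists>!f. f \<in> Hom D (Fo X) (Fo Y)) \<longleftrightarrow> (\<exists>!f. f \<in> Hom C X Y)"
proof
  assume "\<exists>!f. f \<in> Hom D (Fo X) (Fo Y)"
  then obtain c where c: "c \<in> Hom D (Fo X) (Fo Y)"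
    and u: "\<And>b. b \<in> Hom D (Fo X) (Fo Y) \<Longrightarrow> b = c" by (rule ex1_memE) (rule that)
  obtain a where a: "a \<in> Hom C X Y" using full[OF X Y c] by blast
  show "\<exists>!f. f \<in> Hom C X Y"
  proof (rule ex1I, rule a)
    show "f = a" if f: "f \<in> Hom C X Y" for f
      by (rule faithful[OF X Y f a]) (rule trans[OF u[OF F_hom[OF X Y f]] u[OF F_hom[OF X Y a], symmetric]])
  qed
next
  assume "\<exists>!f. f \<in> Hom C X Y"
  then obtain a where a: "a \<in> Hom C X Y" and u: "\<And>b. b \<in> Hom C X Y \<Longrightarrow> b = a" by (rule ex1_memE) (rule that)
  show "\<exists>!f. f \<in> Hom D (Fo X) (Fo Y)"
  proof (rule ex1I, rule F_hom[OF X Y a])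
    show "f = Fh X Y a" if "f \<in> Hom D (Fo X) (Fo Y)" for f
      using full[OF X Y that] u by blast
  qed
qed

lemma zero_object:
  assumes Z: "is_zero_object C Z"
  shows "is_zero_object D (Fo Z)"
proof -
  have ZO: "Z \<in> Obj C" using Z unfolding is_zero_object_def by blast
  have "(\<exists>!f. f \<in> Hom D T (Fo Z)) \<and> (\<exists>!f. f \<in> Hom D (Fo Z) T)" if T: "T \<in> Obj D" for T
  proof -
    obtain X e where X: "X \<in> Obj C" and e: "is_iso_arrow D (Fo X) T e"
      using essentially_surjective[OF T] by blast
    have homs: "(\<exists>!f. f \<in> Hom D (Fo X) (Fo Z)) \<and> (\<exists>!f. f \<in> Hom D (Fo Z) (Fo X))"
      using zero_object_homs[OF Z X] unfolding unique_hom_iff[OF X ZO] unique_hom_iff[OF ZO X] .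
    have "\<exists>!f. f \<in> Hom D T (Fo Z)"
    proof -
      from homs[THEN conjunct1] obtain c where c: "c \<in> Hom D (Fo X) (Fo Z)"
        and u: "\<And>b. b \<in> Hom D (Fo X) (Fo Z) \<Longrightarrow> b = c" by (rule ex1_memE) (rule that)
      obtain d where d: "d \<in> Hom D T (Fo Z)" using D.iso_extend[OF e F_obj[OF X] T F_obj[OF ZO] c] by blast
      show ?thesis
      proof (rule ex1I, rule d)
        show "f = d" if f: "f \<in> Hom D T (Fo Z)" for f
        proof (rule D.iso_epi[OF e F_obj[OF X] T F_obj[OF ZO] f d])
          show "Comp D (Fo X) T (Fo Z) f e = Comp D (Fo X) T (Fo Z) d e"
            using u D.comp_in[OF F_obj[OF X] T F_obj[OF ZO] D.iso_in[OF e]] f d by metis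
        qed
      qed
    qed
    moreover have "\<exists>!f. f \<in> Hom D (Fo Z) T"
    proof -
      from homs[THEN conjunct2] obtain c where c: "c \<in> Hom D (Fo Z) (Fo X)"
        and u: "\<And>b. b \<in> Hom D (Fo Z) (Fo X) \<Longrightarrow> b = c" by (rule ex1_memE) (rule that)
      show ?thesis
      proof (rule ex1I)
        show "Comp D (Fo Z) (Fo X) T e c \<in> Hom D (Fo Z) T"
          by (rule D.comp_in[OF F_obj[OF ZO] F_obj[OF X] T c D.iso_in[OF e]])
        show "f = Comp D (Fo Z) (Fo X) T e c" if "f \<in> Hom D (Fo Z) T" for f
          using D.iso_lift[OF e F_obj[OF X] T F_obj[OF ZO] that] u by blast
      qed
    qed
    ultimately show ?thesis by blast
  qed
  then show ?thesis using F_obj[OF ZO] unfolding is_zero_object_def by blast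
qed

lemma reflects_zero_object:
  assumes Z: "is_zero_object D (Fo Z)" and ZO: "Z \<in> Obj C"
  shows "is_zero_object C Z"
proof -
  have "(\<exists>!f. f \<in> Hom C X Z) \<and> (\<exists>!f. f \<in> Hom C Z X)" if X: "X \<in> Obj C" for X
  proof -
    show ?thesis
      using zero_object_homs[OF Z F_obj[OF X]] unfolding unique_hom_iff[OF X ZO] unique_hom_iff[OF ZO X] .
  qed
  then show ?thesis using ZO unfolding is_zero_object_def by blast
qed

lemma zero_arrow_iff:
  assumes X: "X \<in> Obj C" and Y: "Y \<in> Obj C" and f: "f \<in> Hom C X Y"
  shows "is_zero_arrow D (Fo X) (Fo Y) (Fh X Y f) \<longleftrightarrow> is_zero_arrow C X Y f"
proof
  assume "is_zero_arrow C X Y f"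
  then show "is_zero_arrow D (Fo X) (Fo Y) (Fh X Y f)"
  proof -
    obtain Z g h where Z: "is_zero_object C Z" and g: "g \<in> Hom C X Z" and h: "h \<in> Hom C Z Y"
      and f': "f = Comp C X Z Y h g"
      using \<open>is_zero_arrow C X Y f\<close> unfolding is_zero_arrow_def by blast
    then have ZO: "Z \<in> Obj C" unfolding is_zero_object_def by blast
    show ?thesis unfolding is_zero_arrow_def f' F_comp[OF X ZO Y g h]
      using zero_object[OF Z] F_hom[OF X ZO g] F_hom[OF ZO Y h] by blast
  qed
next
  assume "is_zero_arrow D (Fo X) (Fo Y) (Fh X Y f)"
  then obtain Z g h where Z: "is_zero_object D Z" and g: "g \<in> Hom D (Fo X) Z" and h: "h \<in> Hom D Z (Fo Y)"
    and f': "Fh X Y f = Comp D (Fo X) Z (Fo Y) h g"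
    unfolding is_zero_arrow_def by blast
  have ZO: "Z \<in> Obj D" using Z unfolding is_zero_object_def by blast
  obtain W e where W: "W \<in> Obj C" and e: "is_iso_arrow D (Fo W) Z e"
    using essentially_surjective[OF ZO] by blast
  obtain e' where e': "is_iso_arrow D Z (Fo W) e'"
    using D.iso_inverse[OF e F_obj[OF W] ZO] by blast
  have zW: "is_zero_object C W"
    using reflects_zero_object[OF D.zero_object_iso[OF Z e' F_obj[OF W]] W] .
  obtain g' where g': "g' \<in> Hom D (Fo X) (Fo W)" "Comp D (Fo X) (Fo W) Z e g' = g"
    using D.iso_lift[OF e F_obj[OF W] ZO F_obj[OF X] g] by blast
  let ?h' = "Comp D (Fo W) Z (Fo Y) h e"
  have h': "?h' \<in> Hom D (Fo W) (Fo Y)"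
    by (rule D.comp_in[OF F_obj[OF W] ZO F_obj[OF Y] D.iso_in[OF e] h])
  obtain a where a: "a \<in> Hom C X W" "Fh X W a = g'" using full[OF X W g'(1)] by blast
  obtain b where b: "b \<in> Hom C W Y" "Fh W Y b = ?h'" using full[OF W Y h'] by blast
  have "Fh X Y (Comp C X W Y b a) = Fh X Y f"
    using D.comp_assoc[OF F_obj[OF X] F_obj[OF W] ZO F_obj[OF Y] g'(1) D.iso_in[OF e] h]
    by (simp add: F_comp[OF X W Y a(1) b(1)] a b f' g')
  then have "f = Comp C X W Y b a" using faithful[OF X Y f C.comp_in[OF X W Y a(1) b(1)]] by simp
  then show "is_zero_arrow C X Y f" unfolding is_zero_arrow_def using zW a b by blast
qed

lemma zero_arrow_pre:
  assumes "category E" "X \<in> Obj E" "Y \<in> Obj E" "T \<in> Obj E" "f \<in> Hom E X Y" "g \<in> Hom E T X"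
    and z: "is_zero_arrow E X Y f"
  shows "is_zero_arrow E T Y (Comp E T X Y f g)"
proof -
  interpret E: category E by fact
  obtain Z a b where Z: "is_zero_object E Z" and ab: "a \<in> Hom E X Z" "b \<in> Hom E Z Y" "f = Comp E X Z Y b a"
    using z unfolding is_zero_arrow_def by blast
  then have "Z \<in> Obj E" unfolding is_zero_object_def by blast
  then have "Comp E T X Y f g = Comp E T Z Y b (Comp E T X Z a g)" "Comp E T X Z a g \<in> Hom E T Z"
    using E.comp_assoc[of T X Z Y g a b] E.comp_in assms ab by auto
  then show ?thesis unfolding is_zero_arrow_def using Z ab by blast
qed

lemma zero_arrow_post:
  assumes "category E" "X \<in> Obj E" "Y \<in> Obj E" "T \<in> Obj E" "f \<in> Hom E X Y" "g \<in> Hom E Y T"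
    and z: "is_zero_arrow E X Y f"
  shows "is_zero_arrow E X T (Comp E X Y T g f)"
proof -
  interpret E: category E by fact
  obtain Z a b where Z: "is_zero_object E Z" and ab: "a \<in> Hom E X Z" "b \<in> Hom E Z Y" "f = Comp E X Z Y b a"
    using z unfolding is_zero_arrow_def by blast
  then have "Z \<in> Obj E" unfolding is_zero_object_def by blast
  then have "Comp E X Y T g f = Comp E X Z T (Comp E Z Y T g b) a" "Comp E Z Y T g b \<in> Hom E Z T"
    using E.comp_assoc[of X Z Y T a b g] E.comp_in assms ab by auto
  then show ?thesis unfolding is_zero_arrow_def using Z ab by blast
qed

text \<open>Full faithfulness gives the universal property against the objects \<open>F T\<close>; as every object of \<open>D\<close> is
  isomorphic to one of these, it holds in general.\<close>

lemma kernel: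
  assumes k: "is_kernel C X Y f N i" and X: "X \<in> Obj C" and Y: "Y \<in> Obj C" and f: "f \<in> Hom C X Y"
  shows "is_kernel D (Fo X) (Fo Y) (Fh X Y f) (Fo N) (Fh N X i)"
proof -
  have N: "N \<in> Obj C" and i: "i \<in> Hom C N X" and z: "is_zero_arrow C N Y (Comp C N X Y f i)"
    and u: "\<And>T g. \<lbrakk>T \<in> Obj C; g \<in> Hom C T X; is_zero_arrow C T Y (Comp C T X Y f g)\<rbrakk> \<Longrightarrow>
      \<exists>!h. h \<in> Hom C T N \<and> Comp C T N X i h = g"
    using k unfolding is_kernel_def by blast+
  note FX = F_obj[OF X] and FY = F_obj[OF Y] and FN = F_obj[OF N]
  note Ff = F_hom[OF X Y f] and Fi = F_hom[OF N X i]
  have "\<exists>!h. h \<in> Hom D T (Fo N) \<and> Comp D T (Fo N) (Fo X) (Fh N X i) h = g"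
    if T: "T \<in> Obj D" and g: "g \<in> Hom D T (Fo X)"
      and gz: "is_zero_arrow D T (Fo Y) (Comp D T (Fo X) (Fo Y) (Fh X Y f) g)" for T g
  proof -
    obtain W e where W: "W \<in> Obj C" and e: "is_iso_arrow D (Fo W) T e"
      using essentially_surjective[OF T] by blast
    note FW = F_obj[OF W] and eh = D.iso_in[OF e]
    have ge: "Comp D (Fo W) T (Fo X) g e \<in> Hom D (Fo W) (Fo X)"
      by (rule D.comp_in[OF FW T FX eh g])
    obtain g' where g': "g' \<in> Hom C W X" "Fh W X g' = Comp D (Fo W) T (Fo X) g e"
      using full[OF W X ge] by blast
    have "is_zero_arrow D (Fo W) (Fo Y) (Fh W Y (Comp C W X Y f g'))"
      using zero_arrow_pre[OF D.category_axioms T FY FW D.comp_in[OF T FX FY g Ff] eh gz]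
        D.comp_assoc[OF FW T FX FY eh g Ff] by (simp add: F_comp[OF W X Y g'(1) f] g')
    then have "is_zero_arrow C W Y (Comp C W X Y f g')"
      using zero_arrow_iff[OF W Y C.comp_in[OF W X Y g'(1) f]] by simp
    then obtain h where h: "h \<in> Hom C W N" "Comp C W N X i h = g'"
      and hu: "\<And>h'. h' \<in> Hom C W N \<Longrightarrow> Comp C W N X i h' = g' \<Longrightarrow> h' = h"
      using u[OF W g'(1)] by blast
    obtain j where j: "j \<in> Hom D T (Fo N)" "Comp D (Fo W) T (Fo N) j e = Fh W N h"
      using D.iso_extend[OF e FW T FN F_hom[OF W N h(1)]] by blast
    show ?thesis
    proof (rule ex1I[of _ j], intro conjI)
      show "j \<in> Hom D T (Fo N)" by (rule j)
      show "Comp D T (Fo N) (Fo X) (Fh N X i) j = g"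
      proof (rule D.iso_epi[OF e FW T FX D.comp_in[OF T FN FX j(1) Fi] g])
        show "Comp D (Fo W) T (Fo X) (Comp D T (Fo N) (Fo X) (Fh N X i) j) e
            = Comp D (Fo W) T (Fo X) g e"
          using D.comp_assoc[OF FW T FN FX eh j(1) Fi] F_comp[OF W N X h(1) i] j h g' by simp
      qed
    next
      fix l assume l: "l \<in> Hom D T (Fo N) \<and> Comp D T (Fo N) (Fo X) (Fh N X i) l = g"
      then have le: "Comp D (Fo W) T (Fo N) l e \<in> Hom D (Fo W) (Fo N)"
        using D.comp_in[OF FW T FN eh] by blast
      obtain l' where l': "l' \<in> Hom C W N" "Fh W N l' = Comp D (Fo W) T (Fo N) l e"
        using full[OF W N le] by blast
      have "Fh W X (Comp C W N X i l') = Fh W X g'"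
        using D.comp_assoc[OF FW T FN FX eh _ Fi, of l] l F_comp[OF W N X l'(1) i] l' g' by simp
      then have "l' = h" using faithful[OF W X C.comp_in[OF W N X l'(1) i] g'(1)] hu l'(1) by blast
      then show "l = j" using D.iso_epi[OF e FW T FN _ j(1), of l] l l' j by simp
    qed
  qed
  moreover have "is_zero_arrow D (Fo N) (Fo Y)
      (Comp D (Fo N) (Fo X) (Fo Y) (Fh X Y f) (Fh N X i))"
    using zero_arrow_iff[OF N Y C.comp_in[OF N X Y i f]] z by (simp add: F_comp[OF N X Y i f])
  ultimately show ?thesis unfolding is_kernel_def using FN Fi by blast
qed

lemma cokernel:
  assumes k: "is_cokernel C X Y f Q p" and X: "X \<in> Obj C" and Y: "Y \<in> Obj C" and f: "f \<in> Hom C X Y"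
  shows "is_cokernel D (Fo X) (Fo Y) (Fh X Y f) (Fo Q) (Fh Y Q p)"
proof -
  have Q: "Q \<in> Obj C" and p: "p \<in> Hom C Y Q" and z: "is_zero_arrow C X Q (Comp C X Y Q p f)"
    and u: "\<And>T g. \<lbrakk>T \<in> Obj C; g \<in> Hom C Y T; is_zero_arrow C X T (Comp C X Y T g f)\<rbrakk> \<Longrightarrow>
      \<exists>!h. h \<in> Hom C Q T \<and> Comp C Y Q T h p = g"
    using k unfolding is_cokernel_def by blast+
  note FX = F_obj[OF X] and FY = F_obj[OF Y] and FQ = F_obj[OF Q]
  note Ff = F_hom[OF X Y f] and Fp = F_hom[OF Y Q p]
  have "\<exists>!h. h \<in> Hom D (Fo Q) T \<and> Comp D (Fo Y) (Fo Q) T h (Fh Y Q p) = g"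
    if T: "T \<in> Obj D" and g: "g \<in> Hom D (Fo Y) T"
      and gz: "is_zero_arrow D (Fo X) T (Comp D (Fo X) (Fo Y) T g (Fh X Y f))" for T g
  proof -
    obtain W d where W: "W \<in> Obj C" and d: "is_iso_arrow D (Fo W) T d"
      using essentially_surjective[OF T] by blast
    note FW = F_obj[OF W]
    obtain e where e: "is_iso_arrow D T (Fo W) e" using D.iso_inverse[OF d FW T] by blast
    note eh = D.iso_in[OF e]
    have ge: "Comp D (Fo Y) T (Fo W) e g \<in> Hom D (Fo Y) (Fo W)"
      by (rule D.comp_in[OF FY T FW g eh])
    obtain g' where g': "g' \<in> Hom C Y W" "Fh Y W g' = Comp D (Fo Y) T (Fo W) e g"
      using full[OF Y W ge] by blast
    have "is_zero_arrow D (Fo X) (Fo W) (Fh X W (Comp C X Y W g' f))"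
      using zero_arrow_post[OF D.category_axioms FX T FW D.comp_in[OF FX FY T Ff g] eh gz]
        D.comp_assoc[OF FX FY T FW Ff g eh] by (simp add: F_comp[OF X Y W f g'(1)] g')
    then have "is_zero_arrow C X W (Comp C X Y W g' f)"
      using zero_arrow_iff[OF X W C.comp_in[OF X Y W f g'(1)]] by simp
    then obtain h where h: "h \<in> Hom C Q W" "Comp C Y Q W h p = g'"
      and hu: "\<And>h'. h' \<in> Hom C Q W \<Longrightarrow> Comp C Y Q W h' p = g' \<Longrightarrow> h' = h"
      using u[OF W g'(1)] by blast
    obtain j where j: "j \<in> Hom D (Fo Q) T" "Comp D (Fo Q) T (Fo W) e j = Fh Q W h"
      using D.iso_lift[OF e T FW FQ F_hom[OF Q W h(1)]] by blast
    show ?thesis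
    proof (rule ex1I[of _ j], intro conjI)
      show "j \<in> Hom D (Fo Q) T" by (rule j)
      show "Comp D (Fo Y) (Fo Q) T j (Fh Y Q p) = g"
      proof (rule D.iso_mono[OF e T FW FY D.comp_in[OF FY FQ T Fp j(1)] g])
        show "Comp D (Fo Y) T (Fo W) e (Comp D (Fo Y) (Fo Q) T j (Fh Y Q p))
            = Comp D (Fo Y) T (Fo W) e g"
          using D.comp_assoc[OF FY FQ T FW Fp j(1) eh] F_comp[OF Y Q W p h(1)] j h g' by simp
      qed
    next
      fix l assume l: "l \<in> Hom D (Fo Q) T \<and> Comp D (Fo Y) (Fo Q) T l (Fh Y Q p) = g"
      then have le: "Comp D (Fo Q) T (Fo W) e l \<in> Hom D (Fo Q) (Fo W)"
        using D.comp_in[OF FQ T FW _ eh] by blast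
      obtain l' where l': "l' \<in> Hom C Q W" "Fh Q W l' = Comp D (Fo Q) T (Fo W) e l"
        using full[OF Q W le] by blast
      have "Fh Y W (Comp C Y Q W l' p) = Fh Y W g'"
        using D.comp_assoc[OF FY FQ T FW Fp _ eh, of l] l F_comp[OF Y Q W p l'(1)] l' g' by simp
      then have "l' = h" using faithful[OF Y W C.comp_in[OF Y Q W p l'(1)] g'(1)] hu l'(1) by blast
      then show "l = j" using D.iso_mono[OF e T FW FQ _ j(1), of l] l l' j by simp
    qed
  qed
  moreover have "is_zero_arrow D (Fo X) (Fo Q)
      (Comp D (Fo X) (Fo Y) (Fo Q) (Fh Y Q p) (Fh X Y f))"
    using zero_arrow_iff[OF X Q C.comp_in[OF X Y Q f p]] z by (simp add: F_comp[OF X Y Q f p])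
  ultimately show ?thesis unfolding is_cokernel_def using FQ Fp by blast
qed

lemma exact: "exact_functor C D F"
  unfolding exact_functor_def short_exact_def
  using F kernel cokernel F_obj F_hom by blast

end

section \<open>Functors that invert the arrows of a Serre quotient\<close>

text \<open>The hypotheses under which \<open>L\<close> induces an equivalence from the quotient by \<open>S\<close>. They are stated with
  objects and arrows of \<open>C\<close>, so that nothing about the quotient category enters their verification.\<close>

locale localizing_functor =
  fixes C :: "('o, 'm) cat" and D :: "('p, 'n) cat" and L :: "('o, 'm, 'p, 'n) cfunctor" and S :: "'o set"
  assumes L: "is_functor C D L"
    and inverted_iff: "\<And>X Y f. \<lbrakk>X \<in> Obj C; Y \<in> Obj C; f \<in> Hom C X Y\<rbrakk> \<Longrightarrow>
      inverted_arrow C S X Y f \<longleftrightarrow> is_iso_arrow D (on_obj L X) (on_obj L Y) (on_hom L X Y f)"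
    and full_up_to_roofs: "\<And>X Y h. \<lbrakk>X \<in> Obj C; Y \<in> Obj C; h \<in> Hom D (on_obj L X) (on_obj L Y)\<rbrakk> \<Longrightarrow>
      \<exists>A\<in>Obj C. \<exists>s f. inverted_arrow C S A X s \<and> f \<in> Hom C A Y \<and>
        Comp D (on_obj L A) (on_obj L X) (on_obj L Y) h (on_hom L A X s) = on_hom L A Y f"
    and faithful_up_to_roofs: "\<And>X Y f g. \<lbrakk>X \<in> Obj C; Y \<in> Obj C; f \<in> Hom C X Y; g \<in> Hom C X Y;
      on_hom L X Y f = on_hom L X Y g\<rbrakk> \<Longrightarrow>
      \<exists>U\<in>Obj C. \<exists>u. inverted_arrow C S U X u \<and> Comp C U X Y f u = Comp C U X Y g u"
    and essentially_surjective: "\<And>N. N \<in> Obj D \<Longrightarrow> \<exists>X\<in>Obj C. \<exists>e. is_iso_arrow D (on_obj L X) N e"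
begin

abbreviation "Lo \<equiv> on_obj L"
abbreviation "Lh \<equiv> on_hom L"

sublocale C: category C by (rule functor_category[OF L])
sublocale D: category D by (rule functor_category[OF L])

lemmas L_obj = functor_obj[OF L]
lemmas L_hom = functor_hom[OF L]
lemmas L_idt = functor_idt[OF L]
lemmas L_comp = functor_comp[OF L]

abbreviation Q where "Q \<equiv> serre_quotient C S"
abbreviation q where "q \<equiv> quotient_functor C S"

lemma inverted_in: "inverted_arrow C S X Y f \<Longrightarrow> f \<in> Hom C X Y"
  unfolding inverted_arrow_def by blast

lemma inverted_iso:
  "\<lbrakk>inverted_arrow C S X Y f; X \<in> Obj C; Y \<in> Obj C\<rbrakk> \<Longrightarrow>
    is_iso_arrow D (Lo X) (Lo Y) (Lh X Y f)"
  using inverted_iff inverted_in by blast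

lemma inverted_comp:
  assumes ob: "X \<in> Obj C" "Y \<in> Obj C" "Z \<in> Obj C"
    and s: "inverted_arrow C S X Y s" and t: "inverted_arrow C S Y Z t"
  shows "inverted_arrow C S X Z (Comp C X Y Z t s)"
  using inverted_iff[OF ob(1,3) C.comp_in[OF ob inverted_in[OF s] inverted_in[OF t]]]
    D.iso_comp[OF inverted_iso[OF s ob(1,2)] inverted_iso[OF t ob(2,3)]] L_obj ob
  by (simp add: L_comp[OF ob inverted_in[OF s] inverted_in[OF t]])

lemma inverted_idt: "X \<in> Obj C \<Longrightarrow> inverted_arrow C S X X (Idt C X)"
  using inverted_iff[OF _ _ C.idt_in] D.iso_idt L_idt L_obj by auto

text \<open>The Ore condition: realize the arrow \<open>(L t)\<inverse> \<circ> L f\<close> of \<open>D\<close> by a roof, which closes the square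
  after applying \<open>L\<close>, and refine the roof until the square commutes in \<open>C\<close>.\<close>

lemma ore:
  assumes A: "A \<in> Obj C" and B: "B \<in> Obj C" and Y: "Y \<in> Obj C"
    and f: "f \<in> Hom C A Y" and t: "inverted_arrow C S B Y t"
  shows "\<exists>U\<in>Obj C. \<exists>u v. inverted_arrow C S U A u \<and> v \<in> Hom C U B \<and> Comp C U A Y f u = Comp C U B Y t v"
proof -
  note t' = inverted_in[OF t]
  note LA = L_obj[OF A] and LB = L_obj[OF B] and LY = L_obj[OF Y]
  obtain h where h: "h \<in> Hom D (Lo A) (Lo B)"
    and ht: "Comp D (Lo A) (Lo B) (Lo Y) (Lh B Y t) h = Lh A Y f"
    using D.iso_lift[OF inverted_iso[OF t B Y] LB LY LA L_hom[OF A Y f]] by blast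
  obtain V u v where V: "V \<in> Obj C" and u: "inverted_arrow C S V A u" and v: "v \<in> Hom C V B"
    and hu: "Comp D (Lo V) (Lo A) (Lo B) h (Lh V A u) = Lh V B v"
    using full_up_to_roofs[OF A B h] by blast
  note u' = inverted_in[OF u] and LV = L_obj[OF V]
  have "Lh V Y (Comp C V A Y f u) = Lh V Y (Comp C V B Y t v)"
    using D.comp_assoc[OF LV LA LB LY L_hom[OF V A u'] h L_hom[OF B Y t']] ht hu
    by (simp add: L_comp[OF V A Y u' f] L_comp[OF V B Y v t'])
  then obtain U w where U: "U \<in> Obj C" and w: "inverted_arrow C S U V w"
    and eq: "Comp C U V Y (Comp C V A Y f u) w = Comp C U V Y (Comp C V B Y t v) w"
    using faithful_up_to_roofs[OF V Y C.comp_in[OF V A Y u' f] C.comp_in[OF V B Y v t']] by blast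
  note w' = inverted_in[OF w]
  have "Comp C U A Y f (Comp C U V A u w) = Comp C U B Y t (Comp C U V B v w)"
    using eq by (simp add: C.comp_assoc[OF U V A Y w' u' f] C.comp_assoc[OF U V B Y w' v t'])
  then show ?thesis using U inverted_comp[OF U V A w u] C.comp_in[OF U V B w' v] by blast
qed

text \<open>The arrow \<open>L f \<circ> (L s)\<inverse>\<close> of \<open>D\<close> that the roof \<open>(A, s, f)\<close> from \<open>X\<close> to \<open>Y\<close> represents.\<close>

definition represents :: "'o \<Rightarrow> 'o \<Rightarrow> 'o \<times> 'm \<times> 'm \<Rightarrow> 'n \<Rightarrow> bool" where
  "represents X Y = (\<lambda>(A, s, f) h. (A, s, f) \<in> roofs C S X Y \<and> h \<in> Hom D (Lo X) (Lo Y) \<and>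
     Comp D (Lo A) (Lo X) (Lo Y) h (Lh A X s) = Lh A Y f)"

definition roof_class :: "'o \<Rightarrow> 'o \<Rightarrow> 'n \<Rightarrow> ('o \<times> 'm \<times> 'm) set" where
  "roof_class X Y h = {r. represents X Y r h}"

lemma roofsD:
  assumes "(A, s, f) \<in> roofs C S X Y"
  shows "A \<in> Obj C" "inverted_arrow C S A X s" "s \<in> Hom C A X" "f \<in> Hom C A Y"
  using assms unfolding roofs_def by (auto simp: inverted_in)

lemma representsD:
  assumes "represents X Y (A, s, f) h"
  shows "(A, s, f) \<in> roofs C S X Y" "h \<in> Hom D (Lo X) (Lo Y)"
    "Comp D (Lo A) (Lo X) (Lo Y) h (Lh A X s) = Lh A Y f"
  using assms unfolding represents_def by auto

lemma represents_exists:
  assumes X: "X \<in> Obj C" and Y: "Y \<in> Obj C" and r: "r \<in> roofs C S X Y"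
  shows "\<exists>h. represents X Y r h"
proof -
  obtain A s f where rr: "r = (A, s, f)" by (cases r)
  note R = roofsD[OF r[unfolded rr]]
  show ?thesis unfolding rr represents_def
    using D.iso_extend[OF inverted_iso[OF R(2,1) X] L_obj[OF R(1)] L_obj[OF X] L_obj[OF Y] L_hom[OF R(1) Y R(4)]]
      r rr by auto
qed

lemma represents_unique:
  assumes X: "X \<in> Obj C" and Y: "Y \<in> Obj C" and g: "represents X Y r g" and h: "represents X Y r h"
  shows "g = h"
proof -
  obtain A s f where rr: "r = (A, s, f)" by (cases r)
  note G = representsD[OF g[unfolded rr]] and H = representsD[OF h[unfolded rr]]
  note R = roofsD[OF G(1)]
  show ?thesis
    by (rule D.iso_epi[OF inverted_iso[OF R(2,1) X] L_obj[OF R(1)] L_obj[OF X] L_obj[OF Y] G(2) H(2)])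
      (rule trans[OF G(3) H(3)[symmetric]])
qed

lemma represents_arrow:
  assumes X: "X \<in> Obj C" and Y: "Y \<in> Obj C" and f: "f \<in> Hom C X Y"
  shows "represents X Y (X, Idt C X, f) (Lh X Y f)"
  unfolding represents_def roofs_def
  using X Y f L_hom[OF X Y f] inverted_idt[OF X] D.comp_idt[OF L_obj[OF X] L_obj[OF Y] L_hom[OF X Y f]]
  by (simp add: L_idt)

text \<open>A common refinement of two roofs determines the arrow of \<open>D\<close>, as its first leg becomes invertible.
  Conversely, the Ore condition completes the first legs to a square, and a further refinement makes
  the second legs agree.\<close>

lemma roof_rel_iff:
  assumes X: "X \<in> Obj C" and Y: "Y \<in> Obj C"
  shows "(r, r') \<in> roof_rel C S X Y \<longleftrightarrow> (\<exists>h. represents X Y r h \<and> represents X Y r' h)"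
proof -
  obtain A s f where r: "r = (A, s, f)" by (cases r)
  obtain B t g where r': "r' = (B, t, g)" by (cases r')
  note LX = L_obj[OF X] and LY = L_obj[OF Y]
  show ?thesis
  proof
    assume "(r, r') \<in> roof_rel C S X Y"
    then obtain U u v where roofs: "(A, s, f) \<in> roofs C S X Y" "(B, t, g) \<in> roofs C S X Y"
      and U: "U \<in> Obj C" and u: "u \<in> Hom C U A" and v: "v \<in> Hom C U B"
      and inv: "inverted_arrow C S U X (Comp C U A X s u)"
      and su: "Comp C U A X s u = Comp C U B X t v" and fu: "Comp C U A Y f u = Comp C U B Y g v"
      unfolding roof_rel_def r r' by auto
    note R = roofsD[OF roofs(1)] and R' = roofsD[OF roofs(2)]
    note LU = L_obj[OF U] and LA = L_obj[OF R(1)] and LB = L_obj[OF R'(1)]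
    obtain h where h: "represents X Y r h" using represents_exists[OF X Y] roofs r by blast
    obtain k where k: "represents X Y r' k" using represents_exists[OF X Y] roofs r' by blast
    note H = representsD[OF h[unfolded r]] and K = representsD[OF k[unfolded r']]
    have "h = k"
    proof (rule D.iso_epi[OF inverted_iso[OF inv U X] LU LX LY H(2) K(2)])
      have "Comp D (Lo U) (Lo X) (Lo Y) h (Lh U X (Comp C U A X s u))
          = Lh U Y (Comp C U A Y f u)"
        using D.comp_assoc[OF LU LA LX LY L_hom[OF U R(1) u] L_hom[OF R(1) X R(3)] H(2)] H(3)
        by (simp add: L_comp[OF U R(1) X u R(3)] L_comp[OF U R(1) Y u R(4)])
      also have "\<dots> = Lh U Y (Comp C U B Y g v)" by (simp only: fu)
      also have "\<dots> = Comp D (Lo U) (Lo X) (Lo Y) k (Lh U X (Comp C U B X t v))"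
        using D.comp_assoc[OF LU LB LX LY L_hom[OF U R'(1) v] L_hom[OF R'(1) X R'(3)] K(2)] K(3)
        by (simp add: L_comp[OF U R'(1) X v R'(3)] L_comp[OF U R'(1) Y v R'(4)])
      finally show "Comp D (Lo U) (Lo X) (Lo Y) h (Lh U X (Comp C U A X s u))
        = Comp D (Lo U) (Lo X) (Lo Y) k (Lh U X (Comp C U A X s u))"
        by (simp only: su)
    qed
    then show "\<exists>h. represents X Y r h \<and> represents X Y r' h" using h k by blast
  next
    assume "\<exists>h. represents X Y r h \<and> represents X Y r' h"
    then obtain h where h: "represents X Y (A, s, f) h" and k: "represents X Y (B, t, g) h" using r r' by blast
    note H = representsD[OF h] and K = representsD[OF k]
    note R = roofsD[OF H(1)] and R' = roofsD[OF K(1)]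
    note LA = L_obj[OF R(1)] and LB = L_obj[OF R'(1)]
    obtain V u v where V: "V \<in> Obj C" and u: "inverted_arrow C S V A u" and v: "v \<in> Hom C V B"
      and eq: "Comp C V A X s u = Comp C V B X t v"
      using ore[OF R(1) R'(1) X R(3) R'(2)] by blast
    note u' = inverted_in[OF u] and LV = L_obj[OF V]
    note fu = C.comp_in[OF V R(1) Y u' R(4)] and gv = C.comp_in[OF V R'(1) Y v R'(4)]
    note su = C.comp_in[OF V R(1) X u' R(3)]
    have "Lh V Y (Comp C V A Y f u)
        = Comp D (Lo V) (Lo X) (Lo Y) h (Lh V X (Comp C V A X s u))"
      using D.comp_assoc[OF LV LA LX LY L_hom[OF V R(1) u'] L_hom[OF R(1) X R(3)] H(2)] H(3)
      by (simp add: L_comp[OF V R(1) X u' R(3)] L_comp[OF V R(1) Y u' R(4)])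
    also have "\<dots> = Comp D (Lo V) (Lo X) (Lo Y) h (Lh V X (Comp C V B X t v))"
      by (simp only: eq)
    also have "\<dots> = Lh V Y (Comp C V B Y g v)"
      using D.comp_assoc[OF LV LB LX LY L_hom[OF V R'(1) v] L_hom[OF R'(1) X R'(3)] H(2)] K(3)
      by (simp add: L_comp[OF V R'(1) X v R'(3)] L_comp[OF V R'(1) Y v R'(4)])
    finally obtain U w where U: "U \<in> Obj C" and w: "inverted_arrow C S U V w"
      and fg: "Comp C U V Y (Comp C V A Y f u) w = Comp C U V Y (Comp C V B Y g v) w"
      using faithful_up_to_roofs[OF V Y fu gv] by blast
    note w' = inverted_in[OF w]
    have 1: "Comp C U A X s (Comp C U V A u w) = Comp C U V X (Comp C V A X s u) w"
      by (rule C.comp_assoc[OF U V R(1) X w' u' R(3)])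
    have 2: "Comp C U B X t (Comp C U V B v w) = Comp C U V X (Comp C V B X t v) w"
      by (rule C.comp_assoc[OF U V R'(1) X w' v R'(3)])
    have 3: "Comp C U A Y f (Comp C U V A u w) = Comp C U B Y g (Comp C U V B v w)"
      using fg by (simp only: C.comp_assoc[OF U V R(1) Y w' u' R(4)] C.comp_assoc[OF U V R'(1) Y w' v R'(4)])
    have 4: "inverted_arrow C S U X (Comp C U A X s (Comp C U V A u w))"
      unfolding 1 by (rule inverted_comp[OF U V X w inverted_comp[OF V R(1) X u R(2)]])
    have 5: "Comp C U A X s (Comp C U V A u w) = Comp C U B X t (Comp C U V B v w)"
      by (simp only: 1 2 eq)
    show "(r, r') \<in> roof_rel C S X Y" unfolding roof_rel_def r r'
      using H(1) K(1) U C.comp_in[OF U V R(1) w' u'] C.comp_in[OF U V R'(1) w' v] 3 4 5 by blast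
  qed
qed

lemma roof_rel_class:
  assumes X: "X \<in> Obj C" and Y: "Y \<in> Obj C" and r: "represents X Y r h"
  shows "roof_rel C S X Y `` {r} = roof_class X Y h"
  unfolding roof_class_def
  using roof_rel_iff[OF X Y] r represents_unique[OF X Y] by blast

lemma represents_surj:
  assumes X: "X \<in> Obj C" and Y: "Y \<in> Obj C" and h: "h \<in> Hom D (Lo X) (Lo Y)"
  obtains A s f where "represents X Y (A, s, f) h"
  using full_up_to_roofs[OF X Y h] h unfolding represents_def roofs_def by blast

lemma roof_class_inj:
  assumes X: "X \<in> Obj C" and Y: "Y \<in> Obj C" and g: "g \<in> Hom D (Lo X) (Lo Y)"
    and eq: "roof_class X Y g = roof_class X Y h"
  shows "g = h"
proof -
  obtain A s f where r: "represents X Y (A, s, f) g" using represents_surj[OF X Y g] by blast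
  then have "represents X Y (A, s, f) h" using eq unfolding roof_class_def by blast
  then show ?thesis by (rule represents_unique[OF X Y r])
qed

lemma Q_obj: "Obj Q = Obj C"
  unfolding serre_quotient_def by simp

lemma Q_hom:
  assumes X: "X \<in> Obj C" and Y: "Y \<in> Obj C"
  shows "Hom Q X Y = roof_class X Y ` Hom D (Lo X) (Lo Y)"
proof -
  have "Hom Q X Y = (\<lambda>r. roof_rel C S X Y `` {r}) ` roofs C S X Y"
    unfolding serre_quotient_def quotient_def by auto
  also have "\<dots> = roof_class X Y ` Hom D (Lo X) (Lo Y)"
  proof (intro equalityI subsetI)
    fix c assume "c \<in> (\<lambda>r. roof_rel C S X Y `` {r}) ` roofs C S X Y"
    then obtain r h where "r \<in> roofs C S X Y" "c = roof_rel C S X Y `` {r}" "represents X Y r h"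
      using represents_exists[OF X Y] by blast
    then show "c \<in> roof_class X Y ` Hom D (Lo X) (Lo Y)"
      using roof_rel_class[OF X Y] representsD(2)[of X Y] by (cases r) blast
  next
    fix c assume "c \<in> roof_class X Y ` Hom D (Lo X) (Lo Y)"
    then obtain h where h: "h \<in> Hom D (Lo X) (Lo Y)" and c: "c = roof_class X Y h" by blast
    obtain A s f where r: "represents X Y (A, s, f) h" using represents_surj[OF X Y h] by blast
    show "c \<in> (\<lambda>r. roof_rel C S X Y `` {r}) ` roofs C S X Y"
      using roof_rel_class[OF X Y r] representsD(1)[OF r] c by blast
  qed
  finally show ?thesis .
qed

lemma Q_idt: "X \<in> Obj C \<Longrightarrow> Idt Q X = roof_class X X (Idt D (Lo X))"
  using roof_rel_class[OF _ _ represents_arrow[OF _ _ C.idt_in]] unfolding serre_quotient_def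
  by (simp add: L_idt)

text \<open>Composition in the quotient is defined as a union over all ways of composing representatives. Each
  of these represents \<open>k \<circ> h\<close>, so the union is a single class; it is nonempty by the Ore condition.\<close>

lemma Q_comp:
  assumes X: "X \<in> Obj C" and Y: "Y \<in> Obj C" and Z: "Z \<in> Obj C"
    and h: "h \<in> Hom D (Lo X) (Lo Y)" and k: "k \<in> Hom D (Lo Y) (Lo Z)"
  shows "Comp Q X Y Z (roof_class Y Z k) (roof_class X Y h)
    = roof_class X Z (Comp D (Lo X) (Lo Y) (Lo Z) k h)"
proof -
  define P where "P = {(U, Comp C U A X s u, Comp C U B Z g v) | U u v A s f B t g.
    (A, s, f) \<in> roof_class X Y h \<and> (B, t, g) \<in> roof_class Y Z k \<and> U \<in> Obj C \<and>
    inverted_arrow C S U A u \<and> v \<in> Hom C U B \<and> Comp C U A Y f u = Comp C U B Y t v}"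
  let ?kh = "Comp D (Lo X) (Lo Y) (Lo Z) k h"
  note LX = L_obj[OF X] and LY = L_obj[OF Y] and LZ = L_obj[OF Z]
  have P: "represents X Z r ?kh" if rP: "r \<in> P" for r
  proof -
    obtain U u v A s f B t g where r: "r = (U, Comp C U A X s u, Comp C U B Z g v)"
      and h': "represents X Y (A, s, f) h" and k': "represents Y Z (B, t, g) k" and U: "U \<in> Obj C"
      and u: "inverted_arrow C S U A u" and v: "v \<in> Hom C U B" and eq: "Comp C U A Y f u = Comp C U B Y t v"
      using rP unfolding P_def roof_class_def by blast
    note H = representsD[OF h'] and K = representsD[OF k']
    note R = roofsD[OF H(1)] and R' = roofsD[OF K(1)]
    note u' = inverted_in[OF u]
    note LU = L_obj[OF U] and LA = L_obj[OF R(1)] and LB = L_obj[OF R'(1)]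
    note Lu = L_hom[OF U R(1) u'] and Lv = L_hom[OF U R'(1) v]
    note Ls = L_hom[OF R(1) X R(3)] and Lt = L_hom[OF R'(1) Y R'(3)]
    have "Comp D (Lo U) (Lo X) (Lo Z) ?kh (Lh U X (Comp C U A X s u))
        = Comp D (Lo U) (Lo Y) (Lo Z) k
            (Comp D (Lo U) (Lo X) (Lo Y) h (Lh U X (Comp C U A X s u)))"
      using D.comp_assoc[OF LU LX LY LZ L_hom[OF U X C.comp_in[OF U R(1) X u' R(3)]] h k] by simp
    also have "Comp D (Lo U) (Lo X) (Lo Y) h (Lh U X (Comp C U A X s u))
        = Lh U Y (Comp C U A Y f u)"
      using D.comp_assoc[OF LU LA LX LY Lu Ls h] H(3)
      by (simp add: L_comp[OF U R(1) X u' R(3)] L_comp[OF U R(1) Y u' R(4)])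
    also have "\<dots> = Comp D (Lo U) (Lo B) (Lo Y) (Lh B Y t) (Lh U B v)"
      by (simp add: eq L_comp[OF U R'(1) Y v R'(3)])
    also have "Comp D (Lo U) (Lo Y) (Lo Z) k \<dots> = Lh U Z (Comp C U B Z g v)"
      using D.comp_assoc[OF LU LB LY LZ Lv Lt k] K(3) by (simp add: L_comp[OF U R'(1) Z v R'(4)])
    finally show ?thesis unfolding represents_def roofs_def r
      using U inverted_comp[OF U R(1) X u R(2)] C.comp_in[OF U R'(1) Z v R'(4)] D.comp_in[OF LX LY LZ h k]
      by simp
  qed
  have "P \<noteq> {}"
  proof -
    obtain A s f where h': "represents X Y (A, s, f) h" using represents_surj[OF X Y h] by blast
    obtain B t g where k': "represents Y Z (B, t, g) k" using represents_surj[OF Y Z k] by blast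
    note R = roofsD[OF representsD(1)[OF h']] and R' = roofsD[OF representsD(1)[OF k']]
    show ?thesis using ore[OF R(1) R'(1) Y R(4) R'(2)] h' k' unfolding P_def roof_class_def by blast
  qed
  have "Comp Q X Y Z (roof_class Y Z k) (roof_class X Y h) = roof_rel C S X Z `` P"
    unfolding serre_quotient_def P_def by simp
  also have "\<dots> = (\<Union>r\<in>P. roof_rel C S X Z `` {r})" by blast
  also have "\<dots> = roof_class X Z ?kh"
    using roof_rel_class[OF X Z P] \<open>P \<noteq> {}\<close> by simp
  finally show ?thesis .
qed

definition represented :: "'o \<Rightarrow> 'o \<Rightarrow> ('o \<times> 'm \<times> 'm) set \<Rightarrow> 'n" where
  "represented X Y c = (THE h. h \<in> Hom D (Lo X) (Lo Y) \<and> c = roof_class X Y h)"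

lemma represented_class:
  assumes X: "X \<in> Obj C" and Y: "Y \<in> Obj C" and h: "h \<in> Hom D (Lo X) (Lo Y)"
  shows "represented X Y (roof_class X Y h) = h"
  unfolding represented_def using h roof_class_inj[OF X Y] by (intro the_equality) auto

definition Lbar :: "('o, ('o \<times> 'm \<times> 'm) set, 'p, 'n) cfunctor" where
  "Lbar = \<lparr>on_obj = on_obj L, on_hom = represented\<rparr>"

lemma Q_category: "is_category Q"
  unfolding is_category_def Q_obj
  by (auto simp: Q_hom Q_idt Q_comp D.idt_in L_obj D.comp_in[OF L_obj L_obj L_obj] D.comp_idt D.idt_comp
    D.comp_assoc[OF L_obj L_obj L_obj L_obj])

lemma Lbar_functor: "is_functor Q D Lbar"
  unfolding is_functor_def Q_obj
  by (auto simp: Q_category D.is_category Lbar_def L_obj Q_hom Q_idt Q_comp represented_class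
    D.idt_in D.comp_in[OF L_obj L_obj L_obj])

sublocale Lbar: fully_faithful_essentially_surjective Q D Lbar
proof
  show "bij_betw (on_hom Lbar X Y) (Hom Q X Y) (Hom D (on_obj Lbar X) (on_obj Lbar Y))"
    if "X \<in> Obj Q" "Y \<in> Obj Q" for X Y
  proof -
    have X: "X \<in> Obj C" and Y: "Y \<in> Obj C" using that unfolding Q_obj by auto
    show ?thesis unfolding Lbar_def
      by (rule bij_betw_byWitness[where f' = "roof_class X Y"])
        (auto simp: Q_hom[OF X Y] represented_class[OF X Y])
  qed
qed (use Lbar_functor essentially_surjective in \<open>auto simp: Q_obj Lbar_def\<close>)

lemma q_obj: "on_obj q X = X"
  unfolding quotient_functor_def by simp

lemma q_hom:
  assumes X: "X \<in> Obj C" and Y: "Y \<in> Obj C" and f: "f \<in> Hom C X Y"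
  shows "on_hom q X Y f = roof_class X Y (Lh X Y f)"
  unfolding quotient_functor_def using roof_rel_class[OF X Y represents_arrow[OF X Y f]] by simp

lemma Lbar_factors: "functor_eq C (comp_functor Lbar q) L"
  unfolding functor_eq_def comp_functor_def
  by (auto simp: Lbar_def q_hom represented_class L_hom q_obj)

text \<open>The class of the roof \<open>(A, s, f)\<close> is \<open>q f \<circ> (q s)\<inverse>\<close>, so a functor on the quotient is
  determined by its restriction along \<open>q\<close>.\<close>

lemma Lbar_unique:
  assumes F: "is_functor Q D F" and eq: "functor_eq C (comp_functor F q) L"
  shows "functor_eq Q F Lbar"
  unfolding functor_eq_def Q_obj
proof (intro conjI ballI)
  have FO: "on_obj F X = Lo X" if "X \<in> Obj C" for X
    using eq that unfolding functor_eq_def comp_functor_def by (simp add: q_obj)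
  then show "on_obj F X = on_obj Lbar X" if "X \<in> Obj C" for X using that by (simp add: Lbar_def)
  have Fq: "on_hom F X Y (roof_class X Y (Lh X Y f)) = Lh X Y f"
    if "X \<in> Obj C" "Y \<in> Obj C" "f \<in> Hom C X Y" for X Y f
  proof -
    have "on_hom (comp_functor F q) X Y f = Lh X Y f" using eq that unfolding functor_eq_def by blast
    then show ?thesis using q_hom[OF that] by (simp add: comp_functor_def q_obj)
  qed
  fix X Y c assume X: "X \<in> Obj C" and Y: "Y \<in> Obj C" and "c \<in> Hom Q X Y"
  then obtain h where h: "h \<in> Hom D (Lo X) (Lo Y)" and c: "c = roof_class X Y h"
    unfolding Q_hom[OF X Y] by blast
  obtain A s f where r: "represents X Y (A, s, f) h" using represents_surj[OF X Y h] by blast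
  note H = representsD[OF r]
  note R = roofsD[OF H(1)]
  note A = R(1) and LA = L_obj[OF R(1)] and LX = L_obj[OF X] and LY = L_obj[OF Y]
  note Ls = L_hom[OF A X R(3)]
  have cQ: "c \<in> Hom Q X Y" and sQ: "roof_class A X (Lh A X s) \<in> Hom Q A X"
    using h Ls by (auto simp: c Q_hom X Y A)
  have "Comp D (Lo A) (Lo X) (Lo Y) (on_hom F X Y c) (Lh A X s)
      = on_hom F A Y (Comp Q A X Y c (roof_class A X (Lh A X s)))"
    using functor_comp[OF F _ _ _ sQ cQ] A X Y by (simp add: Q_obj FO Fq R)
  also have "Comp Q A X Y c (roof_class A X (Lh A X s)) = roof_class A Y (Lh A Y f)"
    by (simp add: c Q_comp[OF A X Y Ls h] H)
  also have "on_hom F A Y \<dots> = Comp D (Lo A) (Lo X) (Lo Y) h (Lh A X s)"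
    by (simp add: Fq A Y R H)
  finally have "on_hom F X Y c = h"
    using D.iso_epi[OF inverted_iso[OF R(2) A X] LA LX LY _ h] functor_hom[OF F _ _ cQ] X Y
    by (simp add: Q_obj FO)
  then show "on_hom F X Y c = on_hom Lbar X Y c"
    by (simp add: Lbar_def c represented_class[OF X Y h])
qed

theorem induced_equivalence:
  "\<exists>Lbar. exact_functor Q D Lbar \<and> functor_eq C (comp_functor Lbar q) L \<and>
     (\<forall>F. exact_functor Q D F \<and> functor_eq C (comp_functor F q) L \<longrightarrow> functor_eq Q F Lbar) \<and>
     is_equivalence Q D Lbar"
  using Lbar.exact Lbar.equivalence Lbar_factors Lbar_unique unfolding exact_functor_def by blast

end

section \<open>Laurent polynomials\<close>

abbreviation "monomial \<equiv> Poly_Mapping.single"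

lemma carrier_loc_ring [simp]: "p \<in> carrier (loc_ring \<sigma>) \<longleftrightarrow> Poly_Mapping.keys p \<subseteq> loc_degrees \<sigma>"
  and one_loc_ring [simp]: "one (loc_ring \<sigma>) = 1"
  and zero_loc_ring [simp]: "zero (loc_ring \<sigma>) = 0"
  and add_loc_ring [simp]: "add (loc_ring \<sigma>) p q = p + q"
  and mult_loc_ring [simp]: "monoid.mult (loc_ring \<sigma>) p q = p * q"
  by (auto simp: loc_ring_def)

lemma zero_loc_degrees [simp]: "0 \<in> loc_degrees \<sigma>"
  by (simp add: loc_degrees_def)

lemma add_loc_degrees [simp]: "a \<in> loc_degrees \<sigma> \<Longrightarrow> b \<in> loc_degrees \<sigma> \<Longrightarrow> a + b \<in> loc_degrees \<sigma>"
  by (simp add: loc_degrees_def)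

lemma loc_degrees_mono: "\<sigma> \<subseteq> \<tau> \<Longrightarrow> loc_degrees \<sigma> \<subseteq> loc_degrees \<tau>"
  by (auto simp: loc_degrees_def)

lemma loc_ring_mono: "\<sigma> \<subseteq> \<tau> \<Longrightarrow> p \<in> carrier (loc_ring \<sigma>) \<Longrightarrow> p \<in> carrier (loc_ring \<tau>)"
  unfolding carrier_loc_ring by (rule order_trans[OF _ loc_degrees_mono])

lemma single_loc_ring: "a \<in> loc_degrees \<sigma> \<Longrightarrow> monomial a c \<in> carrier (loc_ring \<sigma>)"
  by simp

lemma add_in_loc_ring:
  "p \<in> carrier (loc_ring \<sigma>) \<Longrightarrow> q \<in> carrier (loc_ring \<sigma>) \<Longrightarrow> p + q \<in> carrier (loc_ring \<sigma>)"
  using Poly_Mapping.keys_add[of p q] by auto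

lemma mult_in_loc_ring:
  fixes p q :: "('k::field, 'n::finite) laurent"
  shows "p \<in> carrier (loc_ring \<sigma>) \<Longrightarrow> q \<in> carrier (loc_ring \<sigma>) \<Longrightarrow> p * q \<in> carrier (loc_ring \<sigma>)"
  using keys_mult[of p q] by force

lemma cring_loc_ring: "cring (loc_ring \<sigma> :: ('k::field, 'n::finite) laurent ring)"
proof (intro cringI abelian_groupI comm_monoidI)
  show "\<exists>y\<in>carrier (loc_ring \<sigma>). y \<oplus>\<^bsub>loc_ring \<sigma>\<^esub> x = \<zero>\<^bsub>loc_ring \<sigma>\<^esub>"
    if "x \<in> carrier (loc_ring \<sigma>)" for x :: "('k, 'n) laurent"
    using that by (intro bexI[of _ "- x"]) (auto simp: Poly_Mapping.keys_def)
qed (auto simp: algebra_simps add_in_loc_ring mult_in_loc_ring simp del: carrier_loc_ring,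
    auto)

lemma loc_ring_induct [consumes 1, case_names zero single add]:
  fixes p :: "('k::field, 'n::finite) laurent"
  assumes p: "p \<in> carrier (loc_ring \<sigma>)" and zero: "P 0"
    and single: "\<And>a c. a \<in> loc_degrees \<sigma> \<Longrightarrow> P (monomial a c)"
    and add: "\<And>p q. \<lbrakk>p \<in> carrier (loc_ring \<sigma>); q \<in> carrier (loc_ring \<sigma>); P p; P q\<rbrakk> \<Longrightarrow> P (p + q)"
  shows "P p"
  using p
proof (induction "card (Poly_Mapping.keys p)" arbitrary: p)
  case 0
  then show ?case using zero by simp
next
  case (Suc n)
  then obtain a where a: "a \<in> Poly_Mapping.keys p" by fastforce
  define r where "r = p - monomial a (Poly_Mapping.lookup p a)"
  have "Poly_Mapping.keys r = Poly_Mapping.keys p - {a}"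
    using a by (auto simp: r_def in_keys_iff lookup_minus lookup_single when_def split: if_splits)
  moreover from this have "n = card (Poly_Mapping.keys r)" using Suc.hyps(2) a by simp
  ultimately have "P r" "r \<in> carrier (loc_ring \<sigma>)" using Suc.hyps(1)[of r] Suc.prems by auto
  then have "P (monomial a (Poly_Mapping.lookup p a) + r)"
    using Suc.prems a by (intro add single single_loc_ring) auto
  then show ?case by (simp add: r_def)
qed

text \<open>The degree of \<open>(\<Prod>i\<in>\<tau>. t\<^sub>i)\<^sup>n\<close>, and that monomial, written \<open>t\<^sub>\<tau>\<^sup>n\<close> in the comments below.\<close>

definition face_degree :: "'n::finite set \<Rightarrow> int \<Rightarrow> int ^ 'n" where
  "face_degree \<tau> n = (\<chi> i. if i \<in> \<tau> then n else 0)"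

definition face_power :: "'n::finite set \<Rightarrow> int \<Rightarrow> ('k::field, 'n) laurent" where
  "face_power \<tau> n = monomial (face_degree \<tau> n) 1"

text \<open>Multiplication by \<open>t\<^sub>\<sigma>\<^sup>n\<close> on \<open>M\<close>.\<close>

abbreviation tpow :: "('k::field, 'n::finite, 'a) gmod \<Rightarrow> 'n set \<Rightarrow> nat \<Rightarrow> 'a \<Rightarrow> 'a" where
  "tpow M \<sigma> n x \<equiv> face_power \<sigma> (int n) \<odot>\<^bsub>M\<^esub> x"

lemma face_degree_add: "face_degree \<tau> (m + n) = face_degree \<tau> m + face_degree \<tau> n"
  by (simp add: face_degree_def vec_eq_iff)

lemma face_degree_0 [simp]: "face_degree \<tau> 0 = 0"
  by (simp add: face_degree_def vec_eq_iff)

lemma face_degree_loc: "\<tau> \<subseteq> \<sigma> \<or> 0 \<le> n \<Longrightarrow> face_degree \<tau> n \<in> loc_degrees \<sigma>"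
  by (auto simp: face_degree_def loc_degrees_def)

lemma face_power_0 [simp]: "face_power \<tau> 0 = 1"
  by (simp add: face_power_def)

lemma face_power_add: "face_power \<tau> (m + n) = face_power \<tau> m * face_power \<tau> n"
  by (simp add: face_power_def face_degree_add mult_single)

lemma face_power_loc: "\<tau> \<subseteq> \<sigma> \<or> 0 \<le> n \<Longrightarrow> face_power \<tau> n \<in> carrier (loc_ring \<sigma>)"
  by (simp add: face_power_def face_degree_loc)

lemma face_degree_clears:
  assumes "a \<in> loc_degrees \<tau>"
  shows "\<exists>N::nat. \<forall>n\<ge>N. face_degree \<tau> (int n) + a \<in> loc_degrees {}"
proof (intro exI allI impI)
  fix n assume n: "n \<ge> nat (\<Sum>i\<in>UNIV. \<bar>a $ i\<bar>)"
  have "\<bar>a $ i\<bar> \<le> int n" for i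
    using member_le_sum[of i UNIV "\<lambda>i. \<bar>a $ i\<bar>"] n by simp
  then have "- (a $ i) \<le> int n" for i by (meson abs_le_D2 order.refl)
  then show "face_degree \<tau> (int n) + a \<in> loc_degrees {}"
    using assms by (auto simp: loc_degrees_def face_degree_def) (smt (verit))
qed

lemma face_power_clears:
  fixes s :: "('k::field, 'n::finite) laurent"
  assumes "s \<in> carrier (loc_ring \<tau>)"
  shows "\<exists>N::nat. \<forall>n\<ge>N. face_power \<tau> (int n) * s \<in> carrier (loc_ring {})"
  using assms
proof (induction s rule: loc_ring_induct)
  case (single a c)
  then show ?case using face_degree_clears[OF single] by (auto simp: face_power_def mult_single)
next
  case (add p q)
  then obtain M N where "\<forall>n\<ge>M. face_power \<tau> (int n) * p \<in> carrier (loc_ring {})"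
    "\<forall>n\<ge>N. face_power \<tau> (int n) * q \<in> carrier (loc_ring {})" by blast
  then have "\<forall>n\<ge>max M N. face_power \<tau> (int n) * (p + q) \<in> carrier (loc_ring {})"
    unfolding distrib_left by (simp add: add_in_loc_ring del: carrier_loc_ring)
  then show ?case by blast
qed auto

section \<open>Homogeneous components\<close>

definition component :: "('r, 'a, 'd) gmodule \<Rightarrow> 'd \<Rightarrow> 'a \<Rightarrow> 'a" where
  "component M d x = (THE c. (\<forall>d. c d \<in> hcomp M d) \<and> finite {d. c d \<noteq> \<zero>\<^bsub>M\<^esub>} \<and>
     x = finsum M c {d. c d \<noteq> \<zero>\<^bsub>M\<^esub>}) d"

lemma additive_finsum:
  assumes "abelian_group M" "abelian_group N" and f: "\<And>x. x \<in> carrier M \<Longrightarrow> f x \<in> carrier N"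
    and add: "\<And>x y. \<lbrakk>x \<in> carrier M; y \<in> carrier M\<rbrakk> \<Longrightarrow> f (x \<oplus>\<^bsub>M\<^esub> y) = f x \<oplus>\<^bsub>N\<^esub> f y"
    and "finite F" "g \<in> F \<rightarrow> carrier M"
  shows "f (finsum M g F) = finsum N (\<lambda>d. f (g d)) F"
proof -
  interpret M: abelian_group M by fact
  interpret N: abelian_group N by fact
  have z: "f \<zero>\<^bsub>M\<^esub> = \<zero>\<^bsub>N\<^esub>"
    using add[of "\<zero>\<^bsub>M\<^esub>" "\<zero>\<^bsub>M\<^esub>"] f N.add.l_cancel_one' by auto
  show ?thesis
    using assms(5,6)
    by (induction F rule: finite_induct) (auto simp: z M.finsum_insert N.finsum_insert f add Pi_iff M.finsum_closed)
qed

lemma finsum_mem: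
  assumes "abelian_group M" "H \<subseteq> carrier M" "\<zero>\<^bsub>M\<^esub> \<in> H" "\<And>x y. x \<in> H \<Longrightarrow> y \<in> H \<Longrightarrow> x \<oplus>\<^bsub>M\<^esub> y \<in> H"
    and "finite F" "\<And>d. d \<in> F \<Longrightarrow> g d \<in> H"
  shows "finsum M g F \<in> H"
proof -
  interpret M: abelian_group M by fact
  have "g \<in> F \<rightarrow> carrier M" using assms by auto
  with assms(5,6) show ?thesis
    by (induction F rule: finite_induct) (auto simp: M.finsum_insert assms(3,4))
qed

text \<open>A grading from its family of projections \<open>\<pi> d\<close>. That every element is the sum of its components
  is expressed by \<open>span\<close>: an additively closed set that contains all components contains everything.
  This form can be verified, and used, without handling finite sums.\<close>

lemma graded_moduleI:
  fixes M :: "('k::field, 'n::finite, 'a) gmod" (structure)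
  assumes mod: "module (loc_ring \<sigma>) M"
    and hcomp: "\<And>d. hcomp M d = {x \<in> carrier M. \<pi> d x = x}"
    and closed: "\<And>d x. x \<in> carrier M \<Longrightarrow> \<pi> d x \<in> carrier M"
    and add: "\<And>d x y. \<lbrakk>x \<in> carrier M; y \<in> carrier M\<rbrakk> \<Longrightarrow> \<pi> d (x \<oplus> y) = \<pi> d x \<oplus> \<pi> d y"
    and proj: "\<And>d e x. x \<in> carrier M \<Longrightarrow> \<pi> d (\<pi> e x) = (if d = e then \<pi> e x else \<zero>)"
    and span: "\<And>H. \<lbrakk>H \<subseteq> carrier M; \<zero> \<in> H; \<And>x y. x \<in> H \<Longrightarrow> y \<in> H \<Longrightarrow> x \<oplus> y \<in> H;
       \<And>d x. x \<in> carrier M \<Longrightarrow> \<pi> d x \<in> H\<rbrakk> \<Longrightarrow> carrier M \<subseteq> H"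
    and outside: "\<And>d x. \<lbrakk>d \<notin> loc_degrees \<sigma>; x \<in> carrier M\<rbrakk> \<Longrightarrow> \<pi> d x = \<zero>"
    and smult: "\<And>a c d x. \<lbrakk>a \<in> loc_degrees \<sigma>; x \<in> carrier M\<rbrakk> \<Longrightarrow>
      \<pi> (a + d) (monomial a c \<odot> \<pi> d x) = monomial a c \<odot> \<pi> d x"
  shows "graded_module \<sigma> M" and "\<And>d x. x \<in> carrier M \<Longrightarrow> component M d x = \<pi> d x"
proof -
  interpret module "loc_ring \<sigma>" M by fact
  have zero: "\<pi> d \<zero> = \<zero>" for d
    using add[of "\<zero>" "\<zero>" d] closed[of "\<zero>" d] M.add.l_cancel_one' by auto
  define dec where "dec x F \<longleftrightarrow> finite F \<and> (\<forall>d. d \<notin> F \<longrightarrow> \<pi> d x = \<zero>) \<and> x = finsum M (\<lambda>d. \<pi> d x) F"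
    for x and F :: "(int ^ 'n) set"
  have decD: "dec x F \<Longrightarrow> finite F" "dec x F \<Longrightarrow> \<forall>d. d \<notin> F \<longrightarrow> \<pi> d x = \<zero>"
    "dec x F \<Longrightarrow> x = finsum M (\<lambda>d. \<pi> d x) F" for x F
    unfolding dec_def by (elim conjE, assumption)+
  define H where "H = {x \<in> carrier M. \<exists>F. dec x F}"
  have mono: "finsum M c G = finsum M c F"
    if "finite G" "F \<subseteq> G" "\<And>d. d \<notin> F \<Longrightarrow> c d = \<zero>" "\<And>d. c d \<in> carrier M" for c and F G :: "(int ^ 'n) set"
    by (rule M.add.finprod_mono_neutral_cong_left[symmetric]) (use that in \<open>auto intro: finite_subset\<close>)
  have "carrier M \<subseteq> H"
  proof (rule span)
    show "H \<subseteq> carrier M" by (auto simp: H_def)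
    show "\<zero> \<in> H" by (auto simp: H_def dec_def zero intro!: exI[of _ "{}"])
    show "x \<oplus> y \<in> H" if xH: "x \<in> H" and yH: "y \<in> H" for x y
    proof -
      obtain F G where "dec x F" "dec y G" using xH yH unfolding H_def by blast
      then have F: "finite F" "\<forall>d. d \<notin> F \<longrightarrow> \<pi> d x = \<zero>" "x = finsum M (\<lambda>d. \<pi> d x) F"
        and G: "finite G" "\<forall>d. d \<notin> G \<longrightarrow> \<pi> d y = \<zero>" "y = finsum M (\<lambda>d. \<pi> d y) G"
        using decD by blast+
      have xy: "x \<in> carrier M" "y \<in> carrier M" using xH yH unfolding H_def by auto
      have "x = finsum M (\<lambda>d. \<pi> d x) (F \<union> G)" "y = finsum M (\<lambda>d. \<pi> d y) (F \<union> G)"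
        using mono[of "F \<union> G" F "\<lambda>d. \<pi> d x"] mono[of "F \<union> G" G "\<lambda>d. \<pi> d y"] F G xy closed by auto
      then have "x \<oplus> y = finsum M (\<lambda>d. \<pi> d (x \<oplus> y)) (F \<union> G)"
        using M.finsum_addf[of "\<lambda>d. \<pi> d x" "F \<union> G" "\<lambda>d. \<pi> d y"] xy closed add by (simp add: Pi_iff)
      moreover have "\<forall>d. d \<notin> F \<union> G \<longrightarrow> \<pi> d (x \<oplus> y) = \<zero>" using F(2) G(2) add[OF xy] by simp
      ultimately have "dec (x \<oplus> y) (F \<union> G)" unfolding dec_def using F(1) G(1) by simp
      then show ?thesis unfolding H_def using xy by blast
    qed
    show "\<pi> d x \<in> H" if x: "x \<in> carrier M" for d x
      using x closed proj[OF x] by (auto simp: H_def dec_def intro!: exI[of _ "{d}"])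
  qed
  have fin: "finite {d. \<pi> d x \<noteq> \<zero>}" and split: "x = finsum M (\<lambda>d. \<pi> d x) {d. \<pi> d x \<noteq> \<zero>}"
    if x: "x \<in> carrier M" for x
  proof -
    obtain F where "dec x F" using x \<open>carrier M \<subseteq> H\<close> unfolding H_def by blast
    then have F: "finite F" "\<forall>d. d \<notin> F \<longrightarrow> \<pi> d x = \<zero>" "x = finsum M (\<lambda>d. \<pi> d x) F"
      using decD by blast+
    then have sub: "{d. \<pi> d x \<noteq> \<zero>} \<subseteq> F" by blast
    then show "finite {d. \<pi> d x \<noteq> \<zero>}" using F finite_subset by blast
    show "x = finsum M (\<lambda>d. \<pi> d x) {d. \<pi> d x \<noteq> \<zero>}"
      using mono[OF F(1) sub, of "\<lambda>d. \<pi> d x"] F(3) closed[OF x] by auto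
  qed
  have uniq: "c = (\<lambda>d. \<pi> d x)"
    if c: "\<forall>d. c d \<in> hcomp M d" and f: "finite {d. c d \<noteq> \<zero>}" and x: "x = finsum M c {d. c d \<noteq> \<zero>}" for c x
  proof
    fix e
    have cc: "c d \<in> carrier M" "\<pi> d (c d) = c d" for d using c hcomp by auto
    have "\<pi> e x = finsum M (\<lambda>d. \<pi> e (c d)) {d. c d \<noteq> \<zero>}"
      unfolding x by (rule additive_finsum) (use add closed cc f in \<open>auto simp: M.abelian_group_axioms\<close>)
    also have "\<dots> = finsum M (\<lambda>d. if e = d then c d else \<zero>) {d. c d \<noteq> \<zero>}"
      using proj cc by (intro M.finsum_cong') (auto simp: simp_implies_def, metis+)
    also have "\<dots> = c e"
    proof (cases "c e = \<zero>")
      case True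
      have "finsum M (\<lambda>d. if e = d then c d else \<zero>) {d. c d \<noteq> \<zero>} = finsum M (\<lambda>d. \<zero>) {d. c d \<noteq> \<zero>}"
        using True by (intro M.finsum_cong') auto
      then show ?thesis using True by simp
    next
      case False
      then show ?thesis using M.add.finprod_singleton[of e _ c] f cc by auto
    qed
    finally show "c e = \<pi> e x" by simp
  qed
  have mem: "\<pi> d x \<in> hcomp M d" if "x \<in> carrier M" for d x
    using that closed proj hcomp by simp
  have ex: "(\<forall>d. \<pi> d x \<in> hcomp M d) \<and> finite {d. \<pi> d x \<noteq> \<zero>} \<and> x = finsum M (\<lambda>d. \<pi> d x) {d. \<pi> d x \<noteq> \<zero>}"
    if "x \<in> carrier M" for x by (intro conjI allI fin[OF that] split[OF that] mem[OF that])
  have hsub: "additive_subgroup (hcomp M d) M" for d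
  proof (intro additive_subgroup.intro M.add.subgroupI)
    show "hcomp M d \<subseteq> carrier M" "hcomp M d \<noteq> {}" using hcomp zero by auto
    show "a \<oplus> b \<in> hcomp M d" if "a \<in> hcomp M d" "b \<in> hcomp M d" for a b using that hcomp add by auto
    show "\<ominus> a \<in> hcomp M d" if a: "a \<in> hcomp M d" for a
    proof -
      have ac: "a \<in> carrier M" "\<pi> d a = a" using a hcomp by auto
      have "\<pi> d (\<ominus> a) \<oplus> a = \<zero>"
        using add[of "\<ominus> a" a d] ac zero by (simp add: M.l_neg)
      then have "\<pi> d (\<ominus> a) = \<ominus> a"
        by (intro M.minus_equality[symmetric] ac(1) closed M.a_inv_closed)
      then show ?thesis using ac hcomp by simp
    qed
  qed
  have graded_smult: "p \<odot> x \<in> hcomp M (a + b)" if "p \<in> ring_homogeneous \<sigma> a" "x \<in> hcomp M b" for p x a b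
  proof -
    have x: "x \<in> carrier M" "\<pi> b x = x" using that hcomp by auto
    have p: "p = monomial a (Poly_Mapping.lookup p a)"
      using that unfolding ring_homogeneous_def
      by (intro poly_mapping_eqI) (auto simp: lookup_single when_def in_keys_iff)
    show ?thesis
    proof (cases "p = 0")
      case True
      then have "p \<odot> x = \<zero>" using x smult_l_null by simp
      then show ?thesis using zero hcomp by simp
    next
      case False
      then have "a \<in> loc_degrees \<sigma>" using that(1) unfolding ring_homogeneous_def by (auto simp: subset_singleton_iff)
      then show ?thesis using smult[of a x b "Poly_Mapping.lookup p a"] p x hcomp smult_closed[of p x] that
        unfolding ring_homogeneous_def by auto
    qed
  qed
  have "hcomp M d = {\<zero>}" if "d \<notin> loc_degrees \<sigma>" for d
    using that hcomp outside zero by auto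
  moreover have "\<exists>!c. (\<forall>d. c d \<in> hcomp M d) \<and> finite {d. c d \<noteq> \<zero>} \<and> x = finsum M c {d. c d \<noteq> \<zero>}"
    if "x \<in> carrier M" for x
    by (rule ex1I[of _ "\<lambda>d. \<pi> d x"], rule ex[OF that]) (elim conjE, rule uniq)
  ultimately show "graded_module \<sigma> M"
    unfolding graded_module_def using mod hsub graded_smult by blast
  show "component M d x = \<pi> d x" if "x \<in> carrier M" for d x
    unfolding component_def
    by (rule fun_cong[of _ "\<lambda>d. \<pi> d x"], rule the_equality, rule ex[OF that]) (elim conjE, rule uniq)
qed

locale graded_mod =
  fixes \<sigma> :: "'n::finite set" and M :: "('k::field, 'n, 'a) gmod" (structure)
  assumes graded: "graded_module \<sigma> M"
begin

sublocale module "loc_ring \<sigma>" M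
  using graded unfolding graded_module_def by blast

lemma hcomp_subgroup: "additive_subgroup (hcomp M d) M"
  using graded unfolding graded_module_def by blast

lemma hcomp_closed: "x \<in> hcomp M d \<Longrightarrow> x \<in> carrier M"
  using additive_subgroup.a_Hcarr[OF hcomp_subgroup] .

lemma zero_hcomp [simp]: "\<zero> \<in> hcomp M d"
  using additive_subgroup.zero_closed[OF hcomp_subgroup] .

lemma hcomp_outside: "d \<notin> loc_degrees \<sigma> \<Longrightarrow> hcomp M d = {\<zero>}"
  using graded unfolding graded_module_def by blast

lemma single_hcomp:
  assumes "a \<in> loc_degrees \<sigma>" "x \<in> hcomp M d"
  shows "monomial a c \<odot> x \<in> hcomp M (a + d)"
proof -
  have "monomial a c \<in> ring_homogeneous \<sigma> a" using assms by (simp add: ring_homogeneous_def)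
  then show ?thesis using assms(2) graded unfolding graded_module_def by blast
qed

lemma decomposition_ex1:
  "x \<in> carrier M \<Longrightarrow> \<exists>!c. (\<forall>d. c d \<in> hcomp M d) \<and> finite {d. c d \<noteq> \<zero>} \<and>
    x = finsum M c {d. c d \<noteq> \<zero>}"
  using graded unfolding graded_module_def by (elim conjE) (erule bspec)

lemma component_decomposition:
  assumes "x \<in> carrier M"
  shows "component M d x \<in> hcomp M d" "finite {d. component M d x \<noteq> \<zero>}"
    "x = finsum M (\<lambda>d. component M d x) {d. component M d x \<noteq> \<zero>}"
proof -
  let ?P = "\<lambda>c. (\<forall>d. c d \<in> hcomp M d) \<and> finite {d. c d \<noteq> \<zero>} \<and> x = finsum M c {d. c d \<noteq> \<zero>}"
  have "?P (THE c. ?P c)" by (rule theI'[OF decomposition_ex1[OF assms]])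
  then have "?P (\<lambda>d. component M d x)" unfolding component_def by simp
  then show "component M d x \<in> hcomp M d" "finite {d. component M d x \<noteq> \<zero>}"
    "x = finsum M (\<lambda>d. component M d x) {d. component M d x \<noteq> \<zero>}"
    by simp_all
qed

lemma component_closed [simp]: "x \<in> carrier M \<Longrightarrow> component M d x \<in> carrier M"
  using component_decomposition(1) hcomp_closed by blast

lemma component_unique:
  assumes c: "\<And>d. c d \<in> hcomp M d" and F: "finite F" "\<And>d. d \<notin> F \<Longrightarrow> c d = \<zero>"
    and x: "x = finsum M c F"
  shows "component M d x = c d"
proof -
  let ?P = "\<lambda>c. (\<forall>d. c d \<in> hcomp M d) \<and> finite {d. c d \<noteq> \<zero>} \<and> x = finsum M c {d. c d \<noteq> \<zero>}"
  have cc: "c d \<in> carrier M" for d using c hcomp_closed by blast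
  have sub: "{d. c d \<noteq> \<zero>} \<subseteq> F" using F by blast
  have "finsum M c {d. c d \<noteq> \<zero>} = finsum M c F"
    by (rule M.add.finprod_mono_neutral_cong_left) (use cc sub F in auto)
  then have c': "?P c" using c sub F(1) x finite_subset by auto
  have xc: "x \<in> carrier M" unfolding x using cc by (simp add: Pi_iff)
  have p: "?P (\<lambda>d. component M d x)"
    by (intro conjI allI component_decomposition[OF xc])
  have "(\<lambda>d. component M d x) = c" by (rule ex1E[OF decomposition_ex1[OF xc]]) (use c' p in metis)
  then show ?thesis by metis
qed

lemma component_homogeneous:
  assumes "x \<in> hcomp M d"
  shows "component M e x = (if e = d then x else \<zero>)"
  by (rule component_unique[of _ "{d}"]) (use assms hcomp_closed in auto)

lemma component_hcomp: "x \<in> carrier M \<Longrightarrow> component M d x = x \<Longrightarrow> x \<in> hcomp M d"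
  using component_decomposition(1) by metis

lemma component_component:
  "x \<in> carrier M \<Longrightarrow> component M d (component M e x) = (if d = e then component M e x else \<zero>)"
  by (simp add: component_homogeneous component_decomposition)

lemma component_outside: "d \<notin> loc_degrees \<sigma> \<Longrightarrow> x \<in> carrier M \<Longrightarrow> component M d x = \<zero>"
  using component_decomposition(1)[of x d] hcomp_outside by blast

lemma component_sum_mem:
  assumes "H \<subseteq> carrier M" "\<zero> \<in> H" "\<And>x y. x \<in> H \<Longrightarrow> y \<in> H \<Longrightarrow> x \<oplus> y \<in> H"
    and x: "x \<in> carrier M" and "\<And>d. component M d x \<in> H"
  shows "x \<in> H"
  by (subst component_decomposition(3)[OF x], rule finsum_mem[OF M.abelian_group_axioms assms(1-3)])
    (use component_decomposition(2)[OF x] assms(5) in auto)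

lemma component_finsum:
  assumes x: "x \<in> carrier M" and F: "finite F" "\<And>d. d \<notin> F \<Longrightarrow> component M d x = \<zero>"
  shows "x = finsum M (\<lambda>d. component M d x) F"
proof -
  have "finsum M (\<lambda>d. component M d x) {d. component M d x \<noteq> \<zero>} = finsum M (\<lambda>d. component M d x) F"
    by (rule M.add.finprod_mono_neutral_cong_left) (use x F in auto)
  then show ?thesis using component_decomposition(3)[OF x] by simp
qed

lemma component_add:
  assumes x: "x \<in> carrier M" and y: "y \<in> carrier M"
  shows "component M d (x \<oplus> y) = component M d x \<oplus> component M d y"
proof -
  let ?F = "{d. component M d x \<noteq> \<zero>} \<union> {d. component M d y \<noteq> \<zero>}"
  have F: "finite ?F" using component_decomposition(2) x y by simp
  show ?thesis
  proof (rule component_unique[OF _ F])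
    show "x \<oplus> y = finsum M (\<lambda>d. component M d x \<oplus> component M d y) ?F"
      using component_finsum[OF x F] component_finsum[OF y F] x y by (subst M.finsum_addf) auto
  qed (use x y component_decomposition(1) additive_subgroup.a_closed[OF hcomp_subgroup] in auto)
qed

lemma component_zero [simp]: "component M d \<zero> = \<zero>"
  using component_homogeneous[OF zero_hcomp, of d d] by simp

lemma component_single:
  assumes a: "a \<in> loc_degrees \<sigma>" and x: "x \<in> carrier M"
  shows "component M d (monomial a c \<odot> x) = monomial a c \<odot> component M (d - a) x"
proof -
  let ?H = "{x \<in> carrier M. \<forall>d. component M d (monomial a c \<odot> x)
      = monomial a c \<odot> component M (d - a) x}"
  have s: "monomial a c \<in> carrier (loc_ring \<sigma>)" by (rule single_loc_ring[OF a])
  have "x \<in> ?H"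
  proof (rule component_sum_mem[OF _ _ _ x])
    show "component M d x \<in> ?H" for d
      using component_decomposition(1)[OF x, of d] x s
        component_homogeneous[OF single_hcomp[OF a component_decomposition(1)[OF x, of d]]]
      by (auto simp: component_homogeneous simp del: carrier_loc_ring)
  qed (use s in \<open>auto simp: component_add smult_r_distr simp del: carrier_loc_ring\<close>)
  then show ?thesis by blast
qed

end

section \<open>Graded submodules and homomorphisms\<close>

text \<open>Closure under multiplication by monomials implies closure under \<open>R\<^sub>\<sigma>\<close>; closure under taking
  components makes the submodule a graded one.\<close>

definition graded_sub :: "'n::finite set \<Rightarrow> ('k::field, 'n, 'a) gmod \<Rightarrow> 'a set \<Rightarrow> bool" where
  "graded_sub \<sigma> M H \<longleftrightarrow> H \<subseteq> carrier M \<and> \<zero>\<^bsub>M\<^esub> \<in> H \<and> (\<forall>x\<in>H. \<forall>y\<in>H. x \<oplus>\<^bsub>M\<^esub> y \<in> H) \<and>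
     (\<forall>a\<in>loc_degrees \<sigma>. \<forall>c. \<forall>x\<in>H. monomial a c \<odot>\<^bsub>M\<^esub> x \<in> H) \<and>
     (\<forall>d. \<forall>x\<in>H. component M d x \<in> H)"

lemma graded_subD:
  assumes "graded_sub \<sigma> M H"
  shows "H \<subseteq> carrier M" "\<zero>\<^bsub>M\<^esub> \<in> H" "\<And>x y. x \<in> H \<Longrightarrow> y \<in> H \<Longrightarrow> x \<oplus>\<^bsub>M\<^esub> y \<in> H"
    "\<And>a c x. a \<in> loc_degrees \<sigma> \<Longrightarrow> x \<in> H \<Longrightarrow> monomial a c \<odot>\<^bsub>M\<^esub> x \<in> H"
    "\<And>d x. x \<in> H \<Longrightarrow> component M d x \<in> H"
  using assms unfolding graded_sub_def by auto

lemma graded_subI: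
  assumes "H \<subseteq> carrier M" "\<zero>\<^bsub>M\<^esub> \<in> H" "\<And>x y. x \<in> H \<Longrightarrow> y \<in> H \<Longrightarrow> x \<oplus>\<^bsub>M\<^esub> y \<in> H"
    "\<And>a c x. a \<in> loc_degrees \<sigma> \<Longrightarrow> x \<in> H \<Longrightarrow> monomial a c \<odot>\<^bsub>M\<^esub> x \<in> H"
    "\<And>d x. x \<in> H \<Longrightarrow> component M d x \<in> H"
  shows "graded_sub \<sigma> M H"
  using assms unfolding graded_sub_def by auto

definition sub_object :: "('k::field, 'n::finite, 'a) gmod \<Rightarrow> 'a set \<Rightarrow> ('k, 'n, 'a) gmod" where
  "sub_object M H = M\<lparr>carrier := H, hcomp := \<lambda>d. hcomp M d \<inter> H\<rparr>"

lemma sub_object_simps [simp]: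
  "carrier (sub_object M H) = H" "add (sub_object M H) = add M" "zero (sub_object M H) = zero M"
  "smult (sub_object M H) = smult M" "hcomp (sub_object M H) d = hcomp M d \<inter> H"
  by (simp_all add: sub_object_def)

definition gspan :: "'n::finite set \<Rightarrow> ('k::field, 'n, 'a) gmod \<Rightarrow> 'a set \<Rightarrow> 'a set" where
  "gspan \<sigma> M A = {x \<in> carrier M. \<forall>H. graded_sub \<sigma> M H \<longrightarrow> A \<subseteq> H \<longrightarrow> x \<in> H}"

lemma gspan_least: "graded_sub \<sigma> M H \<Longrightarrow> A \<subseteq> H \<Longrightarrow> gspan \<sigma> M A \<subseteq> H"
  unfolding gspan_def by blast

lemma single_lookup_loc_ring:
  "p \<in> carrier (loc_ring \<sigma>) \<Longrightarrow> monomial d (Poly_Mapping.lookup p d) \<in> carrier (loc_ring \<sigma>)"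
  by (auto simp: in_keys_iff)

context graded_mod
begin

lemma single_closed: "a \<in> loc_degrees \<sigma> \<Longrightarrow> x \<in> carrier M \<Longrightarrow> monomial a c \<odot> x \<in> carrier M"
  by (rule smult_closed[OF single_loc_ring])

lemma smult_0 [simp]: "x \<in> carrier M \<Longrightarrow> 0 \<odot> x = \<zero>"
  using smult_l_null by simp

lemma smult_1 [simp]: "x \<in> carrier M \<Longrightarrow> 1 \<odot> x = x"
  using smult_one by simp

lemma smult_add:
  "\<lbrakk>p \<in> carrier (loc_ring \<sigma>); r \<in> carrier (loc_ring \<sigma>); x \<in> carrier M\<rbrakk> \<Longrightarrow>
    (p + r) \<odot> x = p \<odot> x \<oplus> r \<odot> x"
  using smult_l_distr[of p r x] by simp

lemma smult_mult:
  "\<lbrakk>p \<in> carrier (loc_ring \<sigma>); r \<in> carrier (loc_ring \<sigma>); x \<in> carrier M\<rbrakk> \<Longrightarrow>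
    (p * r) \<odot> x = p \<odot> (r \<odot> x)"
  using smult_assoc1[of p r x] by simp

lemma single_single:
  "\<lbrakk>a \<in> loc_degrees \<sigma>; b \<in> loc_degrees \<sigma>; x \<in> carrier M\<rbrakk> \<Longrightarrow>
    monomial a c \<odot> (monomial b e \<odot> x) = monomial (a + b) (c * e) \<odot> x"
  using smult_mult[of "monomial a c" "monomial b e" x] by (simp add: mult_single)

lemma minus_single: "x \<in> carrier M \<Longrightarrow> \<ominus> x = monomial 0 (-1) \<odot> x"
proof (rule M.minus_equality)
  assume x: "x \<in> carrier M"
  have "monomial 0 (-1) \<odot> x \<oplus> x = (monomial 0 (-1) + monomial 0 1) \<odot> x"
    using smult_add[of "monomial 0 (-1)" "monomial 0 1" x] x by simp
  then show "monomial 0 (-1) \<odot> x \<oplus> x = \<zero>"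
    using x by (simp add: single_add[symmetric] del: single_one)
qed (use single_closed in auto)

lemma component_minus: "x \<in> carrier M \<Longrightarrow> component M d (\<ominus> x) = \<ominus> component M d x"
  by (simp add: minus_single component_single)

lemma graded_sub_smult:
  assumes H: "graded_sub \<sigma> M H" and p: "p \<in> carrier (loc_ring \<sigma>)" and x: "x \<in> H"
  shows "p \<odot> x \<in> H"
  using p
proof (induction p rule: loc_ring_induct)
  case (add p r)
  then show ?case using smult_add[of p r x] graded_subD(1,3)[OF H] x by auto
qed (use graded_subD[OF H] x in auto)

lemma graded_sub_minus:
  assumes H: "graded_sub \<sigma> M H" and x: "x \<in> H"
  shows "\<ominus> x \<in> H"
  using minus_single[of x] graded_subD(1,4)[OF H] x by auto

lemma graded_sub_diff:
  "graded_sub \<sigma> M H \<Longrightarrow> x \<in> H \<Longrightarrow> y \<in> H \<Longrightarrow> x \<ominus> y \<in> H"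
  using graded_subD(3) graded_sub_minus unfolding a_minus_def by metis

lemma graded_sub_zero: "graded_sub \<sigma> M {\<zero>}"
  by (rule graded_subI) (auto simp: single_loc_ring simp del: carrier_loc_ring)

lemma graded_sub_object:
  assumes H: "graded_sub \<sigma> M H"
  shows "graded_module \<sigma> (sub_object M H)"
    and component_sub_object: "x \<in> H \<Longrightarrow> component (sub_object M H) d x = component M d x"
proof -
  note D = graded_subD[OF H]
  have c: "x \<in> carrier M" if "x \<in> H" for x using D(1) that by blast
  have "module (loc_ring \<sigma>) (sub_object M H)"
  proof (intro moduleI cring_loc_ring abelian_groupI)
    show "\<exists>y\<in>carrier (sub_object M H). y \<oplus>\<^bsub>sub_object M H\<^esub> x = \<zero>\<^bsub>sub_object M H\<^esub>"
      if "x \<in> carrier (sub_object M H)" for x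
      using that graded_sub_minus[OF H, of x] c[of x] by (auto intro!: bexI[of _ "\<ominus> x"] simp: M.l_neg)
  qed (use D(2,3) c graded_sub_smult[OF H] in
      \<open>auto simp: M.add.m_ac smult_add smult_mult smult_r_distr simp del: carrier_loc_ring\<close>)
  note I = graded_moduleI[of \<sigma> "sub_object M H" "component M", OF this]
  have h: "hcomp M d \<inter> H = {x \<in> H. component M d x = x}" for d
    using component_homogeneous component_hcomp c by auto
  have s: "carrier (sub_object M H) \<subseteq> G" if G: "G \<subseteq> carrier (sub_object M H)" "\<zero>\<^bsub>sub_object M H\<^esub> \<in> G"
    "\<And>x y. x \<in> G \<Longrightarrow> y \<in> G \<Longrightarrow> x \<oplus>\<^bsub>sub_object M H\<^esub> y \<in> G"
    "\<And>d x. x \<in> carrier (sub_object M H) \<Longrightarrow> component M d x \<in> G" for G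
  proof
    fix x assume "x \<in> carrier (sub_object M H)"
    then show "x \<in> G" using G D(1) by (intro component_sum_mem[of G x]) auto
  qed
  have m: "component M (a + d) (monomial a e \<odot> component M d x)
      = monomial a e \<odot> component M d x" if "a \<in> loc_degrees \<sigma>" "x \<in> H" for a e d x
    using component_single[OF that(1), of "component M d x" "a + d" e] component_component[of x d d] c[OF that(2)]
    by simp
  show "graded_module \<sigma> (sub_object M H)"
    by (rule I(1)) (use h s m D(5) c in \<open>simp_all add: component_add component_component component_outside\<close>)
  show "x \<in> H \<Longrightarrow> component (sub_object M H) d x = component M d x"
    by (rule I(2)) (use h s m D(5) c in \<open>simp_all add: component_add component_component component_outside\<close>)
qed

lemma graded_sub_in_sub_object:
  assumes H: "graded_sub \<sigma> M H"
  shows "graded_sub \<sigma> (sub_object M H) G \<longleftrightarrow> graded_sub \<sigma> M G \<and> G \<subseteq> H"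
proof (cases "G \<subseteq> H")
  case True
  then have "\<forall>x\<in>G. component (sub_object M H) d x = component M d x" for d
    using component_sub_object[OF H] by blast
  then show ?thesis using True graded_subD(1)[OF H] unfolding graded_sub_def by auto
qed (auto simp: graded_sub_def)

lemma gspan_sub: "A \<subseteq> carrier M \<Longrightarrow> graded_sub \<sigma> M (gspan \<sigma> M A)"
  unfolding gspan_def by (rule graded_subI) (auto dest: graded_subD simp: single_closed)

lemma gspan_superset: "A \<subseteq> carrier M \<Longrightarrow> A \<subseteq> gspan \<sigma> M A"
  unfolding gspan_def by blast

lemma component_smult_homogeneous:
  assumes a: "a \<in> hcomp M e" and p: "p \<in> carrier (loc_ring \<sigma>)"
  shows "component M d (p \<odot> a) = monomial (d - e) (Poly_Mapping.lookup p (d - e)) \<odot> a"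
  using p
proof (induction p rule: loc_ring_induct)
  case zero
  then show ?case using hcomp_closed[OF a] by simp
next
  case (single b c)
  show ?case
  proof (cases "d - b = e")
    case True
    then have "d - e = b" by auto
    then show ?thesis using component_homogeneous[OF a] component_single[OF single hcomp_closed[OF a], of d c] True by simp
  next
    case False
    then have "b \<noteq> d - e" by auto
    then show ?thesis
      using component_homogeneous[OF a, of "d - b"] component_single[OF single hcomp_closed[OF a], of d c] False
        hcomp_closed[OF a] smult_r_null[OF single_loc_ring[OF single]] by (simp add: lookup_single)
  qed
next
  case (add p r)
  show ?case
    using add hcomp_closed[OF a] single_lookup_loc_ring[OF add.hyps(1), of "d - e"]
      single_lookup_loc_ring[OF add.hyps(2), of "d - e"]
    by (simp add: smult_add component_add lookup_add single_add del: carrier_loc_ring)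
qed

text \<open>Passing to the homogeneous components of generators, finite generation can be tested on
  graded submodules.\<close>

lemma finitely_generated_iff:
  "finitely_generated \<sigma> M \<longleftrightarrow>
    (\<exists>A. finite A \<and> (\<forall>a\<in>A. \<exists>d. a \<in> hcomp M d) \<and> gspan \<sigma> M A = carrier M)"
proof
  assume "finitely_generated \<sigma> M"
  then obtain A where A: "finite A" "A \<subseteq> carrier M"
    and gen: "\<And>x. x \<in> carrier M \<Longrightarrow> \<exists>p \<in> A \<rightarrow> carrier (loc_ring \<sigma>). x = finsum M (\<lambda>a. p a \<odot> a) A"
    unfolding finitely_generated_def by (elim exE conjE) simp
  let ?B = "\<Union>a\<in>A. (\<lambda>d. component M d a) ` {d. component M d a \<noteq> \<zero>}"
  have fin: "finite ?B" using A component_decomposition(2) by blast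
  have hom: "\<forall>b\<in>?B. \<exists>d. b \<in> hcomp M d" using A component_decomposition(1) by blast
  have "x \<in> H" if x: "x \<in> carrier M" and H: "graded_sub \<sigma> M H" and B: "?B \<subseteq> H" for x H
  proof -
    note D = graded_subD[OF H]
    have "a \<in> H" if a: "a \<in> A" for a
    proof (rule component_sum_mem[OF D(1-3)])
      show "component M d a \<in> H" for d using a B D(2) by (cases "component M d a = \<zero>") auto
    qed (use a A in auto)
    then have mem: "p a \<odot> a \<in> H" if "p \<in> A \<rightarrow> carrier (loc_ring \<sigma>)" "a \<in> A" for p a
      using graded_sub_smult[OF H] that by blast
    obtain p where p: "p \<in> A \<rightarrow> carrier (loc_ring \<sigma>)" and xp: "x = finsum M (\<lambda>a. p a \<odot> a) A"
      using gen[OF x] by (rule bexE)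
    show ?thesis unfolding xp by (rule finsum_mem[OF M.abelian_group_axioms D(1-3) A(1) mem[OF p]])
  qed
  then have "gspan \<sigma> M ?B = carrier M" unfolding gspan_def by blast
  then show "\<exists>A. finite A \<and> (\<forall>a\<in>A. \<exists>d. a \<in> hcomp M d) \<and> gspan \<sigma> M A = carrier M"
    using fin hom by blast
next
  assume "\<exists>A. finite A \<and> (\<forall>a\<in>A. \<exists>d. a \<in> hcomp M d) \<and> gspan \<sigma> M A = carrier M"
  then obtain A where fin: "finite A" and hom: "\<And>a. a \<in> A \<Longrightarrow> \<exists>d. a \<in> hcomp M d" and span: "gspan \<sigma> M A = carrier M"
    by blast
  obtain \<delta> where \<delta>: "\<And>a. a \<in> A \<Longrightarrow> a \<in> hcomp M (\<delta> a)" using hom by metis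
  have Ac: "a \<in> carrier M" if "a \<in> A" for a using \<delta> hcomp_closed that by blast
  let ?s = "\<lambda>p. finsum M (\<lambda>a. p a \<odot> a) A"
  let ?P = "A \<rightarrow> carrier (loc_ring \<sigma>)"
  have closed: "(\<lambda>a. p a \<odot> a) \<in> A \<rightarrow> carrier M" if "p \<in> ?P" for p
    using that Ac smult_closed by (simp add: Pi_iff del: carrier_loc_ring)
  have s_add: "?s p \<oplus> ?s r = ?s (\<lambda>a. p a + r a)" if "p \<in> ?P" "r \<in> ?P" for p r
    unfolding M.finsum_addf[OF closed[OF that(1)] closed[OF that(2)], symmetric]
    using that Ac by (intro M.finsum_cong')
      (auto simp: smult_add Pi_iff simp_implies_def intro!: add_in_loc_ring smult_closed simp del: carrier_loc_ring)
  have "graded_sub \<sigma> M (?s ` ?P)"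
  proof (rule graded_subI)
    show "?s ` ?P \<subseteq> carrier M" using M.finsum_closed[OF closed] by blast
    have "?s (\<lambda>_. 0) = finsum M (\<lambda>_. \<zero>) A" using Ac by (intro M.finsum_cong') auto
    then have z: "?s (\<lambda>_. 0) = \<zero>" by simp
    show "\<zero> \<in> ?s ` ?P" by (rule image_eqI[of _ _ "\<lambda>_. 0"]) (use z in auto)
    show "x \<oplus> y \<in> ?s ` ?P" if x: "x \<in> ?s ` ?P" and y: "y \<in> ?s ` ?P" for x y
    proof -
      obtain p r where pr: "p \<in> ?P" "x = ?s p" "r \<in> ?P" "y = ?s r" using x y by (elim imageE)
      have "(\<lambda>a. p a + r a) \<in> ?P" using pr(1,3) by (simp add: Pi_iff add_in_loc_ring del: carrier_loc_ring)
      then show ?thesis unfolding pr(2,4) s_add[OF pr(1,3)] by (rule imageI)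
    qed
    show "monomial b c \<odot> x \<in> ?s ` ?P" if b: "b \<in> loc_degrees \<sigma>" and x: "x \<in> ?s ` ?P" for b c x
    proof -
      obtain p where p: "p \<in> ?P" "x = ?s p" using x by (elim imageE)
      have "monomial b c \<odot> x = ?s (\<lambda>a. monomial b c * p a)"
        unfolding p(2) finsum_smult_ldistr[OF fin single_loc_ring[OF b] closed[OF p(1)]]
        using p(1) Ac b by (intro M.finsum_cong')
          (auto simp: smult_mult Pi_iff single_loc_ring simp_implies_def intro!: smult_closed mult_in_loc_ring simp del: carrier_loc_ring)
      moreover have "(\<lambda>a. monomial b c * p a) \<in> ?P"
        using p(1) b by (simp add: Pi_iff mult_in_loc_ring single_loc_ring del: carrier_loc_ring)
      ultimately show ?thesis by (rule image_eqI[of _ _ "\<lambda>a. monomial b c * p a"])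
    qed
    show "component M d x \<in> ?s ` ?P" if x: "x \<in> ?s ` ?P" for d x
    proof -
      obtain p where p: "p \<in> ?P" "x = ?s p" using x by (elim imageE)
      let ?r = "\<lambda>a. monomial (d - \<delta> a) (Poly_Mapping.lookup (p a) (d - \<delta> a))"
      have r: "?r \<in> ?P" using p(1) by (auto simp: Pi_iff in_keys_iff subset_iff)
      have "component M d x = finsum M (\<lambda>a. component M d (p a \<odot> a)) A"
        unfolding p(2) by (rule additive_finsum)
          (use component_add fin closed[OF p(1)] in \<open>auto simp: M.abelian_group_axioms\<close>)
      also have "\<dots> = ?s ?r"
        using p(1) component_smult_homogeneous[OF \<delta>] closed[OF r]
        by (intro M.finsum_cong') (auto simp: Pi_iff simp_implies_def simp del: carrier_loc_ring)
      finally show ?thesis by (rule image_eqI[of _ _ ?r]) (rule r)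
    qed
  qed
  moreover have "A \<subseteq> ?s ` ?P"
  proof
    fix a assume a: "a \<in> A"
    let ?p = "\<lambda>b. if b = a then 1 else 0"
    have "?s ?p = finsum M (\<lambda>b. if a = b then b else \<zero>) A"
      using Ac by (intro M.finsum_cong') (auto simp: simp_implies_def)
    also have "\<dots> = a" using M.add.finprod_singleton[OF a fin, of "\<lambda>b. b"] Ac by auto
    finally have "a = ?s ?p" by simp
    then show "a \<in> ?s ` ?P" by (rule image_eqI[of _ _ ?p]) auto
  qed
  ultimately have sub: "carrier M \<subseteq> ?s ` ?P" using gspan_least[of \<sigma> M "?s ` ?P" A] span by blast
  show "finitely_generated \<sigma> M"
    unfolding finitely_generated_def
  proof (intro exI conjI ballI)
    show "\<exists>p\<in>?P. x = ?s p" if "x \<in> carrier M" for x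
      using subsetD[OF sub that] by (rule imageE) (rule bexI)
  qed (use fin Ac in auto)
qed

end

lemma (in graded_mod) gspan_object_finitely_generated:
  assumes G: "finite G" "\<And>a. a \<in> G \<Longrightarrow> \<exists>d. a \<in> hcomp M d"
  shows "finitely_generated \<sigma> (sub_object M (gspan \<sigma> M G))"
proof -
  let ?S = "gspan \<sigma> M G"
  have GM: "G \<subseteq> carrier M" using G(2) hcomp_closed by blast
  note S = gspan_sub[OF GM]
  interpret S: graded_mod \<sigma> "sub_object M ?S" by unfold_locales (rule graded_sub_object(1)[OF S])
  have "?S \<subseteq> H" if "graded_sub \<sigma> (sub_object M ?S) H" "G \<subseteq> H" for H
    using gspan_least[of \<sigma> M H G] that unfolding graded_sub_in_sub_object[OF S] by blast
  then have "gspan \<sigma> (sub_object M ?S) G = ?S" unfolding gspan_def[of _ "sub_object M ?S"] by auto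
  then show ?thesis
    unfolding S.finitely_generated_iff using G gspan_superset[OF GM] by (intro exI[of _ G]) auto
qed

section \<open>Noetherianity\<close>

lemma nat_sequence_mono_subsequence:
  fixes t :: "nat \<Rightarrow> nat"
  shows "\<exists>r :: nat \<Rightarrow> nat. strict_mono r \<and> (\<forall>m n. m \<le> n \<longrightarrow> t (r m) \<le> t (r n))"
proof -
  obtain f where f: "strict_mono f" "monoseq (\<lambda>n. t (f n))" using seq_monosub[of t] by auto
  show ?thesis
  proof (cases "\<forall>m n. m \<le> n \<longrightarrow> t (f m) \<le> t (f n)")
    case False
    then have dec: "t (f n) \<le> t (f m)" if "m \<le> n" for m n using f(2) that unfolding monoseq_def by blast
    obtain N where "\<forall>n. t (f N) \<le> t (f n)" using ex_has_least_nat[of "\<lambda>_. True" 0 "\<lambda>n. t (f n)"] by auto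
    then have eq: "t (f (N + n)) = t (f N)" for n
      using dec[of N "N + n"] by (intro order_antisym) auto
    have "strict_mono (\<lambda>n. f (N + n))" using f(1) by (simp add: strict_mono_def)
    then show ?thesis by (intro exI[of _ "\<lambda>n. f (N + n)"]) (simp only: eq, simp)
  qed (use f in blast)
qed

lemma dickson_subsequence:
  fixes s :: "nat \<Rightarrow> 'i \<Rightarrow> nat"
  assumes "finite I"
  shows "\<exists>r :: nat \<Rightarrow> nat. strict_mono r \<and> (\<forall>i\<in>I. \<forall>m n. m \<le> n \<longrightarrow> s (r m) i \<le> s (r n) i)"
  using assms
proof (induction I rule: finite_induct)
  case empty
  show ?case by (rule exI[of _ id]) (simp add: strict_mono_def)
next
  case (insert i I)
  from insert.IH obtain r :: "nat \<Rightarrow> nat"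
    where r: "strict_mono r \<and> (\<forall>i\<in>I. \<forall>m n. m \<le> n \<longrightarrow> s (r m) i \<le> s (r n) i)" ..
  from nat_sequence_mono_subsequence[of "\<lambda>n. s (r n) i"] obtain r' :: "nat \<Rightarrow> nat"
    where r': "strict_mono r' \<and> (\<forall>m n. m \<le> n \<longrightarrow> s (r (r' m)) i \<le> s (r (r' n)) i)" ..
  have "strict_mono (\<lambda>n. r (r' n))" using r r' by (simp add: strict_mono_def)
  moreover have "s (r (r' m)) j \<le> s (r (r' n)) j" if "j \<in> insert i I" "m \<le> n" for j m n
    using that r r' strict_mono_less_eq[of r' m n] by auto
  ultimately show ?case by (intro exI[of _ "\<lambda>n. r (r' n)"]) simp
qed

text \<open>Dickson's lemma: a monomial ideal of \<open>R\<close> is generated by finitely many monomials.\<close>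

lemma dickson:
  fixes D :: "(int ^ 'n::finite) set"
  assumes D: "D \<subseteq> loc_degrees {}"
  shows "\<exists>E. finite E \<and> E \<subseteq> D \<and> (\<forall>d\<in>D. \<exists>e\<in>E. d - e \<in> loc_degrees {})"
proof -
  define E where "E = {e \<in> D. \<forall>d\<in>D. e - d \<in> loc_degrees {} \<longrightarrow> d = e}"
  have "finite E"
  proof (rule ccontr)
    assume "infinite E"
    then obtain s :: "nat \<Rightarrow> int ^ 'n" where s: "inj s" "range s \<subseteq> E" using infinite_countable_subset by blast
    obtain r :: "nat \<Rightarrow> nat" where r: "strict_mono r" "\<And>i m n. m \<le> n \<Longrightarrow> nat (s (r m) $ i) \<le> nat (s (r n) $ i)"
      using dickson_subsequence[of "UNIV :: 'n set" "\<lambda>n i. nat (s n $ i)"] by auto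
    have "0 \<le> s (r 1) $ i" for i using s(2) D by (auto simp: E_def loc_degrees_def)
    then have "s (r 1) - s (r 0) \<in> loc_degrees {}"
      using r(2)[of 0 1] by (auto simp: loc_degrees_def nat_le_eq_zle)
    moreover have "s (r 1) \<in> E" "s (r 0) \<in> D" using s(2) by (auto simp: E_def)
    ultimately have "s (r 0) = s (r 1)" unfolding E_def by blast
    then have "r 0 = r 1" using s(1) by (simp add: inj_eq)
    then show False using strict_monoD[OF r(1), of 0 1] by simp
  qed
  moreover have "\<exists>e\<in>E. d - e \<in> loc_degrees {}" if "d \<in> D" for d
    using that
  proof (induction "nat (\<Sum>i\<in>UNIV. d $ i)" arbitrary: d rule: less_induct)
    case less
    show ?case
    proof (cases "d \<in> E")
      case True
      then show ?thesis by (intro bexI[of _ d]) (simp_all add: loc_degrees_def)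
    next
      case False
      then obtain d' where d': "d' \<in> D" "d - d' \<in> loc_degrees {}" "d' \<noteq> d" using less.prems unfolding E_def by blast
      then have le: "d' $ i \<le> d $ i" for i by (simp add: loc_degrees_def)
      obtain j where "d' $ j \<noteq> d $ j" using d'(3) by (auto simp: vec_eq_iff)
      then have "d' $ j < d $ j" using le[of j] by simp
      then have "(\<Sum>i\<in>UNIV. d' $ i) < (\<Sum>i\<in>UNIV. d $ i)" using le by (intro sum_strict_mono_ex1) auto
      moreover have "0 \<le> (\<Sum>i\<in>UNIV. d' $ i)" using d'(1) D by (intro sum_nonneg) (auto simp: loc_degrees_def)
      ultimately obtain e where e: "e \<in> E" "d' - e \<in> loc_degrees {}" using less.hyps[OF _ d'(1)] by auto
      have "(d - d') + (d' - e) \<in> loc_degrees {}" by (rule add_loc_degrees[OF d'(2) e(2)])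
      then have "d - e \<in> loc_degrees {}" by simp
      then show ?thesis using e(1) by blast
    qed
  qed
  moreover have "E \<subseteq> D" unfolding E_def by blast
  ultimately show ?thesis by blast
qed

context graded_mod
begin

text \<open>The elements whose components all have this form are closed under the operations, so they comprise
  the span. For fixed \<open>d\<close> only one monomial multiple of \<open>a\<close> enters, as \<open>a\<close> is homogeneous.\<close>

lemma gspan_insert_component:
  assumes A: "A \<subseteq> carrier M" and a: "a \<in> hcomp M e" and x: "x \<in> gspan \<sigma> M (insert a A)"
  shows "\<exists>c. \<exists>y\<in>gspan \<sigma> M A. (d - e \<notin> loc_degrees \<sigma> \<longrightarrow> c = 0) \<and>
    component M d x = monomial (d - e) c \<odot> a \<oplus> y"
proof -
  let ?Q = "\<lambda>d x c y. y \<in> gspan \<sigma> M A \<and> (d - e \<notin> loc_degrees \<sigma> \<longrightarrow> c = 0) \<and>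
    component M d x = monomial (d - e) c \<odot> a \<oplus> y"
  define H where "H = {x \<in> carrier M. \<forall>d. \<exists>c y. ?Q d x c y}"
  note ac = hcomp_closed[OF a]
  note S = gspan_sub[OF A]
  note D = graded_subD[OF S]
  have yc: "y \<in> carrier M" if "y \<in> gspan \<sigma> M A" for y using D(1) that by blast
  have sc: "monomial (d - e) c \<in> carrier (loc_ring \<sigma>)" if "d - e \<notin> loc_degrees \<sigma> \<longrightarrow> c = 0" for d c
    using that by (cases "d - e \<in> loc_degrees \<sigma>") auto
  have in_span: "x \<in> H" if "x \<in> gspan \<sigma> M A" for x
    unfolding H_def using that yc[OF that] D(5)[OF that] ac
    by (auto intro!: exI[of _ 0] exI[of _ "component M _ x"])
  have "graded_sub \<sigma> M H"
  proof (rule graded_subI)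
    show "H \<subseteq> carrier M" unfolding H_def by blast
    show "\<zero> \<in> H" using in_span D(2) by blast
    show "x \<oplus> x' \<in> H" if x: "x \<in> H" and x': "x' \<in> H" for x x'
    proof -
      have xc: "x \<in> carrier M" "x' \<in> carrier M" using x x' unfolding H_def by auto
      have "\<exists>c y. ?Q d (x \<oplus> x') c y" for d
      proof -
        obtain c y where 1: "?Q d x c y" using x unfolding H_def by blast
        obtain c' y' where 2: "?Q d x' c' y'" using x' unfolding H_def by blast
        have "component M d (x \<oplus> x') = (monomial (d - e) c \<odot> a \<oplus> y) \<oplus>
            (monomial (d - e) c' \<odot> a \<oplus> y')"
          using 1 2 component_add[OF xc] by simp
        also have "\<dots> = monomial (d - e) (c + c') \<odot> a \<oplus> (y \<oplus> y')"
          using 1 2 sc[of d c] sc[of d c'] ac yc[of y] yc[of y']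
          by (simp add: single_add smult_add M.add.m_ac smult_closed del: carrier_loc_ring)
        finally show ?thesis using 1 2 D(3)[of y y'] by (intro exI[of _ "c + c'"] exI[of _ "y \<oplus> y'"]) auto
      qed
      then show ?thesis unfolding H_def using xc by simp
    qed
    show "monomial b f \<odot> x \<in> H" if b: "b \<in> loc_degrees \<sigma>" and x: "x \<in> H" for b f x
    proof -
      have xc: "x \<in> carrier M" using x unfolding H_def by auto
      have "\<exists>c y. ?Q d (monomial b f \<odot> x) c y" for d
      proof -
        obtain c y where 1: "?Q (d - b) x c y" using x unfolding H_def by blast
        have eq: "b + (d - b - e) = d - e" by simp
        have imp: "d - e \<notin> loc_degrees \<sigma> \<longrightarrow> f * c = 0"
          using 1 add_loc_degrees[OF b, of "d - b - e"] eq by auto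
        have "component M d (monomial b f \<odot> x)
            = monomial b f \<odot> (monomial (d - b - e) c \<odot> a \<oplus> y)"
          using 1 component_single[OF b xc] by simp
        also have "\<dots> = (monomial b f * monomial (d - b - e) c) \<odot> a
            \<oplus> monomial b f \<odot> y"
          using 1 sc[of "d - b" c] ac yc[of y] b
          by (simp add: smult_r_distr smult_mult single_loc_ring smult_closed del: carrier_loc_ring)
        finally have "?Q d (monomial b f \<odot> x) (f * c) (monomial b f \<odot> y)"
          using imp 1 D(4)[OF b] by (simp add: mult_single eq)
        then show ?thesis by blast
      qed
      then show ?thesis unfolding H_def using single_closed[OF b xc] by simp
    qed
    show "component M b x \<in> H" if x: "x \<in> H" for b x
    proof -
      have xc: "x \<in> carrier M" using x unfolding H_def by auto
      have "\<exists>c y. ?Q d (component M b x) c y" for d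
      proof (cases "d = b")
        case True
        then show ?thesis using x component_component[OF xc] unfolding H_def by auto
      next
        case False
        then show ?thesis using component_component[OF xc, of d b] D(2) ac
          by (intro exI[of _ 0] exI[of _ "\<zero>"]) simp
      qed
      then show ?thesis unfolding H_def using xc by simp
    qed
  qed
  moreover have "a \<in> H"
  proof -
    have "\<exists>c y. ?Q d a c y" for d
      using component_homogeneous[OF a, of d] D(2) ac
      by (intro exI[of _ "if d = e then 1 else 0"] exI[of _ "\<zero>"]) auto
    then show ?thesis unfolding H_def using ac by simp
  qed
  moreover have "A \<subseteq> H" using in_span gspan_superset[OF A] by blast
  ultimately have "x \<in> H" using x gspan_least[of \<sigma> M H "insert a A"] by blast
  then show ?thesis unfolding H_def by blast
qed

end

text \<open>Hilbert's basis theorem for \<open>\<nat>\<^sup>m\<close>-graded modules. Adding one generator \<open>a\<close> to \<open>A\<close>, the leading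
  parts of a graded submodule \<open>H\<close> form a monomial ideal: the \<open>d\<close> such that \<open>t\<^sup>d a\<close> lies in \<open>H\<close> up to
  the span of \<open>A\<close>. By Dickson's lemma finitely many elements of \<open>H\<close> account for it.\<close>

lemma (in graded_mod) graded_sub_generators:
  assumes \<sigma>: "\<sigma> = {}" and "finite A" "\<forall>a\<in>A. \<exists>d. a \<in> hcomp M d"
    and "graded_sub {} M H" "H \<subseteq> gspan {} M A"
  shows "\<exists>B. finite B \<and> B \<subseteq> H \<and> (\<forall>b\<in>B. \<exists>d. b \<in> hcomp M d) \<and> (\<forall>G. graded_sub {} M G \<longrightarrow> B \<subseteq> G \<longrightarrow> H \<subseteq> G)"
  using assms(2-)
proof (induction A arbitrary: H rule: finite_induct)
  case empty
  have "gspan {} M {} \<subseteq> {\<zero>}" by (rule gspan_least) (use graded_sub_zero \<sigma> in auto)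
  then have "H \<subseteq> {\<zero>}" using empty.prems by blast
  then have "\<forall>G. graded_sub {} M G \<longrightarrow> H \<subseteq> G" using graded_subD(2) by blast
  then show ?case by (intro exI[of _ "{}"]) simp
next
  case (insert a A)
  note H = \<open>graded_sub {} M H\<close>
  note DH = graded_subD[OF H]
  have A: "A \<subseteq> carrier M" using insert.prems(1) hcomp_closed by auto
  obtain e where a: "a \<in> hcomp M e" using insert.prems(1) by auto
  note ac = hcomp_closed[OF a]
  note S = gspan_sub[OF A, unfolded \<sigma>]
  note DS = graded_subD[OF S]
  have "graded_sub {} M (H \<inter> gspan {} M A)"
    by (rule graded_subI) (use DH DS in auto)
  then have "\<exists>B. finite B \<and> B \<subseteq> H \<inter> gspan {} M A \<and> (\<forall>b\<in>B. \<exists>d. b \<in> hcomp M d) \<and>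
      (\<forall>G. graded_sub {} M G \<longrightarrow> B \<subseteq> G \<longrightarrow> H \<inter> gspan {} M A \<subseteq> G)"
    by (intro insert.IH) (use insert.prems(1) in auto)
  then obtain B where B: "finite B \<and> B \<subseteq> H \<inter> gspan {} M A \<and> (\<forall>b\<in>B. \<exists>d. b \<in> hcomp M d) \<and>
      (\<forall>G. graded_sub {} M G \<longrightarrow> B \<subseteq> G \<longrightarrow> H \<inter> gspan {} M A \<subseteq> G)" ..
  then have BG: "H \<inter> gspan {} M A \<subseteq> G" if "graded_sub {} M G" "B \<subseteq> G" for G using that by blast
  let ?t = "\<lambda>d c. monomial d c \<odot> a"
  define D where "D = {d \<in> loc_degrees {}. \<exists>y\<in>H \<inter> hcomp M (d + e). \<exists>z\<in>gspan {} M A. y = ?t d 1 \<oplus> z}"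
  have "D \<subseteq> loc_degrees {}" unfolding D_def by (rule subsetI) simp
  from dickson[OF this] obtain E
    where E': "finite E \<and> E \<subseteq> D \<and> (\<forall>d\<in>D. \<exists>d'\<in>E. d - d' \<in> loc_degrees {})" ..
  then have E: "finite E" "E \<subseteq> D" "\<And>d. d \<in> D \<Longrightarrow> \<exists>d'\<in>E. d - d' \<in> loc_degrees {}" by auto
  have "\<forall>d\<in>E. \<exists>y. y \<in> H \<inter> hcomp M (d + e) \<and> (\<exists>z\<in>gspan {} M A. y = ?t d 1 \<oplus> z)"
    using E(2) unfolding D_def by blast
  from bchoice[OF this] obtain y
    where "\<forall>d\<in>E. y d \<in> H \<inter> hcomp M (d + e) \<and> (\<exists>z\<in>gspan {} M A. y d = ?t d 1 \<oplus> z)" ..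
  then have y: "\<And>d. d \<in> E \<Longrightarrow> y d \<in> H \<inter> hcomp M (d + e)"
    "\<And>d. d \<in> E \<Longrightarrow> \<exists>z\<in>gspan {} M A. y d = ?t d 1 \<oplus> z" by auto
  have gen: "H \<subseteq> G" if G: "graded_sub {} M G" and BY: "B \<union> y ` E \<subseteq> G" for G
  proof
    note DG = graded_subD[OF G]
    fix x assume xH: "x \<in> H"
    then have xc: "x \<in> carrier M" using DH(1) by blast
    show "x \<in> G"
    proof (rule component_sum_mem[OF DG(1-3) xc])
      fix d
      let ?x = "component M d x"
      have xdH: "?x \<in> H" and xdc: "?x \<in> carrier M" using DH(5) xH xc by auto
      obtain c z where z: "z \<in> gspan {} M A" and c: "d - e \<notin> loc_degrees {} \<longrightarrow> c = 0"
        and eq: "?x = ?t (d - e) c \<oplus> z"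
        using gspan_insert_component[OF A a, of x d] insert.prems(3) xH \<sigma> by blast
      have zc: "z \<in> carrier M" using DS(1) z by blast
      show "?x \<in> G"
      proof (cases "c = 0")
        case True
        then have "?x = z" using eq ac zc by simp
        then show ?thesis using BG[OF G] BY xdH z by auto
      next
        case False
        then have de: "d - e \<in> loc_degrees {}" using c by blast
        have td: "?t (d - e) c \<in> carrier M" by (rule single_closed[OF _ ac]) (use de \<sigma> in simp)
        have s0: "monomial 0 (inverse c) \<in> carrier (loc_ring \<sigma>)" by simp
        let ?y = "monomial 0 (inverse c) \<odot> ?x"
        have "?y \<in> hcomp M (0 + d)" by (rule single_hcomp[OF zero_loc_degrees component_decomposition(1)[OF xc]])
        then have yH: "?y \<in> H \<inter> hcomp M ((d - e) + e)" using DH(4)[OF zero_loc_degrees xdH] by simp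
        have "?y = ?t (d - e) 1 \<oplus> monomial 0 (inverse c) \<odot> z"
          unfolding eq smult_r_distr[OF s0 td zc]
          using single_single[of 0 "d - e" a "inverse c" c] False de ac \<sigma> by simp
        then have "d - e \<in> D" unfolding D_def using yH de DS(4)[OF zero_loc_degrees z] by blast
        then obtain d' where d': "d' \<in> E" and b: "d - e - d' \<in> loc_degrees {}" using E(3) by blast
        obtain z' where z': "z' \<in> gspan {} M A" and eq': "y d' = ?t d' 1 \<oplus> z'" using y(2)[OF d'] by blast
        have z'c: "z' \<in> carrier M" using DS(1) z' by blast
        have d'l: "d' \<in> loc_degrees {}" using d' E(2) unfolding D_def by blast
        let ?s = "monomial (d - e - d') c"
        have s: "?s \<in> carrier (loc_ring \<sigma>)" using b \<sigma> by simp
        have sy: "?s \<odot> y d' = ?t (d - e) c \<oplus> ?s \<odot> z'"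
          unfolding eq' using single_single[of "d - e - d'" d' a c 1] b d'l ac \<sigma>
            smult_r_distr[OF s single_closed[OF _ ac] z'c, of d' 1] by simp
        have syH: "?s \<odot> y d' \<in> H" and syG: "?s \<odot> y d' \<in> G"
          using DH(4)[OF b] DG(4)[OF b] y(1)[OF d'] BY d' by auto
        have sz: "?s \<odot> z' \<in> gspan {} M A" by (rule DS(4)[OF b z'])
        then have szc: "?s \<odot> z' \<in> carrier M" using DS(1) by blast
        have "?x = ?s \<odot> y d' \<oplus> (z \<ominus> ?s \<odot> z')"
          unfolding sy eq using td zc szc by (simp add: a_minus_def M.add.m_ac M.r_neg M.r_neg1)
        moreover have diff: "z \<ominus> ?s \<odot> z' \<in> gspan {} M A"
          using graded_sub_diff[unfolded \<sigma>, OF S z sz] .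
        moreover have "z \<ominus> ?s \<odot> z' = ?x \<ominus> ?s \<odot> y d'"
          unfolding sy eq using td zc szc
          by (simp add: a_minus_def M.minus_add M.add.m_ac) (simp add: M.a_assoc[symmetric] M.r_neg)
        then have "z \<ominus> ?s \<odot> z' \<in> H"
          using graded_sub_diff[unfolded \<sigma>, OF H xdH syH] by simp
        ultimately show ?thesis using DG(3)[OF syG] BG[OF G] BY by auto
      qed
    qed
  qed
  have "\<forall>b\<in>B \<union> y ` E. \<exists>d. b \<in> hcomp M d" "B \<union> y ` E \<subseteq> H" using B y(1) by auto
  then show ?case using gen B(1) E(1) by (intro exI[of _ "B \<union> y ` E"]) blast
qed

lemma (in graded_mod) noetherian:
  assumes \<sigma>: "\<sigma> = {}" and fg: "finitely_generated {} M" and H: "graded_sub {} M H"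
  shows "finitely_generated {} (sub_object M H)"
proof -
  obtain A where A: "finite A" "\<forall>a\<in>A. \<exists>d. a \<in> hcomp M d" "gspan {} M A = carrier M"
    using fg finitely_generated_iff \<sigma> by auto
  obtain B where B: "finite B" "B \<subseteq> H" "\<forall>b\<in>B. \<exists>d. b \<in> hcomp M d"
    and BG: "\<And>G. \<lbrakk>graded_sub {} M G; B \<subseteq> G\<rbrakk> \<Longrightarrow> H \<subseteq> G"
    using graded_sub_generators[OF \<sigma> A(1,2) H] A(3) graded_subD(1)[OF H] by auto
  interpret S: graded_mod "{}" "sub_object M H"
    using graded_sub_object(1) H \<sigma> by unfold_locales simp
  have "gspan {} (sub_object M H) B = H"
    using BG graded_sub_in_sub_object[unfolded \<sigma>, OF H] unfolding gspan_def by auto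
  then show ?thesis unfolding S.finitely_generated_iff using B by (intro exI[of _ B]) auto
qed

section \<open>Constructions with graded modules\<close>

lemma (in graded_mod) diff_eq_zero_iff [simp]:
  "\<lbrakk>x \<in> carrier M; y \<in> carrier M\<rbrakk> \<Longrightarrow> x \<ominus> y = \<zero> \<longleftrightarrow> x = y"
  unfolding a_minus_def using M.minus_equality[of x "\<ominus> y"] M.r_neg by auto

lemma (in graded_mod) diff_self [simp]: "x \<in> carrier M \<Longrightarrow> x \<ominus> x = \<zero>"
  by simp

lemma (in graded_mod) minus_zero [simp]: "\<ominus> \<zero> = \<zero>"
  by (rule M.minus_equality) simp_all

lemma (in graded_mod) diff_diff:
  assumes "x \<in> carrier M" "y \<in> carrier M" "z \<in> carrier M"
  shows "(x \<ominus> y) \<oplus> (y \<ominus> z) = x \<ominus> z" "(x \<ominus> z) \<ominus> (y \<ominus> z) = x \<ominus> y"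
    "(x \<ominus> y) \<ominus> (x \<ominus> z) = z \<ominus> y"
proof -
  have "z \<oplus> (\<ominus> y \<oplus> \<ominus> z) = \<ominus> y" using assms M.a_lcomm[of z "\<ominus> y" "\<ominus> z"] by (simp add: M.r_neg)
  then show "(x \<ominus> y) \<oplus> (y \<ominus> z) = x \<ominus> z" "(x \<ominus> z) \<ominus> (y \<ominus> z) = x \<ominus> y" "(x \<ominus> y) \<ominus> (x \<ominus> z) = z \<ominus> y"
    using assms by (simp_all add: a_minus_def M.minus_add M.add.m_ac M.r_neg M.r_neg1 M.r_neg2)
qed

text \<open>A map from an \<open>R\<^sub>\<sigma>\<close>-module to an \<open>R\<^sub>\<tau>\<close>-module with \<open>\<sigma> \<subseteq> \<tau>\<close>; both the homomorphisms of
  \<open>R\<^sub>\<sigma>\<close>-modules and the transition maps are of this kind.\<close>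

locale graded_map = M: graded_mod \<sigma> M + N: graded_mod \<tau> N
  for \<sigma> \<tau> :: "'n::finite set" and M :: "('k::field, 'n, 'a) gmod" and N :: "('k, 'n, 'b) gmod" +
  fixes f :: "'a \<Rightarrow> 'b"
  assumes hom: "f \<in> graded_hom \<sigma> M N" and sub: "\<sigma> \<subseteq> \<tau>"
begin

lemma closed: "x \<in> carrier M \<Longrightarrow> f x \<in> carrier N"
  using hom unfolding graded_hom_def by auto

lemma add: "\<lbrakk>x \<in> carrier M; y \<in> carrier M\<rbrakk> \<Longrightarrow> f (x \<oplus>\<^bsub>M\<^esub> y) = f x \<oplus>\<^bsub>N\<^esub> f y"
  using hom unfolding graded_hom_def by simp

lemma smult: "\<lbrakk>p \<in> carrier (loc_ring \<sigma>); x \<in> carrier M\<rbrakk> \<Longrightarrow> f (p \<odot>\<^bsub>M\<^esub> x) = p \<odot>\<^bsub>N\<^esub> f x"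
  using hom unfolding graded_hom_def by simp

lemma single: "\<lbrakk>a \<in> loc_degrees \<sigma>; x \<in> carrier M\<rbrakk> \<Longrightarrow>
    f (monomial a c \<odot>\<^bsub>M\<^esub> x) = monomial a c \<odot>\<^bsub>N\<^esub> f x"
  by (rule smult[OF single_loc_ring])

lemma hcomp: "x \<in> hcomp M d \<Longrightarrow> f x \<in> hcomp N d"
  using hom unfolding graded_hom_def by blast

lemma extensional: "f \<in> extensional (carrier M)"
  using hom unfolding graded_hom_def by (auto simp: PiE_def)

lemma zero: "f \<zero>\<^bsub>M\<^esub> = \<zero>\<^bsub>N\<^esub>"
  using add[of "\<zero>\<^bsub>M\<^esub>" "\<zero>\<^bsub>M\<^esub>"] closed[of "\<zero>\<^bsub>M\<^esub>"] N.M.add.l_cancel_one' by auto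

lemma minus: "x \<in> carrier M \<Longrightarrow> f (\<ominus>\<^bsub>M\<^esub> x) = \<ominus>\<^bsub>N\<^esub> f x"
  using single[of 0 x "-1"] closed by (simp add: M.minus_single N.minus_single)

lemma diff: "\<lbrakk>x \<in> carrier M; y \<in> carrier M\<rbrakk> \<Longrightarrow> f (x \<ominus>\<^bsub>M\<^esub> y) = f x \<ominus>\<^bsub>N\<^esub> f y"
  by (simp add: a_minus_def add minus)

lemma comp: "x \<in> carrier M \<Longrightarrow> f (component M d x) = component N d (f x)"
proof -
  assume x: "x \<in> carrier M"
  let ?F = "{d. component M d x \<noteq> \<zero>\<^bsub>M\<^esub>}"
  have "f x = finsum N (\<lambda>d. f (component M d x)) ?F"
    by (subst M.component_decomposition(3)[OF x], rule additive_finsum)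
      (use x add closed M.component_decomposition(2)[OF x] in
        \<open>auto simp: M.M.abelian_group_axioms N.M.abelian_group_axioms\<close>)
  then show ?thesis
    by (intro N.component_unique[of "\<lambda>d. f (component M d x)" ?F "f x" d, symmetric])
      (use x M.component_decomposition(1,2)[OF x] hcomp zero in auto)
qed

lemma image_sub: "\<sigma> = \<tau> \<Longrightarrow> graded_sub \<tau> N (f ` carrier M)"
proof (rule graded_subI)
  show "\<zero>\<^bsub>N\<^esub> \<in> f ` carrier M" using zero M.M.zero_closed by (metis imageI)
  show "x \<oplus>\<^bsub>N\<^esub> y \<in> f ` carrier M" if "x \<in> f ` carrier M" "y \<in> f ` carrier M" for x y
    using that by (auto simp: add[symmetric])
  show "monomial a c \<odot>\<^bsub>N\<^esub> x \<in> f ` carrier M"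
    if "\<sigma> = \<tau>" "a \<in> loc_degrees \<tau>" "x \<in> f ` carrier M" for a c x
    using that M.single_closed by (auto simp: single[symmetric])
qed (auto simp: closed comp[symmetric])

lemma preimage_sub:
  assumes H: "graded_sub \<tau> N H"
  shows "graded_sub \<sigma> M {x \<in> carrier M. f x \<in> H}"
  using graded_subD[OF H] loc_degrees_mono[OF sub]
  by (intro graded_subI) (auto simp: zero add single comp M.single_closed)

lemma kernel_sub: "graded_sub \<sigma> M {x \<in> carrier M. f x = \<zero>\<^bsub>N\<^esub>}"
  using preimage_sub[OF N.graded_sub_zero] by simp

lemma inj_iff: "inj_on f (carrier M) \<longleftrightarrow> (\<forall>x\<in>carrier M. f x = \<zero>\<^bsub>N\<^esub> \<longrightarrow> x = \<zero>\<^bsub>M\<^esub>)"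
proof (intro iffI ballI impI inj_onI)
  show "x = \<zero>\<^bsub>M\<^esub>" if "inj_on f (carrier M)" "x \<in> carrier M" "f x = \<zero>\<^bsub>N\<^esub>" for x
    using that zero by (intro inj_onD[of f "carrier M" x "\<zero>\<^bsub>M\<^esub>"]) auto
  show "x = y" if "\<forall>x\<in>carrier M. f x = \<zero>\<^bsub>N\<^esub> \<longrightarrow> x = \<zero>\<^bsub>M\<^esub>" "x \<in> carrier M" "y \<in> carrier M" "f x = f y" for x y
    using that diff[of x y] closed[of y] M.M.minus_closed[of x y] M.diff_eq_zero_iff[of x y] by simp
qed

end

lemma graded_hom_restrictI:
  assumes M: "graded_module \<sigma> M" and N: "graded_module \<tau> N" and sub: "\<sigma> \<subseteq> \<tau>"
    and closed: "\<And>x. x \<in> carrier M \<Longrightarrow> f x \<in> carrier N"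
    and add: "\<And>x y. \<lbrakk>x \<in> carrier M; y \<in> carrier M\<rbrakk> \<Longrightarrow> f (x \<oplus>\<^bsub>M\<^esub> y) = f x \<oplus>\<^bsub>N\<^esub> f y"
    and single: "\<And>a c x. \<lbrakk>a \<in> loc_degrees \<sigma>; x \<in> carrier M\<rbrakk> \<Longrightarrow>
      f (monomial a c \<odot>\<^bsub>M\<^esub> x) = monomial a c \<odot>\<^bsub>N\<^esub> f x"
    and hcomp: "\<And>d x. x \<in> hcomp M d \<Longrightarrow> f x \<in> hcomp N d"
  shows "restrict f (carrier M) \<in> graded_hom \<sigma> M N"
proof -
  interpret M: graded_mod \<sigma> M by (unfold_locales) (rule M)
  interpret N: graded_mod \<tau> N by (unfold_locales) (rule N)
  have smult: "f (p \<odot>\<^bsub>M\<^esub> x) = p \<odot>\<^bsub>N\<^esub> f x" if p: "p \<in> carrier (loc_ring \<sigma>)" and x: "x \<in> carrier M" for p x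
    using p
  proof (induction p rule: loc_ring_induct)
    case zero
    have "f \<zero>\<^bsub>M\<^esub> = \<zero>\<^bsub>N\<^esub>" using single[of 0 x 0] x closed by simp
    then show ?case using x closed by simp
  next
    case (add p r)
    then show ?case
      using M.smult_add[OF add.hyps(1,2) x] N.smult_add[OF loc_ring_mono[OF sub add.hyps(1)] loc_ring_mono[OF sub add.hyps(2)] closed[OF x]]
        assms(5)[OF M.smult_closed[OF add.hyps(1) x] M.smult_closed[OF add.hyps(2) x]] by simp
  qed (use single x in simp)
  show ?thesis unfolding graded_hom_def
    using closed add smult hcomp M.hcomp_closed by (auto simp del: carrier_loc_ring)
qed

lemma graded_hom_eqI:
  assumes "f \<in> graded_hom \<sigma> M N" "g \<in> graded_hom \<sigma> M N" "\<And>x. x \<in> carrier M \<Longrightarrow> f x = g x"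
  shows "f = g"
  using assms unfolding graded_hom_def by (intro PiE_ext[of f "carrier M" _ g]) auto

lemma graded_hom_id: "(\<lambda>x\<in>carrier M. x) \<in> graded_hom \<sigma> M M" if "graded_module \<sigma> M"
  by (rule graded_hom_restrictI[OF that that]) auto

lemma graded_hom_compose:
  assumes L: "graded_module \<sigma> L" and M: "graded_module \<tau> M" and N: "graded_module \<upsilon> N"
    and sub: "\<sigma> \<subseteq> \<tau>" "\<tau> \<subseteq> \<upsilon>" and f: "f \<in> graded_hom \<sigma> L M" and g: "g \<in> graded_hom \<tau> M N"
  shows "compose (carrier L) g f \<in> graded_hom \<sigma> L N"
proof -
  interpret f: graded_map \<sigma> \<tau> L M f using L M f sub by unfold_locales
  interpret g: graded_map \<tau> \<upsilon> M N g using M N g sub by unfold_locales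
  show ?thesis unfolding compose_def
    by (rule graded_hom_restrictI[OF L N])
      (use sub loc_degrees_mono[OF sub(1)] in \<open>auto simp: f.closed g.closed f.add g.add f.single g.single f.hcomp g.hcomp\<close>)
qed

lemma graded_hom_zero:
  assumes M: "graded_module \<sigma> M" and N: "graded_module \<sigma> N"
  shows "(\<lambda>x\<in>carrier M. \<zero>\<^bsub>N\<^esub>) \<in> graded_hom \<sigma> M N"
proof -
  interpret N: graded_mod \<sigma> N by (unfold_locales) (rule N)
  show ?thesis
    by (rule graded_hom_restrictI[OF M N]) (auto simp: N.smult_r_null[OF single_loc_ring] simp del: carrier_loc_ring)
qed

lemma graded_hom_inclusion:
  assumes M: "graded_module \<sigma> M" and H: "graded_sub \<sigma> M H"
  shows "(\<lambda>x\<in>H. x) \<in> graded_hom \<sigma> (sub_object M H) M"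
proof -
  interpret M: graded_mod \<sigma> M by (unfold_locales) (rule M)
  show ?thesis
    using graded_hom_restrictI[OF M.graded_sub_object(1)[OF H] M order_refl, of "\<lambda>x. x"] graded_subD(1)[OF H]
    by auto
qed

lemma graded_hom_lift:
  assumes N: "graded_module \<sigma> N" and X: "graded_module \<sigma> X" and T: "graded_module \<sigma> T"
    and i: "i \<in> graded_hom \<sigma> N X" and inj: "inj_on i (carrier N)"
    and g: "g \<in> graded_hom \<sigma> T X" and im: "\<And>t. t \<in> carrier T \<Longrightarrow> g t \<in> i ` carrier N"
  shows "\<exists>h\<in>graded_hom \<sigma> T N. \<forall>t\<in>carrier T. i (h t) = g t"
proof -
  interpret i: graded_map \<sigma> \<sigma> N X i using N X i by unfold_locales auto
  interpret g: graded_map \<sigma> \<sigma> T X g using T X g by unfold_locales auto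
  let ?h = "\<lambda>t. inv_into (carrier N) i (g t)"
  have h: "?h t \<in> carrier N" "i (?h t) = g t" if "t \<in> carrier T" for t
    using im[OF that] inv_into_into f_inv_into_f by metis+
  have eq: "?h t = n" if "t \<in> carrier T" "n \<in> carrier N" "i n = g t" for t n
    using inj_onD[OF inj, of "?h t" n] h[OF that(1)] that by simp
  have "restrict ?h (carrier T) \<in> graded_hom \<sigma> T N"
  proof (rule graded_hom_restrictI[OF T N order_refl])
    show "?h t \<in> hcomp N d" if t: "t \<in> hcomp T d" for d t
    proof -
      have tc: "t \<in> carrier T" using g.M.hcomp_closed[OF t] .
      have "component X d (g t) = g t" using g.comp[OF tc, of d] by (simp add: g.M.component_homogeneous[OF t])
      then have "i (component N d (?h t)) = g t" using i.comp[OF h(1)[OF tc]] h(2)[OF tc] by simp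
      then have "?h t = component N d (?h t)" by (intro eq tc i.M.component_closed h)
      then show ?thesis using i.M.component_hcomp h(1)[OF tc] by simp
    qed
    show "?h (x \<oplus>\<^bsub>T\<^esub> y) = ?h x \<oplus>\<^bsub>N\<^esub> ?h y" if "x \<in> carrier T" "y \<in> carrier T" for x y
      by (rule eq) (use h that in \<open>auto simp: i.add g.add\<close>)
    show "?h (monomial a c \<odot>\<^bsub>T\<^esub> x) = monomial a c \<odot>\<^bsub>N\<^esub> ?h x"
      if "a \<in> loc_degrees \<sigma>" "x \<in> carrier T" for a c x
      by (rule eq) (use h that in \<open>auto simp: i.single g.single i.M.single_closed g.M.single_closed\<close>)
  qed (use h in auto)
  then show ?thesis using h by (intro bexI[of _ "restrict ?h (carrier T)"]) auto
qed

lemma graded_hom_descend: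
  assumes Y: "graded_module \<sigma> Y" and N: "graded_module \<sigma> N" and T: "graded_module \<sigma> T"
    and p: "p \<in> graded_hom \<sigma> Y N" and surj: "p ` carrier Y = carrier N"
    and g: "g \<in> graded_hom \<sigma> Y T" and ker: "\<And>y. y \<in> carrier Y \<Longrightarrow> p y = \<zero>\<^bsub>N\<^esub> \<Longrightarrow> g y = \<zero>\<^bsub>T\<^esub>"
  shows "\<exists>h\<in>graded_hom \<sigma> N T. \<forall>y\<in>carrier Y. h (p y) = g y"
proof -
  interpret p: graded_map \<sigma> \<sigma> Y N p using Y N p by unfold_locales auto
  interpret g: graded_map \<sigma> \<sigma> Y T g using Y T g by unfold_locales auto
  let ?s = "inv_into (carrier Y) p"
  let ?h = "\<lambda>n. g (?s n)"
  have s: "?s n \<in> carrier Y" "p (?s n) = n" if "n \<in> carrier N" for n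
    using that surj inv_into_into f_inv_into_f by metis+
  have eq: "?h n = g y" if "y \<in> carrier Y" "n = p y" for n y
  proof -
    have n: "n \<in> carrier N" using that p.closed by simp
    have "p (?s n \<ominus>\<^bsub>Y\<^esub> y) = \<zero>\<^bsub>N\<^esub>"
      using p.diff[OF s(1)[OF n] that(1)] s(2)[OF n] that(2) p.N.diff_eq_zero_iff[OF n n] by simp
    then have "g (?s n \<ominus>\<^bsub>Y\<^esub> y) = \<zero>\<^bsub>T\<^esub>" using ker s(1)[OF n] that by simp
    then show ?thesis
      using g.diff[OF s(1)[OF n] that(1)] g.N.diff_eq_zero_iff[OF g.closed[OF s(1)[OF n]] g.closed[OF that(1)]] by simp
  qed
  have "restrict ?h (carrier N) \<in> graded_hom \<sigma> N T"
  proof (rule graded_hom_restrictI[OF N T order_refl])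
    show "?h (n \<oplus>\<^bsub>N\<^esub> n') = ?h n \<oplus>\<^bsub>T\<^esub> ?h n'" if "n \<in> carrier N" "n' \<in> carrier N" for n n'
      using eq[of "?s n \<oplus>\<^bsub>Y\<^esub> ?s n'" "n \<oplus>\<^bsub>N\<^esub> n'"] s that by (simp add: p.add g.add)
    show "?h (monomial a c \<odot>\<^bsub>N\<^esub> n) = monomial a c \<odot>\<^bsub>T\<^esub> ?h n"
      if "a \<in> loc_degrees \<sigma>" "n \<in> carrier N" for a c n
      using eq[of "monomial a c \<odot>\<^bsub>Y\<^esub> ?s n"] s that by (simp add: p.single g.single p.M.single_closed)
    show "?h n \<in> hcomp T d" if n: "n \<in> hcomp N d" for d n
    proof -
      have nc: "n \<in> carrier N" using p.N.hcomp_closed[OF n] .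
      have "p (component Y d (?s n)) = n"
        using p.comp[OF s(1)[OF nc]] s(2)[OF nc] p.N.component_homogeneous[OF n, of d] by simp
      then have "?h n = g (component Y d (?s n))" using eq[of "component Y d (?s n)" n] s(1)[OF nc] by simp
      then show ?thesis using g.hcomp p.M.component_decomposition(1) s(1)[OF nc] by simp
    qed
  qed (use s g.closed in auto)
  then show ?thesis using eq p.closed by (intro bexI[of _ "restrict ?h (carrier N)"]) auto
qed

lemma finitely_generated_image:
  assumes X: "graded_module \<sigma> X" and Y: "graded_module \<tau> Y" and sub: "\<sigma> \<subseteq> \<tau>"
    and f: "f \<in> graded_hom \<sigma> X Y" and fg: "finitely_generated \<sigma> X"
    and gen: "\<And>H. graded_sub \<tau> Y H \<Longrightarrow> f ` carrier X \<subseteq> H \<Longrightarrow> carrier Y \<subseteq> H"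
  shows "finitely_generated \<tau> Y"
proof -
  interpret f: graded_map \<sigma> \<tau> X Y f using X Y f sub by unfold_locales
  obtain A where A: "finite A" "\<forall>a\<in>A. \<exists>d. a \<in> hcomp X d" "gspan \<sigma> X A = carrier X"
    using fg f.M.finitely_generated_iff by auto
  have "carrier Y \<subseteq> H" if H: "graded_sub \<tau> Y H" "f ` A \<subseteq> H" for H
  proof (rule gen[OF H(1)])
    have "A \<subseteq> {x \<in> carrier X. f x \<in> H}" using H(2) A(2) f.M.hcomp_closed by auto
    then show "f ` carrier X \<subseteq> H" using gspan_least[OF f.preimage_sub[OF H(1)]] A(3) by auto
  qed
  then have "gspan \<tau> Y (f ` A) = carrier Y" unfolding gspan_def by blast
  moreover have "\<forall>b\<in>f ` A. \<exists>d. b \<in> hcomp Y d" using A(2) f.hcomp by blast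
  ultimately show ?thesis unfolding f.N.finitely_generated_iff using A(1) by blast
qed

text \<open>A map \<open>q\<close> of sets whose fibres are the cosets of a graded submodule transports the module
  structure to its image. With \<open>q\<close> injective this moves a module to another type of elements; with
  \<open>q\<close> a choice of representatives it yields the quotient by \<open>Z\<close>, without a change of type.\<close>

lemma graded_image:
  fixes M :: "('k::field, 'n::finite, 'b) gmod" (structure) and q :: "'b \<Rightarrow> 'a"
  assumes M: "graded_module \<sigma> M" and Z: "graded_sub \<sigma> M Z"
    and q: "\<And>x y. \<lbrakk>x \<in> carrier M; y \<in> carrier M\<rbrakk> \<Longrightarrow> q x = q y \<longleftrightarrow> x \<ominus> y \<in> Z"
  shows "\<exists>N :: ('k, 'n, 'a) gmod. graded_module \<sigma> N \<and> restrict q (carrier M) \<in> graded_hom \<sigma> M N \<and>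
    carrier N = q ` carrier M \<and> (\<forall>x\<in>carrier M. q x = \<zero>\<^bsub>N\<^esub> \<longleftrightarrow> x \<in> Z)"
proof -
  interpret M: graded_mod \<sigma> M by (unfold_locales) (rule M)
  note Z' = graded_subD[OF Z]
  have cong_add: "q (x \<oplus> y) = q (x' \<oplus> y')"
    if c: "x \<in> carrier M" "x' \<in> carrier M" "y \<in> carrier M" "y' \<in> carrier M" and eq: "q x = q x'" "q y = q y'"
    for x x' y y'
  proof -
    have "(x \<ominus> x') \<oplus> (y \<ominus> y') \<in> Z" using Z'(3) q c eq by simp
    then show ?thesis using c q by (simp add: a_minus_def M.M.minus_add M.M.add.m_ac)
  qed
  have cong_smult: "q (p \<odot> x) = q (p \<odot> x')"
    if "p \<in> carrier (loc_ring \<sigma>)" "x \<in> carrier M" "x' \<in> carrier M" "q x = q x'" for p x x'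
  proof -
    have "p \<odot> (x \<ominus> x') \<in> Z" using M.graded_sub_smult[OF Z] q that by blast
    then show ?thesis
      using that q M.smult_closed[OF that(1,2)] M.smult_closed[OF that(1,3)]
      by (simp add: a_minus_def M.smult_r_distr M.smult_r_minus del: carrier_loc_ring)
  qed
  have cong_comp: "q (component M d x) = q (component M d x')"
    if c: "x \<in> carrier M" "x' \<in> carrier M" and eq: "q x = q x'" for d x x'
  proof -
    have "component M d (x \<ominus> x') \<in> Z" using Z'(5) q c eq by blast
    then show ?thesis using c q by (simp add: a_minus_def M.component_add M.component_minus)
  qed
  define g where "g = inv_into (carrier M) q"
  have g: "g (q x) \<in> carrier M" "q (g (q x)) = q x" if "x \<in> carrier M" for x
    using that unfolding g_def by (auto intro: inv_into_into f_inv_into_f)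
  define N :: "('k, 'n, 'a) gmod" where "N = \<lparr>carrier = q ` carrier M, monoid.mult = undefined, one = undefined,
    zero = q \<zero>, add = (\<lambda>u v. q (g u \<oplus> g v)), smult = (\<lambda>p u. q (p \<odot> g u)), hcomp = (\<lambda>d. q ` hcomp M d)\<rparr>"
  have N: "carrier N = q ` carrier M" "\<zero>\<^bsub>N\<^esub> = q \<zero>" "hcomp N d = q ` hcomp M d" for d by (auto simp: N_def)
  have add: "q x \<oplus>\<^bsub>N\<^esub> q y = q (x \<oplus> y)" if x: "x \<in> carrier M" and y: "y \<in> carrier M" for x y
    unfolding N_def by (simp add: cong_add[OF g(1)[OF x] x g(1)[OF y] y g(2)[OF x] g(2)[OF y]])
  have smult: "p \<odot>\<^bsub>N\<^esub> q x = q (p \<odot> x)" if p: "p \<in> carrier (loc_ring \<sigma>)" and x: "x \<in> carrier M" for p x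
    unfolding N_def by (simp add: cong_smult[OF p g(1)[OF x] x g(2)[OF x]])
  have smult_1: "1 \<odot>\<^bsub>N\<^esub> q x = q x" if "x \<in> carrier M" for x using smult[of 1 x] that by simp
  have "module (loc_ring \<sigma>) N"
  proof (intro moduleI cring_loc_ring abelian_groupI)
    show "\<exists>y\<in>carrier N. y \<oplus>\<^bsub>N\<^esub> u = \<zero>\<^bsub>N\<^esub>" if "u \<in> carrier N" for u
    proof -
      obtain x where "x \<in> carrier M" "u = q x" using \<open>u \<in> carrier N\<close> N(1) by auto
      then show ?thesis by (intro bexI[of _ "q (\<ominus> x)"]) (simp_all add: N add M.M.l_neg)
    qed
  qed (auto simp: N add smult smult_1 M.M.add.m_ac M.smult_add M.smult_mult M.smult_r_distr M.smult_closed add_in_loc_ring mult_in_loc_ring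
      simp del: carrier_loc_ring)
  note I = graded_moduleI[of \<sigma> N "\<lambda>d u. q (component M d (g u))", OF this]
  have pi: "q (component M d (g (q x))) = q (component M d x)" if x: "x \<in> carrier M" for d x
    by (rule cong_comp[OF g(1)[OF x] x g(2)[OF x]])
  have "graded_module \<sigma> N"
  proof (rule I)
    show "hcomp N d = {u \<in> carrier N. q (component M d (g u)) = u}" for d
    proof (intro equalityI subsetI)
      show "u \<in> {u \<in> carrier N. q (component M d (g u)) = u}" if "u \<in> hcomp N d" for u
        using that M.hcomp_closed pi M.component_homogeneous by (auto simp: N)
      show "u \<in> hcomp N d" if "u \<in> {u \<in> carrier N. q (component M d (g u)) = u}" for u
        using that pi M.component_decomposition(1) by (auto simp: N) (metis imageI)
    qed
    show "carrier N \<subseteq> H" if H: "H \<subseteq> carrier N" "\<zero>\<^bsub>N\<^esub> \<in> H" "\<And>x y. x \<in> H \<Longrightarrow> y \<in> H \<Longrightarrow> x \<oplus>\<^bsub>N\<^esub> y \<in> H"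
      "\<And>d u. u \<in> carrier N \<Longrightarrow> q (component M d (g u)) \<in> H" for H
    proof
      fix u assume "u \<in> carrier N"
      then obtain x where x: "x \<in> carrier M" "u = q x" using N by auto
      have "x \<in> {x \<in> carrier M. q x \<in> H}"
      proof (rule M.component_sum_mem)
        show "y \<oplus> z \<in> {x \<in> carrier M. q x \<in> H}"
          if "y \<in> {x \<in> carrier M. q x \<in> H}" "z \<in> {x \<in> carrier M. q x \<in> H}" for y z
          using H(3)[of "q y" "q z"] add[of y z] that by simp
        show "component M d x \<in> {x \<in> carrier M. q x \<in> H}" for d
          using H(4)[of "q x" d] pi[OF x(1), of d] x(1) N(1) by simp
      qed (use H(2) x N in auto)
      then show "u \<in> H" using x by simp
    qed
    show "q (component M (a + d) (g (monomial a c \<odot>\<^bsub>N\<^esub> q (component M d (g u)))))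
        = monomial a c \<odot>\<^bsub>N\<^esub> q (component M d (g u))"
      if "a \<in> loc_degrees \<sigma>" "u \<in> carrier N" for a c d u
      using that by (auto simp: N pi smult single_loc_ring M.single_closed M.component_single M.component_component
        simp del: carrier_loc_ring)
  qed (auto simp: N add pi M.component_add M.component_component M.component_outside)
  moreover have "restrict q (carrier M) \<in> graded_hom \<sigma> M N"
    by (rule graded_hom_restrictI[OF M \<open>graded_module \<sigma> N\<close> order_refl])
      (auto simp: N add smult single_loc_ring simp del: carrier_loc_ring)
  moreover have "q x = \<zero>\<^bsub>N\<^esub> \<longleftrightarrow> x \<in> Z" if "x \<in> carrier M" for x
    using q[OF that M.M.zero_closed] that by (simp add: N a_minus_def)
  ultimately show ?thesis using N(1) by blast
qed

lemma graded_cokernel: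
  fixes Y :: "('k::field, 'n::finite, 'a) gmod"
  assumes Y: "graded_module \<sigma> Y" and Z: "graded_sub \<sigma> Y Z"
  shows "\<exists>(N :: ('k, 'n, 'a) gmod) p. graded_module \<sigma> N \<and> p \<in> graded_hom \<sigma> Y N \<and>
    p ` carrier Y = carrier N \<and> (\<forall>y\<in>carrier Y. p y = \<zero>\<^bsub>N\<^esub> \<longleftrightarrow> y \<in> Z)"
proof -
  interpret Y: graded_mod \<sigma> Y by (unfold_locales) (rule Y)
  note Z' = graded_subD[OF Z]
  let ?q = "\<lambda>y. SOME z. z \<in> carrier Y \<and> y \<ominus>\<^bsub>Y\<^esub> z \<in> Z"
  have q: "?q y \<in> carrier Y \<and> y \<ominus>\<^bsub>Y\<^esub> ?q y \<in> Z" if "y \<in> carrier Y" for y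
    by (rule someI[of _ y]) (use that Z'(2) in simp)
  have "?q x = ?q y \<longleftrightarrow> x \<ominus>\<^bsub>Y\<^esub> y \<in> Z" if c: "x \<in> carrier Y" "y \<in> carrier Y" for x y
  proof
    assume eq: "?q x = ?q y"
    have "(x \<ominus>\<^bsub>Y\<^esub> ?q x) \<ominus>\<^bsub>Y\<^esub> (y \<ominus>\<^bsub>Y\<^esub> ?q y) \<in> Z"
      using Y.graded_sub_diff[OF Z conjunct2[OF q[OF c(1)]] conjunct2[OF q[OF c(2)]]] .
    then show "x \<ominus>\<^bsub>Y\<^esub> y \<in> Z" using q[OF c(2)] unfolding eq by (simp only: Y.diff_diff(2)[OF c])
  next
    assume xy: "x \<ominus>\<^bsub>Y\<^esub> y \<in> Z"
    have "x \<ominus>\<^bsub>Y\<^esub> z \<in> Z \<longleftrightarrow> y \<ominus>\<^bsub>Y\<^esub> z \<in> Z" if z: "z \<in> carrier Y" for z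
    proof
      show "y \<ominus>\<^bsub>Y\<^esub> z \<in> Z" if "x \<ominus>\<^bsub>Y\<^esub> z \<in> Z"
        using Y.graded_sub_diff[OF Z that xy] unfolding Y.diff_diff(3)[OF c(1) z c(2)] .
      show "x \<ominus>\<^bsub>Y\<^esub> z \<in> Z" if "y \<ominus>\<^bsub>Y\<^esub> z \<in> Z"
        using Z'(3)[OF xy that] unfolding Y.diff_diff(1)[OF c z] .
    qed
    then have "(\<lambda>z. z \<in> carrier Y \<and> x \<ominus>\<^bsub>Y\<^esub> z \<in> Z) = (\<lambda>z. z \<in> carrier Y \<and> y \<ominus>\<^bsub>Y\<^esub> z \<in> Z)" by blast
    then show "?q x = ?q y" by simp
  qed
  then obtain N :: "('k, 'n, 'a) gmod" where N: "graded_module \<sigma> N \<and> restrict ?q (carrier Y) \<in> graded_hom \<sigma> Y N \<and>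
    carrier N = ?q ` carrier Y \<and> (\<forall>x\<in>carrier Y. ?q x = \<zero>\<^bsub>N\<^esub> \<longleftrightarrow> x \<in> Z)"
    using graded_image[OF Y Z, of ?q] by blast
  then show ?thesis by (intro exI[of _ N] exI[of _ "restrict ?q (carrier Y)"]) auto
qed

text \<open>The finite product of graded modules over various \<open>R\<^sub>\<sigma>\<close>, truncated to the multidegrees in
  \<open>\<nat>\<^sup>m\<close>, which makes it a graded \<open>R\<close>-module.\<close>

definition truncated_product ::
  "'i set \<Rightarrow> ('i \<Rightarrow> ('k::field, 'n::finite, 'a) gmod) \<Rightarrow> ('k, 'n, 'i \<Rightarrow> 'a) gmod" where
  "truncated_product I F = \<lparr>
     carrier = {y \<in> \<Pi>\<^sub>E i\<in>I. carrier (F i). \<forall>i\<in>I. \<forall>d. d \<notin> loc_degrees {} \<longrightarrow> component (F i) d (y i) = \<zero>\<^bsub>F i\<^esub>},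
     monoid.mult = undefined,
     one = undefined,
     zero = (\<lambda>i\<in>I. \<zero>\<^bsub>F i\<^esub>),
     add = (\<lambda>x y. \<lambda>i\<in>I. x i \<oplus>\<^bsub>F i\<^esub> y i),
     smult = (\<lambda>p x. \<lambda>i\<in>I. p \<odot>\<^bsub>F i\<^esub> x i),
     hcomp = (\<lambda>d. {y \<in> \<Pi>\<^sub>E i\<in>I. hcomp (F i) d. d \<in> loc_degrees {} \<or> (\<forall>i\<in>I. y i = \<zero>\<^bsub>F i\<^esub>)})\<rparr>"

lemma (in graded_mod) component_smult_truncated:
  assumes p: "p \<in> carrier (loc_ring {})" and x: "x \<in> carrier M" and d: "d \<notin> loc_degrees {}"
    and trunc: "\<And>d. d \<notin> loc_degrees {} \<Longrightarrow> component M d x = \<zero>"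
  shows "component M d (p \<odot> x) = \<zero>"
  using p
proof (induction p rule: loc_ring_induct)
  case zero
  then show ?case using x by simp
next
  case (single a c)
  have a: "a \<in> loc_degrees \<sigma>" using single loc_degrees_mono[of "{}" \<sigma>] by auto
  have "d - a \<notin> loc_degrees {}" using add_loc_degrees[of a "{}" "d - a"] single d by auto
  then show ?case using component_single[OF a x] trunc smult_r_null[OF single_loc_ring[OF a]] by simp
next
  case (add p r)
  then show ?case
    using x smult_add[of p r x] smult_closed[of p x] smult_closed[of r x]
      loc_ring_mono[OF empty_subsetI add.hyps(1), of \<sigma>] loc_ring_mono[OF empty_subsetI add.hyps(2), of \<sigma>]
    by (simp add: component_add del: carrier_loc_ring)
qed

locale graded_family =
  fixes I :: "'i set" and \<sigma> :: "'i \<Rightarrow> 'n::finite set" and F :: "'i \<Rightarrow> ('k::field, 'n, 'a) gmod"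
  assumes finite_I: "finite I" and graded_F: "\<And>i. i \<in> I \<Longrightarrow> graded_module (\<sigma> i) (F i)"
begin

abbreviation P where "P \<equiv> truncated_product I F"

lemma F: "i \<in> I \<Longrightarrow> graded_mod (\<sigma> i) (F i)"
  by unfold_locales (rule graded_F)

lemma F_module: "i \<in> I \<Longrightarrow> module (loc_ring (\<sigma> i)) (F i)"
  using graded_F unfolding graded_module_def by blast

lemma F_abelian: "i \<in> I \<Longrightarrow> abelian_group (F i)"
  using F_module unfolding module_def by blast

lemmas F_monoid = abelian_group.axioms(1)[OF F_abelian]

lemma F_minus_zero: "i \<in> I \<Longrightarrow> \<ominus>\<^bsub>F i\<^esub> \<zero>\<^bsub>F i\<^esub> = \<zero>\<^bsub>F i\<^esub>"
  by (rule graded_mod.minus_zero[OF F])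

lemma loc_ring_F: "p \<in> carrier (loc_ring {}) \<Longrightarrow> p \<in> carrier (loc_ring \<sigma>')"
  by (rule loc_ring_mono[OF empty_subsetI])

lemma P_simps:
  "y \<in> carrier P \<longleftrightarrow> y \<in> (\<Pi>\<^sub>E i\<in>I. carrier (F i)) \<and>
    (\<forall>i\<in>I. \<forall>d. d \<notin> loc_degrees {} \<longrightarrow> component (F i) d (y i) = \<zero>\<^bsub>F i\<^esub>)"
  "\<zero>\<^bsub>P\<^esub> = (\<lambda>i\<in>I. \<zero>\<^bsub>F i\<^esub>)" "x \<oplus>\<^bsub>P\<^esub> y = (\<lambda>i\<in>I. x i \<oplus>\<^bsub>F i\<^esub> y i)" "p \<odot>\<^bsub>P\<^esub> x = (\<lambda>i\<in>I. p \<odot>\<^bsub>F i\<^esub> x i)"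
  by (simp_all add: truncated_product_def)

lemma P_closed: "y \<in> carrier P \<Longrightarrow> i \<in> I \<Longrightarrow> y i \<in> carrier (F i)"
  by (auto simp: P_simps)

lemma P_trunc: "\<lbrakk>y \<in> carrier P; i \<in> I; d \<notin> loc_degrees {}\<rbrakk> \<Longrightarrow> component (F i) d (y i) = \<zero>\<^bsub>F i\<^esub>"
  by (auto simp: P_simps)

lemma P_ext: "\<lbrakk>x \<in> carrier P; y \<in> carrier P; \<And>i. i \<in> I \<Longrightarrow> x i = y i\<rbrakk> \<Longrightarrow> x = y"
  unfolding P_simps by (blast intro: PiE_ext)

lemma restrict_P:
  "\<lbrakk>\<And>i. i \<in> I \<Longrightarrow> y i \<in> carrier (F i);
    \<And>i d. i \<in> I \<Longrightarrow> d \<notin> loc_degrees {} \<Longrightarrow> component (F i) d (y i) = \<zero>\<^bsub>F i\<^esub>\<rbrakk> \<Longrightarrow> restrict y I \<in> carrier P"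
  by (simp add: P_simps)

lemma P_add_closed: "x \<in> carrier P \<Longrightarrow> y \<in> carrier P \<Longrightarrow> x \<oplus>\<^bsub>P\<^esub> y \<in> carrier P"
  unfolding P_simps(3)
  by (intro restrict_P abelian_monoid.a_closed[OF F_monoid])
    (simp_all add: P_closed P_trunc graded_mod.component_add[OF F] abelian_group.axioms abelian_monoid.l_zero[OF F_monoid]
      abelian_monoid.zero_closed[OF F_monoid])

lemma P_zero_closed: "\<zero>\<^bsub>P\<^esub> \<in> carrier P"
  unfolding P_simps(2)
  by (intro restrict_P) (simp_all add: graded_mod.component_zero[OF F] abelian_monoid.zero_closed[OF F_monoid])

lemma P_smult_closed: "p \<in> carrier (loc_ring {}) \<Longrightarrow> x \<in> carrier P \<Longrightarrow> p \<odot>\<^bsub>P\<^esub> x \<in> carrier P"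
  unfolding P_simps(4)
  by (intro restrict_P module.smult_closed[OF F_module] graded_mod.component_smult_truncated[OF F])
    (simp_all add: P_closed P_trunc loc_ring_F del: carrier_loc_ring)

lemma P_module: "module (loc_ring {}) P"
proof (intro moduleI cring_loc_ring abelian_groupI)
  note ag = F_abelian and am = F_monoid
  fix x y z assume x: "x \<in> carrier P"
  show "\<zero>\<^bsub>P\<^esub> \<oplus>\<^bsub>P\<^esub> x = x"
    by (rule P_ext[OF P_add_closed[OF P_zero_closed x] x])
      (use P_closed[OF x] in \<open>simp add: P_simps(2,3) abelian_monoid.l_zero[OF am]\<close>)
  show "\<exists>y\<in>carrier P. y \<oplus>\<^bsub>P\<^esub> x = \<zero>\<^bsub>P\<^esub>"
  proof
    let ?m = "\<lambda>i\<in>I. \<ominus>\<^bsub>F i\<^esub> x i"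
    show m: "?m \<in> carrier P"
      using x by (intro restrict_P)
        (simp_all add: P_closed P_trunc graded_mod.component_minus[OF F] abelian_group.a_inv_closed[OF ag] F_minus_zero)
    show "?m \<oplus>\<^bsub>P\<^esub> x = \<zero>\<^bsub>P\<^esub>"
      by (rule P_ext[OF P_add_closed[OF m x] P_zero_closed])
        (use P_closed[OF x] in \<open>simp add: P_simps(2,3) abelian_group.l_neg[OF ag]\<close>)
  qed
  show "\<one>\<^bsub>loc_ring {}\<^esub> \<odot>\<^bsub>P\<^esub> x = x"
    unfolding one_loc_ring
    by (rule P_ext[OF P_smult_closed[OF _ x] x])
      (use P_closed[OF x] in \<open>simp_all add: P_simps(4) graded_mod.smult_1[OF F]\<close>)
  {
    fix p r :: "('k, 'n) laurent" assume p: "p \<in> carrier (loc_ring {})"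
    show "p \<odot>\<^bsub>P\<^esub> x \<in> carrier P" by (rule P_smult_closed[OF p x])
    {
      assume r: "r \<in> carrier (loc_ring {})"
      show "(p \<oplus>\<^bsub>loc_ring {}\<^esub> r) \<odot>\<^bsub>P\<^esub> x = p \<odot>\<^bsub>P\<^esub> x \<oplus>\<^bsub>P\<^esub> r \<odot>\<^bsub>P\<^esub> x"
        unfolding add_loc_ring
        by (rule P_ext[OF P_smult_closed[OF add_in_loc_ring[OF p r] x] P_add_closed[OF P_smult_closed[OF p x] P_smult_closed[OF r x]]])
          (use p r P_closed[OF x] in \<open>simp add: P_simps(3,4) graded_mod.smult_add[OF F] loc_ring_F del: carrier_loc_ring\<close>)
      show "(p \<otimes>\<^bsub>loc_ring {}\<^esub> r) \<odot>\<^bsub>P\<^esub> x = p \<odot>\<^bsub>P\<^esub> (r \<odot>\<^bsub>P\<^esub> x)"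
        unfolding mult_loc_ring
        by (rule P_ext[OF P_smult_closed[OF mult_in_loc_ring[OF p r] x] P_smult_closed[OF p P_smult_closed[OF r x]]])
          (use p r P_closed[OF x] in \<open>simp add: P_simps(4) graded_mod.smult_mult[OF F] loc_ring_F del: carrier_loc_ring\<close>)
    }
    assume y: "y \<in> carrier P"
    show "p \<odot>\<^bsub>P\<^esub> (x \<oplus>\<^bsub>P\<^esub> y) = p \<odot>\<^bsub>P\<^esub> x \<oplus>\<^bsub>P\<^esub> p \<odot>\<^bsub>P\<^esub> y"
      by (rule P_ext[OF P_smult_closed[OF p P_add_closed[OF x y]] P_add_closed[OF P_smult_closed[OF p x] P_smult_closed[OF p y]]])
        (use p P_closed[OF x] P_closed[OF y] in
        \<open>simp add: P_simps(3,4) module.smult_r_distr[OF F_module] loc_ring_F del: carrier_loc_ring\<close>)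
  }
  assume y: "y \<in> carrier P"
  show "x \<oplus>\<^bsub>P\<^esub> y \<in> carrier P" by (rule P_add_closed[OF x y])
  show "x \<oplus>\<^bsub>P\<^esub> y = y \<oplus>\<^bsub>P\<^esub> x"
    by (rule P_ext[OF P_add_closed[OF x y] P_add_closed[OF y x]])
      (use P_closed[OF x] P_closed[OF y] in \<open>simp add: P_simps(3) abelian_monoid.a_comm[OF am]\<close>)
  assume z: "z \<in> carrier P"
  show "x \<oplus>\<^bsub>P\<^esub> y \<oplus>\<^bsub>P\<^esub> z = x \<oplus>\<^bsub>P\<^esub> (y \<oplus>\<^bsub>P\<^esub> z)"
    by (rule P_ext[OF P_add_closed[OF P_add_closed[OF x y] z] P_add_closed[OF x P_add_closed[OF y z]]])
      (use P_closed[OF x] P_closed[OF y] P_closed[OF z] in \<open>simp add: P_simps(3) abelian_monoid.a_assoc[OF am]\<close>)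
qed (rule P_zero_closed)

lemma P_graded: "graded_module {} P"
  and component_P: "y \<in> carrier P \<Longrightarrow> component P d y = (\<lambda>i\<in>I. component (F i) d (y i))"
proof -
  let ?\<pi> = "\<lambda>d y. \<lambda>i\<in>I. component (F i) d (y i)"
  have closed: "?\<pi> d y \<in> carrier P" if "y \<in> carrier P" for d y
    using that by (intro restrict_P)
      (auto simp: P_closed P_trunc graded_mod.component_closed[OF F] graded_mod.component_component[OF F])
  have h: "hcomp P d = {y \<in> carrier P. ?\<pi> d y = y}" for d
  proof (intro equalityI subsetI)
    fix y assume y: "y \<in> hcomp P d"
    have yi: "y i \<in> hcomp (F i) d" if "i \<in> I" for i using y that by (auto simp: truncated_product_def)
    have "component (F i) e (y i) = (if e = d then y i else \<zero>\<^bsub>F i\<^esub>)" if "i \<in> I" for i e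
      using graded_mod.component_homogeneous[OF F[OF that] yi[OF that]] .
    moreover have "y \<in> (\<Pi>\<^sub>E i\<in>I. carrier (F i))" "d \<in> loc_degrees {} \<or> (\<forall>i\<in>I. y i = \<zero>\<^bsub>F i\<^esub>)"
      using y graded_mod.hcomp_closed[OF F] by (auto simp: truncated_product_def PiE_def Pi_def)
    ultimately show "y \<in> {y \<in> carrier P. ?\<pi> d y = y}"
      by (auto simp: P_simps PiE_def extensional_def restrict_def fun_eq_iff)
  next
    fix y assume "y \<in> {y \<in> carrier P. ?\<pi> d y = y}"
    then have y: "y \<in> carrier P" and fix_y: "?\<pi> d y = y" by auto
    have eq: "component (F i) d (y i) = y i" if "i \<in> I" for i
      using fun_cong[OF fix_y, of i] that by simp
    then have "y i \<in> hcomp (F i) d" if "i \<in> I" for i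
      using graded_mod.component_hcomp[OF F P_closed[OF y]] that by blast
    then show "y \<in> hcomp P d"
      using y eq P_trunc[OF y, of _ d] unfolding truncated_product_def by (auto simp: PiE_def)
  qed
  have ab: "abelian_group P" by (rule module.axioms(2)[OF P_module])
  interpret P: abelian_group P by (rule ab)
  have span: "carrier P \<subseteq> H" if "H \<subseteq> carrier P" "\<zero>\<^bsub>P\<^esub> \<in> H" "\<And>x y. x \<in> H \<Longrightarrow> y \<in> H \<Longrightarrow> x \<oplus>\<^bsub>P\<^esub> y \<in> H"
    "\<And>d x. x \<in> carrier P \<Longrightarrow> ?\<pi> d x \<in> H" for H
  proof
    fix y assume y: "y \<in> carrier P"
    let ?D = "\<Union>i\<in>I. {d. component (F i) d (y i) \<noteq> \<zero>\<^bsub>F i\<^esub>}"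
    have fin: "finite ?D" using finite_I graded_mod.component_decomposition(2)[OF F P_closed[OF y]] by blast
    have "finsum P (\<lambda>d. ?\<pi> d y) ?D = y"
    proof (rule P_ext[OF P.finsum_closed y])
      fix i assume i: "i \<in> I"
      have "finsum P (\<lambda>d. ?\<pi> d y) ?D i = finsum (F i) (\<lambda>d. ?\<pi> d y i) ?D"
        by (rule additive_finsum[OF ab F_abelian[OF i] _ _ fin Pi_I[OF closed[OF y]]]) (use i P_closed in \<open>simp_all add: P_simps(3)\<close>)
      also have "\<dots> = y i"
        using graded_mod.component_finsum[OF F[OF i] P_closed[OF y i] fin] i by auto
      finally show "finsum P (\<lambda>d. ?\<pi> d y) ?D i = y i" .
    qed (use closed[OF y] in blast)
    then show "y \<in> H" using finsum_mem[OF ab that(1-3) fin, of "\<lambda>d. ?\<pi> d y"] that(4)[OF y] by simp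
  qed
  have sm: "?\<pi> (a + d) (monomial a c \<odot>\<^bsub>P\<^esub> ?\<pi> d x) = monomial a c \<odot>\<^bsub>P\<^esub> ?\<pi> d x"
    if a: "a \<in> loc_degrees {}" and x: "x \<in> carrier P" for a c d x
    unfolding P_simps(4)
  proof (rule restrict_ext)
    fix i assume i: "i \<in> I"
    have "a \<in> loc_degrees (\<sigma> i)" using a loc_degrees_mono[of "{}" "\<sigma> i"] by auto
    then show "component (F i) (a + d) ((\<lambda>i\<in>I. monomial a c \<odot>\<^bsub>F i\<^esub> ?\<pi> d x i) i)
      = monomial a c \<odot>\<^bsub>F i\<^esub> ?\<pi> d x i"
      using i P_closed[OF x i] graded_mod.component_single[OF F[OF i]] graded_mod.component_closed[OF F[OF i]]
        graded_mod.component_component[OF F[OF i]] by simp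
  qed
  have ad: "?\<pi> d (x \<oplus>\<^bsub>P\<^esub> y) = ?\<pi> d x \<oplus>\<^bsub>P\<^esub> ?\<pi> d y" if "x \<in> carrier P" "y \<in> carrier P" for d x y
    unfolding P_simps(3) by (rule restrict_ext) (use that P_closed in \<open>simp add: graded_mod.component_add[OF F]\<close>)
  have pr: "?\<pi> d (?\<pi> e x) = (if d = e then ?\<pi> e x else \<zero>\<^bsub>P\<^esub>)" if "x \<in> carrier P" for d e x
    unfolding P_simps(2) using that P_closed by (auto intro!: restrict_ext simp: graded_mod.component_component[OF F])
  have out: "?\<pi> d x = \<zero>\<^bsub>P\<^esub>" if "d \<notin> loc_degrees {}" "x \<in> carrier P" for d x
    unfolding P_simps(2) by (rule restrict_ext) (use that P_trunc in simp)
  note I = graded_moduleI[of "{}" P ?\<pi>, OF P_module h closed ad pr span out sm]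
  show "graded_module {} P" by (rule I(1))
  show "y \<in> carrier P \<Longrightarrow> component P d y = ?\<pi> d y" by (rule I(2))
qed

lemma projection_hom:
  assumes i: "i \<in> I"
  shows "(\<lambda>y\<in>carrier P. y i) \<in> graded_hom {} P (F i)"
proof (rule graded_hom_restrictI[OF P_graded graded_F[OF i]])
  show "y i \<in> hcomp (F i) d" if "y \<in> hcomp P d" for d y
    using that i by (auto simp: truncated_product_def)
qed (use i P_closed in \<open>auto simp: P_simps\<close>)

end

section \<open>Localization by extension of scalars\<close>

lemma one_in_loc_ring: "1 \<in> carrier (loc_ring \<sigma>)"
  by simp

lemma face_power_mult: "face_power \<tau> m * face_power \<tau> n = face_power \<tau> (m + n)"
  by (rule face_power_add[symmetric])

lemma tensor_free_simps [simp]: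
  "c \<in> carrier (tensor_free \<tau> M) \<longleftrightarrow> Poly_Mapping.keys c \<subseteq> carrier (loc_ring \<tau>) \<times> carrier M"
  "c \<otimes>\<^bsub>tensor_free \<tau> M\<^esub> e = c + e" "\<one>\<^bsub>tensor_free \<tau> M\<^esub> = 0"
  by (simp_all add: tensor_free_def)

lemma tensor_free_diff:
  "c \<in> carrier (tensor_free \<tau> M) \<Longrightarrow> e \<in> carrier (tensor_free \<tau> M) \<Longrightarrow> c - e \<in> carrier (tensor_free \<tau> M)"
  using keys_diff[of c e] by (simp, blast)

lemma tensor_relatorE:
  assumes "r \<in> tensor_relators \<sigma> \<tau> M"
  obtains (left) s s' y where "s \<in> carrier (loc_ring \<tau>)" "s' \<in> carrier (loc_ring \<tau>)" "y \<in> carrier M"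
      "r = frag_of (s + s', y) - frag_of (s, y) - frag_of (s', y)"
    | (right) s y y' where "s \<in> carrier (loc_ring \<tau>)" "y \<in> carrier M" "y' \<in> carrier M"
      "r = frag_of (s, y \<oplus>\<^bsub>M\<^esub> y') - frag_of (s, y) - frag_of (s, y')"
    | (bal) s p y where "s \<in> carrier (loc_ring \<tau>)" "p \<in> carrier (loc_ring \<sigma>)" "y \<in> carrier M"
      "r = frag_of (s * p, y) - frag_of (s, p \<odot>\<^bsub>M\<^esub> y)"
  using assms unfolding tensor_relators_def by blast

lemma tensor_relatorI:
  "\<lbrakk>s \<in> carrier (loc_ring \<tau>); s' \<in> carrier (loc_ring \<tau>); y \<in> carrier M\<rbrakk> \<Longrightarrow>
    frag_of (s + s', y) - frag_of (s, y) - frag_of (s', y) \<in> tensor_relators \<sigma> \<tau> M"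
  "\<lbrakk>s \<in> carrier (loc_ring \<tau>); y \<in> carrier M; y' \<in> carrier M\<rbrakk> \<Longrightarrow>
    frag_of (s, y \<oplus>\<^bsub>M\<^esub> y') - frag_of (s, y) - frag_of (s, y') \<in> tensor_relators \<sigma> \<tau> M"
  "\<lbrakk>s \<in> carrier (loc_ring \<tau>); p \<in> carrier (loc_ring \<sigma>); y \<in> carrier M\<rbrakk> \<Longrightarrow>
    frag_of (s * p, y) - frag_of (s, p \<odot>\<^bsub>M\<^esub> y) \<in> tensor_relators \<sigma> \<tau> M"
  unfolding tensor_relators_def by blast+

lemma tensor_null_diff:
  assumes rel: "tensor_relators \<sigma> \<tau> M \<subseteq> carrier (tensor_free \<tau> M)"
  shows "subgroup (tensor_null \<sigma> \<tau> M) (tensor_free \<tau> M)"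
    and "a \<in> tensor_null \<sigma> \<tau> M \<Longrightarrow> b \<in> tensor_null \<sigma> \<tau> M \<Longrightarrow> a + b \<in> tensor_null \<sigma> \<tau> M"
    and "a \<in> tensor_null \<sigma> \<tau> M \<Longrightarrow> - a \<in> tensor_null \<sigma> \<tau> M" and "0 \<in> tensor_null \<sigma> \<tau> M"
proof -
  interpret F: comm_group "tensor_free \<tau> M" unfolding tensor_free_def by (rule abelian_free_Abelian_group)
  show sub: "subgroup (tensor_null \<sigma> \<tau> M) (tensor_free \<tau> M)"
    unfolding tensor_null_def by (rule F.generate_is_subgroup[OF rel])
  show "a \<in> tensor_null \<sigma> \<tau> M \<Longrightarrow> b \<in> tensor_null \<sigma> \<tau> M \<Longrightarrow> a + b \<in> tensor_null \<sigma> \<tau> M"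
    using subgroup.m_closed[OF sub] by simp
  show "0 \<in> tensor_null \<sigma> \<tau> M" using subgroup.one_closed[OF sub] by simp
  show "- a \<in> tensor_null \<sigma> \<tau> M" if "a \<in> tensor_null \<sigma> \<tau> M"
  proof -
    have "a \<in> carrier (tensor_free \<tau> M)" using subgroup.mem_carrier[OF sub that] .
    then have "inv\<^bsub>tensor_free \<tau> M\<^esub> a = - a" unfolding tensor_free_def by (intro inv_free_Abelian_group) simp
    then show ?thesis using subgroup.m_inv_closed[OF sub that] by simp
  qed
qed

lemma tensor_null_induct [consumes 2, case_names zero relator minus add]:
  assumes c: "c \<in> tensor_null \<sigma> \<tau> M" and rel: "tensor_relators \<sigma> \<tau> M \<subseteq> carrier (tensor_free \<tau> M)"
    and zero: "P 0" and relator: "\<And>r. r \<in> tensor_relators \<sigma> \<tau> M \<Longrightarrow> P r"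
    and minus: "\<And>r. r \<in> carrier (tensor_free \<tau> M) \<Longrightarrow> P r \<Longrightarrow> P (- r)"
    and add: "\<And>a b. a \<in> carrier (tensor_free \<tau> M) \<Longrightarrow> b \<in> carrier (tensor_free \<tau> M) \<Longrightarrow> P a \<Longrightarrow> P b \<Longrightarrow> P (a + b)"
  shows "P c"
proof -
  interpret F: comm_group "tensor_free \<tau> M" unfolding tensor_free_def by (rule abelian_free_Abelian_group)
  have inc: "a \<in> carrier (tensor_free \<tau> M)" if "a \<in> generate (tensor_free \<tau> M) (tensor_relators \<sigma> \<tau> M)" for a
    using F.generate_in_carrier[OF rel that] .
  show ?thesis using c unfolding tensor_null_def
  proof (induction c rule: generate.induct)
    case one
    then show ?case using zero by simp
  next
    case (incl h)
    then show ?case by (rule relator)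
  next
    case (inv h)
    then have h: "h \<in> carrier (tensor_free \<tau> M)" using rel by blast
    then have "inv\<^bsub>tensor_free \<tau> M\<^esub> h = - h" unfolding tensor_free_def by (intro inv_free_Abelian_group) simp
    then show ?case using minus[OF h relator[OF inv]] by simp
  next
    case (eng h1 h2)
    then show ?case using add[OF inc[OF eng.hyps(1)] inc[OF eng.hyps(2)]] by simp
  qed
qed

locale scalar_extension = M: graded_mod \<sigma> M for \<sigma> \<tau> :: "'n::finite set" and M :: "('k::field, 'n, 'a) gmod" (structure) +
  assumes sub: "\<sigma> \<subseteq> \<tau>"
begin

abbreviation "free \<equiv> tensor_free \<tau> M"
abbreviation "null \<equiv> tensor_null \<sigma> \<tau> M"
abbreviation "cls \<equiv> tensor_class \<sigma> \<tau> M"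
abbreviation "pure \<equiv> pure_tensor \<sigma> \<tau> M"
abbreviation "B \<equiv> base_change \<sigma> \<tau> M"

lemma loc_sub: "p \<in> carrier (loc_ring \<sigma>) \<Longrightarrow> p \<in> carrier (loc_ring \<tau>)"
  by (rule loc_ring_mono[OF sub])

lemma frag_of_free: "s \<in> carrier (loc_ring \<tau>) \<Longrightarrow> x \<in> carrier M \<Longrightarrow> frag_of (s, x) \<in> carrier free"
  by (simp del: carrier_loc_ring)

lemma relators_free: "tensor_relators \<sigma> \<tau> M \<subseteq> carrier free"
proof
  fix r assume "r \<in> tensor_relators \<sigma> \<tau> M"
  then show "r \<in> carrier free"
    by (cases r rule: tensor_relatorE)
      (simp_all add: tensor_free_diff frag_of_free M.smult_closed add_in_loc_ring mult_in_loc_ring loc_sub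
        del: carrier_loc_ring tensor_free_simps)
qed

lemmas null_subgroup = tensor_null_diff(1)[OF relators_free]
lemmas null_add = tensor_null_diff(2)[OF relators_free]
lemmas null_minus = tensor_null_diff(3)[OF relators_free]
lemmas null_zero = tensor_null_diff(4)[OF relators_free]

lemma null_diff: "a \<in> null \<Longrightarrow> b \<in> null \<Longrightarrow> a - b \<in> null"
  using null_add[of a "- b"] null_minus[of b] by simp

lemma relator_null: "r \<in> tensor_relators \<sigma> \<tau> M \<Longrightarrow> r \<in> null"
  unfolding tensor_null_def by (rule generate.incl)

lemma cls_eq: "cls c = (\<lambda>n. n + c) ` null"
  unfolding tensor_class_def r_coset_def by auto

lemma cls_eq_iff: "cls c = cls e \<longleftrightarrow> c - e \<in> null"
proof
  assume "cls c = cls e"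
  moreover have "c \<in> cls c" unfolding cls_eq using null_zero by force
  ultimately obtain n where "n \<in> null" "c = n + e" unfolding cls_eq by auto
  then show "c - e \<in> null" by simp
next
  assume ce: "c - e \<in> null"
  show "cls c = cls e"
  proof (intro equalityI subsetI)
    fix z assume "z \<in> cls c"
    then obtain n where n: "n \<in> null" "z = n + c" unfolding cls_eq by auto
    then have "z = (n + (c - e)) + e" by simp
    then show "z \<in> cls e" unfolding cls_eq using null_add[OF n(1) ce] by blast
  next
    fix z assume "z \<in> cls e"
    then obtain n where n: "n \<in> null" "z = n + e" unfolding cls_eq by auto
    then have "z = (n - (c - e)) + c" by simp
    then show "z \<in> cls c" unfolding cls_eq using null_diff[OF n(1) ce] by blast
  qed
qed

lemma carrier_B: "carrier B = cls ` carrier free"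
  unfolding base_change_def tensor_group_def FactGroup_def RCOSETS_def tensor_class_def by auto

lemma add_B: "c \<in> carrier free \<Longrightarrow> e \<in> carrier free \<Longrightarrow> cls c \<oplus>\<^bsub>B\<^esub> cls e = cls (c + e)"
proof -
  assume c: "c \<in> carrier free" "e \<in> carrier free"
  interpret F: comm_group free unfolding tensor_free_def by (rule abelian_free_Abelian_group)
  have "normal null free" by (rule F.subgroup_imp_normal[OF null_subgroup])
  from normal.rcos_sum[OF this c] show ?thesis
    unfolding base_change_def tensor_group_def FactGroup_def tensor_class_def by simp
qed

lemma zero_B: "\<zero>\<^bsub>B\<^esub> = cls 0"
  unfolding base_change_def tensor_group_def FactGroup_def cls_eq by simp

lemma pure_add_right:
  assumes s: "s \<in> carrier (loc_ring \<tau>)" and x: "x \<in> carrier M" and y: "y \<in> carrier M"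
  shows "pure s x \<oplus>\<^bsub>B\<^esub> pure s y = pure s (x \<oplus> y)"
proof -
  have "frag_of (s, x \<oplus> y) - frag_of (s, x) - frag_of (s, y) \<in> tensor_relators \<sigma> \<tau> M"
    unfolding tensor_relators_def using s x y by blast
  then have "cls (frag_of (s, x \<oplus> y)) = cls (frag_of (s, x) + frag_of (s, y))"
    unfolding cls_eq_iff using relator_null by (simp add: algebra_simps)
  then show ?thesis unfolding pure_tensor_def by (simp add: add_B[OF frag_of_free[OF s x] frag_of_free[OF s y]])
qed

lemma pure_add_left:
  assumes s: "s \<in> carrier (loc_ring \<tau>)" and s': "s' \<in> carrier (loc_ring \<tau>)" and x: "x \<in> carrier M"
  shows "pure s x \<oplus>\<^bsub>B\<^esub> pure s' x = pure (s + s') x"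
proof -
  have "frag_of (s + s', x) - frag_of (s, x) - frag_of (s', x) \<in> tensor_relators \<sigma> \<tau> M"
    unfolding tensor_relators_def using s s' x by blast
  then have "cls (frag_of (s + s', x)) = cls (frag_of (s, x) + frag_of (s', x))"
    unfolding cls_eq_iff using relator_null by (simp add: algebra_simps)
  then show ?thesis unfolding pure_tensor_def by (simp add: add_B[OF frag_of_free[OF s x] frag_of_free[OF s' x]])
qed

lemma pure_balance:
  assumes "s \<in> carrier (loc_ring \<tau>)" "r \<in> carrier (loc_ring \<sigma>)" "x \<in> carrier M"
  shows "pure (s * r) x = pure s (r \<odot> x)"
proof -
  have "frag_of (s * r, x) - frag_of (s, r \<odot> x) \<in> tensor_relators \<sigma> \<tau> M"
    unfolding tensor_relators_def using assms by blast
  then show ?thesis unfolding pure_tensor_def cls_eq_iff by (rule relator_null)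
qed

lemma pure_zero: "s \<in> carrier (loc_ring \<tau>) \<Longrightarrow> pure s \<zero> = \<zero>\<^bsub>B\<^esub>"
proof -
  assume s: "s \<in> carrier (loc_ring \<tau>)"
  have "frag_of (s, \<zero> \<oplus> \<zero>) - frag_of (s, \<zero>) - frag_of (s, \<zero>) \<in> tensor_relators \<sigma> \<tau> M"
    unfolding tensor_relators_def using s M.M.zero_closed by blast
  then have "- frag_of (s, \<zero>) \<in> null" using relator_null by simp
  then have "frag_of (s, \<zero>) \<in> null" using null_minus by fastforce
  then show ?thesis unfolding pure_tensor_def zero_B cls_eq_iff by simp
qed

lemma face_power_inverse: "face_power \<tau> (- int n) \<in> carrier (loc_ring \<tau>)"
  "face_power \<tau> (int n) \<in> carrier (loc_ring \<sigma>)"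
  by (rule face_power_loc; simp)+

lemma pure_fraction:
  assumes s: "s \<in> carrier (loc_ring \<tau>)" and x: "x \<in> carrier M" and n: "face_power \<tau> (int n) * s \<in> carrier (loc_ring \<sigma>)"
  shows "pure s x = pure (face_power \<tau> (- int n)) ((face_power \<tau> (int n) * s) \<odot> x)"
proof -
  have eq: "face_power \<tau> (- int n) * (face_power \<tau> (int n) * s) = s"
    by (simp add: mult.assoc[symmetric] face_power_mult)
  show ?thesis using pure_balance[OF face_power_inverse(1) n x, of n] unfolding eq .
qed

lemma clears: "s \<in> carrier (loc_ring \<tau>) \<Longrightarrow> \<exists>N::nat. \<forall>n\<ge>N. face_power \<tau> (int n) * s \<in> carrier (loc_ring \<sigma>)"
  using face_power_clears[of s \<tau>] loc_ring_mono[of "{}" \<sigma>] by (auto simp del: carrier_loc_ring)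

text \<open>The fraction \<open>x / t\<^sub>\<tau>\<^sup>n\<close>.\<close>

definition frac :: "nat \<Rightarrow> 'a \<Rightarrow> ((('k, 'n) laurent \<times> 'a) \<Rightarrow>\<^sub>0 int) set" where
  "frac n x = pure (face_power \<tau> (- int n)) x"

lemma power_closed: "x \<in> carrier M \<Longrightarrow> tpow M \<tau> n x \<in> carrier M"
  by (rule M.smult_closed[OF face_power_inverse(2)])

lemma power_power: "x \<in> carrier M \<Longrightarrow>
    tpow M \<tau> m (tpow M \<tau> n x) = tpow M \<tau> (m + n) x"
  using M.smult_mult[OF face_power_inverse(2) face_power_inverse(2)] by (simp add: face_power_add)

lemma frac_expand: "x \<in> carrier M \<Longrightarrow> frac n x = frac (n + k) (tpow M \<tau> k x)"
  unfolding frac_def pure_balance[OF face_power_inverse(1)[of "n + k"] face_power_inverse(2)[of k], symmetric] face_power_mult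
  by simp

lemma frac_add: "x \<in> carrier M \<Longrightarrow> y \<in> carrier M \<Longrightarrow> frac n x \<oplus>\<^bsub>B\<^esub> frac n y = frac n (x \<oplus> y)"
  unfolding frac_def by (rule pure_add_right[OF face_power_inverse(1)])

lemma pure_frac: "s \<in> carrier (loc_ring \<tau>) \<Longrightarrow> x \<in> carrier M \<Longrightarrow> \<exists>n. \<exists>y\<in>carrier M. pure s x = frac n y"
proof -
  assume s: "s \<in> carrier (loc_ring \<tau>)" and x: "x \<in> carrier M"
  obtain n :: nat where n: "face_power \<tau> (int n) * s \<in> carrier (loc_ring \<sigma>)" using clears[OF s] by blast
  show ?thesis unfolding frac_def using pure_fraction[OF s x n] M.smult_closed[OF n x] by blast
qed

lemma pure_closed: "s \<in> carrier (loc_ring \<tau>) \<Longrightarrow> x \<in> carrier M \<Longrightarrow> pure s x \<in> carrier B"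
  unfolding carrier_B pure_tensor_def using frag_of_free by blast

lemma frac_closed: "x \<in> carrier M \<Longrightarrow> frac n x \<in> carrier B"
  unfolding frac_def by (rule pure_closed[OF face_power_inverse(1)])

text \<open>By bringing summands to a common denominator, every tensor is a fraction.\<close>

lemma B_frac:
  assumes "z \<in> carrier B"
  shows "\<exists>n. \<exists>x\<in>carrier M. z = frac n x"
proof -
  have "\<exists>n. \<exists>x\<in>carrier M. cls c = frac n x" if "Poly_Mapping.keys c \<subseteq> carrier (loc_ring \<tau>) \<times> carrier M" for c
  proof -
    have "c \<in> carrier free \<and> (\<exists>n. \<exists>x\<in>carrier M. cls c = frac n x)"
      using that
    proof (induction c rule: frag_induction)
      case zero
      have "cls 0 = frac 0 \<zero>" unfolding frac_def zero_B[symmetric] by (rule pure_zero[OF face_power_inverse(1), symmetric])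
      then show ?case by auto
    next
      case (one p)
      then show ?case using pure_frac[of "fst p" "snd p"] frag_of_free[of "fst p" "snd p"]
        unfolding pure_tensor_def by (cases p) (auto simp del: carrier_loc_ring)
    next
      case (diff c e)
      then obtain n x m y where nx: "x \<in> carrier M" "cls c = frac n x" and my: "y \<in> carrier M" "cls e = frac m y" by blast
      have c: "c \<in> carrier free" "e \<in> carrier free" using diff by auto
      let ?x = "tpow M \<tau> m x" and ?y = "tpow M \<tau> n y"
      have xy: "?x \<in> carrier M" "?y \<in> carrier M" using power_closed nx my by auto
      have "frac n x = frac (n + m) (?x \<ominus> ?y) \<oplus>\<^bsub>B\<^esub> frac m y"
        using frac_expand[OF nx(1), of n m] frac_expand[OF my(1), of m n]
          frac_add[of "?x \<ominus> ?y" ?y "n + m"] xy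
        by (simp add: add.commute a_minus_def M.M.a_assoc M.M.l_neg)
      moreover have "frac (n + m) (?x \<ominus> ?y) = cls (frag_of (face_power \<tau> (- int (n + m)), ?x \<ominus> ?y))"
        unfolding frac_def pure_tensor_def ..
      moreover have f: "frag_of (face_power \<tau> (- int (n + m)), ?x \<ominus> ?y) \<in> carrier free"
        by (rule frag_of_free[OF face_power_inverse(1)]) (use xy in simp)
      ultimately have "cls c = cls (frag_of (face_power \<tau> (- int (n + m)), ?x \<ominus> ?y) + e)"
        using add_B[OF f c(2)] nx my by simp
      then have "cls (c - e) = frac (n + m) (?x \<ominus> ?y)"
        unfolding frac_def pure_tensor_def cls_eq_iff by (simp add: algebra_simps)
      then show ?case using tensor_free_diff[OF c] xy M.M.minus_closed by blast
    qed
    then show ?thesis by blast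
  qed
  then show ?thesis using assms unfolding carrier_B by auto
qed

lemma B_common_frac:
  assumes "z \<in> carrier B" "w \<in> carrier B"
  shows "\<exists>n. \<exists>x\<in>carrier M. \<exists>y\<in>carrier M. z = frac n x \<and> w = frac n y"
proof -
  obtain n x m y where nx: "x \<in> carrier M" "z = frac n x" and my: "y \<in> carrier M" "w = frac m y"
    using B_frac assms by metis
  then have "z = frac (n + m) (tpow M \<tau> m x)" "w = frac (n + m) (tpow M \<tau> n y)"
    using frac_expand[of x n m] frac_expand[of y m n] by (auto simp: add.commute)
  then show ?thesis using power_closed nx(1) my(1) by blast
qed

text \<open>The kernel of \<open>x \<mapsto> 1 \<otimes> x\<close> is the \<open>t\<^sub>\<tau>\<close>-power torsion. For large \<open>n\<close>, multiplication by \<open>t\<^sub>\<tau>\<^sup>n\<close>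
  followed by evaluation in \<open>M\<close> is defined on any given element of the free group; on the null
  tensors it eventually vanishes, because it does so on the relators.\<close>

lemma pure_one_zero:
  assumes x: "x \<in> carrier M" and zero: "pure 1 x = \<zero>\<^bsub>B\<^esub>"
  shows "\<exists>n. tpow M \<tau> n x = \<zero>"
proof -
  let ?p = "\<lambda>n::nat. face_power \<tau> (int n)"
  let ?S = "carrier (loc_ring \<tau>) \<times> carrier M"
  define e where "e n = (\<lambda>(s, x). if ?p n * s \<in> carrier (loc_ring \<sigma>) then (?p n * s) \<odot> x else \<zero>)" for n
  have "\<exists>h. h \<in> hom (free_Abelian_group ?S) (add_monoid M) \<and> (\<forall>z\<in>?S. h (frag_of z) = e n z)" for n
  proof -
    have "e n ` ?S \<subseteq> carrier (add_monoid M)" unfolding e_def by (auto simp: M.smult_closed simp del: carrier_loc_ring)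
    from comm_group.free_Abelian_group_universal[OF M.M.a_comm_group this] show ?thesis by metis
  qed
  then obtain ev where hom: "\<And>n. ev n \<in> hom (free_Abelian_group ?S) (add_monoid M)"
    and ev: "\<And>n z. z \<in> ?S \<Longrightarrow> ev n (frag_of z) = e n z" by metis
  have closed: "ev n c \<in> carrier M" if "c \<in> carrier free" for n c
    using hom[of n] that unfolding hom_def tensor_free_def by auto
  have add: "ev n (c + d) = ev n c \<oplus> ev n d" if "c \<in> carrier free" "d \<in> carrier free" for n c d
    using hom[of n] that unfolding hom_def tensor_free_def by auto
  have z: "ev n 0 = \<zero>" for n
    using add[of 0 0 n] closed[of 0 n] M.M.add.l_cancel_one' by auto
  have diff: "ev n (c - d) = ev n c \<ominus> ev n d" if c: "c \<in> carrier free" and d: "d \<in> carrier free" for n c d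
  proof -
    have "ev n c = ev n (c - d) \<oplus> ev n d" using add[OF tensor_free_diff[OF c d] d, of n] by simp
    then show ?thesis using closed[OF tensor_free_diff[OF c d]] closed[OF d]
      by (simp add: a_minus_def M.M.a_assoc M.M.r_neg)
  qed
  have val: "ev n (frag_of (s, y)) = (?p n * s) \<odot> y"
    if "s \<in> carrier (loc_ring \<tau>)" "y \<in> carrier M" "?p n * s \<in> carrier (loc_ring \<sigma>)" for n s y
    using ev[of "(s, y)" n] that by (simp add: e_def del: carrier_loc_ring)
  \<comment> \<open>\<open>ev n\<close> is \<open>s \<otimes> x \<mapsto> (t\<^sub>\<tau>\<^sup>n s) x\<close>, with the default value \<open>0\<close> when \<open>t\<^sub>\<tau>\<^sup>n s\<close> is not in \<open>R\<^sub>\<sigma>\<close>.\<close>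
  let ?Z = "\<lambda>c. \<exists>N. \<forall>n\<ge>N. ev n c = \<zero>"
  have "?Z c" if "c \<in> null" for c
    using that relators_free
  proof (induction c rule: tensor_null_induct)
    case zero
    then show ?case using z by auto
  next
    case (minus r)
    have "ev n (- r) = \<ominus> ev n r" for n
      using diff[of 0 r n] minus.hyps z closed[OF minus.hyps, of n] by (simp add: a_minus_def)
    then show ?case using minus.IH M.minus_zero by (simp, metis)
  next
    case (add a b)
    then obtain N N' where "\<forall>n\<ge>N. ev n a = \<zero>" "\<forall>n\<ge>N'. ev n b = \<zero>" by blast
    then have "\<forall>n\<ge>max N N'. ev n (a + b) = \<zero>"
      using \<open>\<And>n c d. c \<in> carrier free \<Longrightarrow> d \<in> carrier free \<Longrightarrow> ev n (c + d) = ev n c \<oplus> ev n d\<close>[OF add.hyps] by simp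
    then show ?case by blast
  next
    case (relator r)
    then show ?case
    proof (cases r rule: tensor_relatorE)
      case (left s s' y)
      obtain N N' where N: "\<forall>n\<ge>N. ?p n * s \<in> carrier (loc_ring \<sigma>)" "\<forall>n\<ge>N'. ?p n * s' \<in> carrier (loc_ring \<sigma>)"
        using clears[OF left(1)] clears[OF left(2)] by blast
      have "ev n r = \<zero>" if "n \<ge> max N N'" for n
      proof -
        have n: "?p n * s \<in> carrier (loc_ring \<sigma>)" "?p n * s' \<in> carrier (loc_ring \<sigma>)" using N that by auto
        have nn: "?p n * (s + s') \<in> carrier (loc_ring \<sigma>)" unfolding distrib_left by (rule add_in_loc_ring[OF n])
        note F = frag_of_free[OF add_in_loc_ring[OF left(1,2)] left(3)] frag_of_free[OF left(1,3)] frag_of_free[OF left(2,3)]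
        have "ev n r = (?p n * (s + s')) \<odot> y \<ominus> (?p n * s) \<odot> y \<ominus> (?p n * s') \<odot> y"
          unfolding left(4) diff[OF tensor_free_diff[OF F(1,2)] F(3)] diff[OF F(1,2)]
          using val[OF left(1,3) n(1)] val[OF left(2,3) n(2)] val[OF add_in_loc_ring[OF left(1,2)] left(3) nn] by simp
        also have "(?p n * (s + s')) \<odot> y = (?p n * s) \<odot> y \<oplus> (?p n * s') \<odot> y"
          unfolding distrib_left by (rule M.smult_add[OF n left(3)])
        finally show ?thesis using M.smult_closed[OF n(1) left(3)] M.smult_closed[OF n(2) left(3)]
          by (simp add: a_minus_def M.M.add.m_ac M.M.r_neg M.M.r_neg1 M.M.r_neg2)
      qed
      then show ?thesis by blast
    next
      case (right s y y')
      obtain N where N: "\<forall>n\<ge>N. ?p n * s \<in> carrier (loc_ring \<sigma>)" using clears[OF right(1)] by blast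
      have "ev n r = \<zero>" if "n \<ge> N" for n
      proof -
        have n: "?p n * s \<in> carrier (loc_ring \<sigma>)" using N that by auto
        note F = frag_of_free[OF right(1) M.M.a_closed[OF right(2,3)]] frag_of_free[OF right(1,2)] frag_of_free[OF right(1,3)]
        have "ev n r = (?p n * s) \<odot> (y \<oplus> y') \<ominus> (?p n * s) \<odot> y \<ominus> (?p n * s) \<odot> y'"
          unfolding right(4) diff[OF tensor_free_diff[OF F(1,2)] F(3)] diff[OF F(1,2)]
          using val[OF right(1,2) n] val[OF right(1,3) n] val[OF right(1) M.M.a_closed[OF right(2,3)] n] by simp
        also have "(?p n * s) \<odot> (y \<oplus> y') = (?p n * s) \<odot> y \<oplus> (?p n * s) \<odot> y'"
          by (rule M.smult_r_distr[OF n right(2,3)])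
        finally show ?thesis using M.smult_closed[OF n right(2)] M.smult_closed[OF n right(3)]
          by (simp add: a_minus_def M.M.add.m_ac M.M.r_neg M.M.r_neg1 M.M.r_neg2)
      qed
      then show ?thesis by blast
    next
      case (bal s p y)
      obtain N where N: "\<forall>n\<ge>N. ?p n * s \<in> carrier (loc_ring \<sigma>)" using clears[OF bal(1)] by blast
      have "ev n r = \<zero>" if "n \<ge> N" for n
      proof -
        have n: "?p n * s \<in> carrier (loc_ring \<sigma>)" using N that by auto
        have nn: "?p n * (s * p) \<in> carrier (loc_ring \<sigma>)"
          unfolding mult.assoc[symmetric] by (rule mult_in_loc_ring[OF n bal(2)])
        note sp = mult_in_loc_ring[OF bal(1) loc_sub[OF bal(2)]] and py = M.smult_closed[OF bal(2,3)]
        note F = frag_of_free[OF sp bal(3)] frag_of_free[OF bal(1) py]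
        have "ev n r = (?p n * (s * p)) \<odot> y \<ominus> (?p n * s) \<odot> (p \<odot> y)"
          unfolding bal(4) diff[OF F] using val[OF sp bal(3) nn] val[OF bal(1) py n] by simp
        also have "(?p n * (s * p)) \<odot> y = (?p n * s) \<odot> (p \<odot> y)"
          unfolding mult.assoc[symmetric] by (rule M.smult_mult[OF n bal(2,3)])
        finally show ?thesis using M.smult_closed[OF n py] by simp
      qed
      then show ?thesis by blast
    qed
  qed
  moreover have "frag_of (1, x) \<in> null" using zero unfolding pure_tensor_def zero_B cls_eq_iff by simp
  ultimately obtain N where "\<forall>n\<ge>N. ev n (frag_of (1, x)) = \<zero>" by blast
  then have "ev N (frag_of (1, x)) = \<zero>" by blast
  then have "tpow M \<tau> N x = \<zero>"
    using val[OF _ x, of 1 N] by (simp add: face_power_inverse(2) one_in_loc_ring del: carrier_loc_ring)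
  then show ?thesis by blast
qed

text \<open>Two representatives of a class differ by a null tensor, whose image is null because those of the
  relators are. So the union that defines the induced map has a single value.\<close>

lemma tensor_induced_cls:
  fixes N :: "('k, 'n, 'b) gmod"
  assumes N: "graded_module \<sigma>' N" and sub': "\<sigma>' \<subseteq> \<tau>'"
    and maps: "\<And>r. r \<in> tensor_relators \<sigma> \<tau> M \<Longrightarrow> frag_extend (frag_of \<circ> g) r \<in> tensor_null \<sigma>' \<tau>' N"
  shows "tensor_induced \<sigma>' \<tau>' N g (cls c) = tensor_class \<sigma>' \<tau>' N (frag_extend (frag_of \<circ> g) c)"
proof -
  interpret N: scalar_extension \<sigma>' \<tau>' N using N sub' by unfold_locales
  let ?f = "frag_extend (frag_of \<circ> g)"
  have null: "?f n \<in> tensor_null \<sigma>' \<tau>' N" if "n \<in> null" for n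
    using that relators_free
  proof (induction n rule: tensor_null_induct)
    case (add a b)
    then show ?case using N.null_add by (simp add: frag_extend_add)
  next
    case zero
    then show ?case using N.null_zero by simp
  next
    case (relator r)
    then show ?case by (rule maps)
  next
    case (minus r)
    then show ?case using N.null_minus by (simp only: frag_extend_minus)
  qed
  have "tensor_class \<sigma>' \<tau>' N (?f z) = tensor_class \<sigma>' \<tau>' N (?f c)" if z: "z \<in> cls c" for z
  proof -
    obtain n where n: "n \<in> null" "z = n + c" using z unfolding cls_eq by auto
    then show ?thesis unfolding N.cls_eq_iff using null by (simp add: frag_extend_add)
  qed
  moreover have "c \<in> cls c" unfolding cls_eq using null_zero by force
  ultimately show ?thesis unfolding tensor_induced_def by blast
qed

lemma tensor_induced_pure:
  fixes N :: "('k, 'n, 'b) gmod"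
  assumes "graded_module \<sigma>' N" "\<sigma>' \<subseteq> \<tau>'"
    and "\<And>r. r \<in> tensor_relators \<sigma> \<tau> M \<Longrightarrow> frag_extend (frag_of \<circ> g) r \<in> tensor_null \<sigma>' \<tau>' N"
  shows "tensor_induced \<sigma>' \<tau>' N g (pure s x) = tensor_class \<sigma>' \<tau>' N (frag_of (g (s, x)))"
  using tensor_induced_cls[OF assms, where c = "frag_of (s, x)"] unfolding pure_tensor_def by simp

lemma smult_pure:
  assumes p: "p \<in> carrier (loc_ring \<tau>)"
  shows "p \<odot>\<^bsub>B\<^esub> pure s x = pure (p * s) x"
proof -
  let ?g = "\<lambda>(s, x). (p * s, x)"
  have "frag_extend (frag_of \<circ> ?g) r \<in> null" if "r \<in> tensor_relators \<sigma> \<tau> M" for r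
  proof (rule relator_null)
    have l: "s \<in> carrier (loc_ring \<tau>) \<Longrightarrow> p * s \<in> carrier (loc_ring \<tau>)" for s by (rule mult_in_loc_ring[OF p])
    show "frag_extend (frag_of \<circ> ?g) r \<in> tensor_relators \<sigma> \<tau> M"
      using that
    proof (cases r rule: tensor_relatorE)
      case (left s s' y)
      then show ?thesis using tensor_relatorI(1)[OF l l] by (simp add: frag_extend_diff distrib_left del: carrier_loc_ring)
    next
      case (right s y y')
      then show ?thesis using tensor_relatorI(2)[OF l] by (simp add: frag_extend_diff del: carrier_loc_ring)
    next
      case (bal s r' y)
      then show ?thesis using tensor_relatorI(3)[OF l] by (simp add: frag_extend_diff mult.assoc[symmetric] del: carrier_loc_ring)
    qed
  qed
  from tensor_induced_pure[OF M.graded sub this, of s x] show ?thesis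
    unfolding base_change_def pure_tensor_def by simp
qed

lemma smult_frac:
  assumes p: "p \<in> carrier (loc_ring \<tau>)" and x: "x \<in> carrier M" and j: "face_power \<tau> (int j) * p \<in> carrier (loc_ring \<sigma>)"
  shows "p \<odot>\<^bsub>B\<^esub> frac n x = frac (n + j) ((face_power \<tau> (int j) * p) \<odot> x)"
proof -
  have "face_power \<tau> (- int (n + j)) * (face_power \<tau> (int j) * p) = face_power \<tau> (- int n) * p"
    unfolding mult.assoc[symmetric] face_power_mult by simp
  then have "p * face_power \<tau> (- int n) = face_power \<tau> (- int (n + j)) * (face_power \<tau> (int j) * p)"
    by (simp only: mult.commute)
  then show ?thesis unfolding frac_def smult_pure[OF p]
    using pure_balance[OF face_power_inverse(1)[of "n + j"] j x] by simp
qed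

lemma B_module: "module (loc_ring \<tau>) B"
proof (intro moduleI cring_loc_ring abelian_groupI)
  fix z w assume z: "z \<in> carrier B"
  obtain n x where x: "x \<in> carrier M" "z = frac n x" using B_frac[OF z] by blast
  show "\<exists>y\<in>carrier B. y \<oplus>\<^bsub>B\<^esub> z = \<zero>\<^bsub>B\<^esub>"
    by (rule bexI[of _ "frac n (\<ominus> x)"])
      (use x frac_add[of "\<ominus> x" x n] frac_closed[of "\<ominus> x" n] pure_zero[OF face_power_inverse(1)]
        in \<open>auto simp: M.M.l_neg frac_def\<close>)
  show "\<zero>\<^bsub>B\<^esub> \<oplus>\<^bsub>B\<^esub> z = z"
    using frac_add[of "\<zero>" x n] x pure_zero[OF face_power_inverse(1)[of n]] by (simp add: frac_def)
  show "\<one>\<^bsub>loc_ring \<tau>\<^esub> \<odot>\<^bsub>B\<^esub> z = z" unfolding x(2) frac_def by (subst smult_pure) simp_all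
  fix w assume w: "w \<in> carrier B"
  obtain n x y where xy: "x \<in> carrier M" "y \<in> carrier M" "z = frac n x" "w = frac n y"
    using B_common_frac[OF z w] by blast
  show "z \<oplus>\<^bsub>B\<^esub> w \<in> carrier B" "z \<oplus>\<^bsub>B\<^esub> w = w \<oplus>\<^bsub>B\<^esub> z"
    using xy frac_closed by (simp_all add: frac_add M.M.a_comm)
  {
    fix p :: "('k, 'n) laurent" assume p: "p \<in> carrier (loc_ring \<tau>)"
    have "p * face_power \<tau> (- int n) \<in> carrier (loc_ring \<tau>)" by (rule mult_in_loc_ring[OF p face_power_inverse(1)])
    then show "p \<odot>\<^bsub>B\<^esub> (z \<oplus>\<^bsub>B\<^esub> w) = p \<odot>\<^bsub>B\<^esub> z \<oplus>\<^bsub>B\<^esub> p \<odot>\<^bsub>B\<^esub> w"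
      unfolding xy(3,4) frac_add[OF xy(1,2)] unfolding frac_def smult_pure[OF p]
      using xy(1,2) by (simp add: pure_add_right del: carrier_loc_ring)
  }
  fix v assume v: "v \<in> carrier B"
  obtain m y' u where yu: "y' \<in> carrier M" "u \<in> carrier M" "w = frac m y'" "v = frac m u"
    using B_common_frac[OF w v] by blast
  have 1: "z = frac (n + m) (tpow M \<tau> m x)" using xy frac_expand by simp
  have 2: "w = frac (n + m) (tpow M \<tau> m y)" using xy frac_expand by simp
  have 3: "v = frac (n + m) (tpow M \<tau> n u)" using yu frac_expand[of u m n] by (simp add: add.commute)
  show "z \<oplus>\<^bsub>B\<^esub> w \<oplus>\<^bsub>B\<^esub> v = z \<oplus>\<^bsub>B\<^esub> (w \<oplus>\<^bsub>B\<^esub> v)"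
    unfolding 1 2 3 using power_closed xy yu by (simp add: frac_add M.M.a_assoc)
next
  fix z and p r :: "('k, 'n) laurent" assume z: "z \<in> carrier B" and p: "p \<in> carrier (loc_ring \<tau>)"
  obtain n x where x: "x \<in> carrier M" "z = frac n x" using B_frac[OF z] by blast
  note f = face_power_inverse(1)[of n]
  show "p \<odot>\<^bsub>B\<^esub> z \<in> carrier B" unfolding x(2) frac_def smult_pure[OF p]
    by (rule pure_closed[OF mult_in_loc_ring[OF p f] x(1)])
  assume r: "r \<in> carrier (loc_ring \<tau>)"
  show "(p \<oplus>\<^bsub>loc_ring \<tau>\<^esub> r) \<odot>\<^bsub>B\<^esub> z = p \<odot>\<^bsub>B\<^esub> z \<oplus>\<^bsub>B\<^esub> r \<odot>\<^bsub>B\<^esub> z"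
    unfolding x(2) frac_def add_loc_ring smult_pure[OF p] smult_pure[OF r] smult_pure[OF add_in_loc_ring[OF p r]]
      pure_add_left[OF mult_in_loc_ring[OF p f] mult_in_loc_ring[OF r f] x(1)] by (simp add: distrib_right)
  show "(p \<otimes>\<^bsub>loc_ring \<tau>\<^esub> r) \<odot>\<^bsub>B\<^esub> z = p \<odot>\<^bsub>B\<^esub> (r \<odot>\<^bsub>B\<^esub> z)"
    unfolding x(2) frac_def mult_loc_ring smult_pure[OF p] smult_pure[OF r] smult_pure[OF mult_in_loc_ring[OF p r]]
    by (simp add: mult.assoc)
next
  show "\<zero>\<^bsub>B\<^esub> \<in> carrier B" unfolding zero_B carrier_B by (rule imageI) simp
qed

sublocale B: module "loc_ring \<tau>" B by (rule B_module)

lemma frac_zero_iff: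
  assumes x: "x \<in> carrier M"
  shows "frac n x = \<zero>\<^bsub>B\<^esub> \<longleftrightarrow> (\<exists>k. tpow M \<tau> k x = \<zero>)"
proof
  assume z: "frac n x = \<zero>\<^bsub>B\<^esub>"
  have p: "face_power \<tau> (int n) \<in> carrier (loc_ring \<tau>)" by (rule loc_sub[OF face_power_inverse(2)])
  have "pure 1 x = tpow B \<tau> n (frac n x)"
    unfolding frac_def smult_pure[OF p] face_power_mult by simp
  also have "\<dots> = \<zero>\<^bsub>B\<^esub>" unfolding z by (rule B.smult_r_null[OF p])
  finally show "\<exists>k. tpow M \<tau> k x = \<zero>" by (rule pure_one_zero[OF x])
next
  assume "\<exists>k. tpow M \<tau> k x = \<zero>"
  then obtain k :: nat where "tpow M \<tau> k x = \<zero>" by blast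
  then show "frac n x = \<zero>\<^bsub>B\<^esub>" using frac_expand[OF x, of n k] pure_zero[OF face_power_inverse(1)[of "n + k"]] by (simp add: frac_def)
qed

lemma frac_eq_iff:
  assumes x: "x \<in> carrier M" and y: "y \<in> carrier M"
  shows "frac n x = frac n y \<longleftrightarrow> (\<exists>k. tpow M \<tau> k x = tpow M \<tau> k y)"
proof -
  have xy: "x \<ominus> y \<in> carrier M" using x y by simp
  have "frac n x = frac n (x \<ominus> y) \<oplus>\<^bsub>B\<^esub> frac n y"
    using frac_add[OF xy y] x y by (simp add: a_minus_def M.M.a_assoc M.M.l_neg)
  then have "frac n x = frac n y \<longleftrightarrow> frac n (x \<ominus> y) = \<zero>\<^bsub>B\<^esub>"
    using frac_closed[OF xy, of n] frac_closed[OF y, of n] by (metis B.M.add.r_cancel_one B.M.l_zero)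
  also have "\<dots> \<longleftrightarrow> (\<exists>k. tpow M \<tau> k (x \<ominus> y) = \<zero>)" by (rule frac_zero_iff[OF xy])
  also have "\<dots> \<longleftrightarrow> (\<exists>k. tpow M \<tau> k x = tpow M \<tau> k y)"
  proof (intro ex_cong1)
    fix k :: nat
    have "tpow M \<tau> k (x \<ominus> y) = tpow M \<tau> k x \<ominus> tpow M \<tau> k y"
      unfolding a_minus_def
      using M.smult_r_distr[OF face_power_inverse(2) x M.M.a_inv_closed[OF y]] M.smult_r_minus[OF face_power_inverse(2) y] by simp
    then show "tpow M \<tau> k (x \<ominus> y) = \<zero> \<longleftrightarrow> tpow M \<tau> k x = tpow M \<tau> k y"
      using M.diff_eq_zero_iff[OF power_closed[OF x] power_closed[OF y]] by simp
  qed
  finally show ?thesis .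
qed

end

context scalar_extension
begin

lemma component_power:
  "x \<in> carrier M \<Longrightarrow> component M (d + face_degree \<tau> (int k)) (tpow M \<tau> k x)
    = tpow M \<tau> k (component M d x)"
  unfolding face_power_def by (subst M.component_single) (auto intro: face_degree_loc)

lemma frac_component_cong:
  assumes x: "x \<in> carrier M" and y: "y \<in> carrier M" and eq: "frac n x = frac m y"
  shows "frac n (component M (d + face_degree \<tau> (int n)) x) = frac m (component M (d + face_degree \<tau> (int m)) y)"
proof -
  let ?x = "component M (d + face_degree \<tau> (int n)) x" and ?y = "component M (d + face_degree \<tau> (int m)) y"
  have c: "?x \<in> carrier M" "?y \<in> carrier M" using x y by auto
  have "frac (n + m) (tpow M \<tau> m x) = frac (n + m) (tpow M \<tau> n y)"
    using eq frac_expand[OF x, of n m] frac_expand[OF y, of m n] by (simp add: add.commute)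
  then obtain k :: nat where k: "tpow M \<tau> (k + m) x = tpow M \<tau> (k + n) y"
    using frac_eq_iff[OF power_closed[OF x] power_closed[OF y]] power_power[OF x] power_power[OF y] by auto
  have deg: "(d + face_degree \<tau> (int n)) + face_degree \<tau> (int (k + m)) = (d + face_degree \<tau> (int m)) + face_degree \<tau> (int (k + n))"
    by (simp add: face_degree_add algebra_simps)
  have "tpow M \<tau> (k + m) ?x = tpow M \<tau> (k + n) ?y"
    unfolding component_power[OF x, symmetric] component_power[OF y, symmetric] deg k ..
  then have "frac (n + m) (tpow M \<tau> m ?x) = frac (n + m) (tpow M \<tau> n ?y)"
    using frac_eq_iff[OF power_closed[OF c(1)] power_closed[OF c(2)]] power_power[OF c(1)] power_power[OF c(2)] by auto
  then show ?thesis
    using frac_expand[OF c(1), of n m] frac_expand[OF c(2), of m n] by (simp add: add.commute)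
qed

text \<open>The part of \<open>x / t\<^sub>\<tau>\<^sup>n\<close> in degree \<open>d\<close> is the quotient by \<open>t\<^sub>\<tau>\<^sup>n\<close> of the part of \<open>x\<close> in degree
  \<open>d + n e\<^sub>\<tau>\<close>, where \<open>e\<^sub>\<tau>\<close> is the degree of \<open>t\<^sub>\<tau>\<close>.\<close>

definition B_component :: "int ^ 'n \<Rightarrow> ((('k, 'n) laurent \<times> 'a) \<Rightarrow>\<^sub>0 int) set \<Rightarrow> ((('k, 'n) laurent \<times> 'a) \<Rightarrow>\<^sub>0 int) set" where
  "B_component d z = (SOME w. \<exists>n. \<exists>x\<in>carrier M. z = frac n x \<and> w = frac n (component M (d + face_degree \<tau> (int n)) x))"

lemma B_component_frac:
  assumes x: "x \<in> carrier M"
  shows "B_component d (frac n x) = frac n (component M (d + face_degree \<tau> (int n)) x)"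
  unfolding B_component_def
proof (rule some_equality)
  show "\<exists>m. \<exists>y\<in>carrier M. frac n x = frac m y \<and>
      frac n (component M (d + face_degree \<tau> (int n)) x) = frac m (component M (d + face_degree \<tau> (int m)) y)"
    using x by blast
qed (use frac_component_cong[OF x] in metis)

text \<open>A homogeneous pure tensor is a homogeneous fraction, and conversely \<open>x / t\<^sub>\<tau>\<^sup>n\<close> is the pure tensor
  of the homogeneous elements \<open>t\<^sub>\<tau>\<^sup>-\<^sup>n\<close> and \<open>x\<close>.\<close>

lemma hcomp_B: "hcomp B d = {z \<in> carrier B. B_component d z = z}"
proof -
  let ?G = "{pure s x | s x a b. s \<in> ring_homogeneous \<tau> a \<and> x \<in> hcomp M b \<and> a + b = d}"
  let ?T = "tensor_group \<sigma> \<tau> M"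
  have h: "hcomp B d = generate ?T ?G" unfolding base_change_def by simp
  have T: "carrier ?T = carrier B" "monoid.mult ?T = add B" "one ?T = zero B" unfolding base_change_def by auto
  have grp: "comm_group ?T"
  proof -
    interpret F: comm_group free unfolding tensor_free_def by (rule abelian_free_Abelian_group)
    show ?thesis unfolding tensor_group_def by (rule F.abelian_FactGroup[OF null_subgroup])
  qed
  interpret T: comm_group ?T by (rule grp)
  have fixed_add: "z \<oplus>\<^bsub>B\<^esub> w \<in> {z \<in> carrier B. B_component d z = z}"
    if z: "z \<in> {z \<in> carrier B. B_component d z = z}" and w: "w \<in> {z \<in> carrier B. B_component d z = z}" for z w
  proof -
    obtain n x y where xy: "x \<in> carrier M" "y \<in> carrier M" "z = frac n x" "w = frac n y"
      using B_common_frac[of z w] z w by blast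
    then have "B_component d (z \<oplus>\<^bsub>B\<^esub> w) = B_component d z \<oplus>\<^bsub>B\<^esub> B_component d w"
      by (simp add: B_component_frac M.component_add frac_add)
    then show ?thesis using z w by simp
  qed
  have gen: "g \<in> {z \<in> carrier B. B_component d z = z}" if gG: "g \<in> ?G" for g
  proof -
    obtain s x a b where g: "g = pure s x" and s: "s \<in> ring_homogeneous \<tau> a" and x: "x \<in> hcomp M b" and ab: "a + b = d"
      using gG by blast
    have sl: "s \<in> carrier (loc_ring \<tau>)" using s unfolding ring_homogeneous_def by blast
    have xc: "x \<in> carrier M" by (rule M.hcomp_closed[OF x])
    have s1: "s = monomial a (Poly_Mapping.lookup s a)"
      using s unfolding ring_homogeneous_def
      by (intro poly_mapping_eqI) (auto simp: lookup_single when_def in_keys_iff)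
    obtain n :: nat where n: "face_power \<tau> (int n) * s \<in> carrier (loc_ring \<sigma>)" using clears[OF sl] by blast
    let ?y = "(face_power \<tau> (int n) * s) \<odot> x"
    have y: "?y \<in> carrier M" by (rule M.smult_closed[OF n xc])
    have g': "g = frac n ?y" unfolding g frac_def by (rule pure_fraction[OF sl xc n])
    have fs: "face_power \<tau> (int n) * s = monomial (face_degree \<tau> (int n) + a) (Poly_Mapping.lookup s a)"
      by (subst s1) (simp add: face_power_def mult_single)
    have deg: "d + face_degree \<tau> (int n) - b = face_degree \<tau> (int n) + a" using ab by (auto simp: algebra_simps)
    have "component M (d + face_degree \<tau> (int n)) ?y = ?y"
      unfolding M.component_smult_homogeneous[OF x n] deg by (simp add: fs)
    then show ?thesis unfolding g' using frac_closed[OF y] by (simp add: B_component_frac[OF y])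
  qed
  show ?thesis
  proof (intro equalityI subsetI)
    fix z assume "z \<in> hcomp B d"
    then have "z \<in> generate ?T ?G" unfolding h .
    then show "z \<in> {z \<in> carrier B. B_component d z = z}"
    proof (induction z rule: generate.induct)
      case one
      have "\<zero>\<^bsub>B\<^esub> = frac 0 \<zero>" unfolding frac_def by (rule pure_zero[OF face_power_inverse(1), symmetric])
      then have "B_component d \<zero>\<^bsub>B\<^esub> = \<zero>\<^bsub>B\<^esub>" using B_component_frac[of "\<zero>" d 0] by simp
      then show ?case unfolding T by simp
    next
      case (inv g)
      obtain n x where x: "x \<in> carrier M" "g = frac n x" "B_component d g = g" using gen[OF inv] B_frac[of g] by blast
      have "frac n (\<ominus> x) \<oplus>\<^bsub>B\<^esub> frac n x = \<zero>\<^bsub>B\<^esub>" if "x \<in> carrier M" for x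
        using frac_add[of "\<ominus> x" x n] that pure_zero[OF face_power_inverse(1)[of n]] by (simp add: M.M.l_neg frac_def)
      then have m: "inv\<^bsub>?T\<^esub> (frac n x) = frac n (\<ominus> x)" if "x \<in> carrier M" for x
        using that frac_closed by (intro T.inv_equality) (auto simp: T)
      show ?case
        using x m[OF x(1)] m[of "component M (d + face_degree \<tau> (int n)) x"] frac_closed[of "\<ominus> x" n]
        by (simp add: B_component_frac M.component_minus M.component_component)
    next
      case (eng z w)
      then show ?case using fixed_add unfolding T by blast
    qed (rule gen)
  next
    fix z assume z: "z \<in> {z \<in> carrier B. B_component d z = z}"
    then obtain n x where x: "x \<in> carrier M" "z = frac n x" using B_frac by blast
    let ?x = "component M (d + face_degree \<tau> (int n)) x"
    have "z = pure (face_power \<tau> (- int n)) ?x" using z x B_component_frac by (simp add: frac_def)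
    moreover have "face_power \<tau> (- int n) \<in> ring_homogeneous \<tau> (face_degree \<tau> (- int n))"
      using face_power_inverse(1)[of n] unfolding ring_homogeneous_def by (simp add: face_power_def)
    moreover have "?x \<in> hcomp M (d + face_degree \<tau> (int n))" by (rule M.component_decomposition(1)[OF x(1)])
    moreover have "face_degree \<tau> (- int n) + (d + face_degree \<tau> (int n)) = d"
      using face_degree_add[of \<tau> "- int n" "int n"] by simp
    ultimately have "z \<in> ?G" by blast
    then show "z \<in> hcomp B d" unfolding h by (rule generate.incl)
  qed
qed

lemma B_graded: "graded_module \<tau> B"
  and component_B: "z \<in> carrier B \<Longrightarrow> component B d z = B_component d z"
proof -
  have closed: "B_component d z \<in> carrier B" if "z \<in> carrier B" for d z
    using B_frac[OF that] frac_closed by (auto simp: B_component_frac)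
  have add: "B_component d (z \<oplus>\<^bsub>B\<^esub> w) = B_component d z \<oplus>\<^bsub>B\<^esub> B_component d w"
    if zw: "z \<in> carrier B" "w \<in> carrier B" for d z w
  proof -
    obtain n x y where "x \<in> carrier M" "y \<in> carrier M" "z = frac n x" "w = frac n y"
      using B_common_frac[OF zw] by blast
    then show ?thesis by (simp add: B_component_frac frac_add M.component_add)
  qed
  have frac_0: "frac n \<zero> = \<zero>\<^bsub>B\<^esub>" for n
    unfolding frac_def by (rule pure_zero[OF face_power_inverse(1)])
  have proj: "B_component d (B_component e z) = (if d = e then B_component e z else \<zero>\<^bsub>B\<^esub>)"
    if z: "z \<in> carrier B" for d e z
    using B_frac[OF z] by (auto simp: B_component_frac M.component_component frac_0)
  have span: "carrier B \<subseteq> H" if H: "H \<subseteq> carrier B" "\<zero>\<^bsub>B\<^esub> \<in> H" "\<And>z w. z \<in> H \<Longrightarrow> w \<in> H \<Longrightarrow> z \<oplus>\<^bsub>B\<^esub> w \<in> H"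
    "\<And>d z. z \<in> carrier B \<Longrightarrow> B_component d z \<in> H" for H
  proof
    fix z assume "z \<in> carrier B"
    then obtain n x where x: "x \<in> carrier M" "z = frac n x" using B_frac by blast
    have "x \<in> {x \<in> carrier M. frac n x \<in> H}"
    proof (rule M.component_sum_mem)
      show "y \<oplus> y' \<in> {x \<in> carrier M. frac n x \<in> H}"
        if "y \<in> {x \<in> carrier M. frac n x \<in> H}" "y' \<in> {x \<in> carrier M. frac n x \<in> H}" for y y'
        using H(3)[of "frac n y" "frac n y'"] frac_add[of y y' n] that by simp
      show "component M d x \<in> {x \<in> carrier M. frac n x \<in> H}" for d
        using H(4)[OF frac_closed[OF x(1), of n], of "d - face_degree \<tau> (int n)"] x(1) by (simp add: B_component_frac)
    qed (use H(2) x frac_0 in auto)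
    then show "z \<in> H" using x by blast
  qed
  have outside: "B_component d z = \<zero>\<^bsub>B\<^esub>" if d: "d \<notin> loc_degrees \<tau>" and z: "z \<in> carrier B" for d z
  proof -
    have "d + face_degree \<tau> (int n) \<notin> loc_degrees \<sigma>" for n
      using d sub by (auto simp: loc_degrees_def face_degree_def)
    then show ?thesis using B_frac[OF z] by (auto simp: B_component_frac M.component_outside frac_0)
  qed
  have sm: "B_component (a + d) (monomial a c \<odot>\<^bsub>B\<^esub> B_component d z) = monomial a c \<odot>\<^bsub>B\<^esub> B_component d z"
    if a: "a \<in> loc_degrees \<tau>" and z: "z \<in> carrier B" for a c d z
  proof -
    obtain n x where x: "x \<in> carrier M" "z = frac n x" using B_frac[OF z] by blast
    let ?y = "component M (d + face_degree \<tau> (int n)) x"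
    have y: "?y \<in> hcomp M (d + face_degree \<tau> (int n))" by (rule M.component_decomposition(1)[OF x(1)])
    have yc: "?y \<in> carrier M" using x by simp
    obtain j :: nat where j: "face_degree \<tau> (int j) + a \<in> loc_degrees {}" using face_degree_clears[OF a] by blast
    then have js: "face_degree \<tau> (int j) + a \<in> loc_degrees \<sigma>" using loc_degrees_mono[of "{}" \<sigma>] by auto
    have e: "face_power \<tau> (int j) * monomial a c = monomial (face_degree \<tau> (int j) + a) c"
      by (simp add: face_power_def mult_single)
    have eq: "monomial a c \<odot>\<^bsub>B\<^esub> B_component d z = frac (n + j) (monomial (face_degree \<tau> (int j) + a) c \<odot> ?y)"
      unfolding x(2) B_component_frac[OF x(1)] e[symmetric]
      by (rule smult_frac[OF single_loc_ring[OF a] yc]) (use js e in simp)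
    have "monomial (face_degree \<tau> (int j) + a) c \<odot> ?y \<in> hcomp M (a + d + face_degree \<tau> (int (n + j)))"
      using M.single_hcomp[OF js y, of c] by (simp add: face_degree_add algebra_simps)
    then show ?thesis unfolding eq
      by (simp add: B_component_frac M.hcomp_closed M.component_homogeneous)
  qed
  note I = graded_moduleI[of \<tau> B B_component, OF B_module hcomp_B closed add proj span outside sm]
  show "graded_module \<tau> B" by (rule I(1))
  show "z \<in> carrier B \<Longrightarrow> component B d z = B_component d z" by (rule I(2))
qed

sublocale B: graded_mod \<tau> B by unfold_locales (rule B_graded)

lemma unit_hom: "(\<lambda>x\<in>carrier M. pure 1 x) \<in> graded_hom \<sigma> M B"
proof (rule graded_hom_restrictI[OF M.graded B_graded sub])
  have one: "1 \<in> carrier (loc_ring \<tau>)" by simp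
  show "pure 1 x \<in> carrier B" if "x \<in> carrier M" for x by (rule pure_closed[OF one that])
  show "pure 1 (x \<oplus> y) = pure 1 x \<oplus>\<^bsub>B\<^esub> pure 1 y" if "x \<in> carrier M" "y \<in> carrier M" for x y
    using pure_add_right[OF one that] by simp
  show "pure 1 (monomial a c \<odot> x) = monomial a c \<odot>\<^bsub>B\<^esub> pure 1 x"
    if "a \<in> loc_degrees \<sigma>" "x \<in> carrier M" for a c x
    using pure_balance[OF one single_loc_ring[OF that(1)] that(2), of c]
      smult_pure[OF loc_sub[OF single_loc_ring[OF that(1)]], of c 1 x] by simp
  show "pure 1 x \<in> hcomp B d" if x: "x \<in> hcomp M d" for d x
  proof -
    have "pure 1 x = frac 0 x" by (simp add: frac_def)
    then show ?thesis
      unfolding hcomp_B using M.hcomp_closed[OF x] M.component_homogeneous[OF x, of d]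
      by (simp add: B_component_frac frac_closed)
  qed
qed

text \<open>The universal property: \<open>x / t\<^sub>\<tau>\<^sup>n \<mapsto> t\<^sub>\<tau>\<^sup>-\<^sup>n \<psi> x\<close> is well defined by the description of the equality of
  fractions.\<close>

lemma lift_hom:
  assumes P: "graded_module \<upsilon> P" and sub': "\<tau> \<subseteq> \<upsilon>" and \<psi>: "\<psi> \<in> graded_hom \<sigma> M P"
  shows "\<exists>h\<in>graded_hom \<tau> B P. \<forall>s\<in>carrier (loc_ring \<tau>). \<forall>x\<in>carrier M. h (pure s x) = s \<odot>\<^bsub>P\<^esub> \<psi> x"
proof -
  interpret P: graded_mod \<upsilon> P by unfold_locales (rule P)
  interpret \<psi>: graded_map \<sigma> \<upsilon> M P \<psi> by unfold_locales (use \<psi> sub sub' in auto)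
  let ?v = "\<lambda>n x. face_power \<tau> (- int n) \<odot>\<^bsub>P\<^esub> \<psi> x"
  define h where "h z = (SOME w. \<exists>n. \<exists>x\<in>carrier M. z = frac n x \<and> w = ?v n x)" for z
  have inv: "face_power \<tau> i \<in> carrier (loc_ring \<upsilon>)" for i :: int by (rule face_power_loc) (use sub' in simp)
  have inv\<tau>: "face_power \<tau> i \<in> carrier (loc_ring \<tau>)" for i :: int by (rule face_power_loc) simp
  note up = loc_ring_mono[OF sub']
  have vc: "?v n x \<in> carrier P" if "x \<in> carrier M" for n x by (rule P.smult_closed[OF inv \<psi>.closed[OF that]])
  have v_expand: "?v n x = ?v (n + k) (tpow M \<tau> k x)" if x: "x \<in> carrier M" for n k x
    unfolding \<psi>.smult[OF face_power_inverse(2) x] P.smult_mult[OF inv inv \<psi>.closed[OF x], symmetric] face_power_mult by simp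
  have cong: "?v n x = ?v m y" if x: "x \<in> carrier M" and y: "y \<in> carrier M" and eq: "frac n x = frac m y" for n m x y
  proof -
    have "frac (n + m) (tpow M \<tau> m x) = frac (n + m) (tpow M \<tau> n y)"
      using eq frac_expand[OF x, of n m] frac_expand[OF y, of m n] by (simp add: add.commute)
    then obtain k :: nat where k: "tpow M \<tau> (k + m) x = tpow M \<tau> (k + n) y"
      using frac_eq_iff[OF power_closed[OF x] power_closed[OF y]] power_power[OF x] power_power[OF y] by auto
    have "n + (k + m) = m + (k + n)" by simp
    then show ?thesis using v_expand[OF x, of n "k + m"] v_expand[OF y, of m "k + n"] unfolding k by (simp add: algebra_simps)
  qed
  have h: "h (frac n x) = ?v n x" if "x \<in> carrier M" for n x
    unfolding h_def
  proof (rule some_equality)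
    show "\<exists>m. \<exists>y\<in>carrier M. frac n x = frac m y \<and> ?v n x = ?v m y" using that by blast
  qed (use cong[OF that] in metis)
  have pure: "h (pure s x) = s \<odot>\<^bsub>P\<^esub> \<psi> x" if s: "s \<in> carrier (loc_ring \<tau>)" and x: "x \<in> carrier M" for s x
  proof -
    obtain n :: nat where n: "face_power \<tau> (int n) * s \<in> carrier (loc_ring \<sigma>)" using clears[OF s] by blast
    have "face_power \<tau> (- int n) * (face_power \<tau> (int n) * s) = s"
      by (simp add: mult.assoc[symmetric] face_power_mult)
    then show ?thesis
      unfolding pure_fraction[OF s x n] frac_def[symmetric] h[OF M.smult_closed[OF n x]] \<psi>.smult[OF n x]
        P.smult_mult[OF inv up[OF loc_sub[OF n]] \<psi>.closed[OF x], symmetric] by simp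
  qed
  have "restrict h (carrier B) \<in> graded_hom \<tau> B P"
  proof (rule graded_hom_restrictI[OF B_graded P sub'])
    show "h z \<in> carrier P" if "z \<in> carrier B" for z using B_frac[OF that] h vc by auto
    show "h (z \<oplus>\<^bsub>B\<^esub> w) = h z \<oplus>\<^bsub>P\<^esub> h w" if zw: "z \<in> carrier B" "w \<in> carrier B" for z w
    proof -
      obtain n x y where xy: "x \<in> carrier M" "y \<in> carrier M" "z = frac n x" "w = frac n y"
        using B_common_frac[OF zw] by blast
      then show ?thesis using P.smult_r_distr[OF inv \<psi>.closed[OF xy(1)] \<psi>.closed[OF xy(2)]]
        by (simp add: frac_add h \<psi>.add)
    qed
    show "h (monomial a c \<odot>\<^bsub>B\<^esub> z) = monomial a c \<odot>\<^bsub>P\<^esub> h z"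
      if a: "a \<in> loc_degrees \<tau>" and z: "z \<in> carrier B" for a c z
    proof -
      obtain n x where x: "x \<in> carrier M" "z = frac n x" using B_frac[OF z] by blast
      note s = single_loc_ring[OF a, of c]
      show ?thesis
        unfolding x(2) h[OF x(1)] unfolding frac_def smult_pure[OF s] pure[OF mult_in_loc_ring[OF s inv\<tau>] x(1)]
        by (rule P.smult_mult[OF up[OF s] inv \<psi>.closed[OF x(1)]])
    qed
    show "h z \<in> hcomp P d" if z: "z \<in> hcomp B d" for d z
    proof -
      have zc: "z \<in> carrier B" "B_component d z = z" using z unfolding hcomp_B by auto
      obtain n x where x: "x \<in> carrier M" "z = frac n x" using B_frac[OF zc(1)] by blast
      let ?x = "component M (d + face_degree \<tau> (int n)) x"
      have "z = frac n ?x" using zc(2) x by (simp add: B_component_frac)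
      then have hz: "h z = ?v n ?x" using h x(1) by simp
      have "\<psi> ?x \<in> hcomp P (d + face_degree \<tau> (int n))" by (rule \<psi>.hcomp[OF M.component_decomposition(1)[OF x(1)]])
      have "face_degree \<tau> (- int n) \<in> loc_degrees \<upsilon>" by (rule face_degree_loc) (use sub' in simp)
      from P.single_hcomp[OF this \<open>\<psi> ?x \<in> hcomp P (d + face_degree \<tau> (int n))\<close>, of 1]
      show ?thesis unfolding hz face_power_def[symmetric] using face_degree_add[of \<tau> "- int n" "int n"]
        by (simp add: algebra_simps)
    qed
  qed
  moreover have "pure s x \<in> carrier B" if "s \<in> carrier (loc_ring \<tau>)" "x \<in> carrier M" for s x by (rule pure_closed[OF that])
  ultimately show ?thesis using pure by (intro bexI[of _ "restrict h (carrier B)"]) (auto simp del: carrier_loc_ring)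
qed

end

text \<open>A map \<open>\<phi>\<close> is a localization at \<open>t\<^sub>\<tau>\<close> when its kernel is \<open>t\<^sub>\<tau>\<close>-power torsion and every element of the
  target is carried into the image by a power of \<open>t\<^sub>\<tau>\<close>.\<close>

definition power_localization ::
  "'n::finite set \<Rightarrow> 'n set \<Rightarrow> ('k::field, 'n, 'a) gmod \<Rightarrow> ('k, 'n, 'b) gmod \<Rightarrow> ('a \<Rightarrow> 'b) \<Rightarrow> bool" where
  "power_localization \<sigma> \<tau> M N \<phi> \<longleftrightarrow> \<phi> \<in> graded_hom \<sigma> M N \<and>
     (\<forall>x\<in>carrier M. \<phi> x = \<zero>\<^bsub>N\<^esub> \<longrightarrow> (\<exists>n. tpow M \<tau> n x = \<zero>\<^bsub>M\<^esub>)) \<and>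
     (\<forall>y\<in>carrier N. \<exists>n. \<exists>x\<in>carrier M. tpow N \<tau> n y = \<phi> x)"

lemma power_localizationD:
  assumes "power_localization \<sigma> \<tau> M N \<phi>"
  shows "\<phi> \<in> graded_hom \<sigma> M N"
    "x \<in> carrier M \<Longrightarrow> \<phi> x = \<zero>\<^bsub>N\<^esub> \<Longrightarrow> \<exists>n. tpow M \<tau> n x = \<zero>\<^bsub>M\<^esub>"
    "y \<in> carrier N \<Longrightarrow> \<exists>n. \<exists>x\<in>carrier M. tpow N \<tau> n y = \<phi> x"
  using assms unfolding power_localization_def by blast+

lemma (in graded_mod) face_power_cancel:
  assumes "\<tau> \<subseteq> \<sigma>" "x \<in> carrier M" "y \<in> carrier M" "face_power \<tau> n \<odot> x = face_power \<tau> n \<odot> y"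
  shows "x = y"
proof -
  have f: "face_power \<tau> i \<in> carrier (loc_ring \<sigma>)" for i by (rule face_power_loc) (use assms(1) in simp)
  have "face_power \<tau> (- n) \<odot> (face_power \<tau> n \<odot> z) = z" if "z \<in> carrier M" for z
    using smult_mult[OF f f that, of "- n" n] that by (simp add: face_power_mult)
  then show ?thesis using assms(2-4) by metis
qed

lemma (in graded_mod) tpow_closed: "x \<in> carrier M \<Longrightarrow> tpow M \<tau> n x \<in> carrier M"
  by (rule smult_closed[OF face_power_loc]) simp

lemma (in graded_mod) tpow_add:
  "x \<in> carrier M \<Longrightarrow> tpow M \<tau> (m + n) x = tpow M \<tau> m (tpow M \<tau> n x)"
  using smult_mult[OF face_power_loc face_power_loc, of \<tau> "int m" \<tau> "int n" x] by (simp add: face_power_mult)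

lemma (in graded_mod) tpow_zero_mono:
  assumes x: "x \<in> carrier M" and z: "tpow M \<tau> n x = \<zero>" and "n \<le> m"
  shows "tpow M \<tau> m x = \<zero>"
proof -
  have "face_power \<tau> (int (m - n)) \<in> carrier (loc_ring \<sigma>)" by (rule face_power_loc) simp
  from smult_r_null[OF this] show ?thesis
    using tpow_add[OF x, of \<tau> "m - n" n] z \<open>n \<le> m\<close> by simp
qed

context scalar_extension
begin

lemma unit_power_localization: "power_localization \<sigma> \<tau> M B (\<lambda>x\<in>carrier M. pure 1 x)"
  unfolding power_localization_def
proof (intro conjI ballI impI)
  show "\<exists>n. tpow M \<tau> n x = \<zero>" if "x \<in> carrier M" "(\<lambda>x\<in>carrier M. pure 1 x) x = \<zero>\<^bsub>B\<^esub>" for x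
    using pure_one_zero that by simp
  show "\<exists>n. \<exists>x\<in>carrier M. tpow B \<tau> n z = (\<lambda>x\<in>carrier M. pure 1 x) x" if "z \<in> carrier B" for z
  proof -
    obtain n x where x: "x \<in> carrier M" "z = frac n x" using B_frac \<open>z \<in> carrier B\<close> by blast
    have "tpow B \<tau> n z = pure 1 x"
      unfolding x(2) frac_def smult_pure[OF loc_sub[OF face_power_inverse(2)]] face_power_mult by simp
    then show ?thesis using x by (intro exI[of _ n] bexI[of _ x]) simp_all
  qed
qed (rule unit_hom)

text \<open>The induced map sends \<open>x / t\<^sub>\<tau>\<^sup>n\<close> to \<open>t\<^sub>\<tau>\<^sup>-\<^sup>n \<phi> x\<close>. It is injective iff the kernel of \<open>\<phi>\<close> is torsion,
  and surjective iff powers of \<open>t\<^sub>\<tau>\<close> carry \<open>N\<close> into the image of \<open>\<phi>\<close>.\<close>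

theorem localization_map_iff:
  assumes N: "graded_module \<tau> N"
  shows "localization_map \<sigma> \<tau> M N \<phi> \<longleftrightarrow> power_localization \<sigma> \<tau> M N \<phi>"
proof
  interpret N: graded_mod \<tau> N by unfold_locales (rule N)
  have one: "1 \<in> carrier (loc_ring \<tau>)" by simp
  assume "localization_map \<sigma> \<tau> M N \<phi>"
  then obtain h where \<phi>: "\<phi> \<in> graded_hom \<sigma> M N" and h: "h \<in> graded_hom \<tau> B N"
    and hp: "\<And>s x. \<lbrakk>s \<in> carrier (loc_ring \<tau>); x \<in> carrier M\<rbrakk> \<Longrightarrow> h (pure s x) = s \<odot>\<^bsub>N\<^esub> \<phi> x"
    and bij: "bij_betw h (carrier B) (carrier N)" unfolding localization_map_def by blast
  interpret h: graded_map \<tau> \<tau> B N h by unfold_locales (use h in auto)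
  interpret \<phi>: graded_map \<sigma> \<tau> M N \<phi> by unfold_locales (fact \<phi> sub)+
  have h1: "h (pure 1 x) = \<phi> x" if "x \<in> carrier M" for x using hp[OF one that] \<phi>.closed[OF that] by simp
  show "power_localization \<sigma> \<tau> M N \<phi>"
    unfolding power_localization_def
  proof (intro conjI ballI impI)
    show "\<exists>n. tpow M \<tau> n x = \<zero>" if x: "x \<in> carrier M" "\<phi> x = \<zero>\<^bsub>N\<^esub>" for x
    proof (rule pure_one_zero[OF x(1)])
      show "pure 1 x = \<zero>\<^bsub>B\<^esub>"
        using h.inj_iff bij_betw_imp_inj_on[OF bij] h1[OF x(1)] x(2) pure_closed[OF one x(1)] by auto
    qed
    show "\<exists>n. \<exists>x\<in>carrier M. tpow N \<tau> n y = \<phi> x" if y: "y \<in> carrier N" for y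
    proof -
      obtain z where z: "z \<in> carrier B" "y = h z" using bij_betw_imp_surj_on[OF bij] y by blast
      obtain n x where x: "x \<in> carrier M" "tpow B \<tau> n z = pure 1 x"
        using power_localizationD(3)[OF unit_power_localization z(1)] by auto
      have "tpow N \<tau> n y = \<phi> x"
        unfolding z(2) h.smult[OF loc_sub[OF face_power_inverse(2)] z(1), symmetric] x(2) by (rule h1[OF x(1)])
      then show ?thesis using x(1) by blast
    qed
  qed (rule \<phi>)
next
  interpret N: graded_mod \<tau> N by unfold_locales (rule N)
  assume L: "power_localization \<sigma> \<tau> M N \<phi>"
  note \<phi> = power_localizationD(1)[OF L]
  interpret \<phi>: graded_map \<sigma> \<tau> M N \<phi> by unfold_locales (fact \<phi> sub)+
  obtain h where h: "h \<in> graded_hom \<tau> B N"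
    and hp: "\<And>s x. \<lbrakk>s \<in> carrier (loc_ring \<tau>); x \<in> carrier M\<rbrakk> \<Longrightarrow> h (pure s x) = s \<odot>\<^bsub>N\<^esub> \<phi> x"
    using lift_hom[OF N order_refl \<phi>] by blast
  interpret h: graded_map \<tau> \<tau> B N h by unfold_locales (use h in auto)
  have hf: "h (frac n x) = face_power \<tau> (- int n) \<odot>\<^bsub>N\<^esub> \<phi> x" if "x \<in> carrier M" for n x
    unfolding frac_def by (rule hp[OF face_power_inverse(1) that])
  have inv: "face_power \<tau> i \<in> carrier (loc_ring \<tau>)" for i :: int by (rule face_power_loc) simp
  have "inj_on h (carrier B)"
    unfolding h.inj_iff
  proof (intro ballI impI)
    fix z assume z: "z \<in> carrier B" and hz: "h z = \<zero>\<^bsub>N\<^esub>"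
    obtain n x where x: "x \<in> carrier M" "z = frac n x" using B_frac[OF z] by blast
    have "face_power \<tau> (- int n) \<odot>\<^bsub>N\<^esub> \<phi> x = face_power \<tau> (- int n) \<odot>\<^bsub>N\<^esub> \<zero>\<^bsub>N\<^esub>"
      using hz hf[OF x(1)] x(2) N.smult_r_null[OF inv] by simp
    then have "\<phi> x = \<zero>\<^bsub>N\<^esub>" by (rule N.face_power_cancel[OF order_refl \<phi>.closed[OF x(1)] N.M.zero_closed])
    then show "z = \<zero>\<^bsub>B\<^esub>" unfolding x(2) frac_zero_iff[OF x(1)] by (rule power_localizationD(2)[OF L x(1)])
  qed
  moreover have "h ` carrier B = carrier N"
  proof (intro equalityI subsetI)
    show "y \<in> carrier N" if "y \<in> h ` carrier B" for y using that h.closed by blast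
    fix y assume y: "y \<in> carrier N"
    obtain n x where x: "x \<in> carrier M" "tpow N \<tau> n y = \<phi> x"
      using power_localizationD(3)[OF L y] by blast
    have "h (frac n x) = (face_power \<tau> (- int n) * face_power \<tau> (int n)) \<odot>\<^bsub>N\<^esub> y"
      unfolding hf[OF x(1)] x(2)[symmetric] by (rule N.smult_mult[OF inv inv y, symmetric])
    then have "h (frac n x) = y" using y by (simp add: face_power_mult)
    then show "y \<in> h ` carrier B" using frac_closed[OF x(1)] by blast
  qed
  ultimately have "bij_betw h (carrier B) (carrier N)" unfolding bij_betw_def by blast
  then show "localization_map \<sigma> \<tau> M N \<phi>" unfolding localization_map_def using \<phi> h hp by blast
qed

end

text \<open>Two maps that agree on the image of \<open>\<phi>\<close> agree on \<open>t\<^sub>\<tau>\<^sup>n y\<close> for some \<open>n\<close>, and \<open>t\<^sub>\<tau>\<close> is invertible on \<open>P\<close>.\<close>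

lemma power_localization_unique:
  assumes M: "graded_module \<sigma> M" and N: "graded_module \<tau> N" and P: "graded_module \<upsilon> P"
    and sub: "\<sigma> \<subseteq> \<tau>" "\<tau> \<subseteq> \<upsilon>" and \<phi>: "power_localization \<sigma> \<tau> M N \<phi>"
    and f: "f \<in> graded_hom \<tau> N P" and g: "g \<in> graded_hom \<tau> N P"
    and eq: "\<And>x. x \<in> carrier M \<Longrightarrow> f (\<phi> x) = g (\<phi> x)"
  shows "f = g"
proof (rule graded_hom_eqI[OF f g])
  interpret f: graded_map \<tau> \<upsilon> N P f by unfold_locales (use N P f sub in auto)
  interpret g: graded_map \<tau> \<upsilon> N P g by unfold_locales (use g sub in auto)
  fix y assume y: "y \<in> carrier N"
  obtain n x where x: "x \<in> carrier M" "tpow N \<tau> n y = \<phi> x"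
    using power_localizationD(3)[OF \<phi> y] by blast
  have p: "face_power \<tau> (int n) \<in> carrier (loc_ring \<tau>)" by (rule face_power_loc) simp
  show "f y = g y"
    by (rule f.N.face_power_cancel[OF sub(2) f.closed[OF y] g.closed[OF y], of "int n"])
      (simp only: f.smult[OF p y, symmetric] g.smult[OF p y, symmetric] x(2) eq[OF x(1)])
qed

lemma power_localization_cancel:
  assumes M: "graded_module \<sigma> M" and N: "graded_module \<tau> N" and P: "graded_module \<upsilon> P"
    and sub: "\<sigma> \<subseteq> \<tau>" "\<tau> \<subseteq> \<upsilon>" and \<phi>: "power_localization \<sigma> \<tau> M N \<phi>" and \<theta>: "power_localization \<sigma> \<upsilon> M P \<theta>"
    and \<psi>: "\<psi> \<in> graded_hom \<tau> N P" and eq: "\<And>x. x \<in> carrier M \<Longrightarrow> \<psi> (\<phi> x) = \<theta> x"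
  shows "power_localization \<tau> \<upsilon> N P \<psi>"
  unfolding power_localization_def
proof (intro conjI ballI impI)
  interpret \<psi>: graded_map \<tau> \<upsilon> N P \<psi> by unfold_locales (use N P \<psi> sub in auto)
  interpret \<phi>: graded_map \<sigma> \<tau> M N \<phi> by unfold_locales (use M N power_localizationD(1)[OF \<phi>] sub in auto)
  show "\<psi> \<in> graded_hom \<tau> N P" by (rule \<psi>)
  have pn: "face_power \<rho> (int n) \<in> carrier (loc_ring \<rho>')" for \<rho> \<rho>' :: "'a set" and n by (rule face_power_loc) simp
  show "\<exists>n. tpow N \<upsilon> n y = \<zero>\<^bsub>N\<^esub>" if y: "y \<in> carrier N" and z: "\<psi> y = \<zero>\<^bsub>P\<^esub>" for y
  proof -
    obtain n x where x: "x \<in> carrier M" "tpow N \<tau> n y = \<phi> x"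
      using power_localizationD(3)[OF \<phi> y] by blast
    have "\<theta> x = \<zero>\<^bsub>P\<^esub>"
      unfolding eq[OF x(1), symmetric] x(2)[symmetric] \<psi>.smult[OF pn y] z by (rule \<psi>.N.smult_r_null[OF pn])
    then obtain k :: nat where "tpow M \<upsilon> k x = \<zero>\<^bsub>M\<^esub>" using power_localizationD(2)[OF \<theta> x(1)] by blast
    then have "\<phi> (tpow M \<upsilon> k x) = \<zero>\<^bsub>N\<^esub>" using \<phi>.zero by simp
    then have "tpow N \<upsilon> k (tpow N \<tau> n y) = \<zero>\<^bsub>N\<^esub>"
      unfolding x(2) \<phi>.smult[OF pn x(1)] .
    then have "tpow N \<tau> n (tpow N \<upsilon> k y) = tpow N \<tau> n \<zero>\<^bsub>N\<^esub>"
      using \<psi>.M.smult_mult[OF pn pn y, of \<upsilon> k \<tau> n] \<psi>.M.smult_mult[OF pn pn y, of \<tau> n \<upsilon> k]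
        \<psi>.M.smult_r_null[OF pn] by (simp add: mult.commute)
    then have "tpow N \<upsilon> k y = \<zero>\<^bsub>N\<^esub>"
      by (rule \<psi>.M.face_power_cancel[OF order_refl \<psi>.M.tpow_closed[OF y] \<psi>.M.M.zero_closed])
    then show ?thesis by blast
  qed
  show "\<exists>n. \<exists>y\<in>carrier N. tpow P \<upsilon> n z = \<psi> y" if "z \<in> carrier P" for z
    using power_localizationD(3)[OF \<theta> that] eq \<phi>.closed by metis
qed

lemma base_change_finitely_generated:
  assumes M: "graded_module \<sigma> M" and sub: "\<sigma> \<subseteq> \<tau>" and fg: "finitely_generated \<sigma> M"
  shows "finitely_generated \<tau> (base_change \<sigma> \<tau> M)"
proof -
  interpret scalar_extension \<sigma> \<tau> M by unfold_locales (fact M sub)+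
  show ?thesis
  proof (rule finitely_generated_image[OF M B_graded sub unit_hom fg])
    fix H assume H: "graded_sub \<tau> B H" and im: "(\<lambda>x\<in>carrier M. pure 1 x) ` carrier M \<subseteq> H"
    show "carrier B \<subseteq> H"
    proof
      fix z assume "z \<in> carrier B"
      then obtain n x where x: "x \<in> carrier M" "z = frac n x" using B_frac by blast
      have "face_power \<tau> (- int n) \<odot>\<^bsub>B\<^esub> pure 1 x \<in> H"
        by (rule B.graded_sub_smult[OF H face_power_inverse(1)]) (use im x in auto)
      then show "z \<in> H" unfolding x(2) frac_def smult_pure[OF face_power_inverse(1)] by simp
    qed
  qed
qed

section \<open>The localization functor\<close>

lemma Rmod_simps [simp]:
  "M \<in> Obj Rmod \<longleftrightarrow> graded_module {} M \<and> finitely_generated {} M" "Hom Rmod M N = graded_hom {} M N"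
  "Idt Rmod M = (\<lambda>x\<in>carrier M. x)" "Comp Rmod L M N g f = compose (carrier L) g f"
  by (simp_all add: Rmod_def)

lemma Rmod_category: "is_category (Rmod :: (('k::field, 'n::finite, 'a) gmod, 'a \<Rightarrow> 'a) cat)"
  unfolding is_category_def Rmod_simps
proof (intro conjI ballI)
  show "(\<lambda>x\<in>carrier X. x) \<in> graded_hom {} X X" if "X \<in> Obj Rmod" for X :: "('k, 'n, 'a) gmod"
    using that by (intro graded_hom_id) simp
  show "compose (carrier X) g f \<in> graded_hom {} X Z"
    if "X \<in> Obj Rmod" "Y \<in> Obj Rmod" "Z \<in> Obj Rmod" "f \<in> graded_hom {} X Y" "g \<in> graded_hom {} Y Z"
    for X Y Z :: "('k, 'n, 'a) gmod" and f g
    using that by (intro graded_hom_compose[OF _ _ _ subset_refl subset_refl]) auto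
qed (auto simp: graded_hom_def compose_assoc compose_def restrict_def fun_eq_iff PiE_def extensional_def Pi_def)

lemma Lcat_simps [simp]:
  "M \<in> Obj (Lcat K) \<longleftrightarrow> localized_module K M" "Hom (Lcat K) M N = localized_hom K M N"
  "Idt (Lcat K) M = (\<lambda>\<sigma>\<in>missing_faces K. \<lambda>x\<in>carrier (at_face M \<sigma>). x)"
  "Comp (Lcat K) L M N g f = (\<lambda>\<sigma>\<in>missing_faces K. compose (carrier (at_face L \<sigma>)) (g \<sigma>) (f \<sigma>))"
  by (simp_all add: Lcat_def)

lemma localized_moduleD:
  assumes "localized_module K M" "\<sigma> \<in> missing_faces K"
  shows "graded_module \<sigma> (at_face M \<sigma>)" "finitely_generated \<sigma> (at_face M \<sigma>)"
    "\<lbrakk>\<tau> \<in> missing_faces K; \<sigma> \<subseteq> \<tau>\<rbrakk> \<Longrightarrow> power_localization \<sigma> \<tau> (at_face M \<sigma>) (at_face M \<tau>) (transition M \<sigma> \<tau>)"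
    "x \<in> carrier (at_face M \<sigma>) \<Longrightarrow> transition M \<sigma> \<sigma> x = x"
    "\<lbrakk>\<tau> \<in> missing_faces K; \<upsilon> \<in> missing_faces K; \<sigma> \<subseteq> \<tau>; \<tau> \<subseteq> \<upsilon>; x \<in> carrier (at_face M \<sigma>)\<rbrakk> \<Longrightarrow>
      transition M \<tau> \<upsilon> (transition M \<sigma> \<tau> x) = transition M \<sigma> \<upsilon> x"
proof -
  note D = assms(1)[unfolded localized_module_def]
  have all: "\<And>\<sigma>. \<sigma> \<in> missing_faces K \<Longrightarrow> graded_module \<sigma> (at_face M \<sigma>) \<and> finitely_generated \<sigma> (at_face M \<sigma>)"
    "\<And>\<sigma> \<tau>. \<lbrakk>\<sigma> \<in> missing_faces K; \<tau> \<in> missing_faces K; \<sigma> \<subseteq> \<tau>\<rbrakk> \<Longrightarrow>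
      localization_map \<sigma> \<tau> (at_face M \<sigma>) (at_face M \<tau>) (transition M \<sigma> \<tau>)"
    using D[THEN conjunct1] D[THEN conjunct2, THEN conjunct1] by blast+
  show g: "graded_module \<sigma> (at_face M \<sigma>)" "finitely_generated \<sigma> (at_face M \<sigma>)" using all(1) assms(2) by blast+
  show "power_localization \<sigma> \<tau> (at_face M \<sigma>) (at_face M \<tau>) (transition M \<sigma> \<tau>)"
    if "\<tau> \<in> missing_faces K" "\<sigma> \<subseteq> \<tau>"
  proof -
    interpret scalar_extension \<sigma> \<tau> "at_face M \<sigma>" by unfold_locales (fact g that)+
    show ?thesis using localization_map_iff all(1)[OF that(1)] all(2)[OF assms(2) that] by blast
  qed
  show "x \<in> carrier (at_face M \<sigma>) \<Longrightarrow> transition M \<sigma> \<sigma> x = x"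
    using D[THEN conjunct2, THEN conjunct2, THEN conjunct1] assms(2) by blast
  show "\<lbrakk>\<tau> \<in> missing_faces K; \<upsilon> \<in> missing_faces K; \<sigma> \<subseteq> \<tau>; \<tau> \<subseteq> \<upsilon>; x \<in> carrier (at_face M \<sigma>)\<rbrakk> \<Longrightarrow>
      transition M \<tau> \<upsilon> (transition M \<sigma> \<tau> x) = transition M \<sigma> \<upsilon> x"
    using D[THEN conjunct2, THEN conjunct2, THEN conjunct2] assms(2) by simp
qed

lemma localized_moduleI:
  assumes "\<And>\<sigma>. \<sigma> \<in> missing_faces K \<Longrightarrow> graded_module \<sigma> (at_face M \<sigma>)"
    and "\<And>\<sigma>. \<sigma> \<in> missing_faces K \<Longrightarrow> finitely_generated \<sigma> (at_face M \<sigma>)"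
    and "\<And>\<sigma> \<tau>. \<lbrakk>\<sigma> \<in> missing_faces K; \<tau> \<in> missing_faces K; \<sigma> \<subseteq> \<tau>\<rbrakk> \<Longrightarrow>
      power_localization \<sigma> \<tau> (at_face M \<sigma>) (at_face M \<tau>) (transition M \<sigma> \<tau>)"
    and "\<And>\<sigma> x. \<sigma> \<in> missing_faces K \<Longrightarrow> x \<in> carrier (at_face M \<sigma>) \<Longrightarrow> transition M \<sigma> \<sigma> x = x"
    and "\<And>\<sigma> \<tau> \<upsilon> x. \<lbrakk>\<sigma> \<in> missing_faces K; \<tau> \<in> missing_faces K; \<upsilon> \<in> missing_faces K; \<sigma> \<subseteq> \<tau>; \<tau> \<subseteq> \<upsilon>;
      x \<in> carrier (at_face M \<sigma>)\<rbrakk> \<Longrightarrow> transition M \<tau> \<upsilon> (transition M \<sigma> \<tau> x) = transition M \<sigma> \<upsilon> x"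
  shows "localized_module K M"
proof -
  have "localization_map \<sigma> \<tau> (at_face M \<sigma>) (at_face M \<tau>) (transition M \<sigma> \<tau>)"
    if "\<sigma> \<in> missing_faces K" "\<tau> \<in> missing_faces K" "\<sigma> \<subseteq> \<tau>" for \<sigma> \<tau>
  proof -
    interpret scalar_extension \<sigma> \<tau> "at_face M \<sigma>" by unfold_locales (use assms(1) that in auto)
    show ?thesis using localization_map_iff[OF assms(1)] assms(3) that by blast
  qed
  then show ?thesis unfolding localized_module_def by (intro conjI ballI impI assms(1,2,4,5))
qed

lemma localized_homD:
  assumes "f \<in> localized_hom K M N" "\<sigma> \<in> missing_faces K"
  shows "f \<sigma> \<in> graded_hom \<sigma> (at_face M \<sigma>) (at_face N \<sigma>)"
    "\<lbrakk>\<tau> \<in> missing_faces K; \<sigma> \<subseteq> \<tau>; x \<in> carrier (at_face M \<sigma>)\<rbrakk> \<Longrightarrow>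
      f \<tau> (transition M \<sigma> \<tau> x) = transition N \<sigma> \<tau> (f \<sigma> x)"
  using assms unfolding localized_hom_def by auto

lemma localized_homI:
  assumes "\<And>\<sigma>. \<sigma> \<in> missing_faces K \<Longrightarrow> f \<sigma> \<in> graded_hom \<sigma> (at_face M \<sigma>) (at_face N \<sigma>)"
    and "\<And>\<sigma> \<tau> x. \<lbrakk>\<sigma> \<in> missing_faces K; \<tau> \<in> missing_faces K; \<sigma> \<subseteq> \<tau>; x \<in> carrier (at_face M \<sigma>)\<rbrakk> \<Longrightarrow>
      f \<tau> (transition M \<sigma> \<tau> x) = transition N \<sigma> \<tau> (f \<sigma> x)"
    and "\<And>\<sigma> \<tau> x. \<lbrakk>\<sigma> \<in> missing_faces K; \<tau> \<in> missing_faces K; \<sigma> \<subseteq> \<tau>; x \<in> carrier (at_face M \<sigma>)\<rbrakk> \<Longrightarrow>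
      transition M \<sigma> \<tau> x \<in> carrier (at_face M \<tau>)"
  shows "restrict f (missing_faces K) \<in> localized_hom K M N"
  using assms unfolding localized_hom_def by auto

lemma localized_hom_ext:
  assumes "f \<in> localized_hom K M N" "g \<in> localized_hom K M N"
    and "\<And>\<sigma> x. \<sigma> \<in> missing_faces K \<Longrightarrow> x \<in> carrier (at_face M \<sigma>) \<Longrightarrow> f \<sigma> x = g \<sigma> x"
  shows "f = g"
proof -
  have "f \<sigma> = g \<sigma>" if "\<sigma> \<in> missing_faces K" for \<sigma>
    by (rule graded_hom_eqI[OF localized_homD(1)[OF assms(1) that] localized_homD(1)[OF assms(2) that]]) (rule assms(3)[OF that])
  moreover have "f \<in> extensional (missing_faces K)" "g \<in> extensional (missing_faces K)"
    using assms(1,2) unfolding localized_hom_def by (auto simp: PiE_def)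
  ultimately show ?thesis by (rule extensionalityI[rotated 2])
qed

lemma localized_module_map:
  assumes "localized_module K M" "\<sigma> \<in> missing_faces K" "\<tau> \<in> missing_faces K" "\<sigma> \<subseteq> \<tau>"
  shows "graded_map \<sigma> \<tau> (at_face M \<sigma>) (at_face M \<tau>) (transition M \<sigma> \<tau>)"
  by unfold_locales (use assms localized_moduleD(1)[OF assms(1)]
      power_localizationD(1)[OF localized_moduleD(3)[OF assms(1,2,3,4)]] in auto)

lemma localized_hom_map:
  assumes "localized_module K M" "localized_module K N" "f \<in> localized_hom K M N" "\<sigma> \<in> missing_faces K"
  shows "graded_map \<sigma> \<sigma> (at_face M \<sigma>) (at_face N \<sigma>) (f \<sigma>)"
  by unfold_locales (use assms(4) localized_moduleD(1)[OF assms(1)] localized_moduleD(1)[OF assms(2)]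
      localized_homD(1)[OF assms(3,4)] in auto)

lemma Lcat_comp_apply:
  "\<lbrakk>\<sigma> \<in> missing_faces K; x \<in> carrier (at_face L \<sigma>)\<rbrakk> \<Longrightarrow> Comp (Lcat K) L M N g f \<sigma> x = g \<sigma> (f \<sigma> x)"
  by (simp add: compose_def)

lemma localized_hom_compose:
  assumes X: "localized_module K X" and Y: "localized_module K Y" and Z: "localized_module K Z"
    and f: "f \<in> localized_hom K X Y" and g: "g \<in> localized_hom K Y Z"
  shows "Comp (Lcat K) X Y Z g f \<in> localized_hom K X Z"
  unfolding Lcat_simps
proof (rule localized_homI)
  fix \<sigma> assume \<sigma>: "\<sigma> \<in> missing_faces K"
  show "compose (carrier (at_face X \<sigma>)) (g \<sigma>) (f \<sigma>) \<in> graded_hom \<sigma> (at_face X \<sigma>) (at_face Z \<sigma>)"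
    by (rule graded_hom_compose[OF localized_moduleD(1)[OF X \<sigma>] localized_moduleD(1)[OF Y \<sigma>]
        localized_moduleD(1)[OF Z \<sigma>] subset_refl subset_refl localized_homD(1)[OF f \<sigma>] localized_homD(1)[OF g \<sigma>]])
  fix \<tau> x assume \<tau>: "\<tau> \<in> missing_faces K" "\<sigma> \<subseteq> \<tau>" and x: "x \<in> carrier (at_face X \<sigma>)"
  interpret t: graded_map \<sigma> \<tau> "at_face X \<sigma>" "at_face X \<tau>" "transition X \<sigma> \<tau>"
    by (rule localized_module_map[OF X \<sigma> \<tau>])
  interpret f: graded_map \<sigma> \<sigma> "at_face X \<sigma>" "at_face Y \<sigma>" "f \<sigma>" by (rule localized_hom_map[OF X Y f \<sigma>])
  show "transition X \<sigma> \<tau> x \<in> carrier (at_face X \<tau>)" by (rule t.closed[OF x])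
  show "compose (carrier (at_face X \<tau>)) (g \<tau>) (f \<tau>) (transition X \<sigma> \<tau> x)
      = transition Z \<sigma> \<tau> (compose (carrier (at_face X \<sigma>)) (g \<sigma>) (f \<sigma>) x)"
    using x t.closed[OF x] localized_homD(2)[OF f \<sigma> \<tau> x] localized_homD(2)[OF g \<sigma> \<tau> f.closed[OF x]]
    by (simp add: compose_def)
qed

lemma localized_hom_id: 
  assumes X: "localized_module K X"
  shows "Idt (Lcat K) X \<in> localized_hom K X X"
  unfolding Lcat_simps
proof (rule localized_homI)
  fix \<sigma> assume \<sigma>: "\<sigma> \<in> missing_faces K"
  show "(\<lambda>x\<in>carrier (at_face X \<sigma>). x) \<in> graded_hom \<sigma> (at_face X \<sigma>) (at_face X \<sigma>)"
    by (rule graded_hom_id[OF localized_moduleD(1)[OF X \<sigma>]])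
  fix \<tau> x assume \<tau>: "\<tau> \<in> missing_faces K" "\<sigma> \<subseteq> \<tau>" and x: "x \<in> carrier (at_face X \<sigma>)"
  interpret t: graded_map \<sigma> \<tau> "at_face X \<sigma>" "at_face X \<tau>" "transition X \<sigma> \<tau>"
    by (rule localized_module_map[OF X \<sigma> \<tau>])
  show "transition X \<sigma> \<tau> x \<in> carrier (at_face X \<tau>)" by (rule t.closed[OF x])
  show "(\<lambda>x\<in>carrier (at_face X \<tau>). x) (transition X \<sigma> \<tau> x) = transition X \<sigma> \<tau> ((\<lambda>x\<in>carrier (at_face X \<sigma>). x) x)"
    using x t.closed[OF x] by simp
qed

lemma Lcat_category: "is_category (Lcat K :: (('k::field, 'n::finite, 'b) lmod, 'n set \<Rightarrow> 'b \<Rightarrow> 'b) cat)"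
proof -
  note cl = graded_map.closed[OF localized_hom_map]
  have comp: "Comp (Lcat K) X Y Z g f \<in> localized_hom K X Z"
    if "localized_module K X" "localized_module K Y" "localized_module K Z" "f \<in> localized_hom K X Y" "g \<in> localized_hom K Y Z"
    for X Y Z :: "('k, 'n, 'b) lmod" and f g
    by (rule localized_hom_compose[OF that])
  show ?thesis
    unfolding is_category_def Lcat_simps(1,2)
  proof (intro conjI ballI)
    show "Idt (Lcat K) X \<in> localized_hom K X X" if "X \<in> Obj (Lcat K)" for X :: "('k, 'n, 'b) lmod"
      using that by (intro localized_hom_id) simp
    show "Comp (Lcat K) X Y Z g f \<in> localized_hom K X Z"
      if "X \<in> Obj (Lcat K)" "Y \<in> Obj (Lcat K)" "Z \<in> Obj (Lcat K)" "f \<in> localized_hom K X Y" "g \<in> localized_hom K Y Z"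
      for X Y Z :: "('k, 'n, 'b) lmod" and f g
      by (rule comp) (use that in auto)
    fix X Y :: "('k, 'n, 'b) lmod" and f
    assume "X \<in> Obj (Lcat K)" "Y \<in> Obj (Lcat K)" and f: "f \<in> localized_hom K X Y"
    then have XY: "localized_module K X" "localized_module K Y" by auto
    show "Comp (Lcat K) X X Y f (Idt (Lcat K) X) = f"
      by (rule localized_hom_ext[OF comp[OF XY(1) XY localized_hom_id[OF XY(1)] f] f]) (simp add: compose_def)
    show "Comp (Lcat K) X Y Y (Idt (Lcat K) Y) f = f"
      by (rule localized_hom_ext[OF comp[OF XY XY(2) f localized_hom_id[OF XY(2)]] f])
        (simp add: compose_def cl[OF XY f])
  next
    fix W X Y Z :: "('k, 'n, 'b) lmod" and f g h
    assume "W \<in> Obj (Lcat K)" "X \<in> Obj (Lcat K)" "Y \<in> Obj (Lcat K)" "Z \<in> Obj (Lcat K)"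
      and f: "f \<in> localized_hom K W X" and g: "g \<in> localized_hom K X Y" and h: "h \<in> localized_hom K Y Z"
    then have W: "localized_module K W" and X: "localized_module K X" and Y: "localized_module K Y"
      and Z: "localized_module K Z" by auto
    show "Comp (Lcat K) W Y Z h (Comp (Lcat K) W X Y g f) = Comp (Lcat K) W X Z (Comp (Lcat K) X Y Z h g) f"
      by (rule localized_hom_ext[OF comp[OF W Y Z comp[OF W X Y f g] h] comp[OF W X Z f comp[OF X Y Z g h]]])
        (simp add: compose_def cl[OF W X f])
  qed
qed

text \<open>The extension of \<open>x \<mapsto> 1 \<otimes> f x\<close> given by the universal property is the map defined on
  representatives, since both send \<open>s \<otimes> x\<close> to \<open>s \<otimes> f x\<close>. With \<open>\<sigma> = \<tau>\<close> this covers the arrows of \<open>L\<^sub>K M\<close>,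
  and with \<open>f\<close> the identity its transition maps.\<close>

lemma induced_map:
  fixes f :: "'a \<Rightarrow> 'c" and M :: "('k::field, 'n::finite, 'a) gmod" and N :: "('k, 'n, 'c) gmod"
  assumes M: "graded_module {} M" and N: "graded_module {} N" and sub: "\<sigma> \<subseteq> \<tau>"
    and f: "restrict f (carrier M) \<in> graded_hom {} M N"
  shows "(\<lambda>c\<in>carrier (base_change {} \<sigma> M). tensor_induced {} \<tau> N (\<lambda>(s, x). (s, f x)) c)
      \<in> graded_hom \<sigma> (base_change {} \<sigma> M) (base_change {} \<tau> N)" (is "?T \<in> _")
    and "x \<in> carrier M \<Longrightarrow> tensor_induced {} \<tau> N (\<lambda>(s, x). (s, f x)) (pure_tensor {} \<sigma> M 1 x) = pure_tensor {} \<tau> N 1 (f x)"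
proof -
  interpret M: scalar_extension "{}" \<sigma> M by unfold_locales (use M in auto)
  interpret N: scalar_extension "{}" \<tau> N by unfold_locales (use N in auto)
  interpret f: graded_map "{}" "{}" M N "restrict f (carrier M)" by unfold_locales (use f in auto)
  note up = loc_ring_mono[OF sub]
  have fc: "f x \<in> carrier N" if "x \<in> carrier M" for x using f.closed[OF that] that by simp
  have "frag_extend (frag_of \<circ> (\<lambda>(s, x). (s, f x))) r \<in> tensor_null {} \<tau> N" if "r \<in> tensor_relators {} \<sigma> M" for r
  proof (rule N.relator_null)
    show "frag_extend (frag_of \<circ> (\<lambda>(s, x). (s, f x))) r \<in> tensor_relators {} \<tau> N"
      using that
    proof (cases r rule: tensor_relatorE)
      case (left s s' y)
      then show ?thesis using tensor_relatorI(1)[OF up[OF left(1)] up[OF left(2)] fc[OF left(3)]]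
        by (simp add: frag_extend_diff)
    next
      case (right s y y')
      then show ?thesis using tensor_relatorI(2)[OF up[OF right(1)] fc[OF right(2)] fc[OF right(3)]] f.add[of y y']
        by (simp add: frag_extend_diff)
    next
      case (bal s p y)
      then show ?thesis using tensor_relatorI(3)[OF up[OF bal(1)] bal(2) fc[OF bal(3)]] f.smult[OF bal(2,3)]
        by (simp add: frag_extend_diff M.M.smult_closed del: carrier_loc_ring)
    qed
  qed
  from M.tensor_induced_pure[OF N empty_subsetI this]
  have T: "tensor_induced {} \<tau> N (\<lambda>(s, x). (s, f x)) (M.pure s x) = N.pure s (f x)" for s x
    unfolding pure_tensor_def by simp
  then show "x \<in> carrier M \<Longrightarrow> tensor_induced {} \<tau> N (\<lambda>(s, x). (s, f x)) (M.pure 1 x) = N.pure 1 (f x)" by simp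
  let ?\<psi> = "compose (carrier M) (\<lambda>y\<in>carrier N. N.pure 1 y) (restrict f (carrier M))"
  have \<psi>: "?\<psi> \<in> graded_hom {} M N.B"
    by (rule graded_hom_compose[OF M N N.B_graded _ _ f N.unit_hom]) auto
  obtain h where h: "h \<in> graded_hom \<sigma> M.B N.B"
    and hp: "\<And>s x. \<lbrakk>s \<in> carrier (loc_ring \<sigma>); x \<in> carrier M\<rbrakk> \<Longrightarrow> h (M.pure s x) = s \<odot>\<^bsub>N.B\<^esub> ?\<psi> x"
    using M.lift_hom[OF N.B_graded sub \<psi>] by blast
  have hp': "h (M.pure s x) = N.pure s (f x)" if "s \<in> carrier (loc_ring \<sigma>)" "x \<in> carrier M" for s x
    using hp[OF that] that N.smult_pure[OF up[OF that(1)], of 1 "f x"] fc[OF that(2)] by (simp add: compose_def)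
  have "?T = h"
  proof (rule extensionalityI[of _ "carrier M.B"])
    show "h \<in> extensional (carrier M.B)" using h unfolding graded_hom_def by (auto simp: PiE_def)
    show "?T z = h z" if "z \<in> carrier M.B" for z
    proof -
      obtain n x where x: "x \<in> carrier M" "z = M.pure (face_power \<sigma> (- int n)) x"
        using M.B_frac[OF \<open>z \<in> carrier M.B\<close>] unfolding M.frac_def by blast
      have "?T z = tensor_induced {} \<tau> N (\<lambda>(s, x). (s, f x)) z" using \<open>z \<in> carrier M.B\<close> by simp
      also have "\<dots> = h z" unfolding x(2) T hp'[OF M.face_power_inverse(1) x(1)] ..
      finally show ?thesis .
    qed
  qed simp
  then show "?T \<in> graded_hom \<sigma> M.B N.B" using h by simp
qed

abbreviation "loc \<equiv> base_change {}"

definition unit_map :: "'n::finite set \<Rightarrow> ('k::field, 'n, 'a) gmod \<Rightarrow> 'a \<Rightarrow> ((('k, 'n) laurent \<times> 'a) \<Rightarrow>\<^sub>0 int) set" where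
  "unit_map \<sigma> M = (\<lambda>x\<in>carrier M. pure_tensor {} \<sigma> M 1 x)"

lemma base_change_graded: "graded_module {} M \<Longrightarrow> graded_module \<sigma> (loc \<sigma> M)"
proof -
  assume M: "graded_module {} M"
  interpret scalar_extension "{}" \<sigma> M by unfold_locales (use M in auto)
  show ?thesis by (rule B_graded)
qed

lemma unit_map_localization: "graded_module {} M \<Longrightarrow> power_localization {} \<sigma> M (loc \<sigma> M) (unit_map \<sigma> M)"
proof -
  assume M: "graded_module {} M"
  interpret scalar_extension "{}" \<sigma> M by unfold_locales (use M in auto)
  show ?thesis unfolding unit_map_def by (rule unit_power_localization)
qed

lemmas unit_map_hom = power_localizationD(1)[OF unit_map_localization]

lemma unit_map_graded_map: "graded_module {} M \<Longrightarrow> graded_map {} \<sigma> M (loc \<sigma> M) (unit_map \<sigma> M)"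
  using unit_map_hom[of M \<sigma>] base_change_graded[of M \<sigma>] by unfold_locales auto

abbreviation Loc where "Loc K \<equiv> localization_functor K"

abbreviation "Lobj K \<equiv> on_obj (Loc K)"
abbreviation "Lhom K \<equiv> on_hom (Loc K)"

lemma Loc_simps:
  "at_face (Lobj K M) \<sigma> = loc \<sigma> M"
  "transition (Lobj K M) \<sigma> \<tau> = (\<lambda>c\<in>carrier (loc \<sigma> M). tensor_induced {} \<tau> M id c)"
  "Lhom K M N f = (\<lambda>\<sigma>\<in>missing_faces K.
       \<lambda>c\<in>carrier (loc \<sigma> M). tensor_induced {} \<sigma> N (\<lambda>(s, x). (s, f x)) c)"
  by (simp_all add: localization_functor_def)

lemma Loc_transition:
  assumes M: "graded_module {} M" and sub: "\<sigma> \<subseteq> \<tau>"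
  shows "transition (Lobj K M) \<sigma> \<tau> \<in> graded_hom \<sigma> (loc \<sigma> M) (loc \<tau> M)"
    and "x \<in> carrier M \<Longrightarrow> transition (Lobj K M) \<sigma> \<tau> (unit_map \<sigma> M x) = unit_map \<tau> M x"
proof -
  interpret u: graded_map "{}" \<sigma> M "loc \<sigma> M" "unit_map \<sigma> M" by (rule unit_map_graded_map[OF M])
  have id: "(\<lambda>(s, x). (s, id x)) = id" by (auto simp: id_def)
  have r: "restrict id (carrier M) \<in> graded_hom {} M M" using graded_hom_id[OF M] by (simp add: id_def)
  note I = induced_map[OF M M sub r, unfolded id]
  show "transition (Lobj K M) \<sigma> \<tau> \<in> graded_hom \<sigma> (loc \<sigma> M) (loc \<tau> M)"
    using I(1) by (simp add: Loc_simps)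
  show "transition (Lobj K M) \<sigma> \<tau> (unit_map \<sigma> M x) = unit_map \<tau> M x" if "x \<in> carrier M"
    using I(2)[OF that] u.closed[OF that] that by (simp add: Loc_simps unit_map_def)
qed

lemma Loc_hom:
  assumes M: "graded_module {} M" and N: "graded_module {} N" and f: "f \<in> graded_hom {} M N" and \<sigma>: "\<sigma> \<in> missing_faces K"
  shows "Lhom K M N f \<sigma> \<in> graded_hom \<sigma> (loc \<sigma> M) (loc \<sigma> N)"
    and "x \<in> carrier M \<Longrightarrow> Lhom K M N f \<sigma> (unit_map \<sigma> M x) = unit_map \<sigma> N (f x)"
proof -
  interpret u: graded_map "{}" \<sigma> M "loc \<sigma> M" "unit_map \<sigma> M" by (rule unit_map_graded_map[OF M])
  interpret f: graded_map "{}" "{}" M N f by unfold_locales (use f M N in auto)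
  have r: "restrict f (carrier M) \<in> graded_hom {} M N" using f extensional_restrict[OF f.extensional] by simp
  note I = induced_map[OF M N subset_refl r]
  show "Lhom K M N f \<sigma> \<in> graded_hom \<sigma> (loc \<sigma> M) (loc \<sigma> N)"
    using I(1) \<sigma> by (simp add: Loc_simps)
  show "Lhom K M N f \<sigma> (unit_map \<sigma> M x) = unit_map \<sigma> N (f x)" if "x \<in> carrier M"
    using I(2)[OF that] u.closed[OF that] that \<sigma> f.closed by (simp add: Loc_simps unit_map_def)
qed

lemma Loc_localized:
  assumes M: "graded_module {} M" "finitely_generated {} M"
  shows "localized_module K (Lobj K M)"
proof (rule localized_moduleI)
  note B = base_change_graded[OF M(1)]
  note U = unit_map_localization[OF M(1)]
  show "graded_module \<sigma> (at_face (Lobj K M) \<sigma>)" for \<sigma> unfolding Loc_simps by (rule B)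
  show "finitely_generated \<sigma> (at_face (Lobj K M) \<sigma>)" for \<sigma>
    unfolding Loc_simps by (rule base_change_finitely_generated[OF M(1) _ M(2)]) simp
  show "power_localization \<sigma> \<tau> (at_face (Lobj K M) \<sigma>) (at_face (Lobj K M) \<tau>) (transition (Lobj K M) \<sigma> \<tau>)"
    if "\<sigma> \<subseteq> \<tau>" for \<sigma> \<tau>
    unfolding Loc_simps(1)
    by (rule power_localization_cancel[OF M(1) B B _ that U U Loc_transition(1)[OF M(1) that] Loc_transition(2)[OF M(1) that]]) auto
  show "transition (Lobj K M) \<sigma> \<sigma> z = z" if "z \<in> carrier (at_face (Lobj K M) \<sigma>)" for \<sigma> z
  proof -
    have "transition (Lobj K M) \<sigma> \<sigma> = (\<lambda>x\<in>carrier (loc \<sigma> M). x)"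
    proof (rule power_localization_unique[OF M(1) B B _ subset_refl U Loc_transition(1)[OF M(1) subset_refl] graded_hom_id[OF B]])
      show "transition (Lobj K M) \<sigma> \<sigma> (unit_map \<sigma> M x) = (\<lambda>x\<in>carrier (loc \<sigma> M). x) (unit_map \<sigma> M x)"
        if "x \<in> carrier M" for x
        using Loc_transition(2)[OF M(1) subset_refl that] graded_map.closed[OF unit_map_graded_map[OF M(1)] that] by simp
    qed simp
    then show ?thesis using that by (simp add: Loc_simps(1))
  qed
  show "transition (Lobj K M) \<tau> \<upsilon> (transition (Lobj K M) \<sigma> \<tau> z) = transition (Lobj K M) \<sigma> \<upsilon> z"
    if sub: "\<sigma> \<subseteq> \<tau>" "\<tau> \<subseteq> \<upsilon>" and z: "z \<in> carrier (at_face (Lobj K M) \<sigma>)" for \<sigma> \<tau> \<upsilon> z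
  proof -
    note sub' = order_trans[OF sub]
    let ?c = "compose (carrier (loc \<sigma> M)) (transition (Lobj K M) \<tau> \<upsilon>) (transition (Lobj K M) \<sigma> \<tau>)"
    have c: "?c = transition (Lobj K M) \<sigma> \<upsilon>"
    proof (rule power_localization_unique[OF M(1) B B _ sub' U
          graded_hom_compose[OF B B B sub Loc_transition(1)[OF M(1) sub(1)] Loc_transition(1)[OF M(1) sub(2)]]
          Loc_transition(1)[OF M(1) sub']])
      show "?c (unit_map \<sigma> M x) = transition (Lobj K M) \<sigma> \<upsilon> (unit_map \<sigma> M x)" if "x \<in> carrier M" for x
        using Loc_transition(2)[OF M(1) sub(1) that] Loc_transition(2)[OF M(1) sub(2) that] Loc_transition(2)[OF M(1) sub' that]
          graded_map.closed[OF unit_map_graded_map[OF M(1)] that] by (simp add: compose_def)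
    qed simp
    show ?thesis using z fun_cong[OF c, of z] by (simp add: Loc_simps(1) compose_def)
  qed
qed

lemma Loc_localized_hom:
  assumes M: "graded_module {} M" and N: "graded_module {} N" and f: "f \<in> graded_hom {} M N"
  shows "Lhom K M N f \<in> localized_hom K (Lobj K M) (Lobj K N)"
proof -
  note BM = base_change_graded[OF M] and BN = base_change_graded[OF N]
  interpret f: graded_map "{}" "{}" M N f by unfold_locales (use f M N in auto)
  have "restrict (Lhom K M N f) (missing_faces K) \<in> localized_hom K (Lobj K M) (Lobj K N)"
  proof (rule localized_homI)
    fix \<sigma> assume \<sigma>: "\<sigma> \<in> missing_faces K"
    show "Lhom K M N f \<sigma> \<in> graded_hom \<sigma> (at_face (Lobj K M) \<sigma>) (at_face (Lobj K N) \<sigma>)"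
      unfolding Loc_simps(1) by (rule Loc_hom(1)[OF M N f \<sigma>])
    fix \<tau> z assume \<tau>: "\<tau> \<in> missing_faces K" "\<sigma> \<subseteq> \<tau>" and z: "z \<in> carrier (at_face (Lobj K M) \<sigma>)"
    note tM = Loc_transition[OF M \<tau>(2), where K = K] and tN = Loc_transition[OF N \<tau>(2), where K = K]
    show "transition (Lobj K M) \<sigma> \<tau> z \<in> carrier (at_face (Lobj K M) \<tau>)"
      using tM(1) z unfolding Loc_simps(1) graded_hom_def by auto
    let ?B = "carrier (loc \<sigma> M)"
    have "compose ?B (Lhom K M N f \<tau>) (transition (Lobj K M) \<sigma> \<tau>)
        = compose ?B (transition (Lobj K N) \<sigma> \<tau>) (Lhom K M N f \<sigma>)"
    proof (rule power_localization_unique[OF M BM BN _ \<tau>(2) unit_map_localization[OF M]])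
      show "compose ?B (Lhom K M N f \<tau>) (transition (Lobj K M) \<sigma> \<tau>)
          \<in> graded_hom \<sigma> (loc \<sigma> M) (loc \<tau> N)"
        by (rule graded_hom_compose[OF BM BM BN \<tau>(2) subset_refl tM(1) Loc_hom(1)[OF M N f \<tau>(1)]])
      show "compose ?B (transition (Lobj K N) \<sigma> \<tau>) (Lhom K M N f \<sigma>)
          \<in> graded_hom \<sigma> (loc \<sigma> M) (loc \<tau> N)"
        by (rule graded_hom_compose[OF BM BN BN subset_refl \<tau>(2) Loc_hom(1)[OF M N f \<sigma>] tN(1)])
      show "compose ?B (Lhom K M N f \<tau>) (transition (Lobj K M) \<sigma> \<tau>) (unit_map \<sigma> M x)
          = compose ?B (transition (Lobj K N) \<sigma> \<tau>) (Lhom K M N f \<sigma>) (unit_map \<sigma> M x)"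
        if x: "x \<in> carrier M" for x
        using graded_map.closed[OF unit_map_graded_map[OF M] x, of \<sigma>] tM(2)[OF x] tN(2)[OF f.closed[OF x]]
          Loc_hom(2)[OF M N f \<sigma> x] Loc_hom(2)[OF M N f \<tau>(1) x] by (simp add: compose_def)
    qed simp
    from fun_cong[OF this, of z] z
    show "Lhom K M N f \<tau> (transition (Lobj K M) \<sigma> \<tau> z)
        = transition (Lobj K N) \<sigma> \<tau> (Lhom K M N f \<sigma> z)"
      by (simp add: Loc_simps(1) compose_def)
  qed
  then show ?thesis by (simp add: Loc_simps(3))
qed

lemma Loc_hom_ext:
  assumes M: "graded_module {} M" and N: "localized_module K N"
    and f: "f \<in> localized_hom K (Lobj K M) N" and g: "g \<in> localized_hom K (Lobj K M) N"
    and eq: "\<And>\<sigma> x. \<sigma> \<in> missing_faces K \<Longrightarrow> x \<in> carrier M \<Longrightarrow> f \<sigma> (unit_map \<sigma> M x) = g \<sigma> (unit_map \<sigma> M x)"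
  shows "f = g"
proof (rule localized_hom_ext[OF f g])
  fix \<sigma> x assume \<sigma>: "\<sigma> \<in> missing_faces K"
  have "f \<sigma> = g \<sigma>"
    by (rule power_localization_unique[OF M base_change_graded[OF M] localized_moduleD(1)[OF N \<sigma>] _ subset_refl
          unit_map_localization[OF M] localized_homD(1)[OF f \<sigma>, unfolded Loc_simps] localized_homD(1)[OF g \<sigma>, unfolded Loc_simps] eq[OF \<sigma>]]) auto
  then show "f \<sigma> x = g \<sigma> x" by simp
qed

lemma Loc_functor: "is_functor (Rmod :: (('k::field, 'n::finite, 'a) gmod, 'a \<Rightarrow> 'a) cat) (Lcat K) (Loc K)"
  unfolding is_functor_def
proof (intro conjI ballI Rmod_category Lcat_category)
  fix X :: "('k, 'n, 'a) gmod" assume "X \<in> Obj Rmod"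
  then have X: "graded_module {} X" "finitely_generated {} X" by auto
  show LX: "Lobj K X \<in> Obj (Lcat K)" using Loc_localized[OF X] by simp
  then have LX': "localized_module K (Lobj K X)" by simp
  show "Lhom K X X (Idt Rmod X) = Idt (Lcat K) (Lobj K X)"
  proof (rule Loc_hom_ext[OF X(1) LX' _ localized_hom_id[OF LX']])
    show "Lhom K X X (Idt Rmod X) \<in> localized_hom K (Lobj K X) (Lobj K X)"
      unfolding Rmod_simps by (rule Loc_localized_hom[OF X(1) X(1) graded_hom_id[OF X(1)]])
    show "Lhom K X X (Idt Rmod X) \<sigma> (unit_map \<sigma> X x) = Idt (Lcat K) (Lobj K X) \<sigma> (unit_map \<sigma> X x)"
      if "\<sigma> \<in> missing_faces K" "x \<in> carrier X" for \<sigma> x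
      using Loc_hom(2)[OF X(1) X(1) graded_hom_id[OF X(1)] that] that
        graded_map.closed[OF unit_map_graded_map[OF X(1)] that(2), of \<sigma>] by (simp add: Loc_simps(1))
  qed
  fix Y :: "('k, 'n, 'a) gmod" assume "Y \<in> Obj Rmod"
  then have Y: "graded_module {} Y" "finitely_generated {} Y" by auto
  show "Lhom K X Y f \<in> Hom (Lcat K) (Lobj K X) (Lobj K Y)" if "f \<in> Hom Rmod X Y" for f
    using Loc_localized_hom[OF X(1) Y(1)] that by simp
  fix Z :: "('k, 'n, 'a) gmod" and f g assume "Z \<in> Obj Rmod" and "f \<in> Hom Rmod X Y" and "g \<in> Hom Rmod Y Z"
  then have Z: "graded_module {} Z" "finitely_generated {} Z" and f: "f \<in> graded_hom {} X Y" and g: "g \<in> graded_hom {} Y Z" by auto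
  interpret f: graded_map "{}" "{}" X Y f by unfold_locales (use f X Y in auto)
  have gf: "compose (carrier X) g f \<in> graded_hom {} X Z"
    by (rule graded_hom_compose[OF X(1) Y(1) Z(1) _ _ f g]) auto
  show "Lhom K X Z (Comp Rmod X Y Z g f) = Comp (Lcat K) (Lobj K X) (Lobj K Y) (Lobj K Z)
      (Lhom K Y Z g) (Lhom K X Y f)"
  proof (rule Loc_hom_ext[OF X(1) Loc_localized[OF Z]])
    show "Lhom K X Z (Comp Rmod X Y Z g f) \<in> localized_hom K (Lobj K X) (Lobj K Z)"
      unfolding Rmod_simps by (rule Loc_localized_hom[OF X(1) Z(1) gf])
    show "Comp (Lcat K) (Lobj K X) (Lobj K Y) (Lobj K Z) (Lhom K Y Z g) (Lhom K X Y f)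
        \<in> localized_hom K (Lobj K X) (Lobj K Z)"
      by (rule localized_hom_compose[OF Loc_localized[OF X] Loc_localized[OF Y] Loc_localized[OF Z]
            Loc_localized_hom[OF X(1) Y(1) f] Loc_localized_hom[OF Y(1) Z(1) g]])
    fix \<sigma> x assume \<sigma>: "\<sigma> \<in> missing_faces K" and x: "x \<in> carrier X"
    have u: "unit_map \<sigma> X x \<in> carrier (at_face (Lobj K X) \<sigma>)"
      unfolding Loc_simps by (rule graded_map.closed[OF unit_map_graded_map[OF X(1)] x])
    show "Lhom K X Z (Comp Rmod X Y Z g f) \<sigma> (unit_map \<sigma> X x)
        = Comp (Lcat K) (Lobj K X) (Lobj K Y) (Lobj K Z) (Lhom K Y Z g) (Lhom K X Y f) \<sigma> (unit_map \<sigma> X x)"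
      unfolding Lcat_comp_apply[OF \<sigma> u] Rmod_simps Loc_hom(2)[OF X(1) Z(1) gf \<sigma> x] Loc_hom(2)[OF X(1) Y(1) f \<sigma> x]
        Loc_hom(2)[OF Y(1) Z(1) g \<sigma> f.closed[OF x]] using x by (simp add: compose_def)
  qed
qed

section \<open>Kernels, cokernels and isomorphisms in \<open>R\<close>-mod and in \<open>\<L>(K)\<close>\<close>

text \<open>Both categories are described by the underlying functions of their arrows. An object \<open>X\<close> has
  a set \<open>U X\<close> of elements, among them the set \<open>Z X\<close> of zeros; for \<open>\<L>(K)\<close> an element is a pair of a
  missing face and an element of the module there, so that there is one zero for each missing face.\<close>

locale concrete_category = category C for C :: "('o, 'm) cat" +
  fixes U Z :: "'o \<Rightarrow> 'e set" and app :: "'m \<Rightarrow> 'e \<Rightarrow> 'e"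
  assumes closed: "\<lbrakk>X \<in> Obj C; Y \<in> Obj C; f \<in> Hom C X Y; x \<in> U X\<rbrakk> \<Longrightarrow> app f x \<in> U Y"
    and ext: "\<lbrakk>X \<in> Obj C; Y \<in> Obj C; f \<in> Hom C X Y; g \<in> Hom C X Y; \<And>x. x \<in> U X \<Longrightarrow> app f x = app g x\<rbrakk> \<Longrightarrow> f = g"
    and comp: "x \<in> U X \<Longrightarrow> app (Comp C X Y W g f) x = app g (app f x)"
    and idt: "x \<in> U X \<Longrightarrow> app (Idt C X) x = x"
    and zero_sub: "X \<in> Obj C \<Longrightarrow> Z X \<subseteq> U X"
    and zero_map: "\<lbrakk>X \<in> Obj C; Y \<in> Obj C; f \<in> Hom C X Y; x \<in> Z X\<rbrakk> \<Longrightarrow> app f x \<in> Z Y"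
    and zero_unique: "\<lbrakk>X \<in> Obj C; Y \<in> Obj C; f \<in> Hom C X Y; g \<in> Hom C X Y; x \<in> U X; app f x \<in> Z Y; app g x \<in> Z Y\<rbrakk> \<Longrightarrow>
      app f x = app g x"
    and zero_hom: "\<lbrakk>X \<in> Obj C; Y \<in> Obj C\<rbrakk> \<Longrightarrow> \<exists>f\<in>Hom C X Y. \<forall>x\<in>U X. app f x \<in> Z Y"
    and zero_ex: "X \<in> Obj C \<Longrightarrow> \<exists>N\<in>Obj C. U N = Z N"
    and lift: "\<lbrakk>N \<in> Obj C; X \<in> Obj C; T \<in> Obj C; i \<in> Hom C N X; inj_on (app i) (U N); g \<in> Hom C T X;
      app g ` U T \<subseteq> app i ` U N\<rbrakk> \<Longrightarrow> \<exists>h\<in>Hom C T N. \<forall>t\<in>U T. app i (app h t) = app g t"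
    and descend: "\<lbrakk>Y \<in> Obj C; Q \<in> Obj C; T \<in> Obj C; p \<in> Hom C Y Q; app p ` U Y = U Q; g \<in> Hom C Y T;
      \<And>y. y \<in> U Y \<Longrightarrow> app p y \<in> Z Q \<Longrightarrow> app g y \<in> Z T\<rbrakk> \<Longrightarrow> \<exists>h\<in>Hom C Q T. \<forall>y\<in>U Y. app h (app p y) = app g y"
begin

lemma zero_hom_unique:
  "\<lbrakk>X \<in> Obj C; Y \<in> Obj C; f \<in> Hom C X Y; g \<in> Hom C X Y; \<And>x. x \<in> U X \<Longrightarrow> app f x \<in> Z Y; \<And>x. x \<in> U X \<Longrightarrow> app g x \<in> Z Y\<rbrakk>
    \<Longrightarrow> f = g"
  by (rule ext) (auto intro: zero_unique)

lemma zero_object_iff: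
  assumes X: "X \<in> Obj C"
  shows "is_zero_object C X \<longleftrightarrow> U X = Z X"
proof
  assume z: "is_zero_object C X"
  obtain o' where o': "o' \<in> Hom C X X" "\<forall>x\<in>U X. app o' x \<in> Z X" using zero_hom[OF X X] by blast
  from zero_object_homs[OF z X, THEN conjunct1] obtain a where a: "\<And>b. b \<in> Hom C X X \<Longrightarrow> b = a"
    by (rule ex1_memE) (rule that)
  have "o' = Idt C X" by (rule trans[OF a[OF o'(1)] a[OF idt_in[OF X], symmetric]])
  then show "U X = Z X" using o'(2) idt zero_sub[OF X] by auto
next
  assume z: "U X = Z X"
  show "is_zero_object C X"
    unfolding is_zero_object_def
  proof (intro conjI ballI X)
    fix Y assume Y: "Y \<in> Obj C"
    obtain a where a: "a \<in> Hom C Y X" using zero_hom[OF Y X] by blast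
    show "\<exists>!f. f \<in> Hom C Y X"
      using a closed[OF Y X] unfolding z by (intro ex1I[of _ a] zero_hom_unique[OF Y X]) auto
    obtain b where b: "b \<in> Hom C X Y" using zero_hom[OF X Y] by blast
    show "\<exists>!f. f \<in> Hom C X Y"
      using b zero_map[OF X Y] unfolding z[symmetric] by (intro ex1I[of _ b] zero_hom_unique[OF X Y]) auto
  qed
qed

lemma zero_arrow_iff:
  assumes X: "X \<in> Obj C" and Y: "Y \<in> Obj C" and f: "f \<in> Hom C X Y"
  shows "is_zero_arrow C X Y f \<longleftrightarrow> (\<forall>x\<in>U X. app f x \<in> Z Y)"
proof
  assume "is_zero_arrow C X Y f"
  then obtain N g h where N: "is_zero_object C N" and g: "g \<in> Hom C X N" and h: "h \<in> Hom C N Y" and eq: "f = Comp C X N Y h g"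
    unfolding is_zero_arrow_def by blast
  have NO: "N \<in> Obj C" using N unfolding is_zero_object_def by blast
  show "\<forall>x\<in>U X. app f x \<in> Z Y"
    using zero_map[OF NO Y h] closed[OF X NO g] N unfolding zero_object_iff[OF NO] eq by (simp add: comp)
next
  assume z: "\<forall>x\<in>U X. app f x \<in> Z Y"
  obtain N where N: "N \<in> Obj C" "U N = Z N" using zero_ex[OF X] by blast
  obtain g where g: "g \<in> Hom C X N" using zero_hom[OF X N(1)] by blast
  obtain h where h: "h \<in> Hom C N Y" using zero_hom[OF N(1) Y] by blast
  have "f = Comp C X N Y h g"
    by (rule zero_hom_unique[OF X Y f comp_in[OF X N(1) Y g h]])
      (use z zero_map[OF N(1) Y h] closed[OF X N(1) g] N(2) in \<open>auto simp: comp\<close>)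
  then show "is_zero_arrow C X Y f"
    unfolding is_zero_arrow_def using g h N(2)[folded zero_object_iff[OF N(1)]] by (intro exI conjI)
qed

lemma kernel:
  assumes X: "X \<in> Obj C" and Y: "Y \<in> Obj C" and f: "f \<in> Hom C X Y" and N: "N \<in> Obj C" and i: "i \<in> Hom C N X"
    and inj: "inj_on (app i) (U N)" and im: "app i ` U N = {x \<in> U X. app f x \<in> Z Y}"
  shows "is_kernel C X Y f N i"
  unfolding is_kernel_def
proof (intro conjI ballI impI N i)
  show "is_zero_arrow C N Y (Comp C N X Y f i)"
    unfolding zero_arrow_iff[OF N Y comp_in[OF N X Y i f]] using im by (auto simp: comp)
  fix T g assume T: "T \<in> Obj C" and g: "g \<in> Hom C T X" and z: "is_zero_arrow C T Y (Comp C T X Y f g)"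
  have "app g ` U T \<subseteq> app i ` U N"
    using z closed[OF T X g] unfolding zero_arrow_iff[OF T Y comp_in[OF T X Y g f]] im by (auto simp: comp)
  from lift[OF N X T i inj g this] obtain h where h: "h \<in> Hom C T N" "\<And>t. t \<in> U T \<Longrightarrow> app i (app h t) = app g t" by blast
  show "\<exists>!h. h \<in> Hom C T N \<and> Comp C T N X i h = g"
  proof (rule ex1I, intro conjI)
    show "h \<in> Hom C T N" by (rule h)
    show "Comp C T N X i h = g" by (rule ext[OF T X comp_in[OF T N X h(1) i] g]) (simp add: comp h)
    fix k assume k: "k \<in> Hom C T N \<and> Comp C T N X i k = g"
    have ik: "app i (app k t) = app g t" if "t \<in> U T" for t using k comp[OF that, of N X i k] by simp
    show "k = h"
    proof (rule ext[OF T N conjunct1[OF k] h(1)])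
      fix t assume t: "t \<in> U T"
      show "app k t = app h t"
        by (rule inj_onD[OF inj _ closed[OF T N conjunct1[OF k] t] closed[OF T N h(1) t]]) (simp add: ik[OF t] h(2)[OF t])
    qed
  qed
qed

lemma cokernel:
  assumes X: "X \<in> Obj C" and Y: "Y \<in> Obj C" and f: "f \<in> Hom C X Y" and Q: "Q \<in> Obj C" and p: "p \<in> Hom C Y Q"
    and surj: "app p ` U Y = U Q" and ker: "\<And>y. y \<in> U Y \<Longrightarrow> app p y \<in> Z Q \<longleftrightarrow> y \<in> app f ` U X"
  shows "is_cokernel C X Y f Q p"
  unfolding is_cokernel_def
proof (intro conjI ballI impI Q p)
  show "is_zero_arrow C X Q (Comp C X Y Q p f)"
    unfolding zero_arrow_iff[OF X Q comp_in[OF X Y Q f p]] using ker[OF closed[OF X Y f]] by (auto simp: comp)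
  fix T g assume T: "T \<in> Obj C" and g: "g \<in> Hom C Y T" and z: "is_zero_arrow C X T (Comp C X Y T g f)"
  have "app g y \<in> Z T" if "y \<in> U Y" "app p y \<in> Z Q" for y
    using z ker[OF that(1)] that(2) unfolding zero_arrow_iff[OF X T comp_in[OF X Y T f g]] by (auto simp: comp)
  from descend[OF Y Q T p surj g this] obtain h where h: "h \<in> Hom C Q T" "\<And>y. y \<in> U Y \<Longrightarrow> app h (app p y) = app g y" by blast
  show "\<exists>!h. h \<in> Hom C Q T \<and> Comp C Y Q T h p = g"
  proof (rule ex1I, intro conjI)
    show "h \<in> Hom C Q T" by (rule h)
    show "Comp C Y Q T h p = g" by (rule ext[OF Y T comp_in[OF Y Q T p h(1)] g]) (simp add: comp h)
    fix k assume k: "k \<in> Hom C Q T \<and> Comp C Y Q T k p = g"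
    have kp: "app k (app p y) = app g y" if "y \<in> U Y" for y using k comp[OF that, of Q T k p] by simp
    show "k = h"
    proof (rule ext[OF Q T conjunct1[OF k] h(1)])
      fix x assume "x \<in> U Q"
      then obtain y where y: "y \<in> U Y" "x = app p y" unfolding surj[symmetric] by blast
      show "app k x = app h x" unfolding y(2) kp[OF y(1)] h(2)[OF y(1)] ..
    qed
  qed
qed

lemma iso_iff:
  assumes X: "X \<in> Obj C" and Y: "Y \<in> Obj C" and f: "f \<in> Hom C X Y"
  shows "is_iso_arrow C X Y f \<longleftrightarrow> bij_betw (app f) (U X) (U Y)"
proof
  assume "is_iso_arrow C X Y f"
  then obtain g where g: "g \<in> Hom C Y X" "Comp C X Y X g f = Idt C X" "Comp C Y X Y f g = Idt C Y"
    unfolding is_iso_arrow_def by blast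
  have "app g (app f x) = x" if "x \<in> U X" for x using comp[OF that, of Y X g f] idt[OF that] g(2) by simp
  moreover have "app f (app g y) = y" if "y \<in> U Y" for y using comp[OF that, of X Y f g] idt[OF that] g(3) by simp
  ultimately show "bij_betw (app f) (U X) (U Y)"
    using closed[OF X Y f] closed[OF Y X g(1)] by (intro bij_betwI[where g = "app g"]) auto
next
  assume bij: "bij_betw (app f) (U X) (U Y)"
  then have inj: "inj_on (app f) (U X)" unfolding bij_betw_def by blast
  obtain g where g: "g \<in> Hom C Y X" and "\<forall>y\<in>U Y. app f (app g y) = app (Idt C Y) y"
    using lift[OF X Y Y f inj idt_in[OF Y]] bij idt unfolding bij_betw_def by auto
  then have fg: "app f (app g y) = y" if "y \<in> U Y" for y using that idt by simp
  have "Comp C Y X Y f g = Idt C Y"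
    by (rule ext[OF Y Y comp_in[OF Y X Y g f] idt_in[OF Y]]) (simp add: comp idt fg)
  moreover have "Comp C X Y X g f = Idt C X"
    by (rule ext[OF X X comp_in[OF X Y X f g] idt_in[OF X]])
      (use closed[OF X Y f] closed[OF Y X g] in \<open>simp add: comp idt inj_onD[OF inj fg]\<close>)
  ultimately show "is_iso_arrow C X Y f" unfolding is_iso_arrow_def using f g by blast
qed

text \<open>As kernels are unique up to isomorphism, any categorical kernel is the inclusion of the
  set-theoretic one, up to an isomorphism; similarly for cokernels.\<close>

lemma kernel_iff:
  assumes X: "X \<in> Obj C" and Y: "Y \<in> Obj C" and f: "f \<in> Hom C X Y"
    and M: "M \<in> Obj C" and j: "j \<in> Hom C M X" and inj: "inj_on (app j) (U M)" and im: "app j ` U M = {x \<in> U X. app f x \<in> Z Y}"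
  shows "is_kernel C X Y f N i \<longleftrightarrow>
    N \<in> Obj C \<and> i \<in> Hom C N X \<and> inj_on (app i) (U N) \<and> app i ` U N = {x \<in> U X. app f x \<in> Z Y}"
proof
  assume k: "is_kernel C X Y f N i"
  have k': "is_kernel C X Y f M j" by (rule kernel[OF X Y f M j inj im])
  note D = k[unfolded is_kernel_def] k'[unfolded is_kernel_def]
  have N: "N \<in> Obj C" and i: "i \<in> Hom C N X" using D(1) by blast+
  obtain a where a: "a \<in> Hom C N M" "Comp C N M X j a = i" using D by blast
  obtain b where b: "b \<in> Hom C M N" "Comp C M N X i b = j" using D by blast
  have "Comp C N N X i (Comp C N M N b a) = i" using comp_assoc[OF N M N X a(1) b(1) i] a b by simp
  moreover have "\<exists>!h. h \<in> Hom C N N \<and> Comp C N N X i h = i" using D(1) by blast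
  ultimately have "Comp C N M N b a = Idt C N" using comp_in[OF N M N a(1) b(1)] idt_in[OF N] comp_idt[OF N X i] by blast
  moreover have "Comp C M M X j (Comp C M N M a b) = j" using comp_assoc[OF M N M X b(1) a(1) j] a b by simp
  then have "Comp C M N M a b = Idt C M"
    using comp_in[OF M N M b(1) a(1)] idt_in[OF M] comp_idt[OF M X j] D(2) by blast
  ultimately have "is_iso_arrow C N M a" unfolding is_iso_arrow_def using a b by blast
  then have bij: "bij_betw (app a) (U N) (U M)" unfolding iso_iff[OF N M a(1)] .
  have ia: "app i n = app j (app a n)" if "n \<in> U N" for n using comp[OF that, of M X j a] a(2) by simp
  have "app i ` U N = app j ` U M" unfolding bij_betw_imp_surj_on[OF bij, symmetric] image_image by (rule image_cong[OF refl ia])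
  moreover have "inj_on (app i) (U N)"
    using comp_inj_on[OF bij_betw_imp_inj_on[OF bij], of "app j"] inj ia
    unfolding bij_betw_imp_surj_on[OF bij] by (simp add: inj_on_def)
  ultimately show "N \<in> Obj C \<and> i \<in> Hom C N X \<and> inj_on (app i) (U N) \<and> app i ` U N = {x \<in> U X. app f x \<in> Z Y}"
    using N i im by simp
next
  assume "N \<in> Obj C \<and> i \<in> Hom C N X \<and> inj_on (app i) (U N) \<and> app i ` U N = {x \<in> U X. app f x \<in> Z Y}"
  then show "is_kernel C X Y f N i" by (elim conjE) (rule kernel[OF X Y f])
qed

lemma cokernel_iff:
  assumes X: "X \<in> Obj C" and Y: "Y \<in> Obj C" and f: "f \<in> Hom C X Y"
    and P: "P \<in> Obj C" and j: "j \<in> Hom C Y P" and surj: "app j ` U Y = U P"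
    and ker: "\<And>y. y \<in> U Y \<Longrightarrow> app j y \<in> Z P \<longleftrightarrow> y \<in> app f ` U X"
  shows "is_cokernel C X Y f Q p \<longleftrightarrow>
    Q \<in> Obj C \<and> p \<in> Hom C Y Q \<and> app p ` U Y = U Q \<and> (\<forall>y\<in>U Y. app p y \<in> Z Q \<longleftrightarrow> y \<in> app f ` U X)"
proof
  assume k: "is_cokernel C X Y f Q p"
  have k': "is_cokernel C X Y f P j" by (rule cokernel[OF X Y f P j surj ker])
  note D = k[unfolded is_cokernel_def] k'[unfolded is_cokernel_def]
  have Q: "Q \<in> Obj C" and p: "p \<in> Hom C Y Q" using D(1) by blast+
  obtain a where a: "a \<in> Hom C P Q" "Comp C Y P Q a j = p" using D by blast
  obtain b where b: "b \<in> Hom C Q P" "Comp C Y Q P b p = j" using D by blast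
  have "Comp C Y Q Q (Comp C Q P Q a b) p = p" using comp_assoc[OF Y Q P Q p b(1) a(1)] a b by simp
  moreover have "\<exists>!h. h \<in> Hom C Q Q \<and> Comp C Y Q Q h p = p" using D(1) by blast
  ultimately have "Comp C Q P Q a b = Idt C Q" using comp_in[OF Q P Q b(1) a(1)] idt_in[OF Q] idt_comp[OF Y Q p] by blast
  moreover have "Comp C Y P P (Comp C P Q P b a) j = j" using comp_assoc[OF Y P Q P j a(1) b(1)] a b by simp
  then have "Comp C P Q P b a = Idt C P"
    using comp_in[OF P Q P a(1) b(1)] idt_in[OF P] idt_comp[OF Y P j] D(2) by blast
  ultimately have "is_iso_arrow C P Q a" unfolding is_iso_arrow_def using a b by blast
  then have bij: "bij_betw (app a) (U P) (U Q)" unfolding iso_iff[OF P Q a(1)] .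
  have pa: "app p y = app a (app j y)" and pb: "app j y = app b (app p y)" if "y \<in> U Y" for y
    using comp[OF that, of P Q a j] comp[OF that, of Q P b p] a(2) b(2) by simp_all
  have "app p ` U Y = U Q" unfolding bij_betw_imp_surj_on[OF bij, symmetric] surj[symmetric] image_image by (rule image_cong[OF refl pa])
  moreover have "app p y \<in> Z Q \<longleftrightarrow> y \<in> app f ` U X" if "y \<in> U Y" for y
    using zero_map[OF P Q a(1)] zero_map[OF Q P b(1)] pa[OF that] pb[OF that] ker[OF that] by metis
  ultimately show "Q \<in> Obj C \<and> p \<in> Hom C Y Q \<and> app p ` U Y = U Q \<and> (\<forall>y\<in>U Y. app p y \<in> Z Q \<longleftrightarrow> y \<in> app f ` U X)"
    using Q p by blast
next
  assume "Q \<in> Obj C \<and> p \<in> Hom C Y Q \<and> app p ` U Y = U Q \<and> (\<forall>y\<in>U Y. app p y \<in> Z Q \<longleftrightarrow> y \<in> app f ` U X)"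
  then show "is_cokernel C X Y f Q p" by (elim conjE) (rule cokernel[OF X Y f], assumption+, rule bspec)
qed

end

lemma graded_zeroI:
  assumes "graded_module \<sigma> Z" "carrier Z = {\<zero>\<^bsub>Z\<^esub>}"
  shows "finitely_generated \<sigma> Z"
proof -
  interpret Z: graded_mod \<sigma> Z by unfold_locales (rule assms(1))
  have "gspan \<sigma> Z {} = carrier Z" unfolding gspan_def using graded_subD(2) assms(2) by auto
  then show ?thesis unfolding Z.finitely_generated_iff by (intro exI[of _ "{}"]) simp
qed

lemma Rmod_concrete:
  "concrete_category (Rmod :: (('k::field, 'n::finite, 'a) gmod, 'a \<Rightarrow> 'a) cat) carrier (\<lambda>X. {\<zero>\<^bsub>X\<^esub>}) (\<lambda>f. f)"
proof (rule concrete_category.intro, rule category.intro[OF Rmod_category], rule concrete_category_axioms.intro)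
  fix X Y Q T N W :: "('k, 'n, 'a) gmod" and f g i p :: "'a \<Rightarrow> 'a" and x :: 'a
  show "Comp Rmod X Y W g f x = g (f x)" if "x \<in> carrier X" using that by (simp add: compose_def)
  show "Idt Rmod X x = x" if "x \<in> carrier X" using that by simp
  assume X: "X \<in> Obj Rmod"
  then have gX: "graded_module {} X" by simp
  interpret X: graded_mod "{}" X by unfold_locales (rule gX)
  show "{\<zero>\<^bsub>X\<^esub>} \<subseteq> carrier X" by simp
  have z: "graded_module {} (sub_object X {\<zero>\<^bsub>X\<^esub>})" by (rule X.graded_sub_object(1)[OF X.graded_sub_zero])
  show "\<exists>N\<in>Obj Rmod. carrier (N :: ('k, 'n, 'a) gmod) = {\<zero>\<^bsub>N\<^esub>}"
    using z graded_zeroI[OF z] by (intro bexI[of _ "sub_object X {\<zero>\<^bsub>X\<^esub>}"]) auto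
  assume Y: "Y \<in> Obj Rmod"
  then have gY: "graded_module {} Y" by simp
  show "\<exists>f\<in>Hom Rmod X Y. \<forall>x\<in>carrier X. f x \<in> {\<zero>\<^bsub>Y\<^esub>}"
    using graded_hom_zero[OF gX gY] by (intro bexI[of _ "\<lambda>x\<in>carrier X. \<zero>\<^bsub>Y\<^esub>"]) auto
  show "\<exists>h\<in>Hom Rmod T X. \<forall>t\<in>carrier T. i (h t) = g t"
    if "T \<in> Obj Rmod" "i \<in> Hom Rmod X Y" "inj_on i (carrier X)" "g \<in> Hom Rmod T Y" "g ` carrier T \<subseteq> i ` carrier X"
    using graded_hom_lift[OF gX gY _ _ that(3), of T g] that by (simp add: image_subset_iff)
  show "\<exists>h\<in>Hom Rmod Y T. \<forall>y\<in>carrier X. h (p y) = g y"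
    if "T \<in> Obj Rmod" "p \<in> Hom Rmod X Y" "p ` carrier X = carrier Y" "g \<in> Hom Rmod X T"
      "\<And>y. y \<in> carrier X \<Longrightarrow> p y \<in> {\<zero>\<^bsub>Y\<^esub>} \<Longrightarrow> g y \<in> {\<zero>\<^bsub>T\<^esub>}"
    using graded_hom_descend[OF gX gY _ _ that(3)] that by auto
  assume f: "f \<in> Hom Rmod X Y"
  interpret f: graded_map "{}" "{}" X Y f by unfold_locales (use gX gY f in auto)
  show "f x \<in> carrier Y" if "x \<in> carrier X" by (rule f.closed[OF that])
  show "f x \<in> {\<zero>\<^bsub>Y\<^esub>}" if "x \<in> {\<zero>\<^bsub>X\<^esub>}" using that f.zero by simp
  assume g: "g \<in> Hom Rmod X Y"
  show "f = g" if "\<And>x. x \<in> carrier X \<Longrightarrow> f x = g x" using graded_hom_eqI[of f _ X Y g] that f g by simp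
  show "f x = g x" if "x \<in> carrier X" "f x \<in> {\<zero>\<^bsub>Y\<^esub>}" "g x \<in> {\<zero>\<^bsub>Y\<^esub>}" using that by simp
qed

interpretation Rmod: concrete_category "Rmod :: (('k::field, 'n::finite, 'a) gmod, 'a \<Rightarrow> 'a) cat" carrier "\<lambda>X. {\<zero>\<^bsub>X\<^esub>}" "\<lambda>f. f"
  by (rule Rmod_concrete)

lemma Rmod_kernel_exists:
  assumes X: "X \<in> Obj Rmod" and Y: "Y \<in> Obj Rmod" and f: "f \<in> Hom Rmod X Y"
  shows "\<exists>N\<in>Obj Rmod. \<exists>i\<in>Hom Rmod N X. inj_on i (carrier N) \<and> i ` carrier N = {x \<in> carrier X. f x = \<zero>\<^bsub>Y\<^esub>}"
proof -
  have gm: "graded_module {} X" "graded_module {} Y" and fh: "f \<in> graded_hom {} X Y" using X Y f by auto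
  interpret f: graded_map "{}" "{}" X Y f by unfold_locales (use gm fh in auto)
  let ?H = "{x \<in> carrier X. f x = \<zero>\<^bsub>Y\<^esub>}"
  note H = f.kernel_sub
  have "sub_object X ?H \<in> Obj Rmod"
    using f.M.graded_sub_object(1)[OF H] f.M.noetherian[OF _ _ H] X by simp
  moreover have "(\<lambda>x\<in>?H. x) \<in> Hom Rmod (sub_object X ?H) X" using graded_hom_inclusion[OF gm(1) H] by simp
  ultimately show ?thesis by (intro bexI[of _ "sub_object X ?H"] bexI[of _ "\<lambda>x\<in>?H. x"]) (auto simp: inj_on_def)
qed

lemma Rmod_cokernel_exists:
  fixes X Y :: "('k::field, 'n::finite, 'a) gmod"
  assumes X: "X \<in> Obj Rmod" and Y: "Y \<in> Obj Rmod" and f: "f \<in> Hom Rmod X Y"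
  shows "\<exists>Q\<in>Obj Rmod. \<exists>p\<in>Hom Rmod Y Q. p ` carrier Y = carrier Q \<and> (\<forall>y\<in>carrier Y. p y = \<zero>\<^bsub>Q\<^esub> \<longleftrightarrow> y \<in> f ` carrier X)"
proof -
  have gm: "graded_module {} X" "graded_module {} Y" and fh: "f \<in> graded_hom {} X Y" using X Y f by auto
  interpret f: graded_map "{}" "{}" X Y f by unfold_locales (use gm fh in auto)
  obtain Q :: "('k, 'n, 'a) gmod" and p where Q: "graded_module {} Q" and p: "p \<in> graded_hom {} Y Q"
    and surj: "p ` carrier Y = carrier Q" and ker: "\<forall>y\<in>carrier Y. p y = \<zero>\<^bsub>Q\<^esub> \<longleftrightarrow> y \<in> f ` carrier X"
    using graded_cokernel[OF gm(2) f.image_sub] by blast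
  have "finitely_generated {} Q"
    by (rule finitely_generated_image[OF gm(2) Q subset_refl p]) (use Y surj in auto)
  then show ?thesis using Q p surj ker by (intro bexI[of _ Q] bexI[of _ p]) auto
qed

lemma Rmod_kernel_iff:
  assumes "X \<in> Obj Rmod" "Y \<in> Obj Rmod" "f \<in> Hom Rmod X Y"
  shows "is_kernel Rmod X Y f N i \<longleftrightarrow> N \<in> Obj Rmod \<and> i \<in> Hom Rmod N X \<and> inj_on i (carrier N) \<and>
    i ` carrier N = {x \<in> carrier X. f x = \<zero>\<^bsub>Y\<^esub>}"
proof -
  obtain M j where "M \<in> Obj Rmod" "j \<in> Hom Rmod M X" "inj_on j (carrier M)" "j ` carrier M = {x \<in> carrier X. f x \<in> {\<zero>\<^bsub>Y\<^esub>}}"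
    using Rmod_kernel_exists[OF assms] by auto
  from Rmod.kernel_iff[OF assms this] show ?thesis by simp
qed

lemma Rmod_cokernel_iff:
  assumes "X \<in> Obj Rmod" "Y \<in> Obj Rmod" "f \<in> Hom Rmod X Y"
  shows "is_cokernel Rmod X Y f Q p \<longleftrightarrow> Q \<in> Obj Rmod \<and> p \<in> Hom Rmod Y Q \<and> p ` carrier Y = carrier Q \<and>
    (\<forall>y\<in>carrier Y. p y = \<zero>\<^bsub>Q\<^esub> \<longleftrightarrow> y \<in> f ` carrier X)"
proof -
  obtain P j where P: "P \<in> Obj Rmod" "j \<in> Hom Rmod Y P" "j ` carrier Y = carrier P"
    and ker: "\<And>y. y \<in> carrier Y \<Longrightarrow> j y \<in> {\<zero>\<^bsub>P\<^esub>} \<longleftrightarrow> y \<in> f ` carrier X"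
    using Rmod_cokernel_exists[OF assms] by auto
  from Rmod.cokernel_iff[OF assms P ker] show ?thesis by simp
qed

lemma localized_hom_zero:
  assumes X: "localized_module K X" and Y: "localized_module K Y"
  shows "(\<lambda>\<sigma>\<in>missing_faces K. \<lambda>x\<in>carrier (at_face X \<sigma>). \<zero>\<^bsub>at_face Y \<sigma>\<^esub>) \<in> localized_hom K X Y"
proof (rule localized_homI)
  fix \<sigma> assume \<sigma>: "\<sigma> \<in> missing_faces K"
  show "(\<lambda>x\<in>carrier (at_face X \<sigma>). \<zero>\<^bsub>at_face Y \<sigma>\<^esub>) \<in> graded_hom \<sigma> (at_face X \<sigma>) (at_face Y \<sigma>)"
    by (rule graded_hom_zero[OF localized_moduleD(1)[OF X \<sigma>] localized_moduleD(1)[OF Y \<sigma>]])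
  fix \<tau> x assume \<tau>: "\<tau> \<in> missing_faces K" "\<sigma> \<subseteq> \<tau>" and x: "x \<in> carrier (at_face X \<sigma>)"
  interpret t: graded_map \<sigma> \<tau> "at_face X \<sigma>" "at_face X \<tau>" "transition X \<sigma> \<tau>" by (rule localized_module_map[OF X \<sigma> \<tau>])
  interpret s: graded_map \<sigma> \<tau> "at_face Y \<sigma>" "at_face Y \<tau>" "transition Y \<sigma> \<tau>" by (rule localized_module_map[OF Y \<sigma> \<tau>])
  show "transition X \<sigma> \<tau> x \<in> carrier (at_face X \<tau>)" by (rule t.closed[OF x])
  show "(\<lambda>x\<in>carrier (at_face X \<tau>). \<zero>\<^bsub>at_face Y \<tau>\<^esub>) (transition X \<sigma> \<tau> x) =
      transition Y \<sigma> \<tau> ((\<lambda>x\<in>carrier (at_face X \<sigma>). \<zero>\<^bsub>at_face Y \<sigma>\<^esub>) x)" using x t.closed[OF x] s.zero by simp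
qed

abbreviation "points K X \<equiv> SIGMA \<sigma>:missing_faces K. carrier (at_face X \<sigma>)"
abbreviation "zeros K X \<equiv> (\<lambda>\<sigma>. (\<sigma>, \<zero>\<^bsub>at_face X \<sigma>\<^esub>)) ` missing_faces K"
abbreviation "on_points f \<equiv> \<lambda>(\<sigma>, x). (\<sigma>, f \<sigma> x)"

lemma localized_zero_exists:
  fixes X :: "('k::field, 'n::finite, 'b) lmod"
  assumes X: "localized_module K X"
  shows "\<exists>Z\<in>Obj (Lcat K). points K (Z :: ('k, 'n, 'b) lmod) = zeros K Z"
proof -
  let ?S = "\<lambda>\<sigma>. sub_object (at_face X \<sigma>) {\<zero>\<^bsub>at_face X \<sigma>\<^esub>}"
  let ?Z = "\<lparr>at_face = ?S, transition = (\<lambda>\<sigma> \<tau>. \<lambda>x\<in>{\<zero>\<^bsub>at_face X \<sigma>\<^esub>}. \<zero>\<^bsub>at_face X \<tau>\<^esub>)\<rparr>"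
  have S: "graded_module \<sigma> (?S \<sigma>)" if \<sigma>: "\<sigma> \<in> missing_faces K" for \<sigma>
  proof -
    interpret X\<sigma>: graded_mod \<sigma> "at_face X \<sigma>" by unfold_locales (rule localized_moduleD(1)[OF X \<sigma>])
    show ?thesis by (rule X\<sigma>.graded_sub_object(1)[OF X\<sigma>.graded_sub_zero])
  qed
  have "localized_module K ?Z"
  proof (rule localized_moduleI)
    fix \<sigma> assume \<sigma>: "\<sigma> \<in> missing_faces K"
    show "graded_module \<sigma> (at_face ?Z \<sigma>)" using S[OF \<sigma>] by simp
    show "finitely_generated \<sigma> (at_face ?Z \<sigma>)" using graded_zeroI[OF S[OF \<sigma>]] by simp
    fix \<tau> assume \<tau>: "\<tau> \<in> missing_faces K" "\<sigma> \<subseteq> \<tau>"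
    interpret s: graded_mod \<sigma> "?S \<sigma>" by unfold_locales (rule S[OF \<sigma>])
    interpret t: graded_mod \<tau> "?S \<tau>" by unfold_locales (rule S[OF \<tau>(1)])
    have st: "a \<in> loc_degrees \<tau>" if "a \<in> loc_degrees \<sigma>" for a using loc_degrees_mono[OF \<tau>(2)] that by blast
    have "(\<lambda>x\<in>carrier (?S \<sigma>). \<zero>\<^bsub>?S \<tau>\<^esub>) \<in> graded_hom \<sigma> (?S \<sigma>) (?S \<tau>)"
      by (rule graded_hom_restrictI[OF S[OF \<sigma>] S[OF \<tau>(1)] \<tau>(2)])
        (use t.zero_hcomp t.M.l_zero t.smult_r_null[OF single_loc_ring[OF st]] in auto)
    then show "power_localization \<sigma> \<tau> (at_face ?Z \<sigma>) (at_face ?Z \<tau>) (transition ?Z \<sigma> \<tau>)"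
      unfolding power_localization_def using s.smult_1 t.smult_1 by (auto intro!: exI[of _ 0])
  qed auto
  then show ?thesis by (intro bexI[of _ ?Z]) auto
qed

lemma Lcat_concrete:
  "concrete_category (Lcat K :: (('k::field, 'n::finite, 'b) lmod, 'n set \<Rightarrow> 'b \<Rightarrow> 'b) cat) (points K) (zeros K) on_points"
proof (rule concrete_category.intro, rule category.intro[OF Lcat_category], rule concrete_category_axioms.intro)
  fix X Y T W :: "('k, 'n, 'b) lmod" and f g i p :: "'n set \<Rightarrow> 'b \<Rightarrow> 'b" and x :: "'n set \<times> 'b"
  let ?F = "missing_faces K"
  show "on_points (Comp (Lcat K) X Y W g f) x = on_points g (on_points f x)" if "x \<in> points K X" using that by (auto simp: compose_def)
  show "on_points (Idt (Lcat K) X) x = x" if "x \<in> points K X" using that by auto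
  assume "X \<in> Obj (Lcat K)"
  then have X: "localized_module K X" by simp
  note gX = localized_moduleD(1)[OF X]
  have "\<zero>\<^bsub>at_face X \<sigma>\<^esub> \<in> carrier (at_face X \<sigma>)" if \<sigma>: "\<sigma> \<in> ?F" for \<sigma>
  proof -
    interpret M: graded_mod \<sigma> "at_face X \<sigma>" by unfold_locales (rule gX[OF \<sigma>])
    show ?thesis by simp
  qed
  then show "zeros K X \<subseteq> points K X" by auto
  show "\<exists>N\<in>Obj (Lcat K). points K (N :: ('k, 'n, 'b) lmod) = zeros K N" by (rule localized_zero_exists[OF X])
  assume "Y \<in> Obj (Lcat K)"
  then have Y: "localized_module K Y" by simp
  note gY = localized_moduleD(1)[OF Y]
  show "\<exists>f\<in>Hom (Lcat K) X Y. \<forall>x\<in>points K X. on_points f x \<in> zeros K Y"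
    using localized_hom_zero[OF X Y] by (intro bexI[of _ "\<lambda>\<sigma>\<in>?F. \<lambda>x\<in>carrier (at_face X \<sigma>). \<zero>\<^bsub>at_face Y \<sigma>\<^esub>"]) auto
  show "\<exists>h\<in>Hom (Lcat K) T X. \<forall>t\<in>points K T. on_points i (on_points h t) = on_points g t"
    if "T \<in> Obj (Lcat K)" "i \<in> Hom (Lcat K) X Y" and inj: "inj_on (on_points i) (points K X)" and "g \<in> Hom (Lcat K) T Y"
      and im: "on_points g ` points K T \<subseteq> on_points i ` points K X"
  proof -
    have T: "localized_module K T" and i: "i \<in> localized_hom K X Y" and g: "g \<in> localized_hom K T Y" using that by simp_all
    have inj': "inj_on (i \<sigma>) (carrier (at_face X \<sigma>))" if "\<sigma> \<in> ?F" for \<sigma>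
      using that by (intro inj_onI) (use inj_onD[OF inj, of "(\<sigma>, _)" "(\<sigma>, _)"] in auto)
    have "\<forall>\<sigma>\<in>?F. \<exists>h. h \<in> graded_hom \<sigma> (at_face T \<sigma>) (at_face X \<sigma>) \<and> (\<forall>t\<in>carrier (at_face T \<sigma>). i \<sigma> (h t) = g \<sigma> t)"
    proof
      fix \<sigma> assume \<sigma>: "\<sigma> \<in> ?F"
      have "g \<sigma> t \<in> i \<sigma> ` carrier (at_face X \<sigma>)" if "t \<in> carrier (at_face T \<sigma>)" for t
        using subsetD[OF im, of "(\<sigma>, g \<sigma> t)"] that \<sigma> by force
      from graded_hom_lift[OF gX[OF \<sigma>] gY[OF \<sigma>] localized_moduleD(1)[OF T \<sigma>] localized_homD(1)[OF i \<sigma>] inj'[OF \<sigma>] localized_homD(1)[OF g \<sigma>] this]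
      show "\<exists>h. h \<in> graded_hom \<sigma> (at_face T \<sigma>) (at_face X \<sigma>) \<and> (\<forall>t\<in>carrier (at_face T \<sigma>). i \<sigma> (h t) = g \<sigma> t)" by blast
    qed
    from bchoice[OF this] obtain h where h: "\<And>\<sigma>. \<sigma> \<in> ?F \<Longrightarrow> h \<sigma> \<in> graded_hom \<sigma> (at_face T \<sigma>) (at_face X \<sigma>)"
      and ih: "\<And>\<sigma> t. \<sigma> \<in> ?F \<Longrightarrow> t \<in> carrier (at_face T \<sigma>) \<Longrightarrow> i \<sigma> (h \<sigma> t) = g \<sigma> t" by blast
    have hc: "h \<sigma> t \<in> carrier (at_face X \<sigma>)" if "\<sigma> \<in> ?F" "t \<in> carrier (at_face T \<sigma>)" for \<sigma> t
      using h[OF that(1)] that(2) unfolding graded_hom_def by auto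
    have "restrict h ?F \<in> localized_hom K T X"
    proof (rule localized_homI[OF h])
      fix \<sigma> \<tau> t assume \<sigma>: "\<sigma> \<in> ?F" and \<tau>: "\<tau> \<in> ?F" "\<sigma> \<subseteq> \<tau>" and t: "t \<in> carrier (at_face T \<sigma>)"
      note tT = graded_map.closed[OF localized_module_map[OF T \<sigma> \<tau>] t]
      note tX = graded_map.closed[OF localized_module_map[OF X \<sigma> \<tau>] hc[OF \<sigma> t]]
      show "transition T \<sigma> \<tau> t \<in> carrier (at_face T \<tau>)" by (rule tT)
      show "h \<tau> (transition T \<sigma> \<tau> t) = transition X \<sigma> \<tau> (h \<sigma> t)"
      proof (rule inj_onD[OF inj'[OF \<tau>(1)] _ hc[OF \<tau>(1) tT] tX])
        show "i \<tau> (h \<tau> (transition T \<sigma> \<tau> t)) = i \<tau> (transition X \<sigma> \<tau> (h \<sigma> t))"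
          unfolding ih[OF \<tau>(1) tT] localized_homD(2)[OF g \<sigma> \<tau> t] localized_homD(2)[OF i \<sigma> \<tau> hc[OF \<sigma> t]] ih[OF \<sigma> t] ..
      qed
    qed
    then show ?thesis using ih by (intro bexI[of _ "restrict h ?F"]) auto
  qed
  show "\<exists>h\<in>Hom (Lcat K) Y T. \<forall>y\<in>points K X. on_points h (on_points p y) = on_points g y"
    if "T \<in> Obj (Lcat K)" "p \<in> Hom (Lcat K) X Y" and surj: "on_points p ` points K X = points K Y" and "g \<in> Hom (Lcat K) X T"
      and ker: "\<And>y. y \<in> points K X \<Longrightarrow> on_points p y \<in> zeros K Y \<Longrightarrow> on_points g y \<in> zeros K T"
  proof -
    have T: "localized_module K T" and p: "p \<in> localized_hom K X Y" and g: "g \<in> localized_hom K X T" using that by simp_all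
    have surj': "\<exists>y. y \<in> carrier (at_face X \<sigma>) \<and> x = p \<sigma> y" if "\<sigma> \<in> ?F" "x \<in> carrier (at_face Y \<sigma>)" for \<sigma> x
    proof -
      have "(\<sigma>, x) \<in> on_points p ` points K X" unfolding surj using that by simp
      then show ?thesis by auto
    qed
    note pc = graded_map.closed[OF localized_hom_map[OF X Y p]]
    have "\<forall>\<sigma>\<in>?F. \<exists>h. h \<in> graded_hom \<sigma> (at_face Y \<sigma>) (at_face T \<sigma>) \<and> (\<forall>y\<in>carrier (at_face X \<sigma>). h (p \<sigma> y) = g \<sigma> y)"
    proof
      fix \<sigma> assume \<sigma>: "\<sigma> \<in> ?F"
      have im: "p \<sigma> ` carrier (at_face X \<sigma>) = carrier (at_face Y \<sigma>)" using surj'[OF \<sigma>] pc[OF \<sigma>] by blast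
      have "g \<sigma> y = \<zero>\<^bsub>at_face T \<sigma>\<^esub>" if "y \<in> carrier (at_face X \<sigma>)" "p \<sigma> y = \<zero>\<^bsub>at_face Y \<sigma>\<^esub>" for y
        using ker[of "(\<sigma>, y)"] that \<sigma> by auto
      from graded_hom_descend[OF gX[OF \<sigma>] gY[OF \<sigma>] localized_moduleD(1)[OF T \<sigma>] localized_homD(1)[OF p \<sigma>] im localized_homD(1)[OF g \<sigma>] this]
      show "\<exists>h. h \<in> graded_hom \<sigma> (at_face Y \<sigma>) (at_face T \<sigma>) \<and> (\<forall>y\<in>carrier (at_face X \<sigma>). h (p \<sigma> y) = g \<sigma> y)" by blast
    qed
    from bchoice[OF this] obtain h where h: "\<And>\<sigma>. \<sigma> \<in> ?F \<Longrightarrow> h \<sigma> \<in> graded_hom \<sigma> (at_face Y \<sigma>) (at_face T \<sigma>)"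
      and hp: "\<And>\<sigma> y. \<sigma> \<in> ?F \<Longrightarrow> y \<in> carrier (at_face X \<sigma>) \<Longrightarrow> h \<sigma> (p \<sigma> y) = g \<sigma> y" by blast
    have "restrict h ?F \<in> localized_hom K Y T"
    proof (rule localized_homI[OF h])
      fix \<sigma> \<tau> x assume \<sigma>: "\<sigma> \<in> ?F" and \<tau>: "\<tau> \<in> ?F" "\<sigma> \<subseteq> \<tau>" and x: "x \<in> carrier (at_face Y \<sigma>)"
      show "transition Y \<sigma> \<tau> x \<in> carrier (at_face Y \<tau>)" by (rule graded_map.closed[OF localized_module_map[OF Y \<sigma> \<tau>] x])
      obtain y where y: "y \<in> carrier (at_face X \<sigma>)" and xy: "x = p \<sigma> y" using surj'[OF \<sigma> x] by blast
      note tX = graded_map.closed[OF localized_module_map[OF X \<sigma> \<tau>] y]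
      show "h \<tau> (transition Y \<sigma> \<tau> x) = transition T \<sigma> \<tau> (h \<sigma> x)"
        unfolding xy hp[OF \<sigma> y] localized_homD(2)[OF p \<sigma> \<tau> y, symmetric] hp[OF \<tau>(1) tX] by (rule localized_homD(2)[OF g \<sigma> \<tau> y])
    qed
    then show ?thesis using hp by (intro bexI[of _ "restrict h ?F"]) auto
  qed
  assume "f \<in> Hom (Lcat K) X Y"
  then have f: "f \<in> localized_hom K X Y" by simp
  note fm = localized_hom_map[OF X Y f]
  show "on_points f x \<in> points K Y" if "x \<in> points K X" using that graded_map.closed[OF fm] by auto
  show "on_points f x \<in> zeros K Y" if "x \<in> zeros K X" using that graded_map.zero[OF fm] by auto
  assume "g \<in> Hom (Lcat K) X Y"
  then have g: "g \<in> localized_hom K X Y" by simp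
  show "f = g" if eq: "\<And>x. x \<in> points K X \<Longrightarrow> on_points f x = on_points g x"
    by (rule localized_hom_ext[OF f g]) (use eq[of "(_, _)"] in auto)
  show "on_points f x = on_points g x" if "x \<in> points K X" "on_points f x \<in> zeros K Y" "on_points g x \<in> zeros K Y" using that by auto
qed

interpretation Lcat: concrete_category "Lcat K :: (('k::field, 'n::finite, 'b) lmod, 'n set \<Rightarrow> 'b \<Rightarrow> 'b) cat" "points K" "zeros K" on_points
  for K by (rule Lcat_concrete)

lemma Lcat_zero_object_iff:
  assumes X: "localized_module K X"
  shows "is_zero_object (Lcat K) X \<longleftrightarrow> (\<forall>\<sigma>\<in>missing_faces K. carrier (at_face X \<sigma>) = {\<zero>\<^bsub>at_face X \<sigma>\<^esub>})"
proof -
  have "X \<in> Obj (Lcat K)" using X by simp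
  from Lcat.zero_object_iff[OF this] Lcat.zero_sub[OF this] show ?thesis by (auto 4 3)
qed

lemma Lcat_iso_iff:
  fixes X Y :: "('k::field, 'n::finite, 'b) lmod"
  assumes X: "localized_module K X" and Y: "localized_module K Y" and f: "f \<in> localized_hom K X Y"
  shows "is_iso_arrow (Lcat K) X Y f \<longleftrightarrow>
    (\<forall>\<sigma>\<in>missing_faces K. bij_betw (f \<sigma>) (carrier (at_face X \<sigma>)) (carrier (at_face Y \<sigma>)))"
proof -
  have "is_iso_arrow (Lcat K) X Y f \<longleftrightarrow> bij_betw (on_points f) (points K X) (points K Y)"
    using Lcat.iso_iff[of X K Y f] X Y f by simp
  also have "\<dots> \<longleftrightarrow> (\<forall>\<sigma>\<in>missing_faces K. bij_betw (f \<sigma>) (carrier (at_face X \<sigma>)) (carrier (at_face Y \<sigma>)))"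
  proof -
    have "inj_on (on_points f) (points K X) \<longleftrightarrow> (\<forall>\<sigma>\<in>missing_faces K. inj_on (f \<sigma>) (carrier (at_face X \<sigma>)))"
      by (auto simp: inj_on_def)
    moreover have "on_points f ` points K X = (SIGMA \<sigma>:missing_faces K. f \<sigma> ` carrier (at_face X \<sigma>))" by force
    moreover have "Sigma F A = Sigma F B \<longleftrightarrow> (\<forall>\<sigma>\<in>F. A \<sigma> = B \<sigma>)" for F :: "'n set set" and A B :: "'n set \<Rightarrow> 'b set" by auto
    ultimately show ?thesis unfolding bij_betw_def by (simp only: ball_conj_distrib)
  qed
  finally show ?thesis .
qed

lemma Lcat_short_exactI:
  fixes X Y Z :: "('k::field, 'n::finite, 'b) lmod"
  assumes "localized_module K X" "localized_module K Y" "localized_module K Z" "f \<in> localized_hom K X Y" "g \<in> localized_hom K Y Z"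
    and inj: "\<And>\<sigma>. \<sigma> \<in> missing_faces K \<Longrightarrow> inj_on (f \<sigma>) (carrier (at_face X \<sigma>))"
    and im: "\<And>\<sigma>. \<sigma> \<in> missing_faces K \<Longrightarrow> f \<sigma> ` carrier (at_face X \<sigma>) = {y \<in> carrier (at_face Y \<sigma>). g \<sigma> y = \<zero>\<^bsub>at_face Z \<sigma>\<^esub>}"
    and surj: "\<And>\<sigma>. \<sigma> \<in> missing_faces K \<Longrightarrow> g \<sigma> ` carrier (at_face Y \<sigma>) = carrier (at_face Z \<sigma>)"
  shows "short_exact (Lcat K) X Y Z f g"
proof -
  have C: "X \<in> Obj (Lcat K)" "Y \<in> Obj (Lcat K)" "Z \<in> Obj (Lcat K)" "f \<in> Hom (Lcat K) X Y" "g \<in> Hom (Lcat K) Y Z"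
    using assms(1-5) by simp_all
  have range: "on_points h ` points K V = (SIGMA \<sigma>:missing_faces K. h \<sigma> ` carrier (at_face V \<sigma>))" for h and V :: "('k, 'n, 'b) lmod" by force
  have im': "on_points f ` points K X = {y \<in> points K Y. on_points g y \<in> zeros K Z}"
    unfolding range by (rule trans[OF Sigma_cong[OF refl im]]) auto
  have "is_kernel (Lcat K) Y Z g X f"
    by (rule Lcat.kernel[OF C(2,3,5,1,4) _ im']) (auto simp: inj_on_def dest: inj_onD[OF inj])
  moreover have "is_cokernel (Lcat K) X Y f Z g"
  proof (rule Lcat.cokernel[OF C(1,2,4,3,5)])
    show "on_points g ` points K Y = points K Z" unfolding range by (rule Sigma_cong[OF refl surj])
  qed (simp add: im')
  ultimately show ?thesis unfolding short_exact_def using C by blast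
qed

section \<open>Exactness of the localization functor and the arrows it inverts\<close>

lemma tpow_loc: "face_power \<tau> (int n) \<in> carrier (loc_ring \<sigma>)"
  by (rule face_power_loc) simp

lemma (in graded_mod) tpow_diff_zero_iff:
  assumes x: "x \<in> carrier M" and y: "y \<in> carrier M"
  shows "tpow M \<rho> n (x \<ominus> y) = \<zero> \<longleftrightarrow> tpow M \<rho> n x = tpow M \<rho> n y"
  using smult_r_distr[OF tpow_loc x M.a_inv_closed[OF y], of \<rho> n] smult_r_minus[OF tpow_loc y, of \<rho> n]
    diff_eq_zero_iff[OF tpow_closed[OF x] tpow_closed[OF y], of \<rho> n \<rho> n]
  unfolding a_minus_def by simp

lemma unit_map_eq_iff:
  fixes M (structure)
  assumes M: "graded_module {} M" and x: "x \<in> carrier M" and y: "y \<in> carrier M"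
  shows "unit_map \<sigma> M x = unit_map \<sigma> M y \<longleftrightarrow> (\<exists>n. tpow M \<sigma> n x = tpow M \<sigma> n y)"
proof -
  interpret u: graded_map "{}" \<sigma> M "loc \<sigma> M" "unit_map \<sigma> M" by (rule unit_map_graded_map[OF M])
  have xy: "x \<ominus> y \<in> carrier M" using x y by simp
  have "unit_map \<sigma> M x = unit_map \<sigma> M y \<longleftrightarrow> unit_map \<sigma> M (x \<ominus> y) = \<zero>\<^bsub>loc \<sigma> M\<^esub>"
    unfolding u.diff[OF x y] u.N.diff_eq_zero_iff[OF u.closed[OF x] u.closed[OF y]] ..
  also have "\<dots> \<longleftrightarrow> (\<exists>n. tpow M \<sigma> n (x \<ominus> y) = \<zero>)"
  proof
    assume "\<exists>n. tpow M \<sigma> n (x \<ominus> y) = \<zero>"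
    then obtain n :: nat where n: "tpow M \<sigma> n (x \<ominus> y) = \<zero>" ..
    have "tpow (loc \<sigma> M) \<sigma> n (unit_map \<sigma> M (x \<ominus> y))
        = tpow (loc \<sigma> M) \<sigma> n \<zero>\<^bsub>loc \<sigma> M\<^esub>"
      unfolding u.smult[OF tpow_loc xy, symmetric] n u.zero u.N.smult_r_null[OF tpow_loc] ..
    then show "unit_map \<sigma> M (x \<ominus> y) = \<zero>\<^bsub>loc \<sigma> M\<^esub>"
      by (rule u.N.face_power_cancel[OF subset_refl u.closed[OF xy] u.N.M.zero_closed])
  qed (rule power_localizationD(2)[OF unit_map_localization[OF M] xy])
  also have "\<dots> \<longleftrightarrow> (\<exists>n. tpow M \<sigma> n x = tpow M \<sigma> n y)" unfolding u.M.tpow_diff_zero_iff[OF x y] ..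
  finally show ?thesis .
qed

lemma unit_map_zero_iff:
  assumes M: "graded_module {} M" and x: "x \<in> carrier M"
  shows "unit_map \<sigma> M x = \<zero>\<^bsub>loc \<sigma> M\<^esub> \<longleftrightarrow> (\<exists>n. tpow M \<sigma> n x = \<zero>\<^bsub>M\<^esub>)"
proof -
  interpret u: graded_map "{}" \<sigma> M "loc \<sigma> M" "unit_map \<sigma> M" by (rule unit_map_graded_map[OF M])
  show ?thesis using unit_map_eq_iff[OF M x u.M.M.zero_closed, where \<sigma> = \<sigma>] unfolding u.zero u.M.smult_r_null[OF tpow_loc] .
qed

text \<open>\<open>F\<close> is the map that \<open>f\<close> induces on the localizations at \<open>t\<^sub>\<sigma>\<close>. Its kernel and image are described in
  terms of \<open>f\<close> by clearing denominators.\<close>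

locale localized_map = f: graded_map "{}" "{}" X Y f for X :: "('k::field, 'n::finite, 'a) gmod" and Y :: "('k, 'n, 'b) gmod" and f +
  fixes \<sigma> :: "'n set" and F
  assumes F_hom: "F \<in> graded_hom \<sigma> (loc \<sigma> X) (loc \<sigma> Y)"
    and F_unit: "\<And>x. x \<in> carrier X \<Longrightarrow> F (unit_map \<sigma> X x) = unit_map \<sigma> Y (f x)"
begin

abbreviation "BX \<equiv> loc \<sigma> X"
abbreviation "BY \<equiv> loc \<sigma> Y"

sublocale F: graded_map \<sigma> \<sigma> BX BY F
  using F_hom base_change_graded[OF f.M.graded] base_change_graded[OF f.N.graded] by unfold_locales auto
sublocale uX: graded_map "{}" \<sigma> X BX "unit_map \<sigma> X" by (rule unit_map_graded_map[OF f.M.graded])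
sublocale uY: graded_map "{}" \<sigma> Y BY "unit_map \<sigma> Y" by (rule unit_map_graded_map[OF f.N.graded])

lemma fraction:
  assumes "z \<in> carrier BX"
  shows "\<exists>n. \<exists>x\<in>carrier X. tpow BX \<sigma> n z = unit_map \<sigma> X x"
  by (rule power_localizationD(3)[OF unit_map_localization[OF f.M.graded] assms])

lemma zero_iff:
  assumes z: "z \<in> carrier BX" and x: "x \<in> carrier X" and zx: "tpow BX \<sigma> n z = unit_map \<sigma> X x"
  shows "F z = \<zero>\<^bsub>BY\<^esub> \<longleftrightarrow> (\<exists>k. tpow Y \<sigma> k (f x) = \<zero>\<^bsub>Y\<^esub>)"
proof -
  have eq: "tpow BY \<sigma> n (F z) = unit_map \<sigma> Y (f x)"
    unfolding F.smult[OF tpow_loc z, symmetric] zx by (rule F_unit[OF x])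
  have "F z = \<zero>\<^bsub>BY\<^esub> \<longleftrightarrow> unit_map \<sigma> Y (f x) = \<zero>\<^bsub>BY\<^esub>"
  proof
    assume "F z = \<zero>\<^bsub>BY\<^esub>"
    then show "unit_map \<sigma> Y (f x) = \<zero>\<^bsub>BY\<^esub>" unfolding eq[symmetric] by (simp only: F.N.smult_r_null[OF tpow_loc])
  next
    assume "unit_map \<sigma> Y (f x) = \<zero>\<^bsub>BY\<^esub>"
    then have "tpow BY \<sigma> n (F z) = tpow BY \<sigma> n \<zero>\<^bsub>BY\<^esub>"
      unfolding eq F.N.smult_r_null[OF tpow_loc] .
    then show "F z = \<zero>\<^bsub>BY\<^esub>" by (rule F.N.face_power_cancel[OF subset_refl F.closed[OF z] F.N.M.zero_closed])
  qed
  then show ?thesis using unit_map_zero_iff[OF f.N.graded f.closed[OF x]] by blast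
qed

lemma image_iff:
  assumes z: "z \<in> carrier BY"
  shows "z \<in> F ` carrier BX \<longleftrightarrow> (\<exists>n. \<exists>x\<in>carrier X. tpow BY \<sigma> n z = unit_map \<sigma> Y (f x))"
proof
  assume "z \<in> F ` carrier BX"
  then obtain w where w: "w \<in> carrier BX" "z = F w" by blast
  obtain n x where x: "x \<in> carrier X" "tpow BX \<sigma> n w = unit_map \<sigma> X x" using fraction[OF w(1)] by blast
  have "tpow BY \<sigma> n z = unit_map \<sigma> Y (f x)"
    unfolding w(2) F.smult[OF tpow_loc w(1), symmetric] x(2) by (rule F_unit[OF x(1)])
  then show "\<exists>n. \<exists>x\<in>carrier X. tpow BY \<sigma> n z = unit_map \<sigma> Y (f x)" using x(1) by blast
next
  assume "\<exists>n. \<exists>x\<in>carrier X. tpow BY \<sigma> n z = unit_map \<sigma> Y (f x)"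
  then obtain n x where x: "x \<in> carrier X" and zx: "tpow BY \<sigma> n z = unit_map \<sigma> Y (f x)" by blast
  have inv: "face_power \<sigma> i \<in> carrier (loc_ring \<sigma>)" for i :: int by (rule face_power_loc) simp
  let ?w = "face_power \<sigma> (- int n) \<odot>\<^bsub>BX\<^esub> unit_map \<sigma> X x"
  have w: "?w \<in> carrier BX" by (rule F.M.smult_closed[OF inv uX.closed[OF x]])
  have "tpow BX \<sigma> n ?w = unit_map \<sigma> X x"
    unfolding F.M.smult_mult[OF inv inv uX.closed[OF x], symmetric] face_power_mult using uX.closed[OF x] by simp
  then have "tpow BY \<sigma> n (F ?w) = tpow BY \<sigma> n z"
    unfolding F.smult[OF tpow_loc w, symmetric] zx by (simp only: F_unit[OF x])
  then have "F ?w = z" by (rule F.N.face_power_cancel[OF subset_refl F.closed[OF w] z])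
  then show "z \<in> F ` carrier BX" using w by blast
qed

lemma inj_iff_torsion:
  "inj_on F (carrier BX) \<longleftrightarrow>
    (\<forall>x\<in>carrier X. f x = \<zero>\<^bsub>Y\<^esub> \<longrightarrow> (\<exists>n. tpow X \<sigma> n x = \<zero>\<^bsub>X\<^esub>))"
  unfolding F.inj_iff
proof (intro iffI ballI impI)
  fix x assume inj: "\<forall>z\<in>carrier BX. F z = \<zero>\<^bsub>BY\<^esub> \<longrightarrow> z = \<zero>\<^bsub>BX\<^esub>" and x: "x \<in> carrier X" and fx: "f x = \<zero>\<^bsub>Y\<^esub>"
  have "F (unit_map \<sigma> X x) = \<zero>\<^bsub>BY\<^esub>" unfolding F_unit[OF x] fx by (rule uY.zero)
  then have "unit_map \<sigma> X x = \<zero>\<^bsub>BX\<^esub>" using inj uX.closed[OF x] by blast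
  then show "\<exists>n. tpow X \<sigma> n x = \<zero>\<^bsub>X\<^esub>" unfolding unit_map_zero_iff[OF f.M.graded x] .
next
  fix z assume tor: "\<forall>x\<in>carrier X. f x = \<zero>\<^bsub>Y\<^esub> \<longrightarrow> (\<exists>n. tpow X \<sigma> n x = \<zero>\<^bsub>X\<^esub>)"
    and z: "z \<in> carrier BX" and Fz: "F z = \<zero>\<^bsub>BY\<^esub>"
  obtain n x where x: "x \<in> carrier X" "tpow BX \<sigma> n z = unit_map \<sigma> X x" using fraction[OF z] by blast
  obtain k :: nat where k: "tpow Y \<sigma> k (f x) = \<zero>\<^bsub>Y\<^esub>" using zero_iff[OF z x] Fz by blast
  then have "f (tpow X \<sigma> k x) = \<zero>\<^bsub>Y\<^esub>" unfolding f.smult[OF tpow_loc x(1)] .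
  then obtain j :: nat where "tpow X \<sigma> j (tpow X \<sigma> k x) = \<zero>\<^bsub>X\<^esub>"
    using tor f.M.tpow_closed[OF x(1)] by blast
  then have "tpow X \<sigma> (j + k) x = \<zero>\<^bsub>X\<^esub>" unfolding f.M.tpow_add[OF x(1)] .
  then have "unit_map \<sigma> X x = \<zero>\<^bsub>BX\<^esub>" unfolding unit_map_zero_iff[OF f.M.graded x(1)] by blast
  then have "tpow BX \<sigma> n z = tpow BX \<sigma> n \<zero>\<^bsub>BX\<^esub>"
    unfolding x(2) F.M.smult_r_null[OF tpow_loc] .
  then show "z = \<zero>\<^bsub>BX\<^esub>" by (rule F.M.face_power_cancel[OF subset_refl z F.M.M.zero_closed])
qed

lemma surj_iff_torsion:
  "F ` carrier BX = carrier BY \<longleftrightarrow> (\<forall>y\<in>carrier Y. \<exists>n. tpow Y \<sigma> n y \<in> f ` carrier X)"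
proof (intro iffI ballI)
  fix y assume surj: "F ` carrier BX = carrier BY" and y: "y \<in> carrier Y"
  then obtain n x where x: "x \<in> carrier X" "tpow BY \<sigma> n (unit_map \<sigma> Y y) = unit_map \<sigma> Y (f x)"
    using image_iff[OF uY.closed[OF y]] uY.closed[OF y] by blast
  then have "unit_map \<sigma> Y (tpow Y \<sigma> n y) = unit_map \<sigma> Y (f x)"
    unfolding uY.smult[OF tpow_loc y] by simp
  then obtain k :: nat where "tpow Y \<sigma> k (tpow Y \<sigma> n y) = tpow Y \<sigma> k (f x)"
    using unit_map_eq_iff[OF f.N.graded f.N.tpow_closed[OF y] f.closed[OF x(1)]] by blast
  then have "tpow Y \<sigma> (k + n) y = f (tpow X \<sigma> k x)"
    unfolding f.N.tpow_add[OF y] f.smult[OF tpow_loc x(1)] .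
  then show "\<exists>n. tpow Y \<sigma> n y \<in> f ` carrier X" using f.M.tpow_closed[OF x(1)] by blast
next
  assume tor: "\<forall>y\<in>carrier Y. \<exists>n. tpow Y \<sigma> n y \<in> f ` carrier X"
  have "z \<in> F ` carrier BX" if z: "z \<in> carrier BY" for z
  proof -
    obtain n y where y: "y \<in> carrier Y" "tpow BY \<sigma> n z = unit_map \<sigma> Y y"
      using power_localizationD(3)[OF unit_map_localization[OF f.N.graded] z] by blast
    obtain k x where x: "x \<in> carrier X" "tpow Y \<sigma> k y = f x" using tor y(1) by blast
    have "tpow BY \<sigma> (k + n) z = unit_map \<sigma> Y (f x)"
      unfolding F.N.tpow_add[OF z] y(2) x(2)[symmetric] by (rule uY.smult[OF tpow_loc y(1), symmetric])
    then show ?thesis unfolding image_iff[OF z] using x(1) by blast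
  qed
  then show "F ` carrier BX = carrier BY" using F.closed by blast
qed

end

lemma Loc_localized_map:
  assumes "graded_module {} X" "graded_module {} Y" "f \<in> graded_hom {} X Y" "\<sigma> \<in> missing_faces K"
  shows "localized_map X Y f \<sigma> (Lhom K X Y f \<sigma>)"
proof -
  interpret f: graded_map "{}" "{}" X Y f by unfold_locales (use assms in auto)
  show ?thesis by unfold_locales (use Loc_hom[OF assms] in auto)
qed

text \<open>Each of injectivity, exactness in the middle and surjectivity at \<open>\<sigma>\<close> is tested on numerators: there
  it says that something holds after multiplication by a power of \<open>t\<^sub>\<sigma>\<close>.\<close>

lemma Loc_exact: "exact_functor (Rmod :: (('k::field, 'n::finite, 'a) gmod, 'a \<Rightarrow> 'a) cat) (Lcat K) (Loc K)"
  unfolding exact_functor_def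
proof (intro conjI allI impI Loc_functor)
  fix X Y Z :: "('k, 'n, 'a) gmod" and f g
  assume "short_exact Rmod X Y Z f g"
  then have X: "X \<in> Obj Rmod" and Y: "Y \<in> Obj Rmod" and Z: "Z \<in> Obj Rmod" and f: "f \<in> Hom Rmod X Y"
    and g: "g \<in> Hom Rmod Y Z" and ker: "is_kernel Rmod Y Z g X f" and cok: "is_cokernel Rmod X Y f Z g"
    unfolding short_exact_def by blast+
  have inj: "inj_on f (carrier X)" and im: "f ` carrier X = {y \<in> carrier Y. g y = \<zero>\<^bsub>Z\<^esub>}"
    using ker unfolding Rmod_kernel_iff[OF Y Z g] by auto
  have surj: "g ` carrier Y = carrier Z" using cok unfolding Rmod_cokernel_iff[OF X Y f] by auto
  have gm: "graded_module {} X" "graded_module {} Y" "graded_module {} Z" and fh: "f \<in> graded_hom {} X Y" and gh: "g \<in> graded_hom {} Y Z"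
    using X Y Z f g by auto
  have L: "localized_module K (Lobj K X)" "localized_module K (Lobj K Y)" "localized_module K (Lobj K Z)"
    using X Y Z Loc_localized by auto
  note Lf = Loc_localized_hom[OF gm(1,2) fh, of K] and Lg = Loc_localized_hom[OF gm(2,3) gh, of K]
  have pointwise: "inj_on (Lhom K X Y f \<sigma>) (carrier (at_face (Lobj K X) \<sigma>)) \<and>
      Lhom K X Y f \<sigma> ` carrier (at_face (Lobj K X) \<sigma>)
        = {z \<in> carrier (at_face (Lobj K Y) \<sigma>). Lhom K Y Z g \<sigma> z = \<zero>\<^bsub>at_face (Lobj K Z) \<sigma>\<^esub>} \<and>
      Lhom K Y Z g \<sigma> ` carrier (at_face (Lobj K Y) \<sigma>) = carrier (at_face (Lobj K Z) \<sigma>)"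
    if \<sigma>: "\<sigma> \<in> missing_faces K" for \<sigma>
  proof -
    interpret F: localized_map X Y f \<sigma> "Lhom K X Y f \<sigma>" by (rule Loc_localized_map[OF gm(1,2) fh \<sigma>])
    interpret G: localized_map Y Z g \<sigma> "Lhom K Y Z g \<sigma>" by (rule Loc_localized_map[OF gm(2,3) gh \<sigma>])
    have "inj_on (Lhom K X Y f \<sigma>) (carrier F.BX)" (is ?inj)
      unfolding F.inj_iff_torsion
    proof (intro ballI impI)
      fix x assume "x \<in> carrier X" "f x = \<zero>\<^bsub>Y\<^esub>"
      then have "x = \<zero>\<^bsub>X\<^esub>" using inj F.f.inj_iff by blast
      then show "\<exists>n. tpow X \<sigma> n x = \<zero>\<^bsub>X\<^esub>" by (intro exI[of _ 0]) simp
    qed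
    have "Lhom K Y Z g \<sigma> ` carrier G.BX = carrier G.BY" (is ?surj)
      unfolding G.surj_iff_torsion
    proof
      fix z assume z: "z \<in> carrier Z"
      then show "\<exists>n. tpow Z \<sigma> n z \<in> g ` carrier Y" unfolding surj by (intro exI[of _ 0]) simp
    qed
    have mid: "z \<in> Lhom K X Y f \<sigma> ` carrier F.BX \<longleftrightarrow> Lhom K Y Z g \<sigma> z = \<zero>\<^bsub>G.BY\<^esub>" if z: "z \<in> carrier F.BY" for z
    proof -
      obtain n y where y: "y \<in> carrier Y" "tpow F.BY \<sigma> n z = unit_map \<sigma> Y y" using G.fraction[OF z] by blast
      show ?thesis
      proof
        assume "z \<in> Lhom K X Y f \<sigma> ` carrier F.BX"
        then obtain m x where x: "x \<in> carrier X" "tpow F.BY \<sigma> m z = unit_map \<sigma> Y (f x)"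
          unfolding F.image_iff[OF z] by blast
        have "g (f x) = \<zero>\<^bsub>Z\<^esub>" using im x(1) by blast
        then have "tpow Z \<sigma> 0 (g (f x)) = \<zero>\<^bsub>Z\<^esub>" by simp
        then show "Lhom K Y Z g \<sigma> z = \<zero>\<^bsub>G.BY\<^esub>" using G.zero_iff[OF z F.f.closed[OF x(1)] x(2)] by blast
      next
        assume "Lhom K Y Z g \<sigma> z = \<zero>\<^bsub>G.BY\<^esub>"
        then obtain k :: nat where "tpow Z \<sigma> k (g y) = \<zero>\<^bsub>Z\<^esub>" using G.zero_iff[OF z y] by blast
        then have "g (tpow Y \<sigma> k y) = \<zero>\<^bsub>Z\<^esub>" unfolding G.f.smult[OF tpow_loc y(1)] .
        then have "tpow Y \<sigma> k y \<in> f ` carrier X" unfolding im using F.f.N.tpow_closed[OF y(1)] by simp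
        then obtain x where x: "x \<in> carrier X" "tpow Y \<sigma> k y = f x" by blast
        have "tpow F.BY \<sigma> (k + n) z = unit_map \<sigma> Y (f x)"
          unfolding F.F.N.tpow_add[OF z] y(2) x(2)[symmetric] by (rule F.uY.smult[OF tpow_loc y(1), symmetric])
        then show "z \<in> Lhom K X Y f \<sigma> ` carrier F.BX" unfolding F.image_iff[OF z] using x(1) by blast
      qed
    qed
    have "Lhom K X Y f \<sigma> ` carrier F.BX = {z \<in> carrier F.BY. Lhom K Y Z g \<sigma> z = \<zero>\<^bsub>G.BY\<^esub>}"
    proof (intro equalityI subsetI)
      fix z assume z: "z \<in> Lhom K X Y f \<sigma> ` carrier F.BX"
      then have "z \<in> carrier F.BY" by (elim imageE) (simp only: F.F.closed)
      then show "z \<in> {z \<in> carrier F.BY. Lhom K Y Z g \<sigma> z = \<zero>\<^bsub>G.BY\<^esub>}" using z mid by simp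
    next
      fix z assume "z \<in> {z \<in> carrier F.BY. Lhom K Y Z g \<sigma> z = \<zero>\<^bsub>G.BY\<^esub>}"
      then show "z \<in> Lhom K X Y f \<sigma> ` carrier F.BX" using mid by simp
    qed
    with \<open>?inj\<close> \<open>?surj\<close> show ?thesis unfolding Loc_simps(1) by (intro conjI)
  qed
  show "short_exact (Lcat K) (Lobj K X) (Lobj K Y) (Lobj K Z) (Lhom K X Y f) (Lhom K Y Z g)"
    by (rule Lcat_short_exactI[OF L Lf Lg]) (use pointwise in blast)+
qed

lemma localization_kernel_iff:
  shows "N \<in> localization_kernel K \<longleftrightarrow> N \<in> Obj Rmod \<and>
    (\<forall>\<sigma>\<in>missing_faces K. \<forall>x\<in>carrier N. \<exists>n. tpow N \<sigma> n x = \<zero>\<^bsub>N\<^esub>)"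
proof -
  have "carrier (loc \<sigma> N) = {\<zero>\<^bsub>loc \<sigma> N\<^esub>} \<longleftrightarrow>
      (\<forall>x\<in>carrier N. \<exists>n. tpow N \<sigma> n x = \<zero>\<^bsub>N\<^esub>)" if N: "graded_module {} N" for \<sigma>
  proof -
    interpret u: graded_map "{}" \<sigma> N "loc \<sigma> N" "unit_map \<sigma> N" by (rule unit_map_graded_map[OF N])
    show ?thesis
    proof
      assume z: "carrier (loc \<sigma> N) = {\<zero>\<^bsub>loc \<sigma> N\<^esub>}"
      show "\<forall>x\<in>carrier N. \<exists>n. tpow N \<sigma> n x = \<zero>\<^bsub>N\<^esub>"
        using u.closed unit_map_zero_iff[OF N] unfolding z by blast
    next
      assume tor: "\<forall>x\<in>carrier N. \<exists>n. tpow N \<sigma> n x = \<zero>\<^bsub>N\<^esub>"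
      have "z = \<zero>\<^bsub>loc \<sigma> N\<^esub>" if z: "z \<in> carrier (loc \<sigma> N)" for z
      proof -
        obtain n x where x: "x \<in> carrier N" "tpow (loc \<sigma> N) \<sigma> n z = unit_map \<sigma> N x"
          using power_localizationD(3)[OF unit_map_localization[OF N] z] by blast
        have "unit_map \<sigma> N x = \<zero>\<^bsub>loc \<sigma> N\<^esub>" using unit_map_zero_iff[OF N x(1)] tor x(1) by blast
        then have "tpow (loc \<sigma> N) \<sigma> n z = tpow (loc \<sigma> N) \<sigma> n \<zero>\<^bsub>loc \<sigma> N\<^esub>"
          unfolding x(2) u.N.smult_r_null[OF tpow_loc] .
        then show ?thesis by (rule u.N.face_power_cancel[OF subset_refl z u.N.M.zero_closed])
      qed
      then show "carrier (loc \<sigma> N) = {\<zero>\<^bsub>loc \<sigma> N\<^esub>}" by auto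
    qed
  qed
  then show ?thesis
    unfolding localization_kernel_def functor_kernel_def
    using Lcat_zero_object_iff[OF Loc_localized, of N K] by (auto simp: Loc_simps(1))
qed

text \<open>Kernel and cokernel of \<open>f\<close> are killed by \<open>L\<^sub>K\<close>.\<close>

definition torsion_iso :: "'n::finite set set \<Rightarrow> ('k::field, 'n, 'a) gmod \<Rightarrow> ('k, 'n, 'b) gmod \<Rightarrow> ('a \<Rightarrow> 'b) \<Rightarrow> bool" where
  "torsion_iso K X Y f \<longleftrightarrow> (\<forall>\<sigma>\<in>missing_faces K.
     (\<forall>x\<in>carrier X. f x = \<zero>\<^bsub>Y\<^esub> \<longrightarrow> (\<exists>n. tpow X \<sigma> n x = \<zero>\<^bsub>X\<^esub>)) \<and>
     (\<forall>y\<in>carrier Y. \<exists>n. tpow Y \<sigma> n y \<in> f ` carrier X))"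

lemma Loc_iso_iff:
  assumes X: "X \<in> Obj Rmod" and Y: "Y \<in> Obj Rmod" and f: "f \<in> Hom Rmod X Y"
  shows "is_iso_arrow (Lcat K) (Lobj K X) (Lobj K Y) (Lhom K X Y f) \<longleftrightarrow> torsion_iso K X Y f"
proof -
  have gm: "graded_module {} X" "graded_module {} Y" and fh: "f \<in> graded_hom {} X Y"
    and L: "localized_module K (Lobj K X)" "localized_module K (Lobj K Y)"
    using X Y f Loc_localized by auto
  have "bij_betw (Lhom K X Y f \<sigma>) (carrier (loc \<sigma> X)) (carrier (loc \<sigma> Y)) \<longleftrightarrow>
     (\<forall>x\<in>carrier X. f x = \<zero>\<^bsub>Y\<^esub> \<longrightarrow> (\<exists>n. tpow X \<sigma> n x = \<zero>\<^bsub>X\<^esub>)) \<and>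
     (\<forall>y\<in>carrier Y. \<exists>n. tpow Y \<sigma> n y \<in> f ` carrier X)" if \<sigma>: "\<sigma> \<in> missing_faces K" for \<sigma>
  proof -
    interpret localized_map X Y f \<sigma> "Lhom K X Y f \<sigma>" by (rule Loc_localized_map[OF gm fh \<sigma>])
    show ?thesis unfolding bij_betw_def inj_iff_torsion surj_iff_torsion ..
  qed
  then show ?thesis
    unfolding Lcat_iso_iff[OF L Loc_localized_hom[OF gm fh]] torsion_iso_def Loc_simps(1) by blast
qed

text \<open>The modules killed by \<open>L\<^sub>K\<close> are those that are \<open>t\<^sub>\<sigma>\<close>-power torsion for each missing \<open>\<sigma>\<close>; this is
  transferred between \<open>f\<close> and its categorical kernels and cokernels.\<close>

lemma inverted_iff_torsion_iso:
  assumes X: "X \<in> Obj Rmod" and Y: "Y \<in> Obj Rmod" and f: "f \<in> Hom Rmod X Y"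
  shows "inverted_arrow Rmod (localization_kernel K) X Y f \<longleftrightarrow> torsion_iso K X Y f"
proof
  have gm: "graded_module {} X" "graded_module {} Y" and fh: "f \<in> graded_hom {} X Y" using X Y f by auto
  interpret f: graded_map "{}" "{}" X Y f by unfold_locales (use gm fh in auto)
  {
    assume "inverted_arrow Rmod (localization_kernel K) X Y f"
    then obtain N i Q p where N: "N \<in> localization_kernel K" "is_kernel Rmod X Y f N i"
      and Q: "Q \<in> localization_kernel K" "is_cokernel Rmod X Y f Q p" unfolding inverted_arrow_def by blast
    have i: "N \<in> Obj Rmod" "i \<in> graded_hom {} N X" "i ` carrier N = {x \<in> carrier X. f x = \<zero>\<^bsub>Y\<^esub>}"
      using N(2) unfolding Rmod_kernel_iff[OF X Y f] by auto
    have p: "Q \<in> Obj Rmod" "p \<in> graded_hom {} Y Q" "\<forall>y\<in>carrier Y. p y = \<zero>\<^bsub>Q\<^esub> \<longleftrightarrow> y \<in> f ` carrier X"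
      using Q(2) unfolding Rmod_cokernel_iff[OF X Y f] by auto
    interpret i: graded_map "{}" "{}" N X i by unfold_locales (use gm i in auto)
    interpret p: graded_map "{}" "{}" Y Q p by unfold_locales (use gm p in auto)
    show "torsion_iso K X Y f"
      unfolding torsion_iso_def
    proof (intro ballI conjI impI)
      fix \<sigma> x assume \<sigma>: "\<sigma> \<in> missing_faces K" and x: "x \<in> carrier X" "f x = \<zero>\<^bsub>Y\<^esub>"
      then have "x \<in> i ` carrier N" unfolding i(3) by simp
      then obtain n where n: "n \<in> carrier N" "x = i n" by blast
      obtain k :: nat where "tpow N \<sigma> k n = \<zero>\<^bsub>N\<^esub>"
        using N(1) \<sigma> n(1) unfolding localization_kernel_iff by blast
      then have "i (tpow N \<sigma> k n) = \<zero>\<^bsub>X\<^esub>" by (simp only: i.zero)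
      then show "\<exists>n. tpow X \<sigma> n x = \<zero>\<^bsub>X\<^esub>" unfolding n(2) i.smult[OF tpow_loc n(1)] ..
    next
      fix \<sigma> y assume \<sigma>: "\<sigma> \<in> missing_faces K" and y: "y \<in> carrier Y"
      obtain k :: nat where "tpow Q \<sigma> k (p y) = \<zero>\<^bsub>Q\<^esub>"
        using Q(1) \<sigma> p.closed[OF y] unfolding localization_kernel_iff by blast
      then have "p (tpow Y \<sigma> k y) = \<zero>\<^bsub>Q\<^esub>" unfolding p.smult[OF tpow_loc y] .
      then show "\<exists>n. tpow Y \<sigma> n y \<in> f ` carrier X" using p(3) f.N.tpow_closed[OF y] by blast
    qed
  next
    assume T: "torsion_iso K X Y f"
    obtain N i where N: "N \<in> Obj Rmod" and i: "i \<in> Hom Rmod N X" and inj: "inj_on i (carrier N)"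
      and im: "i ` carrier N = {x \<in> carrier X. f x = \<zero>\<^bsub>Y\<^esub>}" using Rmod_kernel_exists[OF X Y f] by blast
    obtain Q p where Q: "Q \<in> Obj Rmod" and p: "p \<in> Hom Rmod Y Q" and surj: "p ` carrier Y = carrier Q"
      and ker: "\<forall>y\<in>carrier Y. p y = \<zero>\<^bsub>Q\<^esub> \<longleftrightarrow> y \<in> f ` carrier X" using Rmod_cokernel_exists[OF X Y f] by blast
    interpret i: graded_map "{}" "{}" N X i by unfold_locales (use gm N i in auto)
    interpret p: graded_map "{}" "{}" Y Q p by unfold_locales (use gm Q p in auto)
    have "N \<in> localization_kernel K"
      unfolding localization_kernel_iff
    proof (intro conjI ballI N)
      fix \<sigma> n assume \<sigma>: "\<sigma> \<in> missing_faces K" and n: "n \<in> carrier N"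
      have "i n \<in> {x \<in> carrier X. f x = \<zero>\<^bsub>Y\<^esub>}" using im n by blast
      then obtain k :: nat where "tpow X \<sigma> k (i n) = \<zero>\<^bsub>X\<^esub>" using T \<sigma> unfolding torsion_iso_def by blast
      then have "i (tpow N \<sigma> k n) = \<zero>\<^bsub>X\<^esub>" unfolding i.smult[OF tpow_loc n] .
      then show "\<exists>k. tpow N \<sigma> k n = \<zero>\<^bsub>N\<^esub>"
        using inj[unfolded i.inj_iff] i.M.tpow_closed[OF n] by blast
    qed
    moreover have "Q \<in> localization_kernel K"
      unfolding localization_kernel_iff
    proof (intro conjI ballI Q)
      fix \<sigma> x assume \<sigma>: "\<sigma> \<in> missing_faces K" and x: "x \<in> carrier Q"
      obtain y where y: "y \<in> carrier Y" "x = p y" using x unfolding surj[symmetric] by blast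
      obtain k :: nat where "tpow Y \<sigma> k y \<in> f ` carrier X" using T \<sigma> y(1) unfolding torsion_iso_def by blast
      then have "p (tpow Y \<sigma> k y) = \<zero>\<^bsub>Q\<^esub>" using ker f.N.tpow_closed[OF y(1)] by blast
      then show "\<exists>k. tpow Q \<sigma> k x = \<zero>\<^bsub>Q\<^esub>" unfolding y(2) p.smult[OF tpow_loc y(1)] ..
    qed
    moreover have "is_kernel Rmod X Y f N i" by (rule Rmod.kernel[OF X Y f N i inj]) (simp add: im)
    moreover have "is_cokernel Rmod X Y f Q p" by (rule Rmod.cokernel[OF X Y f Q p surj]) (use ker in simp)
    ultimately show "inverted_arrow Rmod (localization_kernel K) X Y f" unfolding inverted_arrow_def using f by blast
  }
qed

section \<open>Transport to the universe of \<open>R\<close>-mod\<close>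

lemma infinite_laurent: "infinite (UNIV :: ('k::field, 'n::finite) laurent set)"
proof
  assume fin: "finite (UNIV :: ('k, 'n) laurent set)"
  have "inj (\<lambda>n::nat. face_power UNIV (int n) :: ('k, 'n) laurent)"
  proof (rule injI)
    fix m n :: nat assume "face_power UNIV (int m) = (face_power UNIV (int n) :: ('k, 'n) laurent)"
    then have "Poly_Mapping.keys (face_power UNIV (int m) :: ('k, 'n) laurent) = Poly_Mapping.keys (face_power UNIV (int n) :: ('k, 'n) laurent)"
      by (rule arg_cong)
    then have "face_degree (UNIV :: 'n set) (int m) = face_degree UNIV (int n)" by (simp add: face_power_def)
    then show "m = n" by (simp add: face_degree_def vec_eq_iff)
  qed
  then have "finite (UNIV :: nat set)" using fin by (rule inj_on_finite[OF _ subset_UNIV])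
  then show False by simp
qed

lemma infinite_pairing:
  assumes "infinite (UNIV :: 'c set)"
  shows "\<exists>j :: 'c \<times> 'c \<Rightarrow> 'c. inj j"
  using card_of_Times_same_infinite[OF assms] unfolding card_of_ordIso[symmetric] bij_betw_def UNIV_Times_UNIV by blast

lemma finite_functions_embed:
  assumes inf: "infinite (UNIV :: 'c set)" and "finite (A :: 'b set)"
  shows "\<exists>j :: ('b \<Rightarrow> 'c) \<Rightarrow> 'c. inj_on j (A \<rightarrow>\<^sub>E UNIV)"
  using assms(2)
proof (induction A rule: finite_induct)
  case (insert a A)
  then obtain j :: "('b \<Rightarrow> 'c) \<Rightarrow> 'c" where j: "inj_on j (A \<rightarrow>\<^sub>E UNIV)" by blast
  obtain p :: "'c \<times> 'c \<Rightarrow> 'c" where p: "inj p" using infinite_pairing[OF inf] by blast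
  have "inj_on (\<lambda>f. p (f a, j (restrict f A))) (insert a A \<rightarrow>\<^sub>E UNIV)"
  proof (rule inj_onI)
    fix f g assume f: "f \<in> insert a A \<rightarrow>\<^sub>E UNIV" and g: "g \<in> insert a A \<rightarrow>\<^sub>E UNIV"
      and eq: "p (f a, j (restrict f A)) = p (g a, j (restrict g A))"
    have 1: "f a = g a" "j (restrict f A) = j (restrict g A)" using injD[OF p eq] by auto
    have "restrict f A = restrict g A" by (rule inj_onD[OF j, OF 1(2)]) auto
    then have "f x = g x" if "x \<in> A" for x using that by (metis restrict_apply')
    then show "f = g" using 1 by (intro PiE_ext[OF f g]) auto
  qed
  then show ?case by blast
qed (simp add: exI)

text \<open>An element is determined by the tuple of its coefficients with respect to finitely many generators,
  and an infinite set has as many elements as finite tuples.\<close>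

lemma finitely_generated_embeds:
  fixes M :: "('k::field, 'n::finite, 'b) gmod" (structure)
  assumes universe: "\<exists>e :: ('k, 'n) laurent \<Rightarrow> 'a. inj e" and fg: "finitely_generated \<sigma> M"
    and M: "graded_module \<sigma> M"
  shows "\<exists>q :: 'b \<Rightarrow> 'a. inj_on q (carrier M)"
proof -
  interpret graded_mod \<sigma> M by unfold_locales (rule M)
  obtain A where A: "finite A" "A \<subseteq> carrier M"
    and gen: "\<forall>x\<in>carrier M. \<exists>p\<in>A \<rightarrow> carrier (loc_ring \<sigma>). x = finsum M (\<lambda>a. p a \<odot> a) A"
    using fg unfolding finitely_generated_def by (elim exE conjE) simp
  from bchoice[OF gen[unfolded Bex_def]] obtain p where
    p0: "\<forall>x\<in>carrier M. p x \<in> A \<rightarrow> carrier (loc_ring \<sigma>) \<and> x = finsum M (\<lambda>a. p x a \<odot> a) A" ..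
  note p = conjunct1[OF bspec[OF p0]] and px = conjunct2[OF bspec[OF p0]]
  obtain j :: "('b \<Rightarrow> ('k, 'n) laurent) \<Rightarrow> ('k, 'n) laurent" where j: "inj_on j (A \<rightarrow>\<^sub>E UNIV)"
    using finite_functions_embed[OF infinite_laurent A(1)] by blast
  obtain e :: "('k, 'n) laurent \<Rightarrow> 'a" where e: "inj e" using universe by blast
  have "inj_on (\<lambda>x. e (j (restrict (p x) A))) (carrier M)"
  proof (rule inj_onI)
    fix x y assume x: "x \<in> carrier M" and y: "y \<in> carrier M" and eq: "e (j (restrict (p x) A)) = e (j (restrict (p y) A))"
    have "restrict (p x) A = restrict (p y) A" by (rule inj_onD[OF j, OF injD[OF e eq]]) auto
    then have pe: "p x a = p y a" if "a \<in> A" for a using that by (metis restrict_apply')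
    have "finsum M (\<lambda>a. p x a \<odot> a) A = finsum M (\<lambda>a. p y a \<odot> a) A"
    proof (rule M.finsum_cong'[OF refl])
      show "(\<lambda>a. p y a \<odot> a) \<in> A \<rightarrow> carrier M"
        using p[OF y] A(2) by (intro Pi_I smult_closed) (auto simp del: carrier_loc_ring)
    qed (simp add: pe)
    then show "x = y" unfolding px[OF x, symmetric] px[OF y, symmetric] .
  qed
  then show ?thesis by blast
qed

lemma Rmod_transport:
  fixes M :: "('k::field, 'n::finite, 'b) gmod"
  assumes universe: "\<exists>e :: ('k, 'n) laurent \<Rightarrow> 'a. inj e" and fg: "finitely_generated {} M"
    and M: "graded_module {} M"
  shows "\<exists>(N :: ('k, 'n, 'a) gmod) r. N \<in> Obj Rmod \<and> r \<in> graded_hom {} N M \<and> bij_betw r (carrier N) (carrier M)"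
proof -
  interpret graded_mod "{}" M by unfold_locales (rule M)
  obtain q :: "'b \<Rightarrow> 'a" where q: "inj_on q (carrier M)" using finitely_generated_embeds[OF universe fg M] by blast
  have q': "q x = q y \<longleftrightarrow> x \<ominus>\<^bsub>M\<^esub> y \<in> {\<zero>\<^bsub>M\<^esub>}" if "x \<in> carrier M" "y \<in> carrier M" for x y
    using inj_on_eq_iff[OF q that] that by simp
  obtain N :: "('k, 'n, 'a) gmod" where N: "graded_module {} N" and qN: "restrict q (carrier M) \<in> graded_hom {} M N"
    and N_carrier: "carrier N = q ` carrier M" and zero: "\<forall>x\<in>carrier M. q x = \<zero>\<^bsub>N\<^esub> \<longleftrightarrow> x \<in> {\<zero>\<^bsub>M\<^esub>}"
    using graded_image[OF M graded_sub_zero q'] by blast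
  have im: "restrict q (carrier M) ` carrier M = carrier N" unfolding N_carrier by simp
  have "finitely_generated {} N"
    by (rule finitely_generated_image[OF M N subset_refl qN fg]) (simp only: im)
  moreover obtain r where r: "r \<in> graded_hom {} N M" "\<forall>y\<in>carrier M. r (restrict q (carrier M) y) = (\<lambda>x\<in>carrier M. x) y"
    using graded_hom_descend[OF M N M qN im graded_hom_id[OF M]] zero by auto
  moreover have "bij_betw r (carrier N) (carrier M)"
    using r(2) by (intro bij_betwI[where g = q]) (auto simp: N_carrier)
  ultimately show ?thesis using N by auto
qed

section \<open>The localization functor is full and faithful up to inverted arrows\<close>

lemma equalizer_sub:
  assumes M: "graded_module \<sigma> M" and N: "graded_module \<tau> N" and sub: "\<sigma> \<subseteq> \<tau>"
    and f: "f \<in> graded_hom \<sigma> M N" and g: "g \<in> graded_hom \<sigma> M N"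
  shows "graded_sub \<sigma> M {x \<in> carrier M. f x = g x}"
proof -
  interpret f: graded_map \<sigma> \<tau> M N f by unfold_locales (use assms in auto)
  interpret g: graded_map \<sigma> \<tau> M N g by unfold_locales (use assms in auto)
  show ?thesis
    by (rule graded_subI) (auto simp: f.zero g.zero f.add g.add f.single g.single f.comp g.comp f.M.single_closed)
qed

lemma (in graded_mod) intersection_sub:
  assumes "\<And>i. i \<in> I \<Longrightarrow> graded_sub \<sigma> M (H i)"
  shows "graded_sub \<sigma> M {x \<in> carrier M. \<forall>i\<in>I. x \<in> H i}"
  by (rule graded_subI) (use graded_subD[OF assms] in \<open>auto simp: single_closed\<close>)

text \<open>Take for \<open>U\<close> the equalizer of \<open>f\<close> and \<open>g\<close>. At a missing face \<open>\<sigma>\<close> the images \<open>f x / 1\<close> and \<open>g x / 1\<close>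
  coincide, so a multiple \<open>t\<^sub>\<sigma>\<^sup>n x\<close> lies in \<open>U\<close>.\<close>

lemma Loc_faithful:
  assumes X: "X \<in> Obj Rmod" and Y: "Y \<in> Obj Rmod" and f: "f \<in> Hom Rmod X Y" and g: "g \<in> Hom Rmod X Y"
    and eq: "Lhom K X Y f = Lhom K X Y g"
  shows "\<exists>U\<in>Obj Rmod. \<exists>u. inverted_arrow Rmod (localization_kernel K) U X u \<and> Comp Rmod U X Y f u = Comp Rmod U X Y g u"
proof -
  have gm: "graded_module {} X" "graded_module {} Y" and fg: "finitely_generated {} X"
    and fh: "f \<in> graded_hom {} X Y" and gh: "g \<in> graded_hom {} X Y"
    using X Y f g by auto
  interpret f: graded_map "{}" "{}" X Y f by unfold_locales (use gm fh in auto)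
  interpret g: graded_map "{}" "{}" X Y g by unfold_locales (use gm gh in auto)
  let ?H = "{x \<in> carrier X. f x = g x}" and ?u = "\<lambda>x\<in>{x \<in> carrier X. f x = g x}. x"
  have H: "graded_sub {} X ?H" by (rule equalizer_sub[OF gm subset_refl fh gh])
  let ?U = "sub_object X ?H"
  have U: "?U \<in> Obj Rmod" using f.M.graded_sub_object(1)[OF H] f.M.noetherian[OF refl fg H] by simp
  have "torsion_iso K ?U X ?u"
    unfolding torsion_iso_def
  proof (intro ballI conjI impI)
    fix \<sigma> x assume "x \<in> carrier ?U" "?u x = \<zero>\<^bsub>X\<^esub>"
    then show "\<exists>n. tpow ?U \<sigma> n x = \<zero>\<^bsub>?U\<^esub>" by (intro exI[of _ 0]) simp
  next
    fix \<sigma> y assume \<sigma>: "\<sigma> \<in> missing_faces K" and y: "y \<in> carrier X"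
    have "unit_map \<sigma> Y (f y) = unit_map \<sigma> Y (g y)"
      unfolding Loc_hom(2)[OF gm fh \<sigma> y, symmetric] Loc_hom(2)[OF gm gh \<sigma> y, symmetric] eq ..
    then obtain n :: nat where n: "tpow Y \<sigma> n (f y) = tpow Y \<sigma> n (g y)"
      unfolding unit_map_eq_iff[OF gm(2) f.closed[OF y] g.closed[OF y]] ..
    have "tpow X \<sigma> n y \<in> ?H"
      using n f.M.tpow_closed[OF y] by (simp add: f.smult[OF tpow_loc y] g.smult[OF tpow_loc y])
    then show "\<exists>n. tpow X \<sigma> n y \<in> ?u ` carrier ?U" by (intro exI image_eqI[rotated]) auto
  qed
  then have "inverted_arrow Rmod (localization_kernel K) ?U X ?u"
    using inverted_iff_torsion_iso[OF U X] graded_hom_inclusion[OF gm(1) H] by simp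
  then show ?thesis using U by (intro bexI[of _ ?U] exI[of _ ?u]) (auto simp: compose_def fun_eq_iff)
qed

lemma (in graded_mod) tpow_union:
  assumes "x \<in> carrier M"
  shows "tpow M (\<rho> \<union> \<sigma>') n x = tpow M (\<sigma>' - \<rho>) n (tpow M \<rho> n x)"
proof -
  have "face_power (\<rho> \<union> \<sigma>') (int n) = (face_power (\<sigma>' - \<rho>) (int n) * face_power \<rho> (int n) :: ('k, 'n) laurent)"
    unfolding face_power_def mult_single by (rule arg_cong2[of _ _ _ _ monomial]) (auto simp: face_degree_def vec_eq_iff)
  then show ?thesis by (simp only: smult_mult[OF tpow_loc tpow_loc assms])
qed

text \<open>The variables in \<open>\<tau>\<close> act invertibly on both modules, so inverting \<open>t\<close> for \<open>\<rho> \<union> \<tau>\<close> amounts to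
  inverting \<open>t\<^sub>\<rho>\<close>.\<close>

lemma power_localization_union:
  fixes M (structure)
  assumes M: "graded_module \<tau> M" and N: "graded_module (\<rho> \<union> \<tau>) N" and \<phi>: "power_localization \<tau> (\<rho> \<union> \<tau>) M N \<phi>"
  shows "x \<in> carrier M \<Longrightarrow> \<phi> x = \<zero>\<^bsub>N\<^esub> \<Longrightarrow> \<exists>n. tpow M \<rho> n x = \<zero>"
    and "y \<in> carrier N \<Longrightarrow> \<exists>n. \<exists>x\<in>carrier M. tpow N \<rho> n y = \<phi> x"
proof -
  interpret \<phi>: graded_map \<tau> "\<rho> \<union> \<tau>" M N \<phi> by unfold_locales (use M N power_localizationD(1)[OF \<phi>] in auto)
  show "\<exists>n. tpow M \<rho> n x = \<zero>" if x: "x \<in> carrier M" and z: "\<phi> x = \<zero>\<^bsub>N\<^esub>"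
  proof -
    obtain n :: nat where n: "tpow M (\<rho> \<union> \<tau>) n x = \<zero>" using power_localizationD(2)[OF \<phi> x z] ..
    have "tpow M (\<tau> - \<rho>) n (tpow M \<rho> n x) = tpow M (\<tau> - \<rho>) n \<zero>"
      unfolding \<phi>.M.tpow_union[OF x, symmetric] n \<phi>.M.smult_r_null[OF tpow_loc] ..
    then show ?thesis by (intro exI) (rule \<phi>.M.face_power_cancel[OF Diff_subset \<phi>.M.tpow_closed[OF x] \<phi>.M.M.zero_closed])
  qed
  show "\<exists>n. \<exists>x\<in>carrier M. tpow N \<rho> n y = \<phi> x" if y: "y \<in> carrier N"
  proof -
    obtain n x where x: "x \<in> carrier M" and nx: "tpow N (\<rho> \<union> \<tau>) n y = \<phi> x"
      using power_localizationD(3)[OF \<phi> y] by blast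
    have inv: "face_power (\<tau> - \<rho>) i \<in> carrier (loc_ring \<tau>)" "face_power (\<tau> - \<rho>) i \<in> carrier (loc_ring (\<rho> \<union> \<tau>))" for i
      by (rule face_power_loc; blast)+
    note y' = \<phi>.N.tpow_closed[OF y]
    have "face_power (\<tau> - \<rho>) (- int n) \<odot>\<^bsub>N\<^esub> (tpow N (\<tau> - \<rho>) n (tpow N \<rho> n y)) = tpow N \<rho> n y"
      unfolding \<phi>.N.smult_mult[OF inv(2) inv(2) y', symmetric] face_power_mult using y' by simp
    then have "tpow N \<rho> n y = \<phi> (face_power (\<tau> - \<rho>) (- int n) \<odot> x)"
      unfolding \<phi>.N.tpow_union[OF y, symmetric] nx \<phi>.smult[OF inv(1) x] by (rule sym)
    then show ?thesis using \<phi>.M.smult_closed[OF inv(1) x] by blast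
  qed
qed

lemma missing_faces_Un: "simplicial_complex K \<Longrightarrow> \<sigma> \<in> missing_faces K \<Longrightarrow> \<sigma> \<union> \<tau> \<in> missing_faces K"
  unfolding simplicial_complex_def missing_faces_def by blast

locale localized =
  fixes K :: "'n::finite set set" and N :: "('k::field, 'n, 'b) lmod"
  assumes K: "simplicial_complex K" and N: "localized_module K N"
begin

abbreviation "MF \<equiv> missing_faces K"
abbreviation "F \<equiv> at_face N"
abbreviation "T \<equiv> transition N"

lemma face_mod: "\<tau> \<in> MF \<Longrightarrow> graded_mod \<tau> (F \<tau>)"
  by (rule graded_mod.intro[OF localized_moduleD(1)[OF N]])

lemma face_map: "\<sigma> \<in> MF \<Longrightarrow> \<tau> \<in> MF \<Longrightarrow> \<sigma> \<subseteq> \<tau> \<Longrightarrow> graded_map \<sigma> \<tau> (F \<sigma>) (F \<tau>) (T \<sigma> \<tau>)"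
  by (rule localized_module_map[OF N])

lemma face_union: "\<sigma> \<in> MF \<Longrightarrow> \<sigma> \<union> \<tau> \<in> MF"
  by (rule missing_faces_Un[OF K])

lemma face_map_union: "\<sigma> \<in> MF \<Longrightarrow> \<tau> \<in> MF \<Longrightarrow> power_localization \<tau> (\<sigma> \<union> \<tau>) (F \<tau>) (F (\<sigma> \<union> \<tau>)) (T \<tau> (\<sigma> \<union> \<tau>))"
  by (rule localized_moduleD(3)[OF N]) (auto intro: face_union)

text \<open>Each \<open>d \<tau>\<close> is \<open>t\<^sub>\<sigma>\<close>-power torsion; one exponent serves for the finitely many faces.\<close>

lemma uniform_torsion:
  assumes \<sigma>: "\<sigma> \<in> MF" and d: "\<And>\<tau>. \<tau> \<in> MF \<Longrightarrow> d \<tau> \<in> carrier (F \<tau>)"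
    and zero: "\<And>\<tau>. \<tau> \<in> MF \<Longrightarrow> T \<tau> (\<sigma> \<union> \<tau>) (d \<tau>) = \<zero>\<^bsub>F (\<sigma> \<union> \<tau>)\<^esub>"
  shows "\<exists>k::nat. \<forall>\<tau>\<in>MF. \<forall>j\<ge>k. tpow (F \<tau>) \<sigma> j (d \<tau>) = \<zero>\<^bsub>F \<tau>\<^esub>"
proof -
  have "\<forall>\<tau>\<in>MF. \<exists>n. tpow (F \<tau>) \<sigma> n (d \<tau>) = \<zero>\<^bsub>F \<tau>\<^esub>"
  proof
    fix \<tau> assume \<tau>: "\<tau> \<in> MF"
    show "\<exists>n. tpow (F \<tau>) \<sigma> n (d \<tau>) = \<zero>\<^bsub>F \<tau>\<^esub>"
      by (rule power_localization_union(1)[OF localized_moduleD(1)[OF N \<tau>] localized_moduleD(1)[OF N face_union[OF \<sigma>]]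
        face_map_union[OF \<sigma> \<tau>] d[OF \<tau>] zero[OF \<tau>]])
  qed
  from bchoice[OF this] obtain n :: "'n set \<Rightarrow> nat"
    where n: "\<forall>\<tau>\<in>MF. tpow (F \<tau>) \<sigma> (n \<tau>) (d \<tau>) = \<zero>\<^bsub>F \<tau>\<^esub>" ..
  have "tpow (F \<tau>) \<sigma> j (d \<tau>) = \<zero>\<^bsub>F \<tau>\<^esub>" if "\<tau> \<in> MF" "sum n MF \<le> j" for \<tau> j
    by (rule graded_mod.tpow_zero_mono[OF face_mod d bspec[OF n]])
      (use that member_le_sum[of \<tau> MF n] in \<open>auto intro: order_trans\<close>)
  then show ?thesis by blast
qed

end

text \<open>To see that powers of \<open>t\<^sub>\<rho>\<close> carry all of \<open>N\<close> into the image of \<open>f\<close>, it thus suffices to look at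
  generators of \<open>N\<close>.\<close>

lemma (in graded_map) fraction_sub:
  assumes "\<tau> \<subseteq> \<rho>"
  shows "graded_sub \<tau> N {w \<in> carrier N. \<exists>n. \<exists>x\<in>carrier M. tpow N \<rho> n w = f x}" (is "graded_sub _ _ ?H")
proof (rule graded_subI)
  have shift: "\<exists>x\<in>carrier M. tpow N \<rho> (k + n) w = f x"
    if "w \<in> carrier N" "x \<in> carrier M" "tpow N \<rho> n w = f x" for w x k n
    using that M.tpow_closed[of x \<rho> k] smult[OF tpow_loc that(2), of \<rho> k]
    by (intro bexI[of _ "tpow M \<rho> k x"]) (simp_all only: N.tpow_add)
  show "?H \<subseteq> carrier N" by blast
  show "\<zero>\<^bsub>N\<^esub> \<in> ?H" using zero by (auto intro!: exI[of _ 0] bexI[of _ "\<zero>\<^bsub>M\<^esub>"])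
  show "v \<oplus>\<^bsub>N\<^esub> w \<in> ?H" if "v \<in> ?H" "w \<in> ?H" for v w
  proof -
    from that(1) obtain n x where x: "x \<in> carrier M" "tpow N \<rho> n v = f x" and v: "v \<in> carrier N" by (elim CollectE conjE exE bexE) simp
    from that(2) obtain m y where y: "y \<in> carrier M" "tpow N \<rho> m w = f y" and w: "w \<in> carrier N" by (elim CollectE conjE exE bexE) simp
    from shift[OF v x, of m] obtain x' where x': "x' \<in> carrier M" "tpow N \<rho> (m + n) v = f x'" by (elim bexE) simp
    from shift[OF w y, of n] obtain y' where y': "y' \<in> carrier M" "tpow N \<rho> (n + m) w = f y'" by (elim bexE) simp
    have eq: "tpow N \<rho> (m + n) (v \<oplus>\<^bsub>N\<^esub> w) = f (x' \<oplus>\<^bsub>M\<^esub> y')"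
      unfolding N.smult_r_distr[OF tpow_loc v w] x'(2) add.commute[of m n] y'(2) add[OF x'(1) y'(1)]
      using x'(2) unfolding add.commute[of m n] by simp
    show ?thesis by (rule CollectI, rule conjI, rule N.M.add.m_closed[OF v w], rule exI, rule bexI, rule eq, rule M.M.add.m_closed[OF x'(1) y'(1)])
  qed
  show "monomial a c \<odot>\<^bsub>N\<^esub> w \<in> ?H" if a: "a \<in> loc_degrees \<tau>" and "w \<in> ?H" for a c w
  proof -
    from that(2) obtain n x where x: "x \<in> carrier M" "tpow N \<rho> n w = f x" and w: "w \<in> carrier N" by (elim CollectE conjE exE bexE) simp
    obtain j :: nat where j: "face_degree \<rho> (int j) + a \<in> loc_degrees {}" using face_degree_clears[OF subsetD[OF loc_degrees_mono[OF assms] a]] by blast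
    have j': "face_degree \<rho> (int j) + a \<in> loc_degrees \<tau>" "face_degree \<rho> (int j) + a \<in> loc_degrees \<sigma>"
      using j loc_degrees_mono[of "{}"] by blast+
    have "tpow N \<rho> (j + n) (monomial a c \<odot>\<^bsub>N\<^esub> w)
        = monomial (face_degree \<rho> (int j) + a) c \<odot>\<^bsub>N\<^esub> (tpow N \<rho> n w)"
      unfolding face_power_def by (simp add: N.single_single face_degree_loc a w j' of_nat_add face_degree_add algebra_simps)
    also have "\<dots> = f (monomial (face_degree \<rho> (int j) + a) c \<odot>\<^bsub>M\<^esub> x)"
      unfolding x(2) single[OF j'(2) x(1)] ..
    finally have eq: "tpow N \<rho> (j + n) (monomial a c \<odot>\<^bsub>N\<^esub> w)
        = f (monomial (face_degree \<rho> (int j) + a) c \<odot>\<^bsub>M\<^esub> x)" .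
    show ?thesis by (rule CollectI, rule conjI, rule N.single_closed[OF a w], rule exI, rule bexI, rule eq, rule M.single_closed[OF j'(2) x(1)])
  qed
  show "component N d w \<in> ?H" if "w \<in> ?H" for d w
  proof -
    from that obtain n x where x: "x \<in> carrier M" "tpow N \<rho> n w = f x" and w: "w \<in> carrier N" by (elim CollectE conjE exE bexE) simp
    have "tpow N \<rho> n (component N d w) = component N (face_degree \<rho> (int n) + d) (tpow N \<rho> n w)"
      by (simp add: face_power_def N.component_single face_degree_loc w)
    also have "\<dots> = f (component M (face_degree \<rho> (int n) + d) x)" unfolding x(2) comp[OF x(1)] ..
    finally have eq: "tpow N \<rho> n (component N d w) = f (component M (face_degree \<rho> (int n) + d) x)" .
    show ?thesis by (rule CollectI, rule conjI, rule N.component_closed[OF w], rule exI, rule bexI, rule eq, rule M.component_closed[OF x(1)])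
  qed
qed

text \<open>The module \<open>A\<close> consists of pairs \<open>(x, y)\<close> in \<open>X \<times> Y\<close> with \<open>h (x/1) = y/1\<close> at all missing faces, and \<open>s\<close>, \<open>f\<close>
  are the projections. Then \<open>h \<circ> L s = L f\<close> holds by construction. If \<open>x = 0\<close> then \<open>y/1 = 0\<close> at all
  missing faces, so the kernel of \<open>s\<close> is torsion. For its cokernel, given \<open>x\<close> and \<open>\<sigma>\<close>, write
  \<open>h (t\<^sub>\<sigma>\<^sup>n x / 1)\<close> at \<open>\<sigma>\<close> as \<open>y/1\<close>; over \<open>\<sigma> \<union> \<tau>\<close> this equality persists, so at \<open>\<tau>\<close> it holds up to
  \<open>t\<^sub>\<sigma>\<close>-power torsion. Finitely many homogeneous pairs are enough for this, and their span is finitely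
  generated.\<close>

lemma Loc_full:
  fixes X Y :: "('k::field, 'n::finite, 'a) gmod"
  assumes universe: "\<exists>e :: ('k, 'n) laurent \<Rightarrow> 'a. inj e" and K: "simplicial_complex K"
    and X: "X \<in> Obj Rmod" and Y: "Y \<in> Obj Rmod" and h: "h \<in> Hom (Lcat K) (Lobj K X) (Lobj K Y)"
  shows "\<exists>A\<in>Obj Rmod. \<exists>s f. inverted_arrow Rmod (localization_kernel K) A X s \<and> f \<in> Hom Rmod A Y \<and>
    Comp (Lcat K) (Lobj K A) (Lobj K X) (Lobj K Y) h (Lhom K A X s) = Lhom K A Y f"
proof -
  have gm: "graded_module {} X" "graded_module {} Y" and fg: "finitely_generated {} X" "finitely_generated {} Y"
    and hh: "h \<in> localized_hom K (Lobj K X) (Lobj K Y)" using X Y h by auto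
  note LX = Loc_localized[OF gm(1) fg(1), of K] and LY = Loc_localized[OF gm(2) fg(2), of K]
  interpret N: localized K "Lobj K Y" by unfold_locales (rule K LY)+
  let ?F = "\<lambda>b. if b then X else Y"
  interpret P: graded_family "UNIV :: bool set" "\<lambda>b. {}" ?F by unfold_locales (use gm in auto)
  note P = P.P_graded
  let ?pX = "\<lambda>y\<in>carrier P.P. y True" and ?pY = "\<lambda>y\<in>carrier P.P. y False"
  have pX: "?pX \<in> graded_hom {} P.P X" and pY: "?pY \<in> graded_hom {} P.P Y"
    using P.projection_hom[of True] P.projection_hom[of False] by simp_all
  interpret X: graded_mod "{}" X by unfold_locales (rule gm)
  interpret Y: graded_mod "{}" Y by unfold_locales (rule gm)
  interpret M: graded_mod "{}" P.P by unfold_locales (rule P)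
  let ?B = "\<lambda>\<sigma>. loc \<sigma> Y"
  have h_map: "graded_map \<sigma> \<sigma> (loc \<sigma> X) (?B \<sigma>) (h \<sigma>)" if "\<sigma> \<in> N.MF" for \<sigma>
    using localized_hom_map[OF LX LY hh that] unfolding Loc_simps(1) .
  have h_unit: "graded_map {} \<sigma> X (?B \<sigma>) (compose (carrier X) (h \<sigma>) (unit_map \<sigma> X))" if \<sigma>: "\<sigma> \<in> N.MF" for \<sigma>
    by unfold_locales (rule gm base_change_graded[OF gm(2)] empty_subsetI
      graded_hom_compose[OF gm(1) base_change_graded[OF gm(1)] base_change_graded[OF gm(2)] empty_subsetI subset_refl
        unit_map_hom[OF gm(1)] graded_map.hom[OF h_map[OF \<sigma>]]])+
  let ?g = "\<lambda>\<sigma>. compose (carrier X) (h \<sigma>) (unit_map \<sigma> X)"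
  let ?E = "\<lambda>\<sigma>. {y \<in> carrier P.P. compose (carrier P.P) (?g \<sigma>) ?pX y = compose (carrier P.P) (unit_map \<sigma> Y) ?pY y}"
  let ?H = "{y \<in> carrier P.P. \<forall>\<sigma>\<in>N.MF. y \<in> ?E \<sigma>}"
  have E: "graded_sub {} P.P (?E \<sigma>)" if \<sigma>: "\<sigma> \<in> N.MF" for \<sigma>
    by (rule equalizer_sub[OF P base_change_graded[OF gm(2)] empty_subsetI
      graded_hom_compose[OF P gm(1) base_change_graded[OF gm(2)] subset_refl empty_subsetI pX graded_map.hom[OF h_unit[OF \<sigma>]]]
      graded_hom_compose[OF P gm(2) base_change_graded[OF gm(2)] subset_refl empty_subsetI pY unit_map_hom[OF gm(2)]]])
  have H: "graded_sub {} P.P ?H" by (rule M.intersection_sub[OF E])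
  have PX: "y True \<in> carrier X" and PY: "y False \<in> carrier Y" if "y \<in> carrier P.P" for y
    using P.P_closed[OF that, of True] P.P_closed[OF that, of False] by simp_all
  have H_iff: "y \<in> ?H \<longleftrightarrow> y \<in> carrier P.P \<and> (\<forall>\<sigma>\<in>N.MF. h \<sigma> (unit_map \<sigma> X (y True)) = unit_map \<sigma> Y (y False))" for y
    using PX by (auto simp: compose_def)
  have lift: "\<exists>n z. z \<in> ?H \<and> z True = tpow X \<sigma> n x" if \<sigma>: "\<sigma> \<in> N.MF" and x: "x \<in> carrier X" for \<sigma> x
  proof -
    note x' = X.tpow_closed[OF x]
    interpret g: graded_map "{}" \<sigma> X "?B \<sigma>" "?g \<sigma>" by (rule h_unit[OF \<sigma>])
    obtain n y where y: "y \<in> carrier Y" and ny: "tpow (?B \<sigma>) \<sigma> n (?g \<sigma> x) = unit_map \<sigma> Y y"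
      using power_localizationD(3)[OF unit_map_localization[OF gm(2)] g.closed[OF x]] by blast
    let ?x = "tpow X \<sigma> n x"
    have gx: "?g \<sigma> ?x = unit_map \<sigma> Y y" unfolding g.smult[OF tpow_loc x] ny ..
    \<comment> \<open>The obstruction to \<open>h (x'/1) = y/1\<close>, with \<open>x' = t\<^sub>\<sigma>\<^sup>n x\<close>, at the face \<open>\<tau>\<close>.\<close>
    let ?d = "\<lambda>\<tau>. ?g \<tau> ?x \<ominus>\<^bsub>?B \<tau>\<^esub> unit_map \<tau> Y y"
    have closed: "?g \<tau> ?x \<in> carrier (?B \<tau>)" "unit_map \<tau> Y y \<in> carrier (?B \<tau>)" if "\<tau> \<in> N.MF" for \<tau>
      by (rule graded_map.closed[OF h_unit[OF that] x'] graded_map.closed[OF unit_map_graded_map[OF gm(2)] y])+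
    have d_closed: "?d \<tau> \<in> carrier (at_face (Lobj K Y) \<tau>)" if \<tau>: "\<tau> \<in> N.MF" for \<tau>
    proof -
      interpret B: graded_mod \<tau> "?B \<tau>" by unfold_locales (rule base_change_graded[OF gm(2)])
      show ?thesis unfolding Loc_simps(1) by (rule B.M.minus_closed[OF closed[OF \<tau>]])
    qed
    have trans: "transition (Lobj K Y) \<rho> \<tau> (?d \<rho>) = ?d \<tau>" if \<rho>: "\<rho> \<in> N.MF" and \<tau>: "\<tau> \<in> N.MF" and sub: "\<rho> \<subseteq> \<tau>" for \<rho> \<tau>
    proof -
      interpret t: graded_map \<rho> \<tau> "?B \<rho>" "?B \<tau>" "transition (Lobj K Y) \<rho> \<tau>"
        using N.face_map[OF that] unfolding Loc_simps(1) .
      have "transition (Lobj K Y) \<rho> \<tau> (h \<rho> (unit_map \<rho> X ?x)) = h \<tau> (unit_map \<tau> X ?x)"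
        using localized_homD(2)[OF hh \<rho> \<tau> sub, of "unit_map \<rho> X ?x"] graded_map.closed[OF unit_map_graded_map[OF gm(1)] x', of \<rho>]
        unfolding Loc_simps(1) Loc_transition(2)[OF gm(1) sub x'] by simp
      then show ?thesis
        using t.diff[OF closed[OF \<rho>]] x' unfolding Loc_transition(2)[OF gm(2) sub y] by (simp add: compose_def)
    qed
    have zero: "transition (Lobj K Y) \<tau> (\<sigma> \<union> \<tau>) (?d \<tau>) = \<zero>\<^bsub>at_face (Lobj K Y) (\<sigma> \<union> \<tau>)\<^esub>" if \<tau>: "\<tau> \<in> N.MF" for \<tau>
    proof -
      have \<upsilon>: "\<sigma> \<union> \<tau> \<in> N.MF" by (rule N.face_union[OF \<sigma>])
      interpret t: graded_map \<sigma> "\<sigma> \<union> \<tau>" "?B \<sigma>" "?B (\<sigma> \<union> \<tau>)" "transition (Lobj K Y) \<sigma> (\<sigma> \<union> \<tau>)"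
        using N.face_map[OF \<sigma> \<upsilon> Un_upper1] unfolding Loc_simps(1) .
      have "?d \<sigma> = \<zero>\<^bsub>?B \<sigma>\<^esub>" unfolding gx by (rule g.N.diff_self[OF closed(2)[OF \<sigma>]])
      then show ?thesis
        unfolding trans[OF \<tau> \<upsilon> Un_upper2] trans[OF \<sigma> \<upsilon> Un_upper1, symmetric] Loc_simps(1) by (simp only: t.zero)
    qed
    obtain k :: nat where k: "\<forall>\<tau>\<in>N.MF. \<forall>j\<ge>k. tpow (?B \<tau>) \<sigma> j (?d \<tau>) = \<zero>\<^bsub>?B \<tau>\<^esub>"
      using N.uniform_torsion[OF \<sigma> d_closed zero] unfolding Loc_simps(1) by blast
    let ?z = "\<lambda>b. if b then tpow X \<sigma> k ?x else tpow Y \<sigma> k y"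
    have "restrict ?z UNIV \<in> carrier P.P"
      by (rule P.restrict_P) (use x' y X.tpow_closed Y.tpow_closed X.component_outside Y.component_outside in auto)
    moreover have "h \<tau> (unit_map \<tau> X (tpow X \<sigma> k ?x)) = unit_map \<tau> Y (tpow Y \<sigma> k y)" if \<tau>: "\<tau> \<in> N.MF" for \<tau>
    proof -
      interpret g: graded_map "{}" \<tau> X "?B \<tau>" "?g \<tau>" by (rule h_unit[OF \<tau>])
      interpret u: graded_map "{}" \<tau> Y "?B \<tau>" "unit_map \<tau> Y" by (rule unit_map_graded_map[OF gm(2)])
      have "?g \<tau> (tpow X \<sigma> k ?x) = unit_map \<tau> Y (tpow Y \<sigma> k y)"
        using bspec[OF k \<tau>] unfolding g.N.tpow_diff_zero_iff[OF closed[OF \<tau>], symmetric]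
          g.smult[OF tpow_loc x'] u.smult[OF tpow_loc y] by simp
      then show ?thesis using X.tpow_closed[OF x'] by (simp add: compose_def)
    qed
    ultimately have "restrict ?z UNIV \<in> ?H" unfolding H_iff by simp
    then show ?thesis using X.tpow_add[OF x, of \<sigma> k n] by (intro exI[of _ "k + n"] exI[of _ "restrict ?z UNIV"]) simp
  qed
  have homogeneous_lift: "\<exists>z. z \<in> ?H \<and> (\<exists>e. z \<in> hcomp P.P e) \<and> (\<exists>n. z True = tpow X \<sigma> n x)"
    if \<sigma>: "\<sigma> \<in> N.MF" and x: "x \<in> hcomp X d" for \<sigma> x d
  proof -
    obtain n z where z: "z \<in> ?H" "z True = tpow X \<sigma> n x" using lift[OF \<sigma> X.hcomp_closed[OF x]] by blast
    let ?d = "face_degree \<sigma> (int n) + d"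
    have zP: "z \<in> carrier P.P" using z(1) by blast
    have "tpow X \<sigma> n x \<in> hcomp X ?d" unfolding face_power_def by (rule X.single_hcomp[OF face_degree_loc x]) simp
    then have "component P.P ?d z True = tpow X \<sigma> n x"
      unfolding P.component_P[OF zP] using z(2) X.component_homogeneous[of _ ?d ?d] by simp
    then show ?thesis using graded_subD(5)[OF H z(1), of ?d] M.component_decomposition(1)[OF zP, of ?d] by blast
  qed
  obtain A where A: "finite A" "\<And>a. a \<in> A \<Longrightarrow> \<exists>d. a \<in> hcomp X d" and span: "gspan {} X A = carrier X"
    using fg(1) unfolding X.finitely_generated_iff by blast
  have "\<forall>p\<in>N.MF \<times> A. \<exists>z. z \<in> ?H \<and> (\<exists>e. z \<in> hcomp P.P e) \<and> (\<exists>n. z True = tpow X (fst p) n (snd p))"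
    using homogeneous_lift A(2) by fastforce
  from bchoice[OF this] obtain g where
    g: "\<forall>p\<in>N.MF \<times> A. g p \<in> ?H \<and> (\<exists>e. g p \<in> hcomp P.P e) \<and> (\<exists>n. g p True = tpow X (fst p) n (snd p))" ..
  let ?G = "g ` (N.MF \<times> A)"
  let ?S = "gspan {} P.P ?G"
  have G_sub: "?G \<subseteq> carrier P.P" using g by blast
  note S = M.gspan_sub[OF G_sub]
  have SH: "?S \<subseteq> ?H" by (rule gspan_least[OF H]) (use g in blast)
  have Sf: "finitely_generated {} (sub_object P.P ?S)"
    by (rule M.gspan_object_finitely_generated) (use g A(1) in auto)
  let ?A0 = "sub_object P.P ?S"
  obtain A' :: "('k, 'n, 'a) gmod" and r where A': "A' \<in> Obj Rmod" and r: "r \<in> graded_hom {} A' ?A0" and bij: "bij_betw r (carrier A') ?S"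
    using Rmod_transport[OF universe Sf M.graded_sub_object(1)[OF S]] by auto
  have Ag: "graded_module {} A'" using A' by simp
  interpret r: graded_map "{}" "{}" A' ?A0 r by unfold_locales (use Ag M.graded_sub_object(1)[OF S] r in auto)
  have r_H: "r a \<in> carrier P.P" "\<And>\<sigma>. \<sigma> \<in> N.MF \<Longrightarrow> h \<sigma> (unit_map \<sigma> X (r a True)) = unit_map \<sigma> Y (r a False)" if "a \<in> carrier A'" for a
    using subsetD[OF SH bij_betw_apply[OF bij that]] unfolding H_iff by blast+
  let ?r = "compose (carrier A') (\<lambda>y\<in>?S. y) r"
  have r': "?r \<in> graded_hom {} A' P.P"
    by (rule graded_hom_compose[OF Ag M.graded_sub_object(1)[OF S] P subset_refl subset_refl r graded_hom_inclusion[OF P S]])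
  let ?s = "compose (carrier A') ?pX ?r" and ?f = "compose (carrier A') ?pY ?r"
  have s: "?s \<in> graded_hom {} A' X" by (rule graded_hom_compose[OF Ag P gm(1) subset_refl subset_refl r' pX])
  have f: "?f \<in> graded_hom {} A' Y" by (rule graded_hom_compose[OF Ag P gm(2) subset_refl subset_refl r' pY])
  have sf: "?s a = r a True" "?f a = r a False" if "a \<in> carrier A'" for a
    using restrict_apply'[OF bij_betw_apply[OF bij that], of "\<lambda>y. y"] by (simp_all only: compose_eq[OF that] restrict_apply'[OF r_H(1)[OF that]])
  have "torsion_iso K A' X ?s"
    unfolding torsion_iso_def
  proof (intro ballI conjI impI)
    fix \<sigma> a assume \<sigma>: "\<sigma> \<in> missing_faces K" and a: "a \<in> carrier A'" and z: "?s a = \<zero>\<^bsub>X\<^esub>"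
    interpret g: graded_map "{}" \<sigma> X "?B \<sigma>" "?g \<sigma>" by (rule h_unit[OF \<sigma>])
    have "unit_map \<sigma> Y (r a False) = ?g \<sigma> \<zero>\<^bsub>X\<^esub>"
      using r_H(2)[OF a \<sigma>] z unfolding sf(1)[OF a] by (simp add: compose_def)
    then obtain n :: nat where n: "tpow Y \<sigma> n (r a False) = \<zero>\<^bsub>Y\<^esub>"
      unfolding g.zero unit_map_zero_iff[OF gm(2) PY[OF r_H(1)[OF a]]] ..
    have zX: "tpow X \<sigma> n \<zero>\<^bsub>X\<^esub> = \<zero>\<^bsub>X\<^esub>" by (rule X.smult_r_null[OF tpow_loc])
    have "tpow P.P \<sigma> n (r a) = \<zero>\<^bsub>P.P\<^esub>"
      unfolding P.P_simps using n zX z sf(1)[OF a] by (auto simp: fun_eq_iff split: if_splits)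
    then have "r (tpow A' \<sigma> n a) = r \<zero>\<^bsub>A'\<^esub>" unfolding r.smult[OF tpow_loc a] r.zero by simp
    then have "tpow A' \<sigma> n a = \<zero>\<^bsub>A'\<^esub>"
      by (rule inj_onD[OF bij_betw_imp_inj_on[OF bij], OF _ r.M.tpow_closed[OF a] r.M.M.zero_closed])
    then show "\<exists>n. tpow A' \<sigma> n a = \<zero>\<^bsub>A'\<^esub>" ..
  next
    fix \<sigma> x assume \<sigma>: "\<sigma> \<in> missing_faces K" and x: "x \<in> carrier X"
    interpret s: graded_map "{}" "{}" A' X ?s by unfold_locales (use Ag gm s in auto)
    let ?W = "{w \<in> carrier X. \<exists>n. \<exists>a\<in>carrier A'. tpow X \<sigma> n w = ?s a}"
    have "A \<subseteq> ?W"
    proof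
      fix x assume x: "x \<in> A"
      then obtain n where n: "g (\<sigma>, x) True = tpow X \<sigma> n x" using g \<sigma> by fastforce
      have "g (\<sigma>, x) \<in> ?S" using M.gspan_superset[OF G_sub] x \<sigma> by blast
      then obtain a where a: "a \<in> carrier A'" "g (\<sigma>, x) = r a" using bij_betw_imp_surj_on[OF bij] by blast
      have "tpow X \<sigma> n x = ?s a" unfolding sf(1)[OF a(1)] n[symmetric] a(2) ..
      moreover have "x \<in> carrier X" using A(2)[OF x] X.hcomp_closed by blast
      ultimately show "x \<in> ?W" using a(1) by blast
    qed
    from subsetD[OF gspan_least[OF s.fraction_sub[OF empty_subsetI] this, unfolded span] x]
    show "\<exists>n. tpow X \<sigma> n x \<in> ?s ` carrier A'"
      by (elim CollectE conjE exE bexE) (intro exI, erule image_eqI, assumption)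
  qed
  then have "inverted_arrow Rmod (localization_kernel K) A' X ?s" using inverted_iff_torsion_iso[OF A' X] s by simp
  moreover have "Comp (Lcat K) (Lobj K A') (Lobj K X) (Lobj K Y) h (Lhom K A' X ?s) = Lhom K A' Y ?f"
  proof (rule Loc_hom_ext[OF Ag LY])
    have LA: "localized_module K (Lobj K A')" using A' Loc_localized by auto
    show "Comp (Lcat K) (Lobj K A') (Lobj K X) (Lobj K Y) h (Lhom K A' X ?s)
        \<in> localized_hom K (Lobj K A') (Lobj K Y)"
      by (rule localized_hom_compose[OF LA LX LY Loc_localized_hom[OF Ag gm(1) s] hh])
    show "Lhom K A' Y ?f \<in> localized_hom K (Lobj K A') (Lobj K Y)"
      by (rule Loc_localized_hom[OF Ag gm(2) f])
    fix \<sigma> a assume \<sigma>: "\<sigma> \<in> missing_faces K" and a: "a \<in> carrier A'"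
    have u: "unit_map \<sigma> A' a \<in> carrier (at_face (Lobj K A') \<sigma>)"
      unfolding Loc_simps(1) by (rule graded_map.closed[OF unit_map_graded_map[OF Ag] a])
    show "Comp (Lcat K) (Lobj K A') (Lobj K X) (Lobj K Y) h (Lhom K A' X ?s) \<sigma> (unit_map \<sigma> A' a)
        = Lhom K A' Y ?f \<sigma> (unit_map \<sigma> A' a)"
      unfolding Lcat_comp_apply[OF \<sigma> u] Loc_hom(2)[OF Ag gm(1) s \<sigma> a] Loc_hom(2)[OF Ag gm(2) f \<sigma> a] sf[OF a] by (rule r_H(2)[OF a \<sigma>])
  qed
  ultimately show ?thesis using A' f by (intro bexI[of _ A'] exI[of _ ?s] exI[of _ ?f]) simp
qed

section \<open>Essential surjectivity\<close>

context localized
begin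

definition compatible :: "('n set \<Rightarrow> 'b) \<Rightarrow> bool" where
  "compatible y \<longleftrightarrow> (\<forall>\<sigma>\<in>MF. \<forall>\<tau>\<in>MF. \<sigma> \<subseteq> \<tau> \<longrightarrow> T \<sigma> \<tau> (y \<sigma>) = y \<tau>)"

text \<open>The elements \<open>w \<tau>\<close> are chosen to agree with \<open>t\<^sub>\<sigma>\<^sup>m y\<close> over \<open>\<sigma> \<union> \<tau>\<close>. For \<open>\<rho> \<subseteq> \<tau>\<close> the difference of \<open>w \<tau>\<close> and
  the image of \<open>w \<rho>\<close> then vanishes over \<open>\<sigma> \<union> \<tau>\<close>, so that it is killed by a power of \<open>t\<^sub>\<sigma>\<close>.\<close>

lemma compatible_extension:
  assumes \<sigma>: "\<sigma> \<in> MF" and y: "y \<in> carrier (F \<sigma>)"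
  shows "\<exists>n z. (\<forall>\<tau>\<in>MF. z \<tau> \<in> carrier (F \<tau>)) \<and> compatible z \<and> z \<sigma> = tpow (F \<sigma>) \<sigma> n y"
proof -
  let ?t = "\<lambda>\<tau> n x. tpow (F \<tau>) \<sigma> n x"
  note graded = localized_moduleD(1)[OF N] and U = face_union[OF \<sigma>]
  have Ty: "T \<sigma> (\<sigma> \<union> \<tau>) y \<in> carrier (F (\<sigma> \<union> \<tau>))" for \<tau>
    by (rule graded_map.closed[OF face_map[OF \<sigma> U Un_upper1] y])
  have "\<forall>\<tau>\<in>MF. \<exists>n::nat. \<exists>w\<in>carrier (F \<tau>). ?t (\<sigma> \<union> \<tau>) n (T \<sigma> (\<sigma> \<union> \<tau>) y) = T \<tau> (\<sigma> \<union> \<tau>) w"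
  proof
    fix \<tau> assume \<tau>: "\<tau> \<in> MF"
    show "\<exists>n::nat. \<exists>w\<in>carrier (F \<tau>). ?t (\<sigma> \<union> \<tau>) n (T \<sigma> (\<sigma> \<union> \<tau>) y) = T \<tau> (\<sigma> \<union> \<tau>) w"
      by (rule power_localization_union(2)[OF graded[OF \<tau>] graded[OF U] face_map_union[OF \<sigma> \<tau>] Ty])
  qed
  from bchoice[OF this] obtain n :: "'n set \<Rightarrow> nat"
    where "\<forall>\<tau>\<in>MF. \<exists>w. w \<in> carrier (F \<tau>) \<and> ?t (\<sigma> \<union> \<tau>) (n \<tau>) (T \<sigma> (\<sigma> \<union> \<tau>) y) = T \<tau> (\<sigma> \<union> \<tau>) w"
    unfolding Bex_def ..
  from bchoice[OF this] obtain w0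
    where w0: "\<forall>\<tau>\<in>MF. w0 \<tau> \<in> carrier (F \<tau>) \<and> ?t (\<sigma> \<union> \<tau>) (n \<tau>) (T \<sigma> (\<sigma> \<union> \<tau>) y) = T \<tau> (\<sigma> \<union> \<tau>) (w0 \<tau>)" ..
  \<comment> \<open>The sums of exponents over all missing faces serve as common upper bounds.\<close>
  define m where "m = sum n MF"
  define w where "w \<tau> = ?t \<tau> (m - n \<tau>) (w0 \<tau>)" for \<tau>
  have w: "w \<tau> \<in> carrier (F \<tau>)" "T \<tau> (\<sigma> \<union> \<tau>) (w \<tau>) = ?t (\<sigma> \<union> \<tau>) m (T \<sigma> (\<sigma> \<union> \<tau>) y)" if \<tau>: "\<tau> \<in> MF" for \<tau>
  proof -
    interpret t: graded_map \<tau> "\<sigma> \<union> \<tau>" "F \<tau>" "F (\<sigma> \<union> \<tau>)" "T \<tau> (\<sigma> \<union> \<tau>)" by (rule face_map[OF \<tau> U Un_upper2])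
    note w0\<tau> = bspec[OF w0 \<tau>, THEN conjunct1] bspec[OF w0 \<tau>, THEN conjunct2]
    show "w \<tau> \<in> carrier (F \<tau>)" unfolding w_def by (rule t.M.tpow_closed[OF w0\<tau>(1)])
    have le: "n \<tau> \<le> m" unfolding m_def by (rule member_le_sum[OF \<tau>]) auto
    show "T \<tau> (\<sigma> \<union> \<tau>) (w \<tau>) = ?t (\<sigma> \<union> \<tau>) m (T \<sigma> (\<sigma> \<union> \<tau>) y)"
      unfolding w_def t.smult[OF tpow_loc w0\<tau>(1)] w0\<tau>(2)[symmetric] t.N.tpow_add[OF Ty, symmetric]
        le_add_diff_inverse2[OF le] ..
  qed
  have w\<sigma>: "w \<sigma> = ?t \<sigma> m y"
    using w(2)[OF \<sigma>] localized_moduleD(4)[OF N \<sigma> w(1)[OF \<sigma>]] localized_moduleD(4)[OF N \<sigma> y] by simp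
  have "\<forall>\<rho>\<in>MF. \<exists>k::nat. \<forall>\<tau>\<in>MF. \<forall>j\<ge>k. ?t \<tau> j (if \<rho> \<subseteq> \<tau> then T \<rho> \<tau> (w \<rho>) \<ominus>\<^bsub>F \<tau>\<^esub> w \<tau> else \<zero>\<^bsub>F \<tau>\<^esub>) = \<zero>\<^bsub>F \<tau>\<^esub>"
  proof
    fix \<rho> assume \<rho>: "\<rho> \<in> MF"
    show "\<exists>k::nat. \<forall>\<tau>\<in>MF. \<forall>j\<ge>k. ?t \<tau> j (if \<rho> \<subseteq> \<tau> then T \<rho> \<tau> (w \<rho>) \<ominus>\<^bsub>F \<tau>\<^esub> w \<tau> else \<zero>\<^bsub>F \<tau>\<^esub>) = \<zero>\<^bsub>F \<tau>\<^esub>"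
    proof (rule uniform_torsion[OF \<sigma>])
      fix \<tau> assume \<tau>: "\<tau> \<in> MF"
      interpret t: graded_map \<tau> "\<sigma> \<union> \<tau>" "F \<tau>" "F (\<sigma> \<union> \<tau>)" "T \<tau> (\<sigma> \<union> \<tau>)" by (rule face_map[OF \<tau> U Un_upper2])
      have Tw: "T \<rho> \<tau> (w \<rho>) \<in> carrier (F \<tau>)" if "\<rho> \<subseteq> \<tau>"
        by (rule graded_map.closed[OF face_map[OF \<rho> \<tau> that] w(1)[OF \<rho>]])
      then show "(if \<rho> \<subseteq> \<tau> then T \<rho> \<tau> (w \<rho>) \<ominus>\<^bsub>F \<tau>\<^esub> w \<tau> else \<zero>\<^bsub>F \<tau>\<^esub>) \<in> carrier (F \<tau>)"
        using w(1)[OF \<tau>] by auto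
      show "T \<tau> (\<sigma> \<union> \<tau>) (if \<rho> \<subseteq> \<tau> then T \<rho> \<tau> (w \<rho>) \<ominus>\<^bsub>F \<tau>\<^esub> w \<tau> else \<zero>\<^bsub>F \<tau>\<^esub>) = \<zero>\<^bsub>F (\<sigma> \<union> \<tau>)\<^esub>"
      proof (cases "\<rho> \<subseteq> \<tau>")
        case True
        then have sub: "\<sigma> \<union> \<rho> \<subseteq> \<sigma> \<union> \<tau>" by blast
        interpret s: graded_map "\<sigma> \<union> \<rho>" "\<sigma> \<union> \<tau>" "F (\<sigma> \<union> \<rho>)" "F (\<sigma> \<union> \<tau>)" "T (\<sigma> \<union> \<rho>) (\<sigma> \<union> \<tau>)" by (rule face_map[OF U U sub])
        have "T \<tau> (\<sigma> \<union> \<tau>) (T \<rho> \<tau> (w \<rho>)) = T (\<sigma> \<union> \<rho>) (\<sigma> \<union> \<tau>) (T \<rho> (\<sigma> \<union> \<rho>) (w \<rho>))"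
          unfolding localized_moduleD(5)[OF N \<rho> \<tau> U True Un_upper2 w(1)[OF \<rho>]]
            localized_moduleD(5)[OF N \<rho> U U Un_upper2 sub w(1)[OF \<rho>]] ..
        also have "\<dots> = T \<tau> (\<sigma> \<union> \<tau>) (w \<tau>)"
          unfolding w(2)[OF \<rho>] w(2)[OF \<tau>] s.smult[OF tpow_loc Ty] localized_moduleD(5)[OF N \<sigma> U U Un_upper1 sub y] ..
        finally have "T \<tau> (\<sigma> \<union> \<tau>) (T \<rho> \<tau> (w \<rho>)) = T \<tau> (\<sigma> \<union> \<tau>) (w \<tau>)" .
        then show ?thesis
          using True t.diff[OF Tw[OF True] w(1)[OF \<tau>]] t.N.diff_self[OF t.closed[OF w(1)[OF \<tau>]]] by simp
      qed (simp add: t.zero)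
    qed
  qed
  from bchoice[OF this] obtain k :: "'n set \<Rightarrow> nat" where
    k: "\<forall>\<rho>\<in>MF. \<forall>\<tau>\<in>MF. \<forall>j\<ge>k \<rho>. ?t \<tau> j (if \<rho> \<subseteq> \<tau> then T \<rho> \<tau> (w \<rho>) \<ominus>\<^bsub>F \<tau>\<^esub> w \<tau> else \<zero>\<^bsub>F \<tau>\<^esub>) = \<zero>\<^bsub>F \<tau>\<^esub>" ..
  define l where "l = sum k MF"
  have "compatible (\<lambda>\<tau>. ?t \<tau> l (w \<tau>))"
    unfolding compatible_def
  proof (intro ballI impI)
    fix \<rho> \<tau> assume \<rho>: "\<rho> \<in> MF" and \<tau>: "\<tau> \<in> MF" and sub: "\<rho> \<subseteq> \<tau>"
    interpret t: graded_map \<rho> \<tau> "F \<rho>" "F \<tau>" "T \<rho> \<tau>" by (rule face_map[OF \<rho> \<tau> sub])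
    have "k \<rho> \<le> l" unfolding l_def by (rule member_le_sum[OF \<rho>]) auto
    then have "?t \<tau> l (T \<rho> \<tau> (w \<rho>) \<ominus>\<^bsub>F \<tau>\<^esub> w \<tau>) = \<zero>\<^bsub>F \<tau>\<^esub>" using bspec[OF bspec[OF k \<rho>] \<tau>] sub by simp
    then show "T \<rho> \<tau> (?t \<rho> l (w \<rho>)) = ?t \<tau> l (w \<tau>)"
      unfolding t.N.tpow_diff_zero_iff[OF t.closed[OF w(1)[OF \<rho>]] w(1)[OF \<tau>]] t.smult[OF tpow_loc w(1)[OF \<rho>]] .
  qed
  moreover have "?t \<tau> l (w \<tau>) \<in> carrier (F \<tau>)" if \<tau>: "\<tau> \<in> MF" for \<tau>
    by (rule graded_mod.tpow_closed[OF face_mod[OF \<tau>] w(1)[OF \<tau>]])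
  moreover have "?t \<sigma> l (w \<sigma>) = ?t \<sigma> (l + m) y"
    unfolding w\<sigma> by (rule graded_mod.tpow_add[OF face_mod[OF \<sigma>] y, symmetric])
  ultimately show ?thesis by (intro exI[of _ "l + m"] exI[of _ "\<lambda>\<tau>. ?t \<tau> l (w \<tau>)"]) simp
qed

sublocale product: graded_family MF "\<lambda>\<tau>. \<tau>" F
  by unfold_locales (auto intro: localized_moduleD(1)[OF N])

text \<open>Components of a compatible family form a compatible family; a further power of \<open>t\<^sub>\<sigma>\<close> moves its degree
  into \<open>\<nat>\<^sup>m\<close>.\<close>

lemma homogeneous_extension:
  assumes \<sigma>: "\<sigma> \<in> MF" and y: "y \<in> hcomp (F \<sigma>) d"
  shows "\<exists>n z e. z \<in> hcomp product.P e \<and> compatible z \<and> z \<sigma> = tpow (F \<sigma>) \<sigma> n y"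
proof -
  interpret M: graded_mod \<sigma> "F \<sigma>" by (rule face_mod[OF \<sigma>])
  \<comment> \<open>If \<open>d\<close> is outside the grading set then \<open>y\<close> vanishes, and is homogeneous of degree \<open>0\<close>.\<close>
  obtain d where d: "d \<in> loc_degrees \<sigma>" and y: "y \<in> hcomp (F \<sigma>) d"
    using y M.hcomp_outside[of d] M.zero_hcomp zero_loc_degrees[of \<sigma>] singletonD by metis
  obtain n z where z: "\<And>\<tau>. \<tau> \<in> MF \<Longrightarrow> z \<tau> \<in> carrier (F \<tau>)" and comp: "compatible z"
    and zy: "z \<sigma> = tpow (F \<sigma>) \<sigma> n y"
    using compatible_extension[OF \<sigma> M.hcomp_closed[OF y]] by blast
  let ?d = "face_degree \<sigma> (int n) + d"
  obtain j :: nat where j: "face_degree \<sigma> (int j) + ?d \<in> loc_degrees {}"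
    using face_degree_clears[OF add_loc_degrees[OF face_degree_loc d], of \<sigma> "int n"] by auto
  let ?z = "\<lambda>\<tau>\<in>MF. tpow (F \<tau>) \<sigma> j (component (F \<tau>) ?d (z \<tau>))"
  have "?z \<in> hcomp product.P (face_degree \<sigma> (int j) + ?d)"
    using j graded_mod.single_hcomp[OF face_mod face_degree_loc graded_mod.component_decomposition(1)[OF face_mod z]]
    by (auto simp: truncated_product_def face_power_def)
  moreover have "compatible ?z"
    unfolding compatible_def
  proof (intro ballI impI)
    fix \<rho> \<tau> assume \<rho>: "\<rho> \<in> MF" and \<tau>: "\<tau> \<in> MF" and sub: "\<rho> \<subseteq> \<tau>"
    interpret t: graded_map \<rho> \<tau> "F \<rho>" "F \<tau>" "T \<rho> \<tau>" by (rule face_map[OF \<rho> \<tau> sub])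
    have "T \<rho> \<tau> (z \<rho>) = z \<tau>" using comp \<rho> \<tau> sub unfolding compatible_def by blast
    then show "T \<rho> \<tau> (?z \<rho>) = ?z \<tau>"
      using \<rho> \<tau> t.smult[OF tpow_loc t.M.component_closed[OF z[OF \<rho>]]] t.comp[OF z[OF \<rho>]] by simp
  qed
  moreover have "?z \<sigma> = tpow (F \<sigma>) \<sigma> (j + n) y"
  proof -
    have "z \<sigma> \<in> hcomp (F \<sigma>) ?d"
      unfolding zy face_power_def by (rule M.single_hcomp[OF face_degree_loc y]) simp
    then show ?thesis
      using \<sigma> M.component_homogeneous[of "z \<sigma>" ?d ?d] M.tpow_add[OF M.hcomp_closed[OF y]] by (simp add: zy)
  qed
  ultimately show ?thesis by blast
qed

lemma compatible_sub: "graded_sub {} product.P {y \<in> carrier product.P. compatible y}"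
proof -
  interpret P: graded_mod "{}" product.P by unfold_locales (rule product.P_graded)
  let ?I = "{(\<sigma>, \<tau>). \<sigma> \<in> MF \<and> \<tau> \<in> MF \<and> \<sigma> \<subseteq> \<tau>}" and ?p = "\<lambda>\<sigma>. \<lambda>y\<in>carrier product.P. y \<sigma>"
  let ?H = "\<lambda>(\<sigma>, \<tau>). {y \<in> carrier product.P. compose (carrier product.P) (T \<sigma> \<tau>) (?p \<sigma>) y = ?p \<tau> y}"
  have E: "graded_sub {} product.P (?H (\<sigma>, \<tau>))" if \<sigma>: "\<sigma> \<in> MF" and \<tau>: "\<tau> \<in> MF" and sub: "\<sigma> \<subseteq> \<tau>" for \<sigma> \<tau>
  proof -
    interpret t: graded_map \<sigma> \<tau> "F \<sigma>" "F \<tau>" "T \<sigma> \<tau>" by (rule face_map[OF \<sigma> \<tau> sub])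
    show ?thesis unfolding prod.case
      by (rule equalizer_sub[OF P.graded t.N.graded empty_subsetI
        graded_hom_compose[OF P.graded t.M.graded t.N.graded empty_subsetI sub product.projection_hom[OF \<sigma>] t.hom]
        product.projection_hom[OF \<tau>]])
  qed
  have "graded_sub {} product.P (?H i)" if i: "i \<in> ?I" for i
  proof -
    obtain \<sigma> \<tau> where "i = (\<sigma>, \<tau>)" "\<sigma> \<in> MF" "\<tau> \<in> MF" "\<sigma> \<subseteq> \<tau>" using i by blast
    then show ?thesis using E[of \<sigma> \<tau>] by (simp only:)
  qed
  then have "graded_sub {} product.P {y \<in> carrier product.P. \<forall>i\<in>?I. y \<in> ?H i}" by (rule P.intersection_sub)
  moreover have "{y \<in> carrier product.P. \<forall>i\<in>?I. y \<in> ?H i} = {y \<in> carrier product.P. compatible y}"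
    unfolding compatible_def by (auto simp: compose_eq)
  ultimately show ?thesis by simp
qed

lemma face_generators:
  assumes \<sigma>: "\<sigma> \<in> MF"
  shows "\<exists>G. finite G \<and> (\<forall>z\<in>G. compatible z \<and> (\<exists>e. z \<in> hcomp product.P e)) \<and>
    (\<forall>H. graded_sub \<sigma> (F \<sigma>) H \<longrightarrow> (\<forall>z\<in>G. z \<sigma> \<in> H) \<longrightarrow> carrier (F \<sigma>) \<subseteq> H)"
proof -
  interpret M: graded_mod \<sigma> "F \<sigma>" by (rule face_mod[OF \<sigma>])
  obtain A where A: "finite A" "\<And>a. a \<in> A \<Longrightarrow> \<exists>d. a \<in> hcomp (F \<sigma>) d" and span: "gspan \<sigma> (F \<sigma>) A = carrier (F \<sigma>)"
    using localized_moduleD(2)[OF N \<sigma>] unfolding M.finitely_generated_iff by blast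
  have "\<forall>a\<in>A. \<exists>z. compatible z \<and> (\<exists>e. z \<in> hcomp product.P e) \<and> (\<exists>n::nat. z \<sigma> = tpow (F \<sigma>) \<sigma> n a)"
    using A(2) homogeneous_extension[OF \<sigma>] by meson
  from bchoice[OF this] obtain g where g: "\<forall>a\<in>A. compatible (g a) \<and> (\<exists>e. g a \<in> hcomp product.P e) \<and>
    (\<exists>n::nat. g a \<sigma> = tpow (F \<sigma>) \<sigma> n a)" ..
  have "carrier (F \<sigma>) \<subseteq> H" if H: "graded_sub \<sigma> (F \<sigma>) H" and im: "\<And>a. a \<in> A \<Longrightarrow> g a \<sigma> \<in> H" for H
  proof -
    have "a \<in> H" if a: "a \<in> A" for a
    proof -
      obtain n :: nat where n: "g a \<sigma> = tpow (F \<sigma>) \<sigma> n a" using g a by blast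
      have ac: "a \<in> carrier (F \<sigma>)" using A(2)[OF a] M.hcomp_closed by blast
      have inv: "face_power \<sigma> i \<in> carrier (loc_ring \<sigma>)" for i :: int by (rule face_power_loc) simp
      have "face_power \<sigma> (- int n) \<odot>\<^bsub>F \<sigma>\<^esub> g a \<sigma> = a"
        unfolding n M.smult_mult[OF inv inv ac, symmetric] face_power_mult using ac by simp
      then show ?thesis using M.graded_sub_smult[OF H inv im[OF a], of "- int n"] by simp
    qed
    then show ?thesis using gspan_least[OF H, of A] unfolding span by blast
  qed
  then show ?thesis using A(1) g by (intro exI[of _ "g ` A"]) auto
qed

end

text \<open>\<open>S\<close> is spanned by extensions of generators of the \<open>N\<^sub>\<sigma>\<close>. An element of \<open>S\<close> that vanishes at \<open>\<sigma>\<close> vanishes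
  over all \<open>\<sigma> \<union> \<tau>\<close> by compatibility, hence is \<open>t\<^sub>\<sigma>\<close>-power torsion. So evaluation at \<open>\<sigma>\<close> is a
  localization.\<close>

lemma (in localized) generating_object:
  "\<exists>S. graded_sub {} product.P S \<and> finitely_generated {} (sub_object product.P S) \<and> (\<forall>y\<in>S. compatible y) \<and>
    (\<forall>\<sigma>\<in>MF. power_localization {} \<sigma> (sub_object product.P S) (F \<sigma>) (\<lambda>y\<in>S. y \<sigma>))"
proof -
  interpret P: graded_mod "{}" product.P by unfold_locales (rule product.P_graded)
  have "\<forall>\<sigma>\<in>MF. \<exists>G. finite G \<and> (\<forall>z\<in>G. compatible z \<and> (\<exists>e. z \<in> hcomp product.P e)) \<and>
    (\<forall>H. graded_sub \<sigma> (F \<sigma>) H \<longrightarrow> (\<forall>z\<in>G. z \<sigma> \<in> H) \<longrightarrow> carrier (F \<sigma>) \<subseteq> H)"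
    by (intro ballI face_generators)
  from bchoice[OF this] obtain G where G: "\<forall>\<sigma>\<in>MF. finite (G \<sigma>) \<and> (\<forall>z\<in>G \<sigma>. compatible z \<and> (\<exists>e. z \<in> hcomp product.P e)) \<and>
    (\<forall>H. graded_sub \<sigma> (F \<sigma>) H \<longrightarrow> (\<forall>z\<in>G \<sigma>. z \<sigma> \<in> H) \<longrightarrow> carrier (F \<sigma>) \<subseteq> H)" ..
  let ?G = "\<Union>\<sigma>\<in>MF. G \<sigma>" and ?P = product.P
  let ?S = "gspan {} ?P ?G"
  have GP: "?G \<subseteq> {y \<in> carrier ?P. compatible y}" using G P.hcomp_closed by fastforce
  then have G_sub: "?G \<subseteq> carrier ?P" by blast
  have S: "graded_sub {} ?P ?S" by (rule P.gspan_sub[OF G_sub])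
  have S_comp: "?S \<subseteq> {y \<in> carrier ?P. compatible y}" by (rule gspan_least[OF compatible_sub GP])
  interpret S: graded_mod "{}" "sub_object ?P ?S" by unfold_locales (rule P.graded_sub_object(1)[OF S])
  have fg: "finitely_generated {} (sub_object ?P ?S)"
    by (rule P.gspan_object_finitely_generated) (use G in auto)
  have "power_localization {} \<sigma> (sub_object ?P ?S) (F \<sigma>) (\<lambda>y\<in>?S. y \<sigma>)" if \<sigma>: "\<sigma> \<in> MF" for \<sigma>
  proof -
    have SP: "y \<in> carrier ?P" if "y \<in> ?S" for y using S_comp that by blast
    have "compose ?S (\<lambda>y\<in>carrier ?P. y \<sigma>) (\<lambda>y\<in>?S. y) = (\<lambda>y\<in>?S. y \<sigma>)"
      using SP by (simp add: compose_def restrict_def fun_eq_iff)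
    then have hom: "(\<lambda>y\<in>?S. y \<sigma>) \<in> graded_hom {} (sub_object ?P ?S) (F \<sigma>)"
      using graded_hom_compose[OF S.graded P.graded localized_moduleD(1)[OF N \<sigma>] subset_refl empty_subsetI
        graded_hom_inclusion[OF P.graded S] product.projection_hom[OF \<sigma>]] by simp
    interpret e: graded_map "{}" \<sigma> "sub_object ?P ?S" "F \<sigma>" "\<lambda>y\<in>?S. y \<sigma>"
      by unfold_locales (use hom localized_moduleD(1)[OF N \<sigma>] in auto)
    show ?thesis
      unfolding power_localization_def
    proof (intro conjI hom ballI impI)
      fix y assume y: "y \<in> carrier (sub_object ?P ?S)" and z: "(\<lambda>y\<in>?S. y \<sigma>) y = \<zero>\<^bsub>F \<sigma>\<^esub>"
      have yS: "y \<in> ?S" and y\<sigma>: "y \<sigma> = \<zero>\<^bsub>F \<sigma>\<^esub>" and yP: "y \<in> carrier ?P" using y z SP by auto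
      have comp: "T \<rho> \<tau> (y \<rho>) = y \<tau>" if "\<rho> \<in> MF" "\<tau> \<in> MF" "\<rho> \<subseteq> \<tau>" for \<rho> \<tau>
        using S_comp yS that unfolding compatible_def by blast
      have "T \<tau> (\<sigma> \<union> \<tau>) (y \<tau>) = \<zero>\<^bsub>F (\<sigma> \<union> \<tau>)\<^esub>" if \<tau>: "\<tau> \<in> MF" for \<tau>
        using graded_map.zero[OF face_map[OF \<sigma> face_union[OF \<sigma>] Un_upper1]]
        unfolding comp[OF \<tau> face_union[OF \<sigma>] Un_upper2] comp[OF \<sigma> face_union[OF \<sigma>] Un_upper1, symmetric] y\<sigma> .
      then obtain k :: nat where "\<forall>\<tau>\<in>MF. \<forall>j\<ge>k. tpow (F \<tau>) \<sigma> j (y \<tau>) = \<zero>\<^bsub>F \<tau>\<^esub>"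
        using uniform_torsion[OF \<sigma> product.P_closed[OF yP]] by blast
      then have "tpow ?P \<sigma> k y = \<zero>\<^bsub>?P\<^esub>" unfolding product.P_simps by (intro restrict_ext) simp
      then show "\<exists>n. tpow (sub_object ?P ?S) \<sigma> n y = \<zero>\<^bsub>sub_object ?P ?S\<^esub>" by auto
    next
      fix w assume w: "w \<in> carrier (F \<sigma>)"
      let ?H = "{w \<in> carrier (F \<sigma>). \<exists>n::nat. \<exists>x\<in>carrier (sub_object ?P ?S).
        tpow (F \<sigma>) \<sigma> n w = (\<lambda>y\<in>?S. y \<sigma>) x}"
      have "z \<sigma> \<in> ?H" if z: "z \<in> G \<sigma>" for z
      proof -
        have zS: "z \<in> ?S" using P.gspan_superset[OF G_sub] z \<sigma> by blast
        have zc: "z \<sigma> \<in> carrier (F \<sigma>)" by (rule product.P_closed[OF SP[OF zS] \<sigma>])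
        then have eq: "tpow (F \<sigma>) \<sigma> 0 (z \<sigma>) = (\<lambda>y\<in>?S. y \<sigma>) z" using zS by simp
        show ?thesis by (rule CollectI, rule conjI[OF zc], rule exI, rule bexI, rule eq) (simp add: zS)
      qed
      then have "carrier (F \<sigma>) \<subseteq> ?H" using G \<sigma> e.fraction_sub[OF subset_refl] by blast
      then show "\<exists>n. \<exists>x\<in>carrier (sub_object ?P ?S). tpow (F \<sigma>) \<sigma> n w = (\<lambda>y\<in>?S. y \<sigma>) x"
        using w by blast
    qed
  qed
  then show ?thesis using S fg S_comp by (intro exI[of _ ?S]) blast
qed

lemma power_localization_precompose:
  assumes X: "graded_module \<sigma> X" and M: "graded_module \<sigma> M" and N: "graded_module \<tau> N" and sub: "\<sigma> \<subseteq> \<tau>"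
    and r: "r \<in> graded_hom \<sigma> X M" and bij: "bij_betw r (carrier X) (carrier M)" and \<phi>: "power_localization \<sigma> \<tau> M N \<phi>"
  shows "power_localization \<sigma> \<tau> X N (compose (carrier X) \<phi> r)"
  unfolding power_localization_def
proof (intro conjI ballI impI)
  interpret r: graded_map \<sigma> \<sigma> X M r by unfold_locales (use X M r in auto)
  show "compose (carrier X) \<phi> r \<in> graded_hom \<sigma> X N"
    by (rule graded_hom_compose[OF X M N subset_refl sub r power_localizationD(1)[OF \<phi>]])
  show "\<exists>n. tpow X \<tau> n x = \<zero>\<^bsub>X\<^esub>" if x: "x \<in> carrier X" and z: "compose (carrier X) \<phi> r x = \<zero>\<^bsub>N\<^esub>" for x
  proof -
    obtain n :: nat where "tpow M \<tau> n (r x) = \<zero>\<^bsub>M\<^esub>"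
      using power_localizationD(2)[OF \<phi> r.closed[OF x] z[unfolded compose_eq[OF x]]] ..
    then have "r (tpow X \<tau> n x) = r \<zero>\<^bsub>X\<^esub>" unfolding r.smult[OF tpow_loc x] r.zero .
    then show ?thesis
      by (intro exI) (rule inj_onD[OF bij_betw_imp_inj_on[OF bij], OF _ r.M.tpow_closed[OF x] r.M.M.zero_closed])
  qed
  show "\<exists>n. \<exists>x\<in>carrier X. tpow N \<tau> n y = compose (carrier X) \<phi> r x" if y: "y \<in> carrier N" for y
  proof -
    obtain n m where m: "m \<in> carrier M" and n: "tpow N \<tau> n y = \<phi> m" using power_localizationD(3)[OF \<phi> y] by blast
    obtain x where x: "x \<in> carrier X" "m = r x" using m bij_betw_imp_surj_on[OF bij] by blast
    have "tpow N \<tau> n y = compose (carrier X) \<phi> r x" unfolding n x(2) compose_eq[OF x(1)] ..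
    then show ?thesis using x(1) by blast
  qed
qed

lemma power_localization_bij:
  assumes M: "graded_module \<tau> M" and N: "graded_module \<tau> N" and \<phi>: "power_localization \<tau> \<tau> M N \<phi>"
  shows "bij_betw \<phi> (carrier M) (carrier N)"
proof -
  interpret \<phi>: graded_map \<tau> \<tau> M N \<phi> by unfold_locales (use M N power_localizationD(1)[OF \<phi>] in auto)
  have inv: "face_power \<tau> i \<in> carrier (loc_ring \<tau>)" for i :: int by (rule face_power_loc) simp
  have "x = \<zero>\<^bsub>M\<^esub>" if x: "x \<in> carrier M" and z: "\<phi> x = \<zero>\<^bsub>N\<^esub>" for x
  proof -
    obtain n :: nat where n: "tpow M \<tau> n x = \<zero>\<^bsub>M\<^esub>" using power_localizationD(2)[OF \<phi> x z] ..
    have "tpow M \<tau> n x = tpow M \<tau> n \<zero>\<^bsub>M\<^esub>" unfolding n \<phi>.M.smult_r_null[OF inv] ..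
    then show ?thesis by (rule \<phi>.M.face_power_cancel[OF subset_refl x \<phi>.M.M.zero_closed])
  qed
  then have "inj_on \<phi> (carrier M)" unfolding \<phi>.inj_iff by blast
  moreover have "y \<in> \<phi> ` carrier M" if y: "y \<in> carrier N" for y
  proof -
    obtain n x where x: "x \<in> carrier M" and n: "tpow N \<tau> n y = \<phi> x" using power_localizationD(3)[OF \<phi> y] by blast
    have "\<phi> (face_power \<tau> (- int n) \<odot>\<^bsub>M\<^esub> x) = y"
      unfolding \<phi>.smult[OF inv x] n[symmetric] \<phi>.N.smult_mult[OF inv inv y, symmetric] face_power_mult using y by simp
    then show ?thesis using \<phi>.M.smult_closed[OF inv x] by blast
  qed
  ultimately show ?thesis unfolding bij_betw_def using \<phi>.closed by blast
qed

text \<open>Evaluation at \<open>\<sigma>\<close> and \<open>x \<mapsto> x/1\<close> both localize the generating object at \<open>t\<^sub>\<sigma>\<close>, so the map between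
  their targets is bijective. Compatibility with the transition maps is checked on elements \<open>x/1\<close>.\<close>

lemma Loc_essentially_surjective:
  fixes N :: "('k::field, 'n::finite, ((('k, 'n) laurent \<times> 'a) \<Rightarrow>\<^sub>0 int) set) lmod"
  assumes universe: "\<exists>e :: ('k, 'n) laurent \<Rightarrow> 'a. inj e" and K: "simplicial_complex K" and N: "N \<in> Obj (Lcat K)"
  shows "\<exists>X\<in>Obj Rmod. \<exists>e. is_iso_arrow (Lcat K) (Lobj K (X :: ('k, 'n, 'a) gmod)) N e"
proof -
  have N': "localized_module K N" using N by simp
  interpret localized K N by unfold_locales (rule K N')+
  obtain S where S: "graded_sub {} product.P S" "finitely_generated {} (sub_object product.P S)"
    and comp: "\<And>y. y \<in> S \<Longrightarrow> compatible y"
    and eval: "\<And>\<sigma>. \<sigma> \<in> MF \<Longrightarrow> power_localization {} \<sigma> (sub_object product.P S) (at_face N \<sigma>) (\<lambda>y\<in>S. y \<sigma>)"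
    using generating_object by blast
  interpret P: graded_mod "{}" product.P by unfold_locales (rule product.P_graded)
  note Sg = P.graded_sub_object(1)[OF S(1)]
  obtain X :: "('k, 'n, 'a) gmod" and r where X: "X \<in> Obj Rmod" and r: "r \<in> graded_hom {} X (sub_object product.P S)"
    and bij: "bij_betw r (carrier X) S"
    using Rmod_transport[OF universe S(2) Sg] by auto
  have Xg: "graded_module {} X" and Xf: "finitely_generated {} X" using X by simp_all
  have rS: "r x \<in> S" if "x \<in> carrier X" for x by (rule bij_betw_apply[OF bij that])
  let ?\<phi> = "\<lambda>\<sigma>. compose (carrier X) (\<lambda>y\<in>S. y \<sigma>) r"
  have \<phi>: "power_localization {} \<sigma> X (at_face N \<sigma>) (?\<phi> \<sigma>)" if \<sigma>: "\<sigma> \<in> MF" for \<sigma>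
    by (rule power_localization_precompose[OF Xg Sg localized_moduleD(1)[OF N' \<sigma>] empty_subsetI r _ eval[OF \<sigma>]]) (simp add: bij)
  have \<phi>_apply: "?\<phi> \<sigma> x = r x \<sigma>" if "x \<in> carrier X" for \<sigma> x by (simp only: compose_eq[OF that] restrict_apply'[OF rS[OF that]])
  have "\<forall>\<sigma>\<in>MF. \<exists>h. h \<in> graded_hom \<sigma> (loc \<sigma> X) (at_face N \<sigma>) \<and> (\<forall>x\<in>carrier X. h (unit_map \<sigma> X x) = r x \<sigma>)"
  proof
    fix \<sigma> assume \<sigma>: "\<sigma> \<in> MF"
    interpret N\<sigma>: graded_mod \<sigma> "at_face N \<sigma>" by (rule face_mod[OF \<sigma>])
    interpret X: scalar_extension "{}" \<sigma> X by unfold_locales (rule Xg empty_subsetI)+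
    obtain h where h: "h \<in> graded_hom \<sigma> X.B (at_face N \<sigma>)"
      and hp: "\<forall>s\<in>carrier (loc_ring \<sigma>). \<forall>x\<in>carrier X. h (X.pure s x) = s \<odot>\<^bsub>at_face N \<sigma>\<^esub> ?\<phi> \<sigma> x"
      using X.lift_hom[OF N\<sigma>.graded subset_refl power_localizationD(1)[OF \<phi>[OF \<sigma>]]] by blast
    have "h (unit_map \<sigma> X x) = r x \<sigma>" if x: "x \<in> carrier X" for x
    proof -
      have "r x \<sigma> \<in> carrier (at_face N \<sigma>)" using product.P_closed[OF _ \<sigma>] graded_subD(1)[OF S(1)] rS[OF x] by blast
      then show ?thesis using bspec[OF bspec[OF hp one_in_loc_ring] x] x unfolding unit_map_def \<phi>_apply[OF x] by simp
    qed
    then show "\<exists>h. h \<in> graded_hom \<sigma> X.B (at_face N \<sigma>) \<and> (\<forall>x\<in>carrier X. h (unit_map \<sigma> X x) = r x \<sigma>)" using h by blast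
  qed
  from bchoice[OF this] obtain h where
    h: "\<forall>\<sigma>\<in>MF. h \<sigma> \<in> graded_hom \<sigma> (loc \<sigma> X) (at_face N \<sigma>) \<and> (\<forall>x\<in>carrier X. h \<sigma> (unit_map \<sigma> X x) = r x \<sigma>)" ..
  have h_hom: "h \<sigma> \<in> graded_hom \<sigma> (loc \<sigma> X) (at_face N \<sigma>)" if "\<sigma> \<in> MF" for \<sigma> using h that by blast
  have h_unit: "h \<sigma> (unit_map \<sigma> X x) = r x \<sigma>" if "\<sigma> \<in> MF" "x \<in> carrier X" for \<sigma> x using h that by blast
  note B = base_change_graded[OF Xg]
  note LX = Loc_localized[OF Xg Xf, of K]
  have e: "restrict h MF \<in> localized_hom K (Lobj K X) N"
  proof (rule localized_homI; (unfold Loc_simps(1))?)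
    show "h \<sigma> \<in> graded_hom \<sigma> (loc \<sigma> X) (at_face N \<sigma>)" if "\<sigma> \<in> MF" for \<sigma> by (rule h_hom[OF that])
    fix \<sigma> \<tau> x assume \<sigma>: "\<sigma> \<in> MF" and \<tau>: "\<tau> \<in> MF" and sub: "\<sigma> \<subseteq> \<tau>" and x: "x \<in> carrier (loc \<sigma> X)"
    let ?T = "transition (Lobj K X) \<sigma> \<tau>"
    note T = Loc_transition(1)[OF Xg sub, of K]
    interpret T: graded_map \<sigma> \<tau> "loc \<sigma> X" "loc \<tau> X" ?T by unfold_locales (rule B T sub)+
    show "?T x \<in> carrier (loc \<tau> X)" by (rule T.closed[OF x])
    have "compose (carrier (loc \<sigma> X)) (h \<tau>) ?T = compose (carrier (loc \<sigma> X)) (transition N \<sigma> \<tau>) (h \<sigma>)"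
    proof (rule power_localization_unique[OF Xg B localized_moduleD(1)[OF N' \<tau>] empty_subsetI sub unit_map_localization[OF Xg]])
      show "compose (carrier (loc \<sigma> X)) (h \<tau>) ?T \<in> graded_hom \<sigma> (loc \<sigma> X) (at_face N \<tau>)"
        by (rule graded_hom_compose[OF B B localized_moduleD(1)[OF N' \<tau>] sub subset_refl T h_hom[OF \<tau>]])
      show "compose (carrier (loc \<sigma> X)) (transition N \<sigma> \<tau>) (h \<sigma>) \<in> graded_hom \<sigma> (loc \<sigma> X) (at_face N \<tau>)"
        by (rule graded_hom_compose[OF B localized_moduleD(1)[OF N' \<sigma>] localized_moduleD(1)[OF N' \<tau>] subset_refl sub h_hom[OF \<sigma>]
          graded_map.hom[OF face_map[OF \<sigma> \<tau> sub]]])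
      fix x assume x: "x \<in> carrier X"
      have u: "unit_map \<sigma> X x \<in> carrier (loc \<sigma> X)" by (rule graded_map.closed[OF unit_map_graded_map[OF Xg] x])
      have "transition N \<sigma> \<tau> (r x \<sigma>) = r x \<tau>" using comp[OF rS[OF x]] \<sigma> \<tau> sub unfolding compatible_def by blast
      then show "compose (carrier (loc \<sigma> X)) (h \<tau>) ?T (unit_map \<sigma> X x)
          = compose (carrier (loc \<sigma> X)) (transition N \<sigma> \<tau>) (h \<sigma>) (unit_map \<sigma> X x)"
        unfolding compose_eq[OF u] Loc_transition(2)[OF Xg sub x] h_unit[OF \<sigma> x] h_unit[OF \<tau> x] by (rule sym)
    qed
    from fun_cong[OF this, of x] show "h \<tau> (?T x) = transition N \<sigma> \<tau> (h \<sigma> x)" unfolding compose_eq[OF x] .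
  qed
  have "bij_betw (restrict h MF \<sigma>) (carrier (at_face (Lobj K X) \<sigma>)) (carrier (at_face N \<sigma>))" if \<sigma>: "\<sigma> \<in> MF" for \<sigma>
  proof -
    have "power_localization \<sigma> \<sigma> (loc \<sigma> X) (at_face N \<sigma>) (h \<sigma>)"
      by (rule power_localization_cancel[OF Xg B localized_moduleD(1)[OF N' \<sigma>] empty_subsetI subset_refl unit_map_localization[OF Xg] \<phi>[OF \<sigma>] h_hom[OF \<sigma>]])
        (simp only: h_unit[OF \<sigma>] \<phi>_apply)
    from power_localization_bij[OF B localized_moduleD(1)[OF N' \<sigma>] this] show ?thesis using \<sigma> unfolding Loc_simps(1) by simp
  qed
  then have "is_iso_arrow (Lcat K) (Lobj K X) N (restrict h MF)" unfolding Lcat_iso_iff[OF LX N' e] by blast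
  then show ?thesis using X by blast
qed

section \<open>The equivalence\<close>

theorem proposition4p7:
  fixes K :: "'n::finite set set"
  assumes universe: "\<exists>e :: ('k::field, 'n) laurent \<Rightarrow> 'a. inj e"
    and K: "simplicial_complex K"
  shows "let RM = (Rmod :: (('k, 'n, 'a) gmod, 'a \<Rightarrow> 'a) cat);
             LK = Lcat K;
             L = localization_functor K;
             Q = serre_quotient RM (localization_kernel K);
             q = quotient_functor RM (localization_kernel K)
         in exact_functor RM LK L \<and>
            (\<exists>Lbar. exact_functor Q LK Lbar \<and> functor_eq RM (comp_functor Lbar q) L \<and>
               (\<forall>F. exact_functor Q LK F \<and> functor_eq RM (comp_functor F q) L \<longrightarrow> functor_eq Q F Lbar) \<and>
               is_equivalence Q LK Lbar)"
proof -
  interpret localizing_functor "Rmod :: (('k, 'n, 'a) gmod, 'a \<Rightarrow> 'a) cat" "Lcat K" "Loc K" "localization_kernel K"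
  proof
    show "is_functor (Rmod :: (('k, 'n, 'a) gmod, 'a \<Rightarrow> 'a) cat) (Lcat K) (Loc K)" by (rule Loc_functor)
    show "inverted_arrow Rmod (localization_kernel K) X Y f \<longleftrightarrow> is_iso_arrow (Lcat K) (on_obj (Loc K) X) (on_obj (Loc K) Y) (on_hom (Loc K) X Y f)"
      if "X \<in> Obj Rmod" "Y \<in> Obj Rmod" "f \<in> Hom Rmod X Y" for X Y :: "('k, 'n, 'a) gmod" and f
      unfolding Loc_iso_iff[OF that] by (rule inverted_iff_torsion_iso[OF that])
  qed (rule Loc_full[OF universe K] Loc_faithful Loc_essentially_surjective[OF universe K]; assumption)+
  show ?thesis unfolding Let_def using Loc_exact induced_equivalence by blast
qed

end
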